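(* Let $(\pi:E_0\to X_0,\mu,\mathbb{X})$ be a principal $G$-bundle over a Lie groupoid $\mathbb{X}=[X_1\rightrightarrows X_0]$, let $\omega$ be a connection on it, and let $(G,H,\tau,\alpha)$ be a Lie crossed module. Define an $L(H\rtimes_\alpha G)$-valued 1-form on $s^*E_0\times H$ by $$\omega^{\mathrm{dec}}_{(\gamma,p,h)}(X,v,\mathfrak{K})=\mathrm{ad}_{(h,e)}(\omega_p(v))-\mathfrak{K}\cdot h^{-1}$$ for $(X,v)\in T_{(\gamma,p)}(s^*E_0)$, $\mathfrak{K}\in T_hH$. Then $(\omega^{\mathrm{dec}},\omega)$ is a strict connection 1-form on the corresponding decorated principal $[H\rtimes_\alpha G\rightrightarrows G]$-bundle $\pi^{\mathrm{dec}}:\mathbb{E}^{\mathrm{dec}}\to\mathbb{X}$. Moreover, for any $L(H)$-valued 1-form $\lambda$ on $E_0$ with $\lambda(pg,v\cdot g)=\alpha_{g^{-1}}(\lambda(p,v))$ for all $(p,v)\in TE_0$, $g\in G$, the modified pair $$\big(\omega^{\mathrm{dec}}+\tau(s^*\lambda)+t^*\lambda-s^*\lambda,\ \ \omega+\tau(\lambda)\big)$$ is a semi-strict connection 1-form on $\pi^{\mathrm{dec}}:\mathbb{E}^{\mathrm{dec}}\to\mathbb{X}$.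
   Context: **Basics.** A Lie groupoid $\mathbb{X}=[X_1\rightrightarrows X_0]$ has submersive source/target $s,t$ and smooth structure maps; $\gamma_2\circ\gamma_1$ is defined when $s(\gamma_2)=t(\gamma_1)$. A Lie 2-group is a Lie groupoid $\mathbb{G}=[G_1\rightrightarrows G_0]$ with Lie group structures on $G_1,G_0$ whose multiplication is a smooth functor. Lie crossed module $(G,H,\tau,\alpha)$: Lie groups $G,H$, homomorphism $\tau:H\to G$, smooth action $\alpha_g(h)=\alpha(g,h)$ of $G$ on $H$ by automorphisms, $\tau(\alpha(g,h))=g\tau(h)g^{-1}$, $\alpha(\tau(h),h')=hh'h^{-1}$; $\tau$ and $\alpha_g$ also denote the induced Lie algebra maps. Its Lie 2-group $[H\rtimes_\alpha G\rightrightarrows G]$: $s(h,g)=g$, $t(h,g)=\tau(h)g$, $(h_2,g_2)\circ(h_1,g_1)=(h_2h_1,g_1)$, product $(h_2,g_2)(h_1,g_1)=(h_2\alpha(g_2,h_1),g_2g_1)$. As a vector space $L(H\rtimes_\alpha G)=L(H)\oplus L(G)$, and $L(H),L(G)$ are regarded as subspaces of it. A principal $\mathbb{G}$-bundle over $\mathbb{X}$ is a morphism of Lie groupoids $\pi:\mathbb{E}=[E_1\rightrightarrows E_0]\to\mathbb{X}$ with a right action of $\mathbb{G}$ (a smooth functor, Lie group action on objects and morphisms) such that $\pi_i:E_i\to X_i$ is a principal $G_i$-bundle. **Principal $G$-bundle over $\mathbb{X}$ and connection.** A principal $G$-bundle $\pi:E_0\to X_0$ with a smooth left action $\mu:s^*E_0=X_1\times_{s,X_0,\pi}E_0\to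 E_0$ of $\mathbb{X}$, i.e. $\pi(\mu(\gamma,p))=t(\gamma)$, $\mu(1_{\pi(p)},p)=p$, $\mu(\gamma_2\circ\gamma_1,p)=\mu(\gamma_2,\mu(\gamma_1,p))$, commuting with the $G$-action: $\mu(\gamma,p)g=\mu(\gamma,pg)$. A connection on it is an ordinary connection 1-form $\omega$ on $\pi:E_0\to X_0$ with $\mathrm{pr}_2^*\omega=\mu^*\omega$ on $s^*E_0$. **Decorated bundle.** $\mathbb{E}^{\mathrm{dec}}=[s^*E_0\times H\rightrightarrows E_0]$ with $s(\gamma,p,h)=p$, $t(\gamma,p,h)=\mu(\gamma,p)\tau(h^{-1})$, $(\gamma_2,p_2,h_2)\circ(\gamma_1,p_1,h_1)=(\gamma_2\circ\gamma_1,p_1,h_2h_1)$, $1_p=(1_{\pi(p)},p,e)$, inverse $(\gamma^{-1},\mu(\gamma,p)\tau(h^{-1}),h^{-1})$; action of $[H\rtimes_\alpha G\rightrightarrows G]$: $(p,g)\mapsto pg$, $((\gamma,p,h),(h',g))\mapsto(\gamma,pg,\alpha_{g^{-1}}(h'^{-1}h))$; projection $\pi^{\mathrm{dec}}$: $p\mapsto\pi(p)$, $(\gamma,p,h)\mapsto\gamma$. In the claim $s^*\lambda,t^*\lambda$ are pullbacks along the source and target of $\mathbb{E}^{\mathrm{dec}}$. **Connection 1-forms.** $T\mathbb{E}=[TE_1\rightrightarrows TE_0]$ and $L(\mathbb{G})=[L(G_1)\rightrightarrows L(G_0)]$ have structure maps obtained by differentiation (the latter at the identity). $\delta:\mathbb{E}\times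 L(\mathbb{G})\to T\mathbb{E}$ sends $(x,A)$ to the fundamental vector $\delta_x(A)$ (differential of $g\mapsto xg$ at the identity). A $\mathbb{G}$-equivariant $L(\mathbb{G})$-valued 1-form is a smooth functor $\omega=(\omega_1,\omega_0):T\mathbb{E}\to L(\mathbb{G})$ with $\omega_i$ an $L(G_i)$-valued 1-form on $E_i$ and $\omega_i(v\cdot g)=\mathrm{ad}_{g^{-1}}\omega_i(v)$. It is a strict connection 1-form if $\omega\circ\delta=\mathrm{pr}_2$, and a semi-strict connection 1-form if there is a smooth fibrewise linear natural isomorphism $\kappa:\omega\circ\delta\Rightarrow\mathrm{pr}_2$ with $\kappa(pg,\mathrm{ad}_{g^{-1}}B)=\mathrm{ad}_{1_g^{-1}}\kappa(p,B)$. *)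

theory Defs
  imports "HOL-Analysis.Analysis" "HOL-Algebra.Group"
begin

section \<open>Smooth maps between subsets of Euclidean spaces\<close>

text \<open>Only meant for open sets \<open>S\<close>.\<close>

primrec Ck_on :: "nat \<Rightarrow> 'a::real_normed_vector set \<Rightarrow> ('a \<Rightarrow> 'b::real_normed_vector) \<Rightarrow> bool" where
  "Ck_on 0 S f \<longleftrightarrow> continuous_on S f"
| "Ck_on (Suc k) S f \<longleftrightarrow>
     (\<forall>x\<in>S. f differentiable (at x)) \<and> (\<forall>v. Ck_on k S (\<lambda>x. frechet_derivative f (at x) v))"

definition Cinf_on :: "'a::real_normed_vector set \<Rightarrow> ('a \<Rightarrow> 'b::real_normed_vector) \<Rightarrow> bool" where
  "Cinf_on S f \<longleftrightarrow> (\<forall>k. Ck_on k S f)"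

definition embedded_submanifold :: "nat \<Rightarrow> 'b::euclidean_space set \<Rightarrow> bool" where
  "embedded_submanifold d S \<longleftrightarrow>
     (\<forall>x\<in>S. \<exists>W (\<phi> :: 'b \<Rightarrow> 'b) (\<psi> :: 'b \<Rightarrow> 'b) V.
        open W \<and> x \<in> W \<and> Cinf_on W \<phi> \<and> open (\<phi> ` W) \<and> Cinf_on (\<phi> ` W) \<psi> \<and>
        (\<forall>y\<in>W. \<psi> (\<phi> y) = y) \<and> subspace V \<and> dim V = d \<and> \<phi> ` (W \<inter> S) = \<phi> ` W \<inter> V)"

definition tangent_at :: "'b::euclidean_space set \<Rightarrow> 'b \<Rightarrow> 'b set" where
  "tangent_at S x = {v. \<exists>(c :: real \<Rightarrow> 'b) e. 0 < e \<and> Cinf_on {-e<..<e} c \<and> c ` {-e<..<e} \<subseteq> S \<and>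
     c 0 = x \<and> (c has_vector_derivative v) (at 0)}"


section \<open>Manifolds\<close>

text \<open>A manifold is a set of points together with an atlas indexed by the points; the chart
  attached to \<open>p\<close> is defined around \<open>p\<close>.  Every atlas can be presented like this. A chart is
  a bijection from its domain to a \<open>d\<close>-dimensional embedded submanifold of a Euclidean space
  \<open>'b\<close>; charts onto open subsets of \<open>'b\<close> are the case \<open>d = DIM('b)\<close>.
  Composing with the straightening maps in \<open>embedded_submanifold\<close> yields an atlas with values
  in \<open>d\<close>-dimensional vector spaces, so this is the usual notion of a smooth manifold.  The extra
  freedom is there because a dimension cannot be computed at the level of types: it allows
  fibre products to use the charts of the ambient product.\<close>

record ('a, 'b) mfd =
  pts :: "'a set"
  cdom :: "'a \<Rightarrow> 'a set"
  chart :: "'a \<Rightarrow> 'a \<Rightarrow> 'b"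

definition cimg :: "('a, 'b) mfd \<Rightarrow> 'a \<Rightarrow> 'b set" where
  "cimg M p = chart M p ` cdom M p"

definition cinv :: "('a, 'b) mfd \<Rightarrow> 'a \<Rightarrow> 'b \<Rightarrow> 'a" where
  "cinv M p = inv_into (cdom M p) (chart M p)"

definition mfd_topology :: "('a, 'b::euclidean_space) mfd \<Rightarrow> 'a topology" where
  "mfd_topology M = topology (\<lambda>W. W \<subseteq> pts M \<and>
     (\<forall>p\<in>pts M. openin (top_of_set (cimg M p)) (chart M p ` (W \<inter> cdom M p))))"

definition manifold :: "('a, 'b::euclidean_space) mfd \<Rightarrow> bool" where
  "manifold M \<longleftrightarrow>
     (\<forall>p\<in>pts M. p \<in> cdom M p \<and> cdom M p \<subseteq> pts M \<and> inj_on (chart M p) (cdom M p)) \<and>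
     (\<exists>d. \<forall>p\<in>pts M. embedded_submanifold d (cimg M p)) \<and>
     (\<forall>p\<in>pts M. \<forall>q\<in>pts M. \<forall>r\<in>cdom M p \<inter> cdom M q.
        \<exists>W g. open W \<and> chart M p r \<in> W \<and> Cinf_on W g \<and>
          (\<forall>x\<in>cdom M p. chart M p x \<in> W \<longrightarrow> x \<in> cdom M q \<and> g (chart M p x) = chart M q x)) \<and>
     Hausdorff_space (mfd_topology M) \<and> second_countable (mfd_topology M)"

definition smooth_map ::
  "('a, 'b::euclidean_space) mfd \<Rightarrow> ('c, 'd::euclidean_space) mfd \<Rightarrow> ('a \<Rightarrow> 'c) \<Rightarrow> bool" where
  "smooth_map M N f \<longleftrightarrow> f ` pts M \<subseteq> pts N \<and>
     (\<forall>p\<in>pts M. \<exists>W g. open W \<and> chart M p p \<in> W \<and> Cinf_on W g \<and>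
        (\<forall>x\<in>cdom M p. chart M p x \<in> W \<longrightarrow> f x \<in> cdom N (f p) \<and> g (chart M p x) = chart N (f p) (f x)))"

definition diffeo ::
  "('a, 'b::euclidean_space) mfd \<Rightarrow> ('c, 'd::euclidean_space) mfd \<Rightarrow> ('a \<Rightarrow> 'c) \<Rightarrow> bool" where
  "diffeo M N f \<longleftrightarrow> smooth_map M N f \<and> bij_betw f (pts M) (pts N) \<and>
     smooth_map N M (inv_into (pts M) f)"

text \<open>The tangent space at \<open>p\<close>, read in the chart attached to \<open>p\<close>: a vector subspace of \<open>'b\<close>.\<close>

definition tspace :: "('a, 'b::euclidean_space) mfd \<Rightarrow> 'a \<Rightarrow> 'b set" where
  "tspace M p = tangent_at (cimg M p) (chart M p p)"

text \<open>The differential of \<open>f\<close> at \<open>p\<close>, read in the charts attached to \<open>p\<close> and \<open>f p\<close>.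
  The derivative within the chart image is determined on \<open>tspace M p\<close>, where it agrees with the
  velocity of the image of a curve; its values on other vectors are never used.\<close>

definition mderiv ::
  "('a, 'b::euclidean_space) mfd \<Rightarrow> ('c, 'd::euclidean_space) mfd \<Rightarrow> ('a \<Rightarrow> 'c) \<Rightarrow> 'a \<Rightarrow> 'b \<Rightarrow> 'd" where
  "mderiv M N f p =
     frechet_derivative (chart N (f p) \<circ> f \<circ> cinv M p) (at (chart M p p) within cimg M p)"

definition tmap ::
  "('a, 'b::euclidean_space) mfd \<Rightarrow> ('c, 'd::euclidean_space) mfd \<Rightarrow> ('a \<Rightarrow> 'c) \<Rightarrow> 'a \<times> 'b \<Rightarrow> 'c \<times> 'd" where
  "tmap M N f = (\<lambda>(p, v). (f p, mderiv M N f p v))"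

text \<open>The chart of the tangent bundle at \<open>(p, v)\<close> transports a vector at \<open>q\<close> from the chart attached to
  \<open>q\<close> to the chart attached to \<open>p\<close>.\<close>

definition TM :: "('a, 'b::euclidean_space) mfd \<Rightarrow> ('a \<times> 'b, 'b \<times> 'b) mfd" where
  "TM M = \<lparr> pts = {(p, v). p \<in> pts M \<and> v \<in> tspace M p},
     cdom = (\<lambda>(p, v). {(q, w). q \<in> cdom M p \<and> w \<in> tspace M q}),
     chart = (\<lambda>(p, v) (q, w). (chart M p q,
        frechet_derivative (chart M p \<circ> cinv M q) (at (chart M q q) within cimg M q) w)) \<rparr>"

definition prod_mfd :: "('a, 'b) mfd \<Rightarrow> ('c, 'd) mfd \<Rightarrow> ('a \<times> 'c, 'b \<times> 'd) mfd" where
  "prod_mfd M N = \<lparr> pts = pts M \<times> pts N,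
     cdom = (\<lambda>(p, q). cdom M p \<times> cdom N q),
     chart = (\<lambda>(p, q) (x, y). (chart M p x, chart N q y)) \<rparr>"

definition sub_mfd :: "('a, 'b) mfd \<Rightarrow> 'a set \<Rightarrow> ('a, 'b) mfd" where
  "sub_mfd M S = \<lparr> pts = pts M \<inter> S, cdom = (\<lambda>p. cdom M p \<inter> S), chart = chart M \<rparr>"

definition fib_prod ::
  "('a, 'b) mfd \<Rightarrow> ('c, 'd) mfd \<Rightarrow> ('a \<Rightarrow> 'e) \<Rightarrow> ('c \<Rightarrow> 'e) \<Rightarrow> ('a \<times> 'c, 'b \<times> 'd) mfd" where
  "fib_prod M N f g = sub_mfd (prod_mfd M N) {(x, y). f x = g y}"

definition vec_mfd :: "'b set \<Rightarrow> ('b, 'b) mfd" where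
  "vec_mfd V = \<lparr> pts = V, cdom = (\<lambda>_. V), chart = (\<lambda>_ x. x) \<rparr>"

definition submersion ::
  "('a, 'b::euclidean_space) mfd \<Rightarrow> ('c, 'd::euclidean_space) mfd \<Rightarrow> ('a \<Rightarrow> 'c) \<Rightarrow> bool" where
  "submersion M N f \<longleftrightarrow> smooth_map M N f \<and>
     (\<forall>p\<in>pts M. mderiv M N f p ` tspace M p = tspace N (f p))"

definition linear_on_subspace :: "'b::real_vector set \<Rightarrow> ('b \<Rightarrow> 'd::real_vector) \<Rightarrow> bool" where
  "linear_on_subspace V f \<longleftrightarrow>
     (\<forall>u\<in>V. \<forall>v\<in>V. f (u + v) = f u + f v) \<and> (\<forall>c. \<forall>v\<in>V. f (c *\<^sub>R v) = c *\<^sub>R f v)"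

definition one_form ::
  "('a, 'b::euclidean_space) mfd \<Rightarrow> 'd::euclidean_space set \<Rightarrow> ('a \<times> 'b \<Rightarrow> 'd) \<Rightarrow> bool" where
  "one_form M V \<omega> \<longleftrightarrow> smooth_map (TM M) (vec_mfd V) \<omega> \<and>
     (\<forall>p\<in>pts M. linear_on_subspace (tspace M p) (\<lambda>v. \<omega> (p, v)))"


section \<open>Lie groups and principal bundles\<close>

definition lie_group :: "('g, 'k::euclidean_space) mfd \<Rightarrow> 'g monoid \<Rightarrow> bool" where
  "lie_group M G \<longleftrightarrow> manifold M \<and> group G \<and> carrier G = pts M \<and>
     smooth_map (prod_mfd M M) M (\<lambda>(x, y). x \<otimes>\<^bsub>G\<^esub> y) \<and> smooth_map M M (\<lambda>x. inv\<^bsub>G\<^esub> x)"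

definition lie_alg :: "('g, 'k::euclidean_space) mfd \<Rightarrow> 'g monoid \<Rightarrow> 'k set" where
  "lie_alg M G = tspace M \<one>\<^bsub>G\<^esub>"

definition Ad :: "('g, 'k::euclidean_space) mfd \<Rightarrow> 'g monoid \<Rightarrow> 'g \<Rightarrow> 'k \<Rightarrow> 'k" where
  "Ad M G g = mderiv M M (\<lambda>x. g \<otimes>\<^bsub>G\<^esub> x \<otimes>\<^bsub>G\<^esub> inv\<^bsub>G\<^esub> g) \<one>\<^bsub>G\<^esub>"

definition right_action ::
  "('e, 'f::euclidean_space) mfd \<Rightarrow> ('g, 'k::euclidean_space) mfd \<Rightarrow> 'g monoid \<Rightarrow> ('e \<times> 'g \<Rightarrow> 'e) \<Rightarrow> bool" where
  "right_action E M G R \<longleftrightarrow> smooth_map (prod_mfd E M) E R \<and>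
     (\<forall>p\<in>pts E. R (p, \<one>\<^bsub>G\<^esub>) = p) \<and>
     (\<forall>p\<in>pts E. \<forall>g\<in>carrier G. \<forall>h\<in>carrier G. R (R (p, g), h) = R (p, g \<otimes>\<^bsub>G\<^esub> h))"

definition fundamental ::
  "('e, 'f::euclidean_space) mfd \<Rightarrow> ('g, 'k::euclidean_space) mfd \<Rightarrow> 'g monoid \<Rightarrow> ('e \<times> 'g \<Rightarrow> 'e) \<Rightarrow>
   'e \<times> 'k \<Rightarrow> 'e \<times> 'f" where
  "fundamental E M G R = (\<lambda>(p, A). (p, mderiv M E (\<lambda>g. R (p, g)) \<one>\<^bsub>G\<^esub> A))"

definition tangent_action ::
  "('e, 'f::euclidean_space) mfd \<Rightarrow> ('e \<times> 'g \<Rightarrow> 'e) \<Rightarrow> 'g \<Rightarrow> 'e \<times> 'f \<Rightarrow> 'e \<times> 'f" where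
  "tangent_action E R g = tmap E E (\<lambda>p. R (p, g))"

definition principal_bundle ::
  "('x, 'm::euclidean_space) mfd \<Rightarrow> ('g, 'k::euclidean_space) mfd \<Rightarrow> 'g monoid \<Rightarrow>
   ('e, 'f::euclidean_space) mfd \<Rightarrow> ('e \<Rightarrow> 'x) \<Rightarrow> ('e \<times> 'g \<Rightarrow> 'e) \<Rightarrow> bool" where
  "principal_bundle X M G E \<pi> R \<longleftrightarrow>
     manifold X \<and> lie_group M G \<and> manifold E \<and> smooth_map E X \<pi> \<and> right_action E M G R \<and>
     (\<forall>p\<in>pts E. \<forall>g\<in>carrier G. \<pi> (R (p, g)) = \<pi> p) \<and>
     (\<forall>x\<in>pts X. \<exists>U \<Phi>. openin (mfd_topology X) U \<and> x \<in> U \<and>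
        diffeo (prod_mfd (sub_mfd X U) M) (sub_mfd E (\<pi> -` U)) \<Phi> \<and>
        (\<forall>y\<in>U. \<forall>g\<in>carrier G. \<pi> (\<Phi> (y, g)) = y \<and>
           (\<forall>h\<in>carrier G. R (\<Phi> (y, g), h) = \<Phi> (y, g \<otimes>\<^bsub>G\<^esub> h))))"

definition equivariant_form ::
  "('e, 'f::euclidean_space) mfd \<Rightarrow> ('g, 'k::euclidean_space) mfd \<Rightarrow> 'g monoid \<Rightarrow> ('e \<times> 'g \<Rightarrow> 'e) \<Rightarrow>
   ('e \<times> 'f \<Rightarrow> 'k) \<Rightarrow> bool" where
  "equivariant_form E M G R \<omega> \<longleftrightarrow> one_form E (lie_alg M G) \<omega> \<and>
     (\<forall>v\<in>pts (TM E). \<forall>g\<in>carrier G. \<omega> (tangent_action E R g v) = Ad M G (inv\<^bsub>G\<^esub> g) (\<omega> v))"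

definition connection_form ::
  "('e, 'f::euclidean_space) mfd \<Rightarrow> ('g, 'k::euclidean_space) mfd \<Rightarrow> 'g monoid \<Rightarrow> ('e \<times> 'g \<Rightarrow> 'e) \<Rightarrow>
   ('e \<times> 'f \<Rightarrow> 'k) \<Rightarrow> bool" where
  "connection_form E M G R \<omega> \<longleftrightarrow> equivariant_form E M G R \<omega> \<and>
     (\<forall>p\<in>pts E. \<forall>A\<in>lie_alg M G. \<omega> (fundamental E M G R (p, A)) = A)"


section \<open>Lie groupoids and Lie 2-groups\<close>

text \<open>\<open>gcomp (\<gamma>\<^sub>2, \<gamma>\<^sub>1)\<close> is the composite of \<open>\<gamma>\<^sub>2\<close> after \<open>\<gamma>\<^sub>1\<close>,
  meaningful when \<open>src \<gamma>\<^sub>2 = tgt \<gamma>\<^sub>1\<close>.\<close>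

record ('a1, 'b1, 'a0, 'b0) gpd =
  arr :: "('a1, 'b1) mfd"
  obj :: "('a0, 'b0) mfd"
  src :: "'a1 \<Rightarrow> 'a0"
  tgt :: "'a1 \<Rightarrow> 'a0"
  gcomp :: "'a1 \<times> 'a1 \<Rightarrow> 'a1"
  gunit :: "'a0 \<Rightarrow> 'a1"
  ginv :: "'a1 \<Rightarrow> 'a1"

definition composable :: "('a1, 'b1, 'a0, 'b0) gpd \<Rightarrow> ('a1 \<times> 'a1, 'b1 \<times> 'b1) mfd" where
  "composable X = fib_prod (arr X) (arr X) (src X) (tgt X)"

definition lie_groupoid ::
  "('a1, 'b1::euclidean_space, 'a0, 'b0::euclidean_space) gpd \<Rightarrow> bool" where
  "lie_groupoid X \<longleftrightarrow>
     manifold (arr X) \<and> manifold (obj X) \<and>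
     submersion (arr X) (obj X) (src X) \<and> submersion (arr X) (obj X) (tgt X) \<and>
     smooth_map (composable X) (arr X) (gcomp X) \<and>
     smooth_map (obj X) (arr X) (gunit X) \<and> smooth_map (arr X) (arr X) (ginv X) \<and>
     (\<forall>x\<in>pts (obj X). src X (gunit X x) = x \<and> tgt X (gunit X x) = x) \<and>
     (\<forall>b\<in>pts (arr X). \<forall>a\<in>pts (arr X). src X b = tgt X a \<longrightarrow>
        src X (gcomp X (b, a)) = src X a \<and> tgt X (gcomp X (b, a)) = tgt X b) \<and>
     (\<forall>c\<in>pts (arr X). \<forall>b\<in>pts (arr X). \<forall>a\<in>pts (arr X). src X c = tgt X b \<and> src X b = tgt X a \<longrightarrow>
        gcomp X (gcomp X (c, b), a) = gcomp X (c, gcomp X (b, a))) \<and>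
     (\<forall>a\<in>pts (arr X).
        gcomp X (a, gunit X (src X a)) = a \<and> gcomp X (gunit X (tgt X a), a) = a \<and>
        src X (ginv X a) = tgt X a \<and> tgt X (ginv X a) = src X a \<and>
        gcomp X (ginv X a, a) = gunit X (src X a) \<and> gcomp X (a, ginv X a) = gunit X (tgt X a))"

definition smooth_functor ::
  "('a1, 'b1::euclidean_space, 'a0, 'b0::euclidean_space) gpd \<Rightarrow>
   ('c1, 'd1::euclidean_space, 'c0, 'd0::euclidean_space) gpd \<Rightarrow> ('a1 \<Rightarrow> 'c1) \<Rightarrow> ('a0 \<Rightarrow> 'c0) \<Rightarrow> bool" where
  "smooth_functor X Y F1 F0 \<longleftrightarrow>
     smooth_map (arr X) (arr Y) F1 \<and> smooth_map (obj X) (obj Y) F0 \<and>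
     (\<forall>a\<in>pts (arr X). src Y (F1 a) = F0 (src X a) \<and> tgt Y (F1 a) = F0 (tgt X a)) \<and>
     (\<forall>x\<in>pts (obj X). F1 (gunit X x) = gunit Y (F0 x)) \<and>
     (\<forall>b\<in>pts (arr X). \<forall>a\<in>pts (arr X). src X b = tgt X a \<longrightarrow>
        F1 (gcomp X (b, a)) = gcomp Y (F1 b, F1 a))"

text \<open>A natural isomorphism from \<open>(F1, F0)\<close> to \<open>(F1', F0')\<close>. Invertibility of the components
  is stated through the inversion of the target groupoid.\<close>

definition smooth_nat_iso ::
  "('a1, 'b1::euclidean_space, 'a0, 'b0::euclidean_space) gpd \<Rightarrow>
   ('c1, 'd1::euclidean_space, 'c0, 'd0::euclidean_space) gpd \<Rightarrow>
   ('a1 \<Rightarrow> 'c1) \<Rightarrow> ('a0 \<Rightarrow> 'c0) \<Rightarrow> ('a1 \<Rightarrow> 'c1) \<Rightarrow> ('a0 \<Rightarrow> 'c0) \<Rightarrow> ('a0 \<Rightarrow> 'c1) \<Rightarrow> bool" where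
  "smooth_nat_iso X Y F1 F0 F1' F0' \<kappa> \<longleftrightarrow>
     smooth_map (obj X) (arr Y) \<kappa> \<and>
     (\<forall>x\<in>pts (obj X). src Y (\<kappa> x) = F0 x \<and> tgt Y (\<kappa> x) = F0' x \<and>
        gcomp Y (ginv Y (\<kappa> x), \<kappa> x) = gunit Y (F0 x) \<and> gcomp Y (\<kappa> x, ginv Y (\<kappa> x)) = gunit Y (F0' x)) \<and>
     (\<forall>a\<in>pts (arr X). gcomp Y (F1' a, \<kappa> (src X a)) = gcomp Y (\<kappa> (tgt X a), F1 a))"

definition prod_gpd ::
  "('a1, 'b1, 'a0, 'b0) gpd \<Rightarrow> ('c1, 'd1, 'c0, 'd0) gpd \<Rightarrow>
   ('a1 \<times> 'c1, 'b1 \<times> 'd1, 'a0 \<times> 'c0, 'b0 \<times> 'd0) gpd" where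
  "prod_gpd X Y = \<lparr> arr = prod_mfd (arr X) (arr Y), obj = prod_mfd (obj X) (obj Y),
     src = (\<lambda>(a, c). (src X a, src Y c)), tgt = (\<lambda>(a, c). (tgt X a, tgt Y c)),
     gcomp = (\<lambda>((a2, c2), (a1, c1)). (gcomp X (a2, a1), gcomp Y (c2, c1))),
     gunit = (\<lambda>(x, y). (gunit X x, gunit Y y)), ginv = (\<lambda>(a, c). (ginv X a, ginv Y c)) \<rparr>"

text \<open>Tangent vectors to \<open>composable X\<close> are pairs of tangent vectors with matching differentials of
  source and target, since its charts are those of the product.\<close>

definition tangent_gpd ::
  "('a1, 'b1::euclidean_space, 'a0, 'b0::euclidean_space) gpd \<Rightarrow>
   ('a1 \<times> 'b1, 'b1 \<times> 'b1, 'a0 \<times> 'b0, 'b0 \<times> 'b0) gpd" where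
  "tangent_gpd X = \<lparr> arr = TM (arr X), obj = TM (obj X),
     src = tmap (arr X) (obj X) (src X), tgt = tmap (arr X) (obj X) (tgt X),
     gcomp = (\<lambda>((a2, v2), (a1, v1)). tmap (composable X) (arr X) (gcomp X) ((a2, a1), (v2, v1))),
     gunit = tmap (obj X) (arr X) (gunit X), ginv = tmap (arr X) (arr X) (ginv X) \<rparr>"

record ('a1, 'b1, 'a0, 'b0) two_group =
  tg_gpd :: "('a1, 'b1, 'a0, 'b0) gpd"
  grp1 :: "'a1 monoid"
  grp0 :: "'a0 monoid"

definition lie_two_group ::
  "('a1, 'b1::euclidean_space, 'a0, 'b0::euclidean_space) two_group \<Rightarrow> bool" where
  "lie_two_group \<G> \<longleftrightarrow> lie_groupoid (tg_gpd \<G>) \<and>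
     lie_group (arr (tg_gpd \<G>)) (grp1 \<G>) \<and> lie_group (obj (tg_gpd \<G>)) (grp0 \<G>) \<and>
     smooth_functor (prod_gpd (tg_gpd \<G>) (tg_gpd \<G>)) (tg_gpd \<G>)
       (\<lambda>(x, y). x \<otimes>\<^bsub>grp1 \<G>\<^esub> y) (\<lambda>(x, y). x \<otimes>\<^bsub>grp0 \<G>\<^esub> y)"

abbreviation lie_alg1 :: "('a1, 'b1::euclidean_space, 'a0, 'b0) two_group \<Rightarrow> 'b1 set" where
  "lie_alg1 \<G> \<equiv> lie_alg (arr (tg_gpd \<G>)) (grp1 \<G>)"

abbreviation lie_alg0 :: "('a1, 'b1, 'a0, 'b0::euclidean_space) two_group \<Rightarrow> 'b0 set" where
  "lie_alg0 \<G> \<equiv> lie_alg (obj (tg_gpd \<G>)) (grp0 \<G>)"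

definition lie_alg_gpd ::
  "('a1, 'b1::euclidean_space, 'a0, 'b0::euclidean_space) two_group \<Rightarrow> ('b1, 'b1, 'b0, 'b0) gpd" where
  "lie_alg_gpd \<G> = (let X = tg_gpd \<G>; e1 = \<one>\<^bsub>grp1 \<G>\<^esub>; e0 = \<one>\<^bsub>grp0 \<G>\<^esub> in
     \<lparr> arr = vec_mfd (lie_alg1 \<G>), obj = vec_mfd (lie_alg0 \<G>),
       src = mderiv (arr X) (obj X) (src X) e1, tgt = mderiv (arr X) (obj X) (tgt X) e1,
       gcomp = mderiv (composable X) (arr X) (gcomp X) (e1, e1),
       gunit = mderiv (obj X) (arr X) (gunit X) e0, ginv = mderiv (arr X) (arr X) (ginv X) e1 \<rparr>)"


section \<open>Principal bundles over Lie groupoids with Lie 2-group structure, and their connections\<close>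

text \<open>The action \<open>(R1, R0)\<close> is a functor and a Lie group action on morphisms and on objects; the
  latter is part of \<open>principal_bundle\<close>.\<close>

definition principal_two_bundle ::
  "('x1, 'm1::euclidean_space, 'x0, 'm0::euclidean_space) gpd \<Rightarrow>
   ('g1, 'k1::euclidean_space, 'g0, 'k0::euclidean_space) two_group \<Rightarrow>
   ('e1, 'f1::euclidean_space, 'e0, 'f0::euclidean_space) gpd \<Rightarrow>
   ('e1 \<Rightarrow> 'x1) \<Rightarrow> ('e0 \<Rightarrow> 'x0) \<Rightarrow> ('e1 \<times> 'g1 \<Rightarrow> 'e1) \<Rightarrow> ('e0 \<times> 'g0 \<Rightarrow> 'e0) \<Rightarrow> bool" where
  "principal_two_bundle X \<G> E \<pi>1 \<pi>0 R1 R0 \<longleftrightarrow>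
     lie_groupoid X \<and> lie_two_group \<G> \<and> lie_groupoid E \<and> smooth_functor E X \<pi>1 \<pi>0 \<and>
     smooth_functor (prod_gpd E (tg_gpd \<G>)) E R1 R0 \<and>
     principal_bundle (arr X) (arr (tg_gpd \<G>)) (grp1 \<G>) (arr E) \<pi>1 R1 \<and>
     principal_bundle (obj X) (obj (tg_gpd \<G>)) (grp0 \<G>) (obj E) \<pi>0 R0"

definition equivariant_two_form ::
  "('g1, 'k1::euclidean_space, 'g0, 'k0::euclidean_space) two_group \<Rightarrow>
   ('e1, 'f1::euclidean_space, 'e0, 'f0::euclidean_space) gpd \<Rightarrow>
   ('e1 \<times> 'g1 \<Rightarrow> 'e1) \<Rightarrow> ('e0 \<times> 'g0 \<Rightarrow> 'e0) \<Rightarrow> ('e1 \<times> 'f1 \<Rightarrow> 'k1) \<Rightarrow> ('e0 \<times> 'f0 \<Rightarrow> 'k0) \<Rightarrow> bool" where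
  "equivariant_two_form \<G> E R1 R0 \<omega>1 \<omega>0 \<longleftrightarrow>
     smooth_functor (tangent_gpd E) (lie_alg_gpd \<G>) \<omega>1 \<omega>0 \<and>
     equivariant_form (arr E) (arr (tg_gpd \<G>)) (grp1 \<G>) R1 \<omega>1 \<and>
     equivariant_form (obj E) (obj (tg_gpd \<G>)) (grp0 \<G>) R0 \<omega>0"

abbreviation fundamental1 where
  "fundamental1 \<G> E R1 \<equiv> fundamental (arr E) (arr (tg_gpd \<G>)) (grp1 \<G>) R1"

abbreviation fundamental0 where
  "fundamental0 \<G> E R0 \<equiv> fundamental (obj E) (obj (tg_gpd \<G>)) (grp0 \<G>) R0"

definition strict_connection ::
  "('x1, 'm1::euclidean_space, 'x0, 'm0::euclidean_space) gpd \<Rightarrow>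
   ('g1, 'k1::euclidean_space, 'g0, 'k0::euclidean_space) two_group \<Rightarrow>
   ('e1, 'f1::euclidean_space, 'e0, 'f0::euclidean_space) gpd \<Rightarrow>
   ('e1 \<Rightarrow> 'x1) \<Rightarrow> ('e0 \<Rightarrow> 'x0) \<Rightarrow> ('e1 \<times> 'g1 \<Rightarrow> 'e1) \<Rightarrow> ('e0 \<times> 'g0 \<Rightarrow> 'e0) \<Rightarrow>
   ('e1 \<times> 'f1 \<Rightarrow> 'k1) \<Rightarrow> ('e0 \<times> 'f0 \<Rightarrow> 'k0) \<Rightarrow> bool" where
  "strict_connection X \<G> E \<pi>1 \<pi>0 R1 R0 \<omega>1 \<omega>0 \<longleftrightarrow>
     principal_two_bundle X \<G> E \<pi>1 \<pi>0 R1 R0 \<and> equivariant_two_form \<G> E R1 R0 \<omega>1 \<omega>0 \<and>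
     (\<forall>x\<in>pts (arr E). \<forall>A\<in>lie_alg1 \<G>. \<omega>1 (fundamental1 \<G> E R1 (x, A)) = A) \<and>
     (\<forall>p\<in>pts (obj E). \<forall>B\<in>lie_alg0 \<G>. \<omega>0 (fundamental0 \<G> E R0 (p, B)) = B)"

definition semistrict_connection ::
  "('x1, 'm1::euclidean_space, 'x0, 'm0::euclidean_space) gpd \<Rightarrow>
   ('g1, 'k1::euclidean_space, 'g0, 'k0::euclidean_space) two_group \<Rightarrow>
   ('e1, 'f1::euclidean_space, 'e0, 'f0::euclidean_space) gpd \<Rightarrow>
   ('e1 \<Rightarrow> 'x1) \<Rightarrow> ('e0 \<Rightarrow> 'x0) \<Rightarrow> ('e1 \<times> 'g1 \<Rightarrow> 'e1) \<Rightarrow> ('e0 \<times> 'g0 \<Rightarrow> 'e0) \<Rightarrow>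
   ('e1 \<times> 'f1 \<Rightarrow> 'k1) \<Rightarrow> ('e0 \<times> 'f0 \<Rightarrow> 'k0) \<Rightarrow> bool" where
  "semistrict_connection X \<G> E \<pi>1 \<pi>0 R1 R0 \<omega>1 \<omega>0 \<longleftrightarrow>
     principal_two_bundle X \<G> E \<pi>1 \<pi>0 R1 R0 \<and> equivariant_two_form \<G> E R1 R0 \<omega>1 \<omega>0 \<and>
     (\<exists>\<kappa> :: 'e0 \<times> 'k0 \<Rightarrow> 'k1.
        smooth_nat_iso (prod_gpd E (lie_alg_gpd \<G>)) (lie_alg_gpd \<G>)
          (\<lambda>z. \<omega>1 (fundamental1 \<G> E R1 z)) (\<lambda>z. \<omega>0 (fundamental0 \<G> E R0 z)) snd snd \<kappa> \<and>
        (\<forall>p\<in>pts (obj E). linear_on_subspace (lie_alg0 \<G>) (\<lambda>B. \<kappa> (p, B))) \<and>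
        (\<forall>p\<in>pts (obj E). \<forall>B\<in>lie_alg0 \<G>. \<forall>g\<in>carrier (grp0 \<G>).
           \<kappa> (R0 (p, g), Ad (obj (tg_gpd \<G>)) (grp0 \<G>) (inv\<^bsub>grp0 \<G>\<^esub> g) B) =
           Ad (arr (tg_gpd \<G>)) (grp1 \<G>) (inv\<^bsub>grp1 \<G>\<^esub> (gunit (tg_gpd \<G>) g)) (\<kappa> (p, B))))"


section \<open>Lie crossed modules\<close>

definition crossed_module ::
  "('g, 'k::euclidean_space) mfd \<Rightarrow> 'g monoid \<Rightarrow> ('h, 'l::euclidean_space) mfd \<Rightarrow> 'h monoid \<Rightarrow>
   ('h \<Rightarrow> 'g) \<Rightarrow> ('g \<times> 'h \<Rightarrow> 'h) \<Rightarrow> bool" where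
  "crossed_module MG G MH H \<tau> \<alpha> \<longleftrightarrow>
     lie_group MG G \<and> lie_group MH H \<and>
     smooth_map MH MG \<tau> \<and> \<tau> \<in> hom H G \<and>
     smooth_map (prod_mfd MG MH) MH \<alpha> \<and>
     (\<forall>g\<in>carrier G. (\<lambda>h. \<alpha> (g, h)) \<in> iso H H) \<and>
     (\<forall>h\<in>carrier H. \<alpha> (\<one>\<^bsub>G\<^esub>, h) = h) \<and>
     (\<forall>g\<in>carrier G. \<forall>g'\<in>carrier G. \<forall>h\<in>carrier H. \<alpha> (g \<otimes>\<^bsub>G\<^esub> g', h) = \<alpha> (g, \<alpha> (g', h))) \<and>
     (\<forall>g\<in>carrier G. \<forall>h\<in>carrier H. \<tau> (\<alpha> (g, h)) = g \<otimes>\<^bsub>G\<^esub> \<tau> h \<otimes>\<^bsub>G\<^esub> inv\<^bsub>G\<^esub> g) \<and>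
     (\<forall>h\<in>carrier H. \<forall>h'\<in>carrier H. \<alpha> (\<tau> h, h') = h \<otimes>\<^bsub>H\<^esub> h' \<otimes>\<^bsub>H\<^esub> inv\<^bsub>H\<^esub> h)"

definition semidirect :: "'g monoid \<Rightarrow> 'h monoid \<Rightarrow> ('g \<times> 'h \<Rightarrow> 'h) \<Rightarrow> ('h \<times> 'g) monoid" where
  "semidirect G H \<alpha> = \<lparr> carrier = carrier H \<times> carrier G,
     monoid.mult = (\<lambda>(h2, g2) (h1, g1). (h2 \<otimes>\<^bsub>H\<^esub> \<alpha> (g2, h1), g2 \<otimes>\<^bsub>G\<^esub> g1)),
     one = (\<one>\<^bsub>H\<^esub>, \<one>\<^bsub>G\<^esub>) \<rparr>"

definition cm_two_group ::
  "('g, 'k) mfd \<Rightarrow> 'g monoid \<Rightarrow> ('h, 'l) mfd \<Rightarrow> 'h monoid \<Rightarrow> ('h \<Rightarrow> 'g) \<Rightarrow> ('g \<times> 'h \<Rightarrow> 'h) \<Rightarrow>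
   ('h \<times> 'g, 'l \<times> 'k, 'g, 'k) two_group" where
  "cm_two_group MG G MH H \<tau> \<alpha> =
     \<lparr> tg_gpd = \<lparr> arr = prod_mfd MH MG, obj = MG, src = snd, tgt = (\<lambda>(h, g). \<tau> h \<otimes>\<^bsub>G\<^esub> g),
         gcomp = (\<lambda>((h2, g2), (h1, g1)). (h2 \<otimes>\<^bsub>H\<^esub> h1, g1)),
         gunit = (\<lambda>g. (\<one>\<^bsub>H\<^esub>, g)), ginv = (\<lambda>(h, g). (inv\<^bsub>H\<^esub> h, \<tau> h \<otimes>\<^bsub>G\<^esub> g)) \<rparr>,
       grp1 = semidirect G H \<alpha>, grp0 = G \<rparr>"


section \<open>Principal bundles over a Lie groupoid and their decorations\<close>

definition groupoid_bundle ::
  "('x1, 'm1::euclidean_space, 'x0, 'm0::euclidean_space) gpd \<Rightarrow> ('g, 'k::euclidean_space) mfd \<Rightarrow>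
   'g monoid \<Rightarrow> ('e, 'f::euclidean_space) mfd \<Rightarrow> ('e \<Rightarrow> 'x0) \<Rightarrow> ('e \<times> 'g \<Rightarrow> 'e) \<Rightarrow> ('x1 \<times> 'e \<Rightarrow> 'e) \<Rightarrow> bool" where
  "groupoid_bundle X MG G E \<pi> R \<mu> \<longleftrightarrow>
     lie_groupoid X \<and> principal_bundle (obj X) MG G E \<pi> R \<and>
     smooth_map (fib_prod (arr X) E (src X) \<pi>) E \<mu> \<and>
     (\<forall>\<gamma>\<in>pts (arr X). \<forall>p\<in>pts E. src X \<gamma> = \<pi> p \<longrightarrow> \<pi> (\<mu> (\<gamma>, p)) = tgt X \<gamma>) \<and>
     (\<forall>p\<in>pts E. \<mu> (gunit X (\<pi> p), p) = p) \<and>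
     (\<forall>\<gamma>2\<in>pts (arr X). \<forall>\<gamma>1\<in>pts (arr X). \<forall>p\<in>pts E. src X \<gamma>2 = tgt X \<gamma>1 \<and> src X \<gamma>1 = \<pi> p \<longrightarrow>
        \<mu> (gcomp X (\<gamma>2, \<gamma>1), p) = \<mu> (\<gamma>2, \<mu> (\<gamma>1, p))) \<and>
     (\<forall>\<gamma>\<in>pts (arr X). \<forall>p\<in>pts E. \<forall>g\<in>carrier G. src X \<gamma> = \<pi> p \<longrightarrow>
        R (\<mu> (\<gamma>, p), g) = \<mu> (\<gamma>, R (p, g)))"

definition groupoid_bundle_connection ::
  "('x1, 'm1::euclidean_space, 'x0, 'm0::euclidean_space) gpd \<Rightarrow> ('g, 'k::euclidean_space) mfd \<Rightarrow>
   'g monoid \<Rightarrow> ('e, 'f::euclidean_space) mfd \<Rightarrow> ('e \<Rightarrow> 'x0) \<Rightarrow> ('e \<times> 'g \<Rightarrow> 'e) \<Rightarrow> ('x1 \<times> 'e \<Rightarrow> 'e) \<Rightarrow>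
   ('e \<times> 'f \<Rightarrow> 'k) \<Rightarrow> bool" where
  "groupoid_bundle_connection X MG G E \<pi> R \<mu> \<omega> \<longleftrightarrow> connection_form E MG G R \<omega> \<and>
     (let sE = fib_prod (arr X) E (src X) \<pi> in
      \<forall>z\<in>pts (TM sE). \<omega> (tmap sE E snd z) = \<omega> (tmap sE E \<mu> z))"

definition dec_gpd ::
  "('x1, 'm1, 'x0, 'm0) gpd \<Rightarrow> 'g monoid \<Rightarrow> ('h, 'l) mfd \<Rightarrow> 'h monoid \<Rightarrow> ('h \<Rightarrow> 'g) \<Rightarrow>
   ('e, 'f) mfd \<Rightarrow> ('e \<Rightarrow> 'x0) \<Rightarrow> ('e \<times> 'g \<Rightarrow> 'e) \<Rightarrow> ('x1 \<times> 'e \<Rightarrow> 'e) \<Rightarrow>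
   (('x1 \<times> 'e) \<times> 'h, ('m1 \<times> 'f) \<times> 'l, 'e, 'f) gpd" where
  "dec_gpd X G MH H \<tau> E \<pi> R \<mu> =
     \<lparr> arr = prod_mfd (fib_prod (arr X) E (src X) \<pi>) MH, obj = E,
       src = (\<lambda>((\<gamma>, p), h). p),
       tgt = (\<lambda>((\<gamma>, p), h). R (\<mu> (\<gamma>, p), \<tau> (inv\<^bsub>H\<^esub> h))),
       gcomp = (\<lambda>(((\<gamma>2, p2), h2), ((\<gamma>1, p1), h1)). ((gcomp X (\<gamma>2, \<gamma>1), p1), h2 \<otimes>\<^bsub>H\<^esub> h1)),
       gunit = (\<lambda>p. ((gunit X (\<pi> p), p), \<one>\<^bsub>H\<^esub>)),
       ginv = (\<lambda>((\<gamma>, p), h). ((ginv X \<gamma>, R (\<mu> (\<gamma>, p), \<tau> (inv\<^bsub>H\<^esub> h))), inv\<^bsub>H\<^esub> h)) \<rparr>"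

definition dec_proj :: "('x1 \<times> 'e) \<times> 'h \<Rightarrow> 'x1" where
  "dec_proj = (\<lambda>((\<gamma>, p), h). \<gamma>)"

definition dec_action ::
  "'g monoid \<Rightarrow> 'h monoid \<Rightarrow> ('g \<times> 'h \<Rightarrow> 'h) \<Rightarrow> ('e \<times> 'g \<Rightarrow> 'e) \<Rightarrow>
   (('x1 \<times> 'e) \<times> 'h) \<times> ('h \<times> 'g) \<Rightarrow> ('x1 \<times> 'e) \<times> 'h" where
  "dec_action G H \<alpha> R =
     (\<lambda>(((\<gamma>, p), h), (h', g)). ((\<gamma>, R (p, g)), \<alpha> (inv\<^bsub>G\<^esub> g, inv\<^bsub>H\<^esub> h' \<otimes>\<^bsub>H\<^esub> h)))"

text \<open>The second summand is \<open>\<KK> \<cdot> h\<inverse>\<close>, the differential of right translation by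
  \<open>h\<inverse>\<close> applied to \<open>\<KK>\<close>.  The embeddings of the Lie algebras of \<open>H\<close> and \<open>G\<close> into that of
  the semidirect product are \<open>B \<mapsto> (B, 0)\<close> and \<open>A \<mapsto> (0, A)\<close>.\<close>

definition dec_form ::
  "('g, 'k::euclidean_space) mfd \<Rightarrow> 'g monoid \<Rightarrow> ('h, 'l::euclidean_space) mfd \<Rightarrow> 'h monoid \<Rightarrow>
   ('g \<times> 'h \<Rightarrow> 'h) \<Rightarrow> ('e \<times> 'f \<Rightarrow> 'k) \<Rightarrow> (('x1 \<times> 'e) \<times> 'h) \<times> (('m1 \<times> 'f) \<times> 'l) \<Rightarrow> 'l \<times> 'k" where
  "dec_form MG G MH H \<alpha> \<omega> = (\<lambda>(((\<gamma>, p), h), ((X, v), \<KK>)).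
     Ad (prod_mfd MH MG) (semidirect G H \<alpha>) (h, \<one>\<^bsub>G\<^esub>) (0, \<omega> (p, v))
     - (mderiv MH MH (\<lambda>x. x \<otimes>\<^bsub>H\<^esub> inv\<^bsub>H\<^esub> h) h \<KK>, 0))"

definition modified_form1 ::
  "('x1, 'm1::euclidean_space, 'x0, 'm0::euclidean_space) gpd \<Rightarrow>
   ('g, 'k::euclidean_space) mfd \<Rightarrow> 'g monoid \<Rightarrow> ('h, 'l::euclidean_space) mfd \<Rightarrow> 'h monoid \<Rightarrow>
   ('h \<Rightarrow> 'g) \<Rightarrow> ('g \<times> 'h \<Rightarrow> 'h) \<Rightarrow>
   ('e, 'f::euclidean_space) mfd \<Rightarrow> ('e \<Rightarrow> 'x0) \<Rightarrow> ('e \<times> 'g \<Rightarrow> 'e) \<Rightarrow> ('x1 \<times> 'e \<Rightarrow> 'e) \<Rightarrow>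
   ('e \<times> 'f \<Rightarrow> 'k) \<Rightarrow> ('e \<times> 'f \<Rightarrow> 'l) \<Rightarrow>
   (('x1 \<times> 'e) \<times> 'h) \<times> (('m1 \<times> 'f) \<times> 'l) \<Rightarrow> 'l \<times> 'k" where
  "modified_form1 X MG G MH H \<tau> \<alpha> E \<pi> R \<mu> \<omega> lam z =
     (let D = dec_gpd X G MH H \<tau> E \<pi> R \<mu>;
          s_lam = lam (tmap (arr D) (obj D) (src D) z);
          t_lam = lam (tmap (arr D) (obj D) (tgt D) z)
      in dec_form MG G MH H \<alpha> \<omega> z + (0, mderiv MH MG \<tau> \<one>\<^bsub>H\<^esub> s_lam) + (t_lam, 0) - (s_lam, 0))"

definition modified_form0 ::
  "('g, 'k::euclidean_space) mfd \<Rightarrow> ('h, 'l::euclidean_space) mfd \<Rightarrow> 'h monoid \<Rightarrow> ('h \<Rightarrow> 'g) \<Rightarrow>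
   ('e \<times> 'f \<Rightarrow> 'k) \<Rightarrow> ('e \<times> 'f \<Rightarrow> 'l) \<Rightarrow> 'e \<times> 'f \<Rightarrow> 'k" where
  "modified_form0 MG MH H \<tau> \<omega> lam z = \<omega> z + mderiv MH MG \<tau> \<one>\<^bsub>H\<^esub> (lam z)"

end

theory Submission
  imports Defs
begin

text \<open>
  Everything happens on three levels: manifolds, Lie groups, and the decorated bundle.

  A tangent vector is handled as the velocity of a smooth curve, and a differential is computed by
  recognising the image of one such curve. What makes this work for the fibre products that occur
  everywhere (\<open>s\<^sup>*E\<^sub>0\<close>, composable pairs of arrows) is that a submersion is linear in suitable
  coordinates (\<open>submersion_normal_form\<close>, from the inverse function theorem for infinitely differentiable
  maps). Hence the fibre product of a submersion with any smooth map is a manifold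
  (\<open>manifold_fib_prod\<close>), and its tangent vectors are exactly the matching pairs of tangent vectors
  (\<open>tspace_fib_prod\<close>). In particular two composable tangent arrows are a tangent vector of the
  manifold of composable pairs, so that the tangent groupoid makes sense.

  On a Lie group the differential of multiplication at the identity is addition (\<open>mderiv_mult\<close>), so
  identities between Lie algebra maps arise by differentiating identities between group elements. For
  a crossed module the important one concerns \<open>dcross h\<close>, the \<open>L(H)\<close>-component of \<open>ad\<^bsub>(h,e)\<^esub>\<close> on \<open>L(G)\<close>:
  it is a cocycle in \<open>h\<close>, it satisfies \<open>\<tau>(dcross h B) = ad\<^bsub>\<tau>(h)\<^esub> B - B\<close>, and by the Peiffer identity
  \<open>dcross h (\<tau> b) = ad\<^sub>h b - b\<close>.

  The decorated groupoid inherits its algebra from \<open>\<mu>\<close> and the crossed module, its smoothness from the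
  fibre products, and its local trivialisations from those of \<open>E\<^sub>0\<close> (\<open>principal_two_bundle_D\<close>). That
  \<open>\<omega>\<^sup>d\<^sup>e\<^sup>c\<close> restricts to the identity on fundamental vectors and is equivariant is the product rule for the
  translated velocity \<open>v h\<inverse>\<close>. Being a functor amounts to linear conditions on source, target, units
  and composition (\<open>form_functorI\<close>). The source is clear. For the target (\<open>W1_tgt\<close>), the target of \<open>(\<gamma>, p, h)\<close> is
  \<open>\<mu>(\<gamma>, p) \<tau>(h\<inverse>)\<close>; the form \<open>\<omega>\<close> does not see \<open>\<mu>\<close>, and the usual formula for a connection in a moving
  frame gives \<open>ad\<^bsub>\<tau>(h)\<^esub> \<omega>(v) - \<tau>(K h\<inverse>)\<close>, which is the target of \<open>\<omega>\<^sup>d\<^sup>e\<^sup>c\<close>. For the composition (\<open>W1_comp\<close>) the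
  cocycle rule for \<open>dcross\<close> and the Peiffer identity turn the form of \<open>h\<^sub>2 h\<^sub>1\<close> into the sum of the
  \<open>L(H)\<close>-components.

  The modified pair adds \<open>(t\<^sup>*\<lambda> - s\<^sup>*\<lambda>, \<tau>(s\<^sup>*\<lambda>))\<close>, an arrow from \<open>\<tau>(s\<^sup>*\<lambda>)\<close> to \<open>\<tau>(t\<^sup>*\<lambda>)\<close> in the Lie 2-algebra;
  along a composition these differences telescope, so the sum is again a functor. Its equivariance
  (\<open>V1_equivariant\<close>) needs the Peiffer identity once more. On the fundamental vector of \<open>B\<close> the modified
  form is off by \<open>\<tau>(\<lambda>(\<delta>\<^sub>p B))\<close>, which lies in the image of \<open>\<tau>\<close>; hence
  \<open>\<kappa>(p, B) = (- \<lambda>(\<delta>\<^sub>p B), B + \<tau>(\<lambda>(\<delta>\<^sub>p B)))\<close> is an arrow back to \<open>B\<close>, and these arrows form the required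
  natural isomorphism (\<open>kappa_nat_iso\<close>).
\<close>

section \<open>Calculus of infinitely differentiable maps\<close>

lemma Ck_on_subset: "Ck_on k S f \<Longrightarrow> T \<subseteq> S \<Longrightarrow> Ck_on k T f"
  by (induction k arbitrary: f) (auto intro: continuous_on_subset)

lemma frechet_derivative_cong_open:
  assumes "open S" "x \<in> S" "\<And>y. y \<in> S \<Longrightarrow> f y = g y"
  shows "frechet_derivative f (at x) = frechet_derivative g (at x)"
proof -
  have "(f has_derivative D) (at x) \<longleftrightarrow> (g has_derivative D) (at x)" for D
    using has_derivative_transform_within_open[OF _ assms(1,2)] assms(3) by metis
  then show ?thesis unfolding frechet_derivative_def by simp
qed

lemma differentiable_cong_open:
  assumes "open S" "x \<in> S" "\<And>y. y \<in> S \<Longrightarrow> f y = g y"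
  shows "f differentiable (at x) \<longleftrightarrow> g differentiable (at x)"
  unfolding differentiable_def using has_derivative_transform_within_open[OF _ assms(1,2)] assms(3) by metis

lemma Ck_on_cong:
  assumes "open S" "\<And>x. x \<in> S \<Longrightarrow> f x = g x"
  shows "Ck_on k S f \<longleftrightarrow> Ck_on k S g"
  using assms(2)
proof (induction k arbitrary: f g)
  case 0
  then show ?case by (auto cong: continuous_on_cong)
next
  case (Suc k)
  have "Ck_on k S (\<lambda>x. frechet_derivative f (at x) v) \<longleftrightarrow> Ck_on k S (\<lambda>x. frechet_derivative g (at x) v)" for v
    by (rule Suc.IH) (simp add: frechet_derivative_cong_open[OF assms(1) _ Suc.prems])
  then show ?case using differentiable_cong_open[OF assms(1) _ Suc.prems] by simp
qed

lemma Ck_on_continuous: "Ck_on k S f \<Longrightarrow> continuous_on S f"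
proof (cases k)
  case (Suc n)
  assume "Ck_on k S f"
  then show ?thesis
    using Suc by (auto intro!: continuous_at_imp_continuous_on differentiable_imp_continuous_within)
qed simp

lemma Ck_on_Suc_imp: "Ck_on (Suc k) S f \<Longrightarrow> Ck_on k S f"
proof (induction k arbitrary: f)
  case 0
  then show ?case using Ck_on_continuous[of "Suc 0" S f] by simp
next
  case (Suc k)
  then show ?case by (metis Ck_on.simps(2))
qed

text \<open>The recursion for \<open>Ck_on\<close> with a concretely given derivative, which avoids the choice
  operator in \<open>frechet_derivative\<close>.\<close>

lemma Ck_on_SucI:
  assumes S: "open S" and d: "\<And>x. x \<in> S \<Longrightarrow> (f has_derivative D x) (at x)"
    and C: "\<And>v. Ck_on k S (\<lambda>x. D x v)"
  shows "Ck_on (Suc k) S f"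
proof -
  have eq: "x \<in> S \<Longrightarrow> frechet_derivative f (at x) = D x" for x
    using d frechet_derivative_at by metis
  have "Ck_on k S (\<lambda>x. frechet_derivative f (at x) v)" for v
    using C[of v] Ck_on_cong[OF S, of "\<lambda>x. frechet_derivative f (at x) v" "\<lambda>x. D x v" k] eq by simp
  then show ?thesis using d by (auto simp: differentiable_def)
qed

lemma Ck_on_has_derivative:
  "Ck_on (Suc k) S f \<Longrightarrow> x \<in> S \<Longrightarrow> (f has_derivative frechet_derivative f (at x)) (at x)"
  by (simp add: frechet_derivative_works)

lemma Ck_on_const: "open S \<Longrightarrow> Ck_on k S (\<lambda>x. c)"
proof (induction k arbitrary: c)
  case (Suc k)
  show ?case by (rule Ck_on_SucI[where D = "\<lambda>_ _. 0"]) (use Suc in auto)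
qed simp

lemma Ck_on_bounded_linear:
  assumes "open S" "bounded_linear L" shows "Ck_on k S L"
proof (cases k)
  case 0
  then show ?thesis using assms(2) by (simp add: linear_continuous_on)
next
  case (Suc n)
  show ?thesis unfolding Suc
    by (rule Ck_on_SucI[where D = "\<lambda>_. L"])
       (use assms bounded_linear_imp_has_derivative Ck_on_const in auto)
qed

lemma Ck_on_linear_comp:
  assumes "open S" "bounded_linear L" "Ck_on k S f"
  shows "Ck_on k S (\<lambda>x. L (f x))"
  using assms(3)
proof (induction k arbitrary: f)
  case 0
  then show ?case using assms(2) bounded_linear.continuous_on by auto
next
  case (Suc k)
  show ?case
    by (rule Ck_on_SucI[OF assms(1), where D = "\<lambda>x v. L (frechet_derivative f (at x) v)"])
       (use bounded_linear.has_derivative[OF assms(2) Ck_on_has_derivative[OF Suc.prems]] Suc in auto)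
qed

lemma Ck_on_add:
  assumes "open S" "Ck_on k S f" "Ck_on k S g"
  shows "Ck_on k S (\<lambda>x. f x + g x)"
  using assms(2,3)
proof (induction k arbitrary: f g)
  case 0
  then show ?case by (auto intro: continuous_intros)
next
  case (Suc k)
  show ?case
    by (rule Ck_on_SucI[OF assms(1), OF has_derivative_add[OF Ck_on_has_derivative[OF Suc.prems(1)] Ck_on_has_derivative[OF Suc.prems(2)]]])
       (use Suc in auto)
qed

lemma Ck_on_sum:
  assumes "open S" "finite I" "\<And>i. i \<in> I \<Longrightarrow> Ck_on k S (f i)"
  shows "Ck_on k S (\<lambda>x. \<Sum>i\<in>I. f i x)"
  using assms(2,3) by (induction I rule: finite_induct) (auto intro!: Ck_on_add Ck_on_const assms(1))

lemma Ck_on_scaleR: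
  assumes "open S" "Ck_on k S a" "Ck_on k S f"
  shows "Ck_on k S (\<lambda>x. a x *\<^sub>R f x)"
  using assms(2,3)
proof (induction k arbitrary: a f)
  case 0
  then show ?case by (auto intro: continuous_intros)
next
  case (Suc k)
  show ?case
  proof (rule Ck_on_SucI[OF assms(1) has_derivative_scaleR[OF Ck_on_has_derivative[OF Suc.prems(1)] Ck_on_has_derivative[OF Suc.prems(2)]]])
    show "Ck_on k S (\<lambda>x. a x *\<^sub>R frechet_derivative f (at x) v + frechet_derivative a (at x) v *\<^sub>R f x)" for v
    proof (intro Ck_on_add[OF assms(1)])
      show "Ck_on k S (\<lambda>x. a x *\<^sub>R frechet_derivative f (at x) v)"
        by (rule Suc.IH[OF Ck_on_Suc_imp[OF Suc.prems(1)]]) (use Suc.prems(2) in simp)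
      show "Ck_on k S (\<lambda>x. frechet_derivative a (at x) v *\<^sub>R f x)"
        by (rule Suc.IH[OF _ Ck_on_Suc_imp[OF Suc.prems(2)]]) (use Suc.prems(1) in simp)
    qed
  qed
qed

text \<open>Derivatives of a composition are finite sums of products of partial derivatives, so the
  chain rule propagates through all orders by induction.\<close>

lemma Ck_on_compose:
  fixes f :: "'a::real_normed_vector \<Rightarrow> 'b::euclidean_space" and g :: "'b \<Rightarrow> 'c::real_normed_vector"
  assumes "open S" "open T" "Ck_on k S f" "Ck_on k T g" "f ` S \<subseteq> T"
  shows "Ck_on k S (\<lambda>x. g (f x))"
  using assms(3,4)
proof (induction k arbitrary: g)
  case 0
  then show ?case using assms(5) by (auto intro: continuous_on_compose2)
next
  case (Suc k)
  have lin: "f x \<in> T \<Longrightarrow> bounded_linear (frechet_derivative g (at (f x)))" for x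
    using Ck_on_has_derivative[OF Suc.prems(2)] has_derivative_bounded_linear by blast
  have fS: "x \<in> S \<Longrightarrow> f x \<in> T" for x using assms(5) by blast
  show ?case
  proof (rule Ck_on_SucI[OF assms(1)])
    show "((\<lambda>x. g (f x)) has_derivative (\<lambda>v. frechet_derivative g (at (f x)) (frechet_derivative f (at x) v))) (at x)"
      if "x \<in> S" for x
      using has_derivative_compose[OF Ck_on_has_derivative[OF Suc.prems(1) that], of g]
        Ck_on_has_derivative[OF Suc.prems(2) fS[OF that]] by blast
    have "Ck_on k S (\<lambda>x. \<Sum>b\<in>Basis. (frechet_derivative f (at x) v \<bullet> b) *\<^sub>R frechet_derivative g (at (f x)) b)" for v
    proof (intro Ck_on_sum Ck_on_scaleR assms(1) finite_Basis)
      fix b :: 'b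
      show "Ck_on k S (\<lambda>x. frechet_derivative f (at x) v \<bullet> b)"
        using Suc.prems(1) by (intro Ck_on_linear_comp[OF assms(1) bounded_linear_inner_left]) auto
      show "Ck_on k S (\<lambda>x. frechet_derivative g (at (f x)) b)"
        using Suc.prems Ck_on_Suc_imp[OF Suc.prems(1)] by (intro Suc.IH) auto
    qed
    moreover have "(\<Sum>b\<in>Basis. (frechet_derivative f (at x) v \<bullet> b) *\<^sub>R frechet_derivative g (at (f x)) b)
        = frechet_derivative g (at (f x)) (frechet_derivative f (at x) v)" if "x \<in> S" for x v
    proof -
      interpret L: bounded_linear "frechet_derivative g (at (f x))" using lin fS that by blast
      have "frechet_derivative g (at (f x)) (frechet_derivative f (at x) v)
          = frechet_derivative g (at (f x)) (\<Sum>b\<in>Basis. (frechet_derivative f (at x) v \<bullet> b) *\<^sub>R b)"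
        by (simp add: euclidean_representation)
      then show ?thesis by (simp add: L.sum L.scaleR)
    qed
    ultimately show "Ck_on k S (\<lambda>x. frechet_derivative g (at (f x)) (frechet_derivative f (at x) v))" for v
      using Ck_on_cong[OF assms(1)] by (metis (no_types, lifting))
  qed
qed

lemma Ck_on_Pair:
  fixes f :: "'a::real_normed_vector \<Rightarrow> 'b::euclidean_space" and g :: "'a \<Rightarrow> 'c::euclidean_space"
  assumes "open S" "Ck_on k S f" "Ck_on k S g"
  shows "Ck_on k S (\<lambda>x. (f x, g x))"
proof -
  have "Ck_on k S (\<lambda>x. (f x, 0::'c) + (0::'b, g x))"
    by (intro Ck_on_add assms(1) Ck_on_linear_comp[OF assms(1) _ assms(2)] Ck_on_linear_comp[OF assms(1) _ assms(3)]
        bounded_linear_Pair bounded_linear_ident bounded_linear_zero)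
  then show ?thesis by simp
qed

lemma Cinf_on_subset: "Cinf_on S f \<Longrightarrow> T \<subseteq> S \<Longrightarrow> Cinf_on T f"
  unfolding Cinf_on_def using Ck_on_subset by blast

lemma Cinf_on_cong: "open S \<Longrightarrow> (\<And>x. x \<in> S \<Longrightarrow> f x = g x) \<Longrightarrow> Cinf_on S f \<longleftrightarrow> Cinf_on S g"
  unfolding Cinf_on_def using Ck_on_cong by metis

lemma Cinf_on_continuous: "Cinf_on S f \<Longrightarrow> continuous_on S f"
  unfolding Cinf_on_def using Ck_on_continuous by blast

lemma Cinf_on_has_derivative: 
  "Cinf_on S f \<Longrightarrow> x \<in> S \<Longrightarrow> (f has_derivative frechet_derivative f (at x)) (at x)"
  unfolding Cinf_on_def using Ck_on_has_derivative by blast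

lemma Cinf_on_derivative: "Cinf_on S f \<Longrightarrow> Cinf_on S (\<lambda>x. frechet_derivative f (at x) v)"
  unfolding Cinf_on_def by (metis Ck_on.simps(2))

lemma Cinf_on_const: "open S \<Longrightarrow> Cinf_on S (\<lambda>x. c)"
  unfolding Cinf_on_def by (simp add: Ck_on_const)

lemma Cinf_on_bounded_linear: "open S \<Longrightarrow> bounded_linear L \<Longrightarrow> Cinf_on S L"
  unfolding Cinf_on_def by (simp add: Ck_on_bounded_linear)

lemma Cinf_on_linear_comp: "open S \<Longrightarrow> bounded_linear L \<Longrightarrow> Cinf_on S f \<Longrightarrow> Cinf_on S (\<lambda>x. L (f x))"
  unfolding Cinf_on_def by (simp add: Ck_on_linear_comp)

lemma Cinf_on_add: "open S \<Longrightarrow> Cinf_on S f \<Longrightarrow> Cinf_on S g \<Longrightarrow> Cinf_on S (\<lambda>x. f x + g x)"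
  unfolding Cinf_on_def by (simp add: Ck_on_add)

lemma Cinf_on_scaleR: "open S \<Longrightarrow> Cinf_on S a \<Longrightarrow> Cinf_on S f \<Longrightarrow> Cinf_on S (\<lambda>x. a x *\<^sub>R f x)"
  unfolding Cinf_on_def by (simp add: Ck_on_scaleR)

lemma Cinf_on_sum:
  "open S \<Longrightarrow> finite I \<Longrightarrow> (\<And>i. i \<in> I \<Longrightarrow> Cinf_on S (h i)) \<Longrightarrow> Cinf_on S (\<lambda>x. \<Sum>i\<in>I. h i x)"
  unfolding Cinf_on_def by (simp add: Ck_on_sum)

lemma Cinf_on_ident: "open S \<Longrightarrow> Cinf_on S (\<lambda>x. x)"
  by (simp add: Cinf_on_bounded_linear bounded_linear_ident)

lemma Cinf_on_diff:
  assumes "open S" "Cinf_on S f" "Cinf_on S g" shows "Cinf_on S (\<lambda>x. f x - g x)"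
proof -
  have "Cinf_on S (\<lambda>x. - g x)"
    by (rule Cinf_on_linear_comp[OF assms(1) bounded_linear_minus[OF bounded_linear_ident] assms(3)])
  then show ?thesis using Cinf_on_add[OF assms(1,2)] by fastforce
qed

lemma Cinf_on_compose:
  fixes f :: "'a::real_normed_vector \<Rightarrow> 'b::euclidean_space"
  assumes "open S" "open T" "Cinf_on S f" "Cinf_on T g" "f ` S \<subseteq> T"
  shows "Cinf_on S (\<lambda>x. g (f x))"
  using assms unfolding Cinf_on_def by (simp add: Ck_on_compose[of S T])

lemma Cinf_on_Pair:
  fixes f :: "'a::real_normed_vector \<Rightarrow> 'b::euclidean_space" and g :: "'a \<Rightarrow> 'c::euclidean_space"
  assumes "open S" "Cinf_on S f" "Cinf_on S g"
  shows "Cinf_on S (\<lambda>x. (f x, g x))"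
  using assms unfolding Cinf_on_def by (simp add: Ck_on_Pair)

lemma Cinf_on_fst: "open S \<Longrightarrow> Cinf_on S fst"
  by (simp add: Cinf_on_bounded_linear bounded_linear_fst)

lemma Cinf_on_snd: "open S \<Longrightarrow> Cinf_on S snd"
  by (simp add: Cinf_on_bounded_linear bounded_linear_snd)

lemma open_preimage_Cinf:
  assumes "open S" "Cinf_on S f" "open T" shows "open (S \<inter> f -` T)"
  using continuous_open_preimage[OF Cinf_on_continuous[OF assms(2)] assms(1,3)] .

lemma bounded_linear_frechet_derivative:
  "Cinf_on S f \<Longrightarrow> x \<in> S \<Longrightarrow> bounded_linear (frechet_derivative f (at x))"
  using Cinf_on_has_derivative has_derivative_bounded_linear by blast

text \<open>The tangent map \<open>(x, v) \<mapsto> Df(x) v\<close> is jointly smooth because, \<open>v\<close> being a combination of basis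
  vectors, it is a finite sum of coordinates of \<open>v\<close> times partial derivatives. It is the local
  expression of the differential on the tangent bundle.\<close>

lemma Cinf_on_total_derivative:
  fixes f :: "'a::euclidean_space \<Rightarrow> 'b::real_normed_vector"
  assumes "open S" "Cinf_on S f"
  shows "Cinf_on (S \<times> UNIV) (\<lambda>(x, v). frechet_derivative f (at x) v)"
proof -
  have o: "open (S \<times> (UNIV :: 'a set))" by (simp add: assms(1) open_Times)
  have "Cinf_on (S \<times> UNIV) (\<lambda>z. \<Sum>b\<in>Basis. (snd z \<bullet> b) *\<^sub>R frechet_derivative f (at (fst z)) b)"
  proof (intro Cinf_on_sum[OF o] Cinf_on_scaleR[OF o] finite_Basis)
    fix b :: 'a
    show "Cinf_on (S \<times> UNIV) (\<lambda>z :: 'a \<times> 'a. snd z \<bullet> b)"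
      by (intro Cinf_on_bounded_linear[OF o] bounded_linear_inner_left_comp bounded_linear_snd)
    show "Cinf_on (S \<times> (UNIV::'a set)) (\<lambda>z. frechet_derivative f (at (fst z)) b)"
      by (rule Cinf_on_compose[OF o assms(1) Cinf_on_fst[OF o] Cinf_on_derivative[OF assms(2)]]) auto
  qed
  moreover have "(\<Sum>b\<in>Basis. (snd z \<bullet> b) *\<^sub>R frechet_derivative f (at (fst z)) b) = (\<lambda>(x, v). frechet_derivative f (at x) v) z"
    if "z \<in> S \<times> UNIV" for z
  proof -
    interpret L: bounded_linear "frechet_derivative f (at (fst z))"
      using bounded_linear_frechet_derivative[OF assms(2)] that by auto
    have "frechet_derivative f (at (fst z)) (snd z) = frechet_derivative f (at (fst z)) (\<Sum>b\<in>Basis. (snd z \<bullet> b) *\<^sub>R b)"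
      by (simp add: euclidean_representation)
    then show ?thesis by (simp add: L.sum L.scaleR case_prod_beta)
  qed
  ultimately show ?thesis using Cinf_on_cong[OF o] by (metis (no_types, lifting))
qed


section \<open>The inverse function theorem for infinitely differentiable maps\<close>

text \<open>When \<open>r\<close> vanishes at the point, the product rule for \<open>r b\<close> needs \<open>b\<close> only to be continuous there.
  This is what breaks the circle in differentiating \<open>A\<inverse>\<close>, which is at first only known to be
  continuous.\<close>

lemma has_derivative_mult_vanishing:
  fixes r :: "'a::real_normed_vector \<Rightarrow> real" and b :: "'a \<Rightarrow> 'b::real_normed_vector"
  assumes r: "(r has_derivative r') (at x)" "r x = 0" and b: "isCont b x"
  shows "((\<lambda>y. r y *\<^sub>R b y) has_derivative (\<lambda>h. r' h *\<^sub>R b x)) (at x)"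
proof -
  interpret r': bounded_linear r' using r(1) has_derivative_bounded_linear by blast
  obtain K where K: "\<And>h. \<bar>r' h\<bar> \<le> norm h * K" using r'.bounded by auto
  \<comment> \<open>The difference quotient splits into the error term of \<open>r\<close> times \<open>b y\<close> and a bounded factor times \<open>b y - b x\<close>.\<close>
  let ?q = "\<lambda>y. (r y - r' (y - x)) / norm (y - x)"
  have q: "(?q \<longlongrightarrow> 0) (at x)" using r by (auto simp: has_derivative_at_within divide_inverse ac_simps)
  have bl: "(b \<longlongrightarrow> b x) (at x)" using b isCont_def by blast
  have p: "((\<lambda>y. (r' (y - x) / norm (y - x)) *\<^sub>R (b y - b x)) \<longlongrightarrow> 0) (at x)"
  proof (rule Lim_null_comparison)
    show "((\<lambda>y. \<bar>K\<bar> * norm (b y - b x)) \<longlongrightarrow> 0) (at x)"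
      using bl by (auto intro!: tendsto_mult_right_zero simp: tendsto_norm_zero_iff LIM_zero_iff)
    show "\<forall>\<^sub>F y in at x. norm ((r' (y - x) / norm (y - x)) *\<^sub>R (b y - b x)) \<le> \<bar>K\<bar> * norm (b y - b x)"
    proof (rule eventually_at_filter[THEN iffD2], rule always_eventually, intro allI impI)
      fix y assume "y \<noteq> x"
      then have n: "norm (y - x) > 0" by simp
      have "\<bar>r' (y - x)\<bar> \<le> norm (y - x) * \<bar>K\<bar>" using K[of "y - x"] n
        by (smt (verit) mult_le_cancel_left_pos)
      then have "\<bar>r' (y - x)\<bar> / norm (y - x) \<le> \<bar>K\<bar>" using n by (simp add: divide_le_eq mult.commute)
      then show "norm ((r' (y - x) / norm (y - x)) *\<^sub>R (b y - b x)) \<le> \<bar>K\<bar> * norm (b y - b x)"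
        using mult_right_mono[OF _ norm_ge_zero[of "b y - b x"]] by fastforce
    qed
  qed
  have "((\<lambda>y. ?q y *\<^sub>R b y + (r' (y - x) / norm (y - x)) *\<^sub>R (b y - b x)) \<longlongrightarrow> 0 *\<^sub>R b x + 0) (at x)"
    by (intro tendsto_add tendsto_scaleR q bl p)
  moreover have "?q y *\<^sub>R b y + (r' (y - x) / norm (y - x)) *\<^sub>R (b y - b x)
      = (1 / norm (y - x)) *\<^sub>R (r y *\<^sub>R b y - r x *\<^sub>R b x - r' (y - x) *\<^sub>R b x)" for y
  proof -
    let ?c = "r' (y - x) / norm (y - x)"
    have "?q y *\<^sub>R b y + ?c *\<^sub>R (b y - b x) = (?q y + ?c) *\<^sub>R b y - ?c *\<^sub>R b x"
      by (simp add: algebra_simps)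
    also have "?q y + ?c = r y / norm (y - x)" by (simp add: diff_divide_distrib)
    finally show ?thesis by (simp add: r(2) scaleR_diff_right)
  qed
  ultimately have "((\<lambda>y. (r y *\<^sub>R b y - r x *\<^sub>R b x - r' (y - x) *\<^sub>R b x) /\<^sub>R norm (y - x)) \<longlongrightarrow> 0) (at x)"
    by (simp add: divide_inverse)
  moreover have "bounded_linear (\<lambda>h. r' h *\<^sub>R b x)"
    by (rule bounded_linear_scaleR_const[OF r'.bounded_linear_axioms])
  ultimately show ?thesis by (simp add: has_derivative_at_within)
qed

text \<open>Inversion of a family of linear maps is smooth: the derivative of \<open>A\<inverse> v\<close> is
  \<open>- A\<inverse> A' A\<inverse> v\<close>, which is again assembled from the functions \<open>A\<inverse> b\<close>, so each order of
  differentiability follows from the previous one.  Closeness to the identity gives the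
  uniform bound on \<open>A\<inverse>\<close> that makes it continuous.\<close>

lemma Ck_on_inverse_family:
  fixes A :: "'a::euclidean_space \<Rightarrow> 'b::euclidean_space \<Rightarrow> 'b"
  assumes S: "open S" and lin: "\<And>y. y \<in> S \<Longrightarrow> linear (A y)"
    and near: "\<And>y u. y \<in> S \<Longrightarrow> norm (A y u - u) \<le> norm u / 2"
    and AB: "\<And>y u. y \<in> S \<Longrightarrow> A y (B y u) = u"
    and C: "\<And>u. Ck_on k S (\<lambda>y. A y u)"
  shows "Ck_on k S (\<lambda>y. B y v)"
proof -
  have inj: "norm u \<le> 2 * norm (A y u)" if "y \<in> S" for y u
    using near[OF that, of u] norm_triangle_ineq3[of "A y u" u] norm_minus_commute[of u]
    by (smt (verit) field_sum_of_halves norm_triangle_ineq2)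
  have inj0: "A y u = 0 \<Longrightarrow> u = 0" if "y \<in> S" for y u using inj[OF that, of u] by simp
  have BA: "B y (A y u) = u" if "y \<in> S" for y u
    using inj0[OF that, of "B y (A y u) - u"] AB[OF that] linear_diff[OF lin[OF that]] by simp
  have Blin: "linear (B y)" if "y \<in> S" for y
  proof (rule linearI)
    show "B y (u + v) = B y u + B y v" for u v
      using BA[OF that, of "B y u + B y v"] by (simp add: linear_add[OF lin[OF that]] AB[OF that])
    show "B y (c *\<^sub>R u) = c *\<^sub>R B y u" for c u
      using BA[OF that, of "c *\<^sub>R B y u"] by (simp add: linear_scale[OF lin[OF that]] AB[OF that])
  qed
  have Bexp: "B y z = (\<Sum>b\<in>Basis. (z \<bullet> b) *\<^sub>R B y b)" if "y \<in> S" for y z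
  proof -
    have "B y z = B y (\<Sum>b\<in>Basis. (z \<bullet> b) *\<^sub>R b)" by (simp add: euclidean_representation)
    then show ?thesis by (simp add: linear_sum[OF Blin[OF that]] linear_scale[OF Blin[OF that]])
  qed
  have Bcont: "isCont (\<lambda>y. B y v) x" if x: "x \<in> S" for x v
  proof -
    have "continuous_on S (\<lambda>y. A y (B x v))" using Ck_on_continuous[OF C] .
    then have "((\<lambda>y. A y (B x v)) \<longlongrightarrow> v) (at x)"
      using x S AB[OF x] by (metis continuous_on_eq_continuous_at isCont_def)
    then have "((\<lambda>y. v - A y (B x v)) \<longlongrightarrow> v - v) (at x)" by (intro tendsto_diff tendsto_const)
    then have l: "((\<lambda>y. 2 * norm (v - A y (B x v))) \<longlongrightarrow> 0) (at x)"
      by (auto intro!: tendsto_mult_right_zero tendsto_norm_zero)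
    have "\<forall>\<^sub>F y in at x. norm (B y v - B x v) \<le> 2 * norm (v - A y (B x v))"
    proof -
      have "\<forall>\<^sub>F y in at x. y \<in> S" using S x eventually_at_in_open' by blast
      then show ?thesis
      proof eventually_elim
        case (elim y)
        show ?case using inj[OF elim, of "B y v - B x v"] AB[OF elim] linear_diff[OF lin[OF elim]] by simp
      qed
    qed
    then have "((\<lambda>y. B y v - B x v) \<longlongrightarrow> 0) (at x)" using l by (rule Lim_null_comparison)
    then show ?thesis by (simp add: isCont_def LIM_zero_iff)
  qed
  show ?thesis using C
  proof (induction k arbitrary: v)
    case 0
    show ?case using Bcont by (simp add: continuous_at_imp_continuous_on)
  next
    case (Suc k)
    let ?D = "\<lambda>x w. \<Sum>b\<in>Basis. (- (\<Sum>c\<in>Basis. (B x v \<bullet> c) *\<^sub>R frechet_derivative (\<lambda>y. A y c) (at x) w) \<bullet> b) *\<^sub>R B x b"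
    show ?case
    proof (rule Ck_on_SucI[OF S, where D = ?D])
      fix x assume x: "x \<in> S"
      let ?u = "B x v"
      have Aexp: "(\<Sum>c\<in>Basis. (?u \<bullet> c) *\<^sub>R A y c) = A y ?u" if "y \<in> S" for y
      proof -
        have "A y ?u = A y (\<Sum>c\<in>Basis. (?u \<bullet> c) *\<^sub>R c)" by (simp add: euclidean_representation)
        then show ?thesis by (simp add: linear_sum[OF lin[OF that]] linear_scale[OF lin[OF that]])
      qed
      have d1: "((\<lambda>y. \<Sum>c\<in>Basis. (?u \<bullet> c) *\<^sub>R A y c) has_derivative
          (\<lambda>w. \<Sum>c\<in>Basis. (?u \<bullet> c) *\<^sub>R frechet_derivative (\<lambda>y. A y c) (at x) w)) (at x)"
        by (intro has_derivative_sum has_derivative_scaleR_right Ck_on_has_derivative[OF Suc.prems x])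
      \<comment> \<open>\<open>B y v = u + B y (v - A y u)\<close> with \<open>u = B x v\<close>, and the argument \<open>v - A y u\<close> vanishes at \<open>y = x\<close>.\<close>
      let ?r = "\<lambda>y. v - (\<Sum>c\<in>Basis. (?u \<bullet> c) *\<^sub>R A y c)"
      have d2: "(?r has_derivative
          (\<lambda>w. - (\<Sum>c\<in>Basis. (?u \<bullet> c) *\<^sub>R frechet_derivative (\<lambda>y. A y c) (at x) w))) (at x)"
        using has_derivative_diff[OF has_derivative_const d1, of v] by simp
      have r0: "?r x = 0" by (simp add: Aexp[OF x] AB[OF x])
      have "((\<lambda>y. \<Sum>b\<in>Basis. (?r y \<bullet> b) *\<^sub>R B y b) has_derivative ?D x) (at x)"
        by (intro has_derivative_sum has_derivative_mult_vanishing Bcont x)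
           (use has_derivative_inner_left[OF d2] r0 in auto)
      then have "((\<lambda>y. ?u + (\<Sum>b\<in>Basis. (?r y \<bullet> b) *\<^sub>R B y b)) has_derivative ?D x) (at x)"
        using has_derivative_add[OF has_derivative_const, of _ "?D x" "at x" ?u] by simp
      then show "((\<lambda>y. B y v) has_derivative ?D x) (at x)"
      proof (rule has_derivative_transform_within_open[OF _ S x])
        fix y assume y: "y \<in> S"
        show "?u + (\<Sum>b\<in>Basis. (?r y \<bullet> b) *\<^sub>R B y b) = B y v"
          unfolding Bexp[OF y, symmetric] by (simp add: Aexp[OF y] linear_diff[OF Blin[OF y]] BA[OF y])
      qed
    next
      have k: "Ck_on k S (\<lambda>y. B y v)" for v by (rule Suc.IH) (use Ck_on_Suc_imp[OF Suc.prems] in blast)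
      show "Ck_on k S (\<lambda>x. ?D x w)" for w
        by (intro Ck_on_sum[OF S] Ck_on_scaleR[OF S] finite_Basis k
            Ck_on_linear_comp[OF S bounded_linear_inner_left] Ck_on_linear_comp[OF S bounded_linear_minus[OF bounded_linear_ident]])
           (use Suc.prems in auto)
    qed
  qed
qed

text \<open>The derivative of the inverse \<open>g\<close> is \<open>DF(g y)\<inverse>\<close>, which is as often differentiable as \<open>g\<close> itself, so
  the order of differentiability of \<open>g\<close> climbs by induction from the continuously differentiable
  case. The derivative at the base point is normalised to the identity because the changes of
  coordinates between flat models below have that form.\<close>

theorem Cinf_local_inverse:
  fixes F :: "'a::euclidean_space \<Rightarrow> 'a"
  assumes U: "open U" and F: "Cinf_on U F" and a: "a \<in> U" and id: "frechet_derivative F (at a) = (\<lambda>v. v)"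
  obtains U' G where "open U'" "a \<in> U'" "U' \<subseteq> U" "open (F ` U')" "Cinf_on (F ` U') G"
    "\<And>x. x \<in> U' \<Longrightarrow> G (F x) = x"
proof -
  let ?f' = "\<lambda>x. Blinfun (frechet_derivative F (at x))"
  have f': "blinfun_apply (?f' x) = frechet_derivative F (at x)" if "x \<in> U" for x
    using bounded_linear_Blinfun_apply bounded_linear_frechet_derivative[OF F that] by blast
  have cont: "continuous_on U ?f'"
  proof (rule continuous_on_blinfun_componentwise)
    fix i :: 'a
    have "continuous_on U (\<lambda>x. frechet_derivative F (at x) i)"
      by (rule Cinf_on_continuous[OF Cinf_on_derivative[OF F]])
    then show "continuous_on U (\<lambda>x. blinfun_apply (?f' x) i)" using f' by (simp cong: continuous_on_cong)
  qed
  have idb: "?f' a = id_blinfun" using f'[OF a] id by (intro blinfun_eqI) simp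
  \<comment> \<open>Shrink to where \<open>DF\<close> is within \<open>1/2\<close> of the identity, which keeps its inverses uniformly bounded.\<close>
  define U2 where "U2 = U \<inter> ?f' -` ball id_blinfun (1/2)"
  have U2: "open U2" unfolding U2_def by (rule continuous_open_preimage[OF cont U]) simp
  have a2: "a \<in> U2" unfolding U2_def using a idb by simp
  have near: "norm (frechet_derivative F (at x) u - u) \<le> norm u / 2" if "x \<in> U2" for x u
  proof -
    have "norm (?f' x - id_blinfun) \<le> 1/2" using that unfolding U2_def by (simp add: dist_norm norm_minus_commute)
    then have "norm (blinfun_apply (?f' x - id_blinfun) u) \<le> 1/2 * norm u"
      using norm_blinfun[of "?f' x - id_blinfun" u] mult_right_mono[of _ "1/2" "norm u"] by fastforce
    then show ?thesis using f' that unfolding U2_def by (simp add: blinfun.diff_left)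
  qed
  obtain U' V g g' where *: "open U'" "U' \<subseteq> U2" "a \<in> U'" "open V" "homeomorphism U' V F g"
    "\<And>y. y \<in> V \<Longrightarrow> (g has_derivative (g' y)) (at y)"
    "\<And>y. y \<in> V \<Longrightarrow> g' y = inv_into UNIV (blinfun_apply (?f' (g y)))"
    "\<And>y. y \<in> V \<Longrightarrow> bij (blinfun_apply (?f' (g y)))"
  proof (rule inverse_function_theorem[OF U2, of F ?f' a id_blinfun])
    show "(F has_derivative blinfun_apply (?f' x)) (at x)" if "x \<in> U2" for x
      using that f' Cinf_on_has_derivative[OF F] by (simp add: U2_def)
    show "continuous_on U2 ?f'" using cont continuous_on_subset unfolding U2_def by blast
    show "id_blinfun o\<^sub>L ?f' a = id_blinfun" unfolding idb by (intro blinfun_eqI) simp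
  qed (use a2 in blast)+
  have VU: "F ` U' = V" and gU: "\<And>y. y \<in> V \<Longrightarrow> g y \<in> U'" and gF: "\<And>x. x \<in> U' \<Longrightarrow> g (F x) = x"
    using *(5) by (auto simp: homeomorphism_def)
  have gU': "y \<in> V \<Longrightarrow> g y \<in> U" for y using gU *(2) U2_def by blast
  have Ck: "Ck_on k V g" for k
  proof (induction k)
    case 0
    have "isCont g y" if "y \<in> V" for y using has_derivative_continuous[OF *(6)[OF that]] .
    then show ?case by (simp add: continuous_at_imp_continuous_on)
  next
    case (Suc k)
    show ?case
    proof (rule Ck_on_SucI[OF *(4,6)])
      fix v
      show "Ck_on k V (\<lambda>x. g' x v)"
      proof (rule Ck_on_inverse_family[OF *(4), where A = "\<lambda>y. frechet_derivative F (at (g y))"])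
        fix y assume y: "y \<in> V"
        show "linear (frechet_derivative F (at (g y)))"
          using bounded_linear.linear bounded_linear_frechet_derivative[OF F gU'[OF y]] by blast
        show "norm (frechet_derivative F (at (g y)) u - u) \<le> norm u / 2" for u
          using near gU[OF y] *(2) by blast
        show "frechet_derivative F (at (g y)) (g' y u) = u" for u
          using *(7,8)[OF y] f'[OF gU'[OF y]] surj_f_inv_f[OF bij_is_surj] by metis
      next
        fix u
        show "Ck_on k V (\<lambda>y. frechet_derivative F (at (g y)) u)"
          using Cinf_on_derivative[OF F, of u] gU' unfolding Cinf_on_def
          by (intro Ck_on_compose[OF *(4) U Suc]) auto
      qed
    qed
  qed
  show ?thesis
    by (rule that[of U' g]) (use * gF VU Ck in \<open>auto simp: U2_def Cinf_on_def\<close>)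
qed

section \<open>Charts, smooth maps and velocities of curves\<close>

text \<open>Smooth maps are tested at each point \<open>p\<close> in the two charts attached to \<open>p\<close> and to its image.
  Composition and most closure properties therefore need only this first part of the definition of
  an atlas; the tangent bundle has it for trivial reasons.\<close>

definition pointed :: "('a, 'b) mfd \<Rightarrow> bool" where
  "pointed M \<longleftrightarrow> (\<forall>p\<in>pts M. p \<in> cdom M p \<and> cdom M p \<subseteq> pts M)"

text \<open>A manifold without the conditions on its topology and on the shape of its chart images: all that
  the calculus of differentials uses.\<close>

definition charted :: "('a, 'b::euclidean_space) mfd \<Rightarrow> bool" where
  "charted M \<longleftrightarrow> pointed M \<and> (\<forall>p\<in>pts M. inj_on (chart M p) (cdom M p)) \<and>
     (\<forall>p\<in>pts M. \<forall>q\<in>pts M. \<forall>r\<in>cdom M p \<inter> cdom M q.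
        \<exists>W g. open W \<and> chart M p r \<in> W \<and> Cinf_on W g \<and>
          (\<forall>x\<in>cdom M p. chart M p x \<in> W \<longrightarrow> x \<in> cdom M q \<and> g (chart M p x) = chart M q x))"

text \<open>\<open>g\<close> extends the expression of \<open>f\<close> in the chart attached to \<open>p\<close> smoothly to a neighbourhood of the image
  of \<open>x\<close> in the ambient Euclidean space.\<close>

definition local_rep where
  "local_rep M p x f W g \<longleftrightarrow> open W \<and> chart M p x \<in> W \<and> Cinf_on W g \<and>
     (\<forall>y\<in>cdom M p. chart M p y \<in> W \<longrightarrow> g (chart M p y) = f y)"

text \<open>A smooth curve through \<open>x\<close> with velocity \<open>v\<close> in the chart attached to \<open>p\<close>. Tangent vectors are handled as
  velocities of such curves, since a derivative within the image of a chart is determined only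
  along curves.\<close>

definition curve_in :: "('a, 'b::euclidean_space) mfd \<Rightarrow> 'a \<Rightarrow> 'a \<Rightarrow> 'b \<Rightarrow> (real \<Rightarrow> 'a) \<Rightarrow> bool" where
  "curve_in M p x v c \<longleftrightarrow> c 0 = x \<and>
     (\<exists>e>0. Cinf_on {-e<..<e} (\<lambda>t. chart M p (c t)) \<and> (\<forall>t\<in>{-e<..<e}. c t \<in> cdom M p)) \<and>
     ((\<lambda>t. chart M p (c t)) has_vector_derivative v) (at 0)"

abbreviation curve_at where "curve_at M x \<equiv> curve_in M x x"

lemma manifold_charted: "manifold M \<Longrightarrow> charted M"
  unfolding manifold_def charted_def pointed_def by blast

lemma charted_pointed: "charted M \<Longrightarrow> pointed M"
  unfolding charted_def by blast

lemma pointedD: "pointed M \<Longrightarrow> p \<in> pts M \<Longrightarrow> p \<in> cdom M p"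
  "pointed M \<Longrightarrow> p \<in> pts M \<Longrightarrow> x \<in> cdom M p \<Longrightarrow> x \<in> pts M"
  unfolding pointed_def by blast+

lemma chartedD: "charted M \<Longrightarrow> p \<in> pts M \<Longrightarrow> p \<in> cdom M p"
  "charted M \<Longrightarrow> p \<in> pts M \<Longrightarrow> x \<in> cdom M p \<Longrightarrow> x \<in> pts M"
  "charted M \<Longrightarrow> p \<in> pts M \<Longrightarrow> inj_on (chart M p) (cdom M p)"
  unfolding charted_def pointed_def by blast+

lemma charted_transition:
  assumes "charted M" "p \<in> pts M" "q \<in> pts M" "x \<in> cdom M p" "x \<in> cdom M q"
  obtains W g where "local_rep M p x (chart M q) W g" "\<And>y. y \<in> cdom M p \<Longrightarrow> chart M p y \<in> W \<Longrightarrow> y \<in> cdom M q"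
proof -
  obtain W g where "open W" "chart M p x \<in> W" "Cinf_on W g"
    "\<forall>y\<in>cdom M p. chart M p y \<in> W \<longrightarrow> y \<in> cdom M q \<and> g (chart M p y) = chart M q y"
    using assms unfolding charted_def by blast
  then show ?thesis by (intro that[of W g]) (auto simp: local_rep_def)
qed

lemma smooth_map_local_rep:
  assumes "smooth_map M N f" "p \<in> pts M"
  obtains W g where "local_rep M p p (\<lambda>x. chart N (f p) (f x)) W g"
    "\<And>x. x \<in> cdom M p \<Longrightarrow> chart M p x \<in> W \<Longrightarrow> f x \<in> cdom N (f p)"
proof -
  obtain W g where "open W" "chart M p p \<in> W" "Cinf_on W g"
    "\<forall>x\<in>cdom M p. chart M p x \<in> W \<longrightarrow> f x \<in> cdom N (f p) \<and> g (chart M p x) = chart N (f p) (f x)"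
    using assms unfolding smooth_map_def by blast
  then show ?thesis by (intro that[of W g]) (auto simp: local_rep_def)
qed

lemma smooth_map_pts: "smooth_map M N f \<Longrightarrow> p \<in> pts M \<Longrightarrow> f p \<in> pts N"
  unfolding smooth_map_def by blast

lemma smooth_mapI:
  assumes "\<And>p. p \<in> pts M \<Longrightarrow> f p \<in> pts N"
    and "\<And>p. p \<in> pts M \<Longrightarrow> \<exists>W g. open W \<and> chart M p p \<in> W \<and> Cinf_on W g \<and>
        (\<forall>x\<in>cdom M p. chart M p x \<in> W \<longrightarrow> f x \<in> cdom N (f p) \<and> g (chart M p x) = chart N (f p) (f x))"
  shows "smooth_map M N f"
  using assms unfolding smooth_map_def by blast

lemma curve_in_cong:
  assumes c: "curve_in M p x v c" and e: "0 < e" "\<And>t. t \<in> {-e<..<e} \<Longrightarrow> c' t = c t"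
  shows "curve_in M p x v c'"
proof -
  obtain d where d: "d > 0" "Cinf_on {-d<..<d} (\<lambda>t. chart M p (c t))" "\<forall>t\<in>{-d<..<d}. c t \<in> cdom M p"
    using c unfolding curve_in_def by blast
  let ?m = "min d e"
  have m: "?m > 0" using d e by simp
  have eq: "t \<in> {- ?m<..<?m} \<Longrightarrow> c' t = c t" for t using e by auto
  have "Cinf_on {- ?m<..<?m} (\<lambda>t. chart M p (c t))" by (rule Cinf_on_subset[OF d(2)]) auto
  then have 1: "Cinf_on {- ?m<..<?m} (\<lambda>t. chart M p (c' t))"
    using Cinf_on_cong[of "{- ?m<..<?m}" "\<lambda>t. chart M p (c' t)" "\<lambda>t. chart M p (c t)"] eq by simp
  have 2: "\<forall>t\<in>{- ?m<..<?m}. c' t \<in> cdom M p" using eq d(3) by auto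
  have 3: "((\<lambda>t. chart M p (c' t)) has_vector_derivative v) (at 0)"
    by (rule has_vector_derivative_transform_within_open[of "\<lambda>t. chart M p (c t)" _ _ "{- ?m<..<?m}"])
       (use c eq m in \<open>auto simp: curve_in_def\<close>)
  have "c' 0 = x" using c e by (auto simp: curve_in_def)
  then show ?thesis unfolding curve_in_def using 1 2 3 m by blast
qed

lemma curve_in_unique: "curve_in M p x v c \<Longrightarrow> curve_in M p x w c \<Longrightarrow> v = w"
  unfolding curve_in_def using vector_derivative_unique_at by blast

lemma curve_in_cdom: "curve_in M p x v c \<Longrightarrow> x \<in> cdom M p"
  unfolding curve_in_def by force

text \<open>A velocity vector pushes forward along any map with a smooth local representative, whatever
  derivative the choice operator picks within the image of the chart.\<close>

lemma curve_in_local_rep: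
  assumes c: "curve_in M p x v c" and r: "local_rep M p x f W g"
  shows "((\<lambda>t. f (c t)) has_vector_derivative frechet_derivative g (at (chart M p x)) v) (at 0)"
    and "\<exists>e>0. Cinf_on {-e<..<e} (\<lambda>t. f (c t)) \<and> (\<forall>t\<in>{-e<..<e}. c t \<in> cdom M p \<and> chart M p (c t) \<in> W)"
proof -
  obtain d where d: "d > 0" "Cinf_on {-d<..<d} (\<lambda>t. chart M p (c t))" "\<forall>t\<in>{-d<..<d}. c t \<in> cdom M p"
    and c0: "c 0 = x" and v: "((\<lambda>t. chart M p (c t)) has_vector_derivative v) (at 0)"
    using c unfolding curve_in_def by blast
  have W: "open W" "chart M p x \<in> W" "Cinf_on W g" and g: "\<And>y. y \<in> cdom M p \<Longrightarrow> chart M p y \<in> W \<Longrightarrow> g (chart M p y) = f y"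
    using r unfolding local_rep_def by blast+
  let ?O = "{-d<..<d} \<inter> (\<lambda>t. chart M p (c t)) -` W"
  have O: "open ?O" by (rule open_preimage_Cinf[OF _ d(2) W(1)]) simp
  have O0: "0 \<in> ?O" using d c0 W by simp
  obtain e where e: "e > 0" "ball 0 e \<subseteq> ?O" using O O0 open_contains_ball by blast
  have be: "ball (0::real) e = {-e<..<e}" by (auto simp: dist_real_def)
  have gc: "g (chart M p (c t)) = f (c t)" if "t \<in> {-e<..<e}" for t
    using g d(3) e(2) that unfolding be by blast
  have "Cinf_on {-e<..<e} (\<lambda>t. g (chart M p (c t)))"
    by (rule Cinf_on_compose[OF _ W(1) Cinf_on_subset[OF d(2)] W(3)]) (use e(2) in \<open>auto simp: be\<close>)
  then have "Cinf_on {-e<..<e} (\<lambda>t. f (c t))"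
    using Cinf_on_cong[of "{-e<..<e}" "\<lambda>t. f (c t)" "\<lambda>t. g (chart M p (c t))"] gc by simp
  then show "\<exists>e>0. Cinf_on {-e<..<e} (\<lambda>t. f (c t)) \<and> (\<forall>t\<in>{-e<..<e}. c t \<in> cdom M p \<and> chart M p (c t) \<in> W)"
    using e d(3) unfolding be by blast
  have "((\<lambda>t. g (chart M p (c t))) has_derivative (\<lambda>h. frechet_derivative g (at (chart M p x)) (h *\<^sub>R v))) (at 0)"
    using has_derivative_compose[OF v[unfolded has_vector_derivative_def], of g] Cinf_on_has_derivative[OF W(3,2)] c0
    by simp
  moreover have "frechet_derivative g (at (chart M p x)) (h *\<^sub>R v) = h *\<^sub>R frechet_derivative g (at (chart M p x)) v" for h
    using bounded_linear.linear[OF bounded_linear_frechet_derivative[OF W(3,2)]] linear_scale by blast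
  ultimately have "((\<lambda>t. g (chart M p (c t))) has_vector_derivative frechet_derivative g (at (chart M p x)) v) (at 0)"
    unfolding has_vector_derivative_def by simp
  then show "((\<lambda>t. f (c t)) has_vector_derivative frechet_derivative g (at (chart M p x)) v) (at 0)"
    by (rule has_vector_derivative_transform_within_open[of _ _ _ "{-e<..<e}"]) (use e gc in auto)
qed

lemma cinv_chart: "charted M \<Longrightarrow> p \<in> pts M \<Longrightarrow> x \<in> cdom M p \<Longrightarrow> cinv M p (chart M p x) = x"
  unfolding cinv_def using chartedD(3) inv_into_f_f by metis

lemma frechet_derivative_within_rep:
  assumes M: "charted M" "p \<in> pts M" "x \<in> cdom M p" and r: "local_rep M p x f W g"
  shows "(f \<circ> cinv M p has_derivative frechet_derivative g (at (chart M p x))) (at (chart M p x) within cimg M p)"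
proof -
  have W: "open W" "chart M p x \<in> W" "Cinf_on W g" and g: "\<And>y. y \<in> cdom M p \<Longrightarrow> chart M p y \<in> W \<Longrightarrow> g (chart M p y) = f y"
    using r unfolding local_rep_def by blast+
  obtain d where d: "d > 0" "ball (chart M p x) d \<subseteq> W" using W open_contains_ball by blast
  show ?thesis
  proof (rule has_derivative_transform_within[OF _ d(1)])
    show "(g has_derivative frechet_derivative g (at (chart M p x))) (at (chart M p x) within cimg M p)"
      using Cinf_on_has_derivative[OF W(3,2)] has_derivative_at_withinI by blast
    show "chart M p x \<in> cimg M p" using M unfolding cimg_def by blast
    fix z assume z: "z \<in> cimg M p" "dist z (chart M p x) < d"
    then obtain y where y: "y \<in> cdom M p" "z = chart M p y" unfolding cimg_def by blast
    have "z \<in> W" using d z by (auto simp: dist_commute)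
    then show "g z = (f \<circ> cinv M p) z" using y g M cinv_chart by (simp add: cinv_chart)
  qed
qed

lemma frechet_derivative_within_works:
  assumes "charted M" "p \<in> pts M" "x \<in> cdom M p" "local_rep M p x f W g"
  shows "(f \<circ> cinv M p has_derivative frechet_derivative (f \<circ> cinv M p) (at (chart M p x) within cimg M p))
    (at (chart M p x) within cimg M p)"
  using frechet_derivative_within_rep[OF assms] frechet_derivative_works unfolding differentiable_def by blast

lemma curve_in_frechet_derivative:
  assumes M: "charted M" "p \<in> pts M" and c: "curve_in M p x v c" and r: "local_rep M p x f W g"
  shows "((\<lambda>t. f (c t)) has_vector_derivative
    frechet_derivative (f \<circ> cinv M p) (at (chart M p x) within cimg M p) v) (at 0)"
proof -
  let ?D = "frechet_derivative (f \<circ> cinv M p) (at (chart M p x) within cimg M p)"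
  obtain d where d: "d > 0" "\<forall>t\<in>{-d<..<d}. c t \<in> cdom M p"
    and c0: "c 0 = x" and v: "((\<lambda>t. chart M p (c t)) has_vector_derivative v) (at 0)"
    using c unfolding curve_in_def by blast
  have D: "(f \<circ> cinv M p has_derivative ?D) (at (chart M p x) within cimg M p)"
    by (rule frechet_derivative_within_works[OF M curve_in_cdom[OF c] r])
  have v': "((\<lambda>t. chart M p (c t)) has_derivative (\<lambda>h. h *\<^sub>R v)) (at 0 within {-d<..<d})"
    using v unfolding has_vector_derivative_def by (rule has_derivative_at_withinI)
  have "((\<lambda>t. (f \<circ> cinv M p) (chart M p (c t))) has_derivative (\<lambda>h. ?D (h *\<^sub>R v))) (at 0 within {-d<..<d})"
  proof (rule has_derivative_in_compose[OF v'])
    have "(\<lambda>t. chart M p (c t)) ` {-d<..<d} \<subseteq> cimg M p" using d unfolding cimg_def by blast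
    then show "(f \<circ> cinv M p has_derivative ?D) (at (chart M p (c 0)) within (\<lambda>t. chart M p (c t)) ` {-d<..<d})"
      unfolding c0 by (rule has_derivative_subset[OF D])
  qed
  moreover have "?D (h *\<^sub>R v) = h *\<^sub>R ?D v" for h
    using bounded_linear.linear[OF has_derivative_bounded_linear[OF D]] linear_scale by blast
  moreover have "at (0::real) within {-d<..<d} = at 0" using d(1) by (intro at_within_open) auto
  ultimately have "((\<lambda>t. (f \<circ> cinv M p) (chart M p (c t))) has_vector_derivative ?D v) (at 0)"
    unfolding has_vector_derivative_def by simp
  then show ?thesis
    by (rule has_vector_derivative_transform_within_open[of _ _ _ "{-d<..<d}"]) (use d M in \<open>auto simp: cinv_chart\<close>)
qed

lemma tangent_at_curve_in:
  assumes M: "charted M" "p \<in> pts M" "x \<in> cdom M p"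
  shows "v \<in> tangent_at (cimg M p) (chart M p x) \<longleftrightarrow> (\<exists>c. curve_in M p x v c)"
proof
  assume "v \<in> tangent_at (cimg M p) (chart M p x)"
  then obtain \<gamma> :: "real \<Rightarrow> 'b" and e where g: "0 < e" "Cinf_on {-e<..<e} \<gamma>" "\<gamma> ` {-e<..<e} \<subseteq> cimg M p"
     "\<gamma> 0 = chart M p x" "(\<gamma> has_vector_derivative v) (at 0)" unfolding tangent_at_def by blast
  let ?c = "\<lambda>t. cinv M p (\<gamma> t)"
  have c: "?c t \<in> cdom M p \<and> chart M p (?c t) = \<gamma> t" if "t \<in> {-e<..<e}" for t
    using g(3) that unfolding cimg_def cinv_def by (meson f_inv_into_f image_subset_iff inv_into_into)
  have "curve_in M p x v ?c"
    unfolding curve_in_def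
  proof (intro conjI exI)
    show "?c 0 = x" using M g by (simp add: cinv_chart)
    show "0 < e" by fact
    show "Cinf_on {-e<..<e} (\<lambda>t. chart M p (?c t))"
      using Cinf_on_cong[of "{-e<..<e}" "\<lambda>t. chart M p (?c t)" \<gamma>] c g by simp
    show "\<forall>t\<in>{-e<..<e}. ?c t \<in> cdom M p" using c by blast
    show "((\<lambda>t. chart M p (?c t)) has_vector_derivative v) (at 0)"
      by (rule has_vector_derivative_transform_within_open[OF g(5), of "{-e<..<e}"]) (use c g in auto)
  qed
  then show "\<exists>c. curve_in M p x v c" by blast
next
  assume "\<exists>c. curve_in M p x v c"
  then obtain c where "curve_in M p x v c" by blast
  then show "v \<in> tangent_at (cimg M p) (chart M p x)"
    unfolding curve_in_def tangent_at_def cimg_def by blast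
qed

lemma tspace_iff: "charted M \<Longrightarrow> p \<in> pts M \<Longrightarrow> v \<in> tspace M p \<longleftrightarrow> (\<exists>c. curve_at M p v c)"
  unfolding tspace_def by (simp add: tangent_at_curve_in chartedD)

lemma curve_at_tspace: "charted M \<Longrightarrow> p \<in> pts M \<Longrightarrow> curve_at M p v c \<Longrightarrow> v \<in> tspace M p"
  by (subst tspace_iff) auto

lemma tspace_curveE:
  assumes "charted M" "p \<in> pts M" "v \<in> tspace M p" obtains c where "curve_at M p v c"
  using assms(3) unfolding tspace_iff[OF assms(1,2)] by auto

lemma curve_transition:
  assumes M: "charted M" "p \<in> pts M" "q \<in> pts M" "x \<in> cdom M q" and c: "curve_in M p x v c"
  shows "curve_in M q x (frechet_derivative (chart M q \<circ> cinv M p) (at (chart M p x) within cimg M p) v) c"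
proof -
  obtain W g where W: "local_rep M p x (chart M q) W g" "\<And>y. y \<in> cdom M p \<Longrightarrow> chart M p y \<in> W \<Longrightarrow> y \<in> cdom M q"
    using charted_transition[OF M(1-3) curve_in_cdom[OF c] M(4)] by metis
  show ?thesis
    using curve_in_frechet_derivative[OF M(1,2) c W(1)] curve_in_local_rep(2)[OF c W(1)] W(2) c
    unfolding curve_in_def by blast
qed

lemma curve_push:
  assumes M: "charted M" "p \<in> pts M" and f: "smooth_map M N f" and c: "curve_at M p v c"
  shows "curve_at N (f p) (mderiv M N f p v) (\<lambda>t. f (c t))"
proof -
  obtain W g where W: "local_rep M p p (\<lambda>x. chart N (f p) (f x)) W g"
    "\<And>x. x \<in> cdom M p \<Longrightarrow> chart M p x \<in> W \<Longrightarrow> f x \<in> cdom N (f p)"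
    using smooth_map_local_rep[OF f M(2)] by metis
  have "chart N (f p) \<circ> f = (\<lambda>x. chart N (f p) (f x))" by auto
  then show ?thesis
    using curve_in_frechet_derivative[OF M c W(1)] curve_in_local_rep(2)[OF c W(1)] W(2) c
    unfolding curve_in_def mderiv_def by auto
qed

text \<open>The way to compute a differential: recognise the image of one curve with the given velocity.\<close>

lemma mderiv_eqI:
  assumes "charted M" "p \<in> pts M" "smooth_map M N f" "curve_at M p v c" "curve_at N (f p) w (\<lambda>t. f (c t))"
  shows "mderiv M N f p v = w"
  by (rule curve_in_unique[OF curve_push[OF assms(1-4)] assms(5)])

lemma mderiv_tspace:
  assumes "charted M" "charted N" "p \<in> pts M" "smooth_map M N f" "v \<in> tspace M p"
  shows "mderiv M N f p v \<in> tspace N (f p)"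
proof -
  obtain c where "curve_at M p v c" using tspace_curveE[OF assms(1,3,5)] .
  then show ?thesis
    using curve_at_tspace[OF assms(2) smooth_map_pts[OF assms(4,3)] curve_push[OF assms(1,3,4)]] by blast
qed

lemma mderiv_bounded_linear:
  assumes M: "charted M" "p \<in> pts M" and f: "smooth_map M N f"
  shows "bounded_linear (mderiv M N f p)"
proof -
  obtain W g where W: "local_rep M p p (\<lambda>x. chart N (f p) (f x)) W g"
    using smooth_map_local_rep[OF f M(2)] by metis
  have "chart N (f p) \<circ> f = (\<lambda>x. chart N (f p) (f x))" by auto
  then show ?thesis
    using frechet_derivative_within_works[OF M chartedD(1)[OF M] W] has_derivative_bounded_linear
    unfolding mderiv_def by metis
qed

lemma mderiv_linear: "charted M \<Longrightarrow> p \<in> pts M \<Longrightarrow> smooth_map M N f \<Longrightarrow> linear (mderiv M N f p)"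
  by (rule bounded_linear.linear[OF mderiv_bounded_linear])

lemmas mderiv_add = linear_add[OF mderiv_linear]
  and mderiv_scaleR = linear_scale[OF mderiv_linear]
  and mderiv_zero = linear_0[OF mderiv_linear]

lemma curve_const: "pointed M \<Longrightarrow> p \<in> pts M \<Longrightarrow> curve_at M p 0 (\<lambda>t. p)"
  unfolding curve_in_def using pointedD(1)[of M p] by (auto intro!: exI[of _ 1] Cinf_on_const)

lemma zero_in_tspace: "charted M \<Longrightarrow> p \<in> pts M \<Longrightarrow> 0 \<in> tspace M p"
  by (rule curve_at_tspace[OF _ _ curve_const[OF charted_pointed]])

text \<open>The derivative within a chart image comes from a choice operator, so equality of the maps on the
  manifold does not make the differentials equal as functions. They agree on tangent vectors, whose
  curves stay in the manifold.\<close>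

lemma mderiv_cong:
  assumes M: "charted M" "p \<in> pts M" and f: "smooth_map M N f" and eq: "\<And>x. x \<in> pts M \<Longrightarrow> f x = g x"
    and g: "smooth_map M N g" and v: "v \<in> tspace M p"
  shows "mderiv M N f p v = mderiv M N g p v"
proof -
  obtain c where c: "curve_at M p v c" using tspace_curveE[OF M v] .
  then obtain e where e: "e > 0" "\<forall>t\<in>{-e<..<e}. c t \<in> cdom M p" unfolding curve_in_def by blast
  have "curve_at N (g p) (mderiv M N g p v) (\<lambda>t. f (c t))"
  proof (rule curve_in_cong[OF curve_push[OF M g c] e(1)])
    fix t assume "t \<in> {-e<..<e}"
    then have "c t \<in> pts M" using e(2) chartedD(2)[OF M] by blast
    then show "f (c t) = g (c t)" by (rule eq)
  qed
  then show ?thesis using mderiv_eqI[OF M f c] eq[OF M(2)] by simp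
qed

lemma smooth_map_cong:
  assumes "pointed M" "\<And>x. x \<in> pts M \<Longrightarrow> f x = g x" "smooth_map M N g"
  shows "smooth_map M N f"
proof (rule smooth_mapI)
  fix p assume p: "p \<in> pts M"
  show "f p \<in> pts N" using assms p smooth_map_pts by metis
  show "\<exists>W h. open W \<and> chart M p p \<in> W \<and> Cinf_on W h \<and>
        (\<forall>x\<in>cdom M p. chart M p x \<in> W \<longrightarrow> f x \<in> cdom N (f p) \<and> h (chart M p x) = chart N (f p) (f x))"
  proof -
    obtain W h where W: "local_rep M p p (\<lambda>x. chart N (g p) (g x)) W h"
      "\<And>x. x \<in> cdom M p \<Longrightarrow> chart M p x \<in> W \<Longrightarrow> g x \<in> cdom N (g p)"
      using smooth_map_local_rep[OF assms(3) p] by metis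
    show ?thesis
      by (rule exI[of _ W], rule exI[of _ h])
         (use W assms(2) p pointedD(2)[OF assms(1) p] in \<open>auto simp: local_rep_def\<close>)
  qed
qed

lemma smooth_map_compose:
  assumes M: "pointed M" and f: "smooth_map M N f" and g: "smooth_map N P g"
  shows "smooth_map M P (\<lambda>x. g (f x))"
proof (rule smooth_mapI)
  fix p assume p: "p \<in> pts M"
  then have fp: "f p \<in> pts N" using f smooth_map_pts by metis
  then show "g (f p) \<in> pts P" using g smooth_map_pts by metis
  obtain W a where W: "open W" "chart M p p \<in> W" "Cinf_on W a"
     "\<And>x. x \<in> cdom M p \<Longrightarrow> chart M p x \<in> W \<Longrightarrow> f x \<in> cdom N (f p) \<and> a (chart M p x) = chart N (f p) (f x)"
    using f p unfolding smooth_map_def by blast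
  obtain W' b where W': "open W'" "chart N (f p) (f p) \<in> W'" "Cinf_on W' b"
     "\<And>x. x \<in> cdom N (f p) \<Longrightarrow> chart N (f p) x \<in> W' \<Longrightarrow> g x \<in> cdom P (g (f p)) \<and> b (chart N (f p) x) = chart P (g (f p)) (g x)"
    using g fp unfolding smooth_map_def by blast
  let ?W = "W \<inter> a -` W'"
  have oW: "open ?W" using W W' open_preimage_Cinf by blast
  have *: "Cinf_on ?W (\<lambda>z. b (a z))"
    by (rule Cinf_on_compose[OF oW W'(1) Cinf_on_subset[OF W(3)] W'(3)]) auto
  show "\<exists>W h. open W \<and> chart M p p \<in> W \<and> Cinf_on W h \<and>
        (\<forall>x\<in>cdom M p. chart M p x \<in> W \<longrightarrow> g (f x) \<in> cdom P (g (f p)) \<and> h (chart M p x) = chart P (g (f p)) (g (f x)))"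
    by (rule exI[of _ ?W], rule exI[of _ "\<lambda>z. b (a z)"])
       (use oW * W W' pointedD(1)[OF M p] in auto)
qed

section \<open>Products, submanifolds and vector spaces\<close>

lemma pts_prod [simp]: "pts (prod_mfd M N) = pts M \<times> pts N"
  and cdom_prod [simp]: "cdom (prod_mfd M N) p = cdom M (fst p) \<times> cdom N (snd p)"
  and chart_prod [simp]: "chart (prod_mfd M N) p z = (chart M (fst p) (fst z), chart N (snd p) (snd z))"
  by (auto simp: prod_mfd_def case_prod_beta)

lemma pts_sub [simp]: "pts (sub_mfd M S) = pts M \<inter> S"
  and cdom_sub [simp]: "cdom (sub_mfd M S) p = cdom M p \<inter> S"
  and chart_sub [simp]: "chart (sub_mfd M S) = chart M"
  by (auto simp: sub_mfd_def)

lemma pts_vec [simp]: "pts (vec_mfd V) = V"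
  and cdom_vec [simp]: "cdom (vec_mfd V) p = V"
  and chart_vec [simp]: "chart (vec_mfd V) p x = x"
  by (auto simp: vec_mfd_def)

lemma pts_TM [simp]: "pts (TM M) = {(p, v). p \<in> pts M \<and> v \<in> tspace M p}"
  and cdom_TM [simp]: "cdom (TM M) z = {(q, w). q \<in> cdom M (fst z) \<and> w \<in> tspace M q}"
  and chart_TM [simp]: "chart (TM M) z y = (chart M (fst z) (fst y),
        frechet_derivative (chart M (fst z) \<circ> cinv M (fst y)) (at (chart M (fst y) (fst y)) within cimg M (fst y)) (snd y))"
  by (auto simp: TM_def case_prod_beta)

lemma pointed_prod: "pointed M \<Longrightarrow> pointed N \<Longrightarrow> pointed (prod_mfd M N)"
  unfolding pointed_def by auto

lemma pointed_sub: "pointed M \<Longrightarrow> pointed (sub_mfd M S)"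
  unfolding pointed_def by auto

lemma pointed_vec: "pointed (vec_mfd V)"
  unfolding pointed_def by auto

lemma pointed_TM: "pointed M \<Longrightarrow> pointed (TM M)"
  unfolding pointed_def by auto

lemma charted_sub:
  assumes M: "charted M" shows "charted (sub_mfd M S)"
  unfolding charted_def
proof (intro conjI ballI)
  show "pointed (sub_mfd M S)" using M by (simp add: charted_pointed pointed_sub)
  show "inj_on (chart (sub_mfd M S) p) (cdom (sub_mfd M S) p)" if "p \<in> pts (sub_mfd M S)" for p
    using that chartedD(3)[OF M, of p] by (auto intro: inj_on_subset)
next
  fix p q r assume p: "p \<in> pts (sub_mfd M S)" and q: "q \<in> pts (sub_mfd M S)"
    and r: "r \<in> cdom (sub_mfd M S) p \<inter> cdom (sub_mfd M S) q"
  then have *: "p \<in> pts M" "q \<in> pts M" "r \<in> cdom M p" "r \<in> cdom M q" by auto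
  obtain W g where W: "local_rep M p r (chart M q) W g"
    "\<And>y. y \<in> cdom M p \<Longrightarrow> chart M p y \<in> W \<Longrightarrow> y \<in> cdom M q"
    using charted_transition[OF M *] by metis
  show "\<exists>W g. open W \<and> chart (sub_mfd M S) p r \<in> W \<and> Cinf_on W g \<and>
          (\<forall>x\<in>cdom (sub_mfd M S) p. chart (sub_mfd M S) p x \<in> W \<longrightarrow>
             x \<in> cdom (sub_mfd M S) q \<and> g (chart (sub_mfd M S) p x) = chart (sub_mfd M S) q x)"
    by (rule exI[of _ W], rule exI[of _ g]) (use W in \<open>auto simp: local_rep_def\<close>)
qed

lemma charted_prod:
  assumes M: "charted M" and N: "charted N"
  shows "charted (prod_mfd M N)"
  unfolding charted_def
proof (intro conjI ballI)
  show "pointed (prod_mfd M N)" using M N by (simp add: charted_pointed pointed_prod)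
  show "inj_on (chart (prod_mfd M N) p) (cdom (prod_mfd M N) p)" if "p \<in> pts (prod_mfd M N)" for p
    using that chartedD(3)[OF M, of "fst p"] chartedD(3)[OF N, of "snd p"] by (auto simp: inj_on_def)
next
  fix p q r assume p: "p \<in> pts (prod_mfd M N)" and q: "q \<in> pts (prod_mfd M N)"
    and r: "r \<in> cdom (prod_mfd M N) p \<inter> cdom (prod_mfd M N) q"
  have *: "fst p \<in> pts M" "fst q \<in> pts M" "fst r \<in> cdom M (fst p)" "fst r \<in> cdom M (fst q)"
    "snd p \<in> pts N" "snd q \<in> pts N" "snd r \<in> cdom N (snd p)" "snd r \<in> cdom N (snd q)"
    using p q r by (auto simp: mem_Times_iff)
  obtain W1 g1 where 1: "local_rep M (fst p) (fst r) (chart M (fst q)) W1 g1"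
    "\<And>y. y \<in> cdom M (fst p) \<Longrightarrow> chart M (fst p) y \<in> W1 \<Longrightarrow> y \<in> cdom M (fst q)"
    using charted_transition[OF M *(1-4)] by metis
  obtain W2 g2 where 2: "local_rep N (snd p) (snd r) (chart N (snd q)) W2 g2"
    "\<And>y. y \<in> cdom N (snd p) \<Longrightarrow> chart N (snd p) y \<in> W2 \<Longrightarrow> y \<in> cdom N (snd q)"
    using charted_transition[OF N *(5-8)] by metis
  have o: "open (W1 \<times> W2)" using 1 2 by (simp add: local_rep_def open_Times)
  have C: "Cinf_on (W1 \<times> W2) (\<lambda>z. (g1 (fst z), g2 (snd z)))"
    using 1 2 unfolding local_rep_def
    by (intro Cinf_on_Pair[OF o] Cinf_on_compose[OF o _ Cinf_on_fst[OF o], of W1]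
        Cinf_on_compose[OF o _ Cinf_on_snd[OF o], of W2]) auto
  show "\<exists>W g. open W \<and> chart (prod_mfd M N) p r \<in> W \<and> Cinf_on W g \<and>
          (\<forall>x\<in>cdom (prod_mfd M N) p. chart (prod_mfd M N) p x \<in> W \<longrightarrow>
             x \<in> cdom (prod_mfd M N) q \<and> g (chart (prod_mfd M N) p x) = chart (prod_mfd M N) q x)"
    by (rule exI[of _ "W1 \<times> W2"], rule exI[of _ "\<lambda>z. (g1 (fst z), g2 (snd z))"])
       (use o C 1 2 in \<open>auto simp: local_rep_def\<close>)
qed

lemma charted_fib_prod: "charted M \<Longrightarrow> charted N \<Longrightarrow> charted (fib_prod M N f g)"
  unfolding fib_prod_def by (simp add: charted_sub charted_prod)

lemma charted_vec: "charted (vec_mfd V)"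
  unfolding charted_def using pointed_vec
  by (auto simp: inj_on_def intro!: exI[of _ UNIV] exI[of _ "\<lambda>x. x"] Cinf_on_ident)

lemma curve_in_prod:
  "curve_in (prod_mfd M N) p x v c \<longleftrightarrow>
     curve_in M (fst p) (fst x) (fst v) (\<lambda>t. fst (c t)) \<and> curve_in N (snd p) (snd x) (snd v) (\<lambda>t. snd (c t))"
    (is "?L \<longleftrightarrow> ?A \<and> ?B")
proof
  assume L: ?L
  then obtain e where e: "e > 0" "Cinf_on {-e<..<e} (\<lambda>t. chart (prod_mfd M N) p (c t))"
    "\<forall>t\<in>{-e<..<e}. c t \<in> cdom (prod_mfd M N) p"
    and v: "((\<lambda>t. chart (prod_mfd M N) p (c t)) has_vector_derivative v) (at 0)" and c0: "c 0 = x"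
    unfolding curve_in_def by blast
  have "Cinf_on {-e<..<e} (\<lambda>t. fst (chart (prod_mfd M N) p (c t)))"
    by (rule Cinf_on_linear_comp[OF _ bounded_linear_fst e(2)]) simp
  moreover have "Cinf_on {-e<..<e} (\<lambda>t. snd (chart (prod_mfd M N) p (c t)))"
    by (rule Cinf_on_linear_comp[OF _ bounded_linear_snd e(2)]) simp
  moreover have "((\<lambda>t. fst (chart (prod_mfd M N) p (c t))) has_vector_derivative fst v) (at 0)"
    using bounded_linear.has_vector_derivative[OF bounded_linear_fst v] .
  moreover have "((\<lambda>t. snd (chart (prod_mfd M N) p (c t))) has_vector_derivative snd v) (at 0)"
    using bounded_linear.has_vector_derivative[OF bounded_linear_snd v] .
  ultimately show "?A \<and> ?B" unfolding curve_in_def using e c0 by (auto simp: mem_Times_iff)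
next
  assume AB: "?A \<and> ?B"
  obtain d where d: "d > 0" "Cinf_on {-d<..<d} (\<lambda>t. chart M (fst p) (fst (c t)))"
    "\<forall>t\<in>{-d<..<d}. fst (c t) \<in> cdom M (fst p)" using AB unfolding curve_in_def by blast
  obtain e where e: "e > 0" "Cinf_on {-e<..<e} (\<lambda>t. chart N (snd p) (snd (c t)))"
    "\<forall>t\<in>{-e<..<e}. snd (c t) \<in> cdom N (snd p)" using AB unfolding curve_in_def by blast
  let ?m = "min d e"
  have "Cinf_on {- ?m<..<?m} (\<lambda>t. (chart M (fst p) (fst (c t)), chart N (snd p) (snd (c t))))"
    by (intro Cinf_on_Pair Cinf_on_subset[OF d(2)] Cinf_on_subset[OF e(2)]) auto
  moreover have "((\<lambda>t. (chart M (fst p) (fst (c t)), chart N (snd p) (snd (c t)))) has_vector_derivative (fst v, snd v)) (at 0)"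
    using AB unfolding curve_in_def by (intro has_vector_derivative_Pair) auto
  moreover have "c 0 = x" using AB unfolding curve_in_def by (simp add: prod_eq_iff)
  ultimately show ?L unfolding curve_in_def
    using d e by (auto simp: mem_Times_iff intro!: exI[of _ ?m])
qed

lemma curve_in_sub:
  "curve_in (sub_mfd M S) p x v c \<longleftrightarrow> curve_in M p x v c \<and> (\<exists>e>0. \<forall>t\<in>{-e<..<e}. c t \<in> S)"
    (is "?L \<longleftrightarrow> ?A \<and> ?B")
proof
  show "?L \<Longrightarrow> ?A \<and> ?B" unfolding curve_in_def by auto
next
  assume AB: "?A \<and> ?B"
  obtain d where d: "d > 0" "Cinf_on {-d<..<d} (\<lambda>t. chart M p (c t))"
    "\<forall>t\<in>{-d<..<d}. c t \<in> cdom M p" using AB unfolding curve_in_def by blast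
  obtain e where e: "e > 0" "\<forall>t\<in>{-e<..<e}. c t \<in> S" using AB by blast
  let ?m = "min d e"
  have "Cinf_on {- ?m<..<?m} (\<lambda>t. chart M p (c t))" by (rule Cinf_on_subset[OF d(2)]) auto
  then show ?L using AB d e unfolding curve_in_def by (auto intro!: exI[of _ ?m])
qed

lemma tspace_prod:
  assumes "charted M" "charted N" "p \<in> pts M" "q \<in> pts N"
  shows "tspace (prod_mfd M N) (p, q) = tspace M p \<times> tspace N q"
proof -
  have "(\<exists>c. curve_at (prod_mfd M N) (p, q) (u, v) c) \<longleftrightarrow> (\<exists>c. curve_at M p u c) \<and> (\<exists>c. curve_at N q v c)" for u v
  proof
    assume "(\<exists>c. curve_at M p u c) \<and> (\<exists>c. curve_at N q v c)"
    then obtain a b where "curve_at M p u a" "curve_at N q v b" by blast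
    then have "curve_at (prod_mfd M N) (p, q) (u, v) (\<lambda>t. (a t, b t))" by (simp add: curve_in_prod)
    then show "\<exists>c. curve_at (prod_mfd M N) (p, q) (u, v) c" by blast
  qed (auto simp: curve_in_prod)
  then show ?thesis using assms by (auto simp: tspace_iff charted_prod)
qed

lemma tspace_sub_subset: "charted M \<Longrightarrow> p \<in> pts M \<inter> S \<Longrightarrow> tspace (sub_mfd M S) p \<subseteq> tspace M p"
  by (auto simp: tspace_iff charted_sub curve_in_sub)

subsection \<open>Smooth maps into and out of products and subsets\<close>

lemma smooth_id: "smooth_map M M (\<lambda>x. x)"
  by (rule smooth_mapI) (auto intro!: exI[of _ UNIV] exI[of _ "\<lambda>x. x"] Cinf_on_ident)

lemma smooth_const: "pointed N \<Longrightarrow> c \<in> pts N \<Longrightarrow> smooth_map M N (\<lambda>x. c)"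
  by (rule smooth_mapI) (auto intro!: exI[of _ UNIV] exI[of _ "\<lambda>x. chart N c c"] Cinf_on_const pointedD)

lemma smooth_fst: 
  assumes "smooth_map P (prod_mfd M N) f" shows "smooth_map P M (\<lambda>x. fst (f x))"
proof (rule smooth_mapI)
  fix p assume p: "p \<in> pts P"
  then show "fst (f p) \<in> pts M" using smooth_map_pts[OF assms] by fastforce
  obtain W g where W: "local_rep P p p (\<lambda>x. chart (prod_mfd M N) (f p) (f x)) W g"
    "\<And>x. x \<in> cdom P p \<Longrightarrow> chart P p x \<in> W \<Longrightarrow> f x \<in> cdom (prod_mfd M N) (f p)"
    using smooth_map_local_rep[OF assms p] by metis
  show "\<exists>W g. open W \<and> chart P p p \<in> W \<and> Cinf_on W g \<and>
        (\<forall>x\<in>cdom P p. chart P p x \<in> W \<longrightarrow> fst (f x) \<in> cdom M (fst (f p)) \<and> g (chart P p x) = chart M (fst (f p)) (fst (f x)))"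
    by (rule exI[of _ W], rule exI[of _ "\<lambda>z. fst (g z)"])
       (use W in \<open>auto simp: local_rep_def mem_Times_iff intro: Cinf_on_linear_comp[OF _ bounded_linear_fst]\<close>)
qed

lemma smooth_snd: 
  assumes "smooth_map P (prod_mfd M N) f" shows "smooth_map P N (\<lambda>x. snd (f x))"
proof (rule smooth_mapI)
  fix p assume p: "p \<in> pts P"
  then show "snd (f p) \<in> pts N" using smooth_map_pts[OF assms] by fastforce
  obtain W g where W: "local_rep P p p (\<lambda>x. chart (prod_mfd M N) (f p) (f x)) W g"
    "\<And>x. x \<in> cdom P p \<Longrightarrow> chart P p x \<in> W \<Longrightarrow> f x \<in> cdom (prod_mfd M N) (f p)"
    using smooth_map_local_rep[OF assms p] by metis
  show "\<exists>W g. open W \<and> chart P p p \<in> W \<and> Cinf_on W g \<and>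
        (\<forall>x\<in>cdom P p. chart P p x \<in> W \<longrightarrow> snd (f x) \<in> cdom N (snd (f p)) \<and> g (chart P p x) = chart N (snd (f p)) (snd (f x)))"
    by (rule exI[of _ W], rule exI[of _ "\<lambda>z. snd (g z)"])
       (use W in \<open>auto simp: local_rep_def mem_Times_iff intro: Cinf_on_linear_comp[OF _ bounded_linear_snd]\<close>)
qed

lemma smooth_Pair: 
  assumes f: "smooth_map P M f" and g: "smooth_map P N g" shows "smooth_map P (prod_mfd M N) (\<lambda>x. (f x, g x))"
proof (rule smooth_mapI)
  fix p assume p: "p \<in> pts P"
  then show "(f p, g p) \<in> pts (prod_mfd M N)" using smooth_map_pts[OF f] smooth_map_pts[OF g] by simp
  obtain W a where W: "local_rep P p p (\<lambda>x. chart M (f p) (f x)) W a"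
    "\<And>x. x \<in> cdom P p \<Longrightarrow> chart P p x \<in> W \<Longrightarrow> f x \<in> cdom M (f p)"
    using smooth_map_local_rep[OF f p] by metis
  obtain W' b where W': "local_rep P p p (\<lambda>x. chart N (g p) (g x)) W' b"
    "\<And>x. x \<in> cdom P p \<Longrightarrow> chart P p x \<in> W' \<Longrightarrow> g x \<in> cdom N (g p)"
    using smooth_map_local_rep[OF g p] by metis
  have o: "open (W \<inter> W')" using W W' by (auto simp: local_rep_def)
  have "Cinf_on (W \<inter> W') (\<lambda>z. (a z, b z))"
    using W W' by (intro Cinf_on_Pair o) (auto simp: local_rep_def intro: Cinf_on_subset)
  then show "\<exists>W h. open W \<and> chart P p p \<in> W \<and> Cinf_on W h \<and>
        (\<forall>x\<in>cdom P p. chart P p x \<in> W \<longrightarrow> (f x, g x) \<in> cdom (prod_mfd M N) (f p, g p) \<and>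
           h (chart P p x) = chart (prod_mfd M N) (f p, g p) (f x, g x))"
    by (intro exI[of _ "W \<inter> W'"] exI[of _ "\<lambda>z. (a z, b z)"])
       (use W W' o in \<open>auto simp: local_rep_def\<close>)
qed

lemma smooth_into_sub:
  assumes "pointed P" "smooth_map P M f" "\<And>x. x \<in> pts P \<Longrightarrow> f x \<in> S"
  shows "smooth_map P (sub_mfd M S) f"
proof (rule smooth_mapI)
  fix p assume p: "p \<in> pts P"
  then show "f p \<in> pts (sub_mfd M S)" using smooth_map_pts assms by fastforce
  obtain W g where "local_rep P p p (\<lambda>x. chart M (f p) (f x)) W g"
    "\<And>x. x \<in> cdom P p \<Longrightarrow> chart P p x \<in> W \<Longrightarrow> f x \<in> cdom M (f p)"
    using smooth_map_local_rep[OF assms(2) p] by metis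
  then show "\<exists>W g. open W \<and> chart P p p \<in> W \<and> Cinf_on W g \<and>
        (\<forall>x\<in>cdom P p. chart P p x \<in> W \<longrightarrow> f x \<in> cdom (sub_mfd M S) (f p) \<and>
           g (chart P p x) = chart (sub_mfd M S) (f p) (f x))"
    using pointedD(2)[OF assms(1) p] assms(3) unfolding local_rep_def by (intro exI[of _ W] exI[of _ g]) auto
qed

lemma smooth_out_of_sub:
  assumes f: "smooth_map P (sub_mfd M S) f"
  shows "smooth_map P M f"
proof (rule smooth_mapI)
  fix p assume p: "p \<in> pts P"
  then show "f p \<in> pts M" using smooth_map_pts[OF f] by fastforce
  obtain W g where "local_rep P p p (\<lambda>x. chart M (f p) (f x)) W g"
    "\<And>x. x \<in> cdom P p \<Longrightarrow> chart P p x \<in> W \<Longrightarrow> f x \<in> cdom M (f p)"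
    using smooth_map_local_rep[OF f p] by (metis IntD1 cdom_sub chart_sub)
  then show "\<exists>W g. open W \<and> chart P p p \<in> W \<and> Cinf_on W g \<and>
        (\<forall>x\<in>cdom P p. chart P p x \<in> W \<longrightarrow> f x \<in> cdom M (f p) \<and> g (chart P p x) = chart M (f p) (f x))"
    unfolding local_rep_def by (intro exI[of _ W] exI[of _ g]) auto
qed

lemma smooth_restrict:
  assumes "smooth_map M N f"
  shows "smooth_map (sub_mfd M S) N f"
  using assms unfolding smooth_map_def by (fastforce simp: image_subset_iff)

lemma smooth_into_fib_prod:
  assumes "pointed P" "smooth_map P M f" "smooth_map P N g" "\<And>x. x \<in> pts P \<Longrightarrow> a (f x) = b (g x)"
  shows "smooth_map P (fib_prod M N a b) (\<lambda>x. (f x, g x))"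
  unfolding fib_prod_def using assms by (intro smooth_into_sub smooth_Pair) auto

lemma smooth_fib_prod_fst:
  assumes "smooth_map P (fib_prod M N a b) f"
  shows "smooth_map P M (\<lambda>x. fst (f x))"
  using smooth_fst smooth_out_of_sub assms unfolding fib_prod_def by blast

lemma smooth_fib_prod_snd:
  assumes "smooth_map P (fib_prod M N a b) f"
  shows "smooth_map P N (\<lambda>x. snd (f x))"
  using smooth_snd smooth_out_of_sub assms unfolding fib_prod_def by blast

section \<open>Rules for derivatives\<close>

lemma mderiv_compose:
  assumes M: "charted M" "charted N" "p \<in> pts M" and f: "smooth_map M N f" and g: "smooth_map N P g"
    and v: "v \<in> tspace M p"
  shows "mderiv M P (\<lambda>x. g (f x)) p v = mderiv N P g (f p) (mderiv M N f p v)"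
proof -
  obtain c where c: "curve_at M p v c" using tspace_curveE[OF M(1,3) v] .
  show ?thesis
    by (rule mderiv_eqI[OF M(1,3) smooth_map_compose[OF charted_pointed[OF M(1)] f g] c])
       (rule curve_push[OF M(2) smooth_map_pts[OF f M(3)] g curve_push[OF M(1,3) f c]])
qed

lemma mderiv_id: "charted M \<Longrightarrow> p \<in> pts M \<Longrightarrow> v \<in> tspace M p \<Longrightarrow> mderiv M M (\<lambda>x. x) p v = v"
  by (rule tspace_curveE) (auto intro: mderiv_eqI[OF _ _ smooth_id])

lemma mderiv_const:
  assumes "charted M" "p \<in> pts M" "pointed N" "c \<in> pts N" "v \<in> tspace M p"
  shows "mderiv M N (\<lambda>x. c) p v = 0"
  by (rule tspace_curveE[OF assms(1,2,5)])
     (rule mderiv_eqI[OF assms(1,2) smooth_const[OF assms(3,4)] _ curve_const[OF assms(3,4)]])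

lemma mderiv_Pair:
  assumes M: "charted M" "p \<in> pts M" and f: "smooth_map M N f" and g: "smooth_map M P g" and v: "v \<in> tspace M p"
  shows "mderiv M (prod_mfd N P) (\<lambda>x. (f x, g x)) p v = (mderiv M N f p v, mderiv M P g p v)"
proof -
  obtain c where c: "curve_at M p v c" using tspace_curveE[OF M v] .
  show ?thesis
    by (rule mderiv_eqI[OF M smooth_Pair[OF f g] c]) (simp add: curve_in_prod curve_push[OF M f c] curve_push[OF M g c])
qed

lemma mderiv_fst_comp:
  assumes M: "charted M" "p \<in> pts M" and f: "smooth_map M (prod_mfd N P) f" and v: "v \<in> tspace M p"
  shows "mderiv M N (\<lambda>x. fst (f x)) p v = fst (mderiv M (prod_mfd N P) f p v)"
proof -
  obtain c where c: "curve_at M p v c" using tspace_curveE[OF M v] .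
  show ?thesis
    by (rule mderiv_eqI[OF M smooth_fst[OF f] c]) (use curve_push[OF M f c] in \<open>simp add: curve_in_prod\<close>)
qed

lemma mderiv_snd_comp:
  assumes M: "charted M" "p \<in> pts M" and f: "smooth_map M (prod_mfd N P) f" and v: "v \<in> tspace M p"
  shows "mderiv M P (\<lambda>x. snd (f x)) p v = snd (mderiv M (prod_mfd N P) f p v)"
proof -
  obtain c where c: "curve_at M p v c" using tspace_curveE[OF M v] .
  show ?thesis
    by (rule mderiv_eqI[OF M smooth_snd[OF f] c]) (use curve_push[OF M f c] in \<open>simp add: curve_in_prod\<close>)
qed

lemma mderiv_fst:
  "charted M \<Longrightarrow> charted N \<Longrightarrow> p \<in> pts (prod_mfd M N) \<Longrightarrow> v \<in> tspace (prod_mfd M N) p \<Longrightarrow>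
    mderiv (prod_mfd M N) M fst p v = fst v"
  using mderiv_fst_comp[OF charted_prod _ smooth_id, of M N p v] mderiv_id[OF charted_prod, of M N p v]
  by (simp add: fun_eq_iff del: pts_prod)

lemma mderiv_snd:
  "charted M \<Longrightarrow> charted N \<Longrightarrow> p \<in> pts (prod_mfd M N) \<Longrightarrow> v \<in> tspace (prod_mfd M N) p \<Longrightarrow>
    mderiv (prod_mfd M N) N snd p v = snd v"
  using mderiv_snd_comp[OF charted_prod _ smooth_id, of M N p v] mderiv_id[OF charted_prod, of M N p v]
  by (simp add: fun_eq_iff del: pts_prod)

lemma mderiv_restrict:
  assumes M: "charted M" "p \<in> pts M \<inter> S" and f: "smooth_map M N f" and v: "v \<in> tspace (sub_mfd M S) p"
  shows "mderiv (sub_mfd M S) N f p v = mderiv M N f p v"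
proof -
  have p: "p \<in> pts (sub_mfd M S)" "p \<in> pts M" using M by auto
  obtain c where c: "curve_at (sub_mfd M S) p v c" using tspace_curveE[OF charted_sub[OF M(1)] p(1) v] .
  then have "curve_at M p v c" by (simp add: curve_in_sub)
  then show ?thesis
    by (intro mderiv_eqI[OF charted_sub[OF M(1)] p(1) smooth_restrict[OF f] c] curve_push[OF M(1) p(2) f])
qed

text \<open>Since \<open>(u, v) = (u, 0) + (0, v)\<close>, linearity reduces this to the chain rule for the two inclusions
  \<open>x \<mapsto> (x, q)\<close> and \<open>y \<mapsto> (p, y)\<close>.\<close>

lemma mderiv_partials:
  assumes M: "charted M" "charted N" and p: "p \<in> pts M" "q \<in> pts N" and f: "smooth_map (prod_mfd M N) P f"
    and u: "u \<in> tspace M p" and v: "v \<in> tspace N q"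
  shows "mderiv (prod_mfd M N) P f (p, q) (u, v)
    = mderiv M P (\<lambda>x. f (x, q)) p u + mderiv N P (\<lambda>y. f (p, y)) q v"
proof -
  have pq: "(p, q) \<in> pts (prod_mfd M N)" using p by simp
  note C = charted_prod[OF M]
  have 1: "mderiv M P (\<lambda>x. f (x, q)) p u = mderiv (prod_mfd M N) P f (p, q) (u, 0)"
    by (subst mderiv_compose[OF M(1) C p(1) smooth_Pair[OF smooth_id smooth_const[OF charted_pointed[OF M(2)] p(2)]] f u])
       (simp add: mderiv_Pair[OF M(1) p(1) smooth_id smooth_const[OF charted_pointed[OF M(2)] p(2)] u]
         mderiv_id[OF M(1) p(1) u] mderiv_const[OF M(1) p(1) charted_pointed[OF M(2)] p(2) u])
  have 2: "mderiv N P (\<lambda>y. f (p, y)) q v = mderiv (prod_mfd M N) P f (p, q) (0, v)"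
    by (subst mderiv_compose[OF M(2) C p(2) smooth_Pair[OF smooth_const[OF charted_pointed[OF M(1)] p(1)] smooth_id] f v])
       (simp add: mderiv_Pair[OF M(2) p(2) smooth_const[OF charted_pointed[OF M(1)] p(1)] smooth_id v]
         mderiv_id[OF M(2) p(2) v] mderiv_const[OF M(2) p(2) charted_pointed[OF M(1)] p(1) v])
  show ?thesis unfolding 1 2 mderiv_add[OF C pq f, symmetric] by simp
qed


section \<open>The tangent bundle\<close>

text \<open>The chart of the tangent bundle transports a vector between charts; along a curve, the transported
  vector is just the velocity of the same curve in the other chart.\<close>

lemma TM_chart_curve:
  assumes "charted M" "p \<in> pts M" "q \<in> cdom M p" "curve_at M q w c"
  shows "curve_in M p q (snd (chart (TM M) (p, v) (q, w))) c"
  using curve_transition[OF assms(1) chartedD(2)[OF assms(1-3)] assms(2,3,4)] by simp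

lemma TM_chart_self:
  assumes M: "charted M" "q \<in> pts M" and w: "w \<in> tspace M q"
  shows "snd (chart (TM M) (q, v) (q, w)) = w"
proof -
  obtain c where c: "curve_at M q w c" using tspace_curveE[OF M w] .
  show ?thesis using curve_in_unique[OF TM_chart_curve[OF M chartedD(1)[OF M] c] c] .
qed

lemma smooth_TM_base: "smooth_map (TM M) M fst"
  by (rule smooth_mapI) (auto intro!: exI[of _ UNIV] exI[of _ fst] Cinf_on_fst)

lemma tmap_pts: "charted M \<Longrightarrow> charted N \<Longrightarrow> smooth_map M N f \<Longrightarrow> z \<in> pts (TM M) \<Longrightarrow> tmap M N f z \<in> pts (TM N)"
  unfolding tmap_def by (auto simp: mderiv_tspace smooth_map_pts)

lemma smooth_tmap:
  assumes M: "charted M" and N: "charted N" and f: "smooth_map M N f"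
  shows "smooth_map (TM M) (TM N) (tmap M N f)"
proof (rule smooth_mapI)
  fix z assume z: "z \<in> pts (TM M)"
  show "tmap M N f z \<in> pts (TM N)" using tmap_pts[OF M N f z] .
  obtain p v where pv: "z = (p, v)" and p: "p \<in> pts M" using z by auto
  have fp: "f p \<in> pts N" using smooth_map_pts[OF f p] .
  obtain W g where W: "local_rep M p p (\<lambda>x. chart N (f p) (f x)) W g"
    "\<And>x. x \<in> cdom M p \<Longrightarrow> chart M p x \<in> W \<Longrightarrow> f x \<in> cdom N (f p)"
    using smooth_map_local_rep[OF f p] by metis
  have W': "open W" "chart M p p \<in> W" "Cinf_on W g" using W(1) unfolding local_rep_def by blast+
  have o: "open (W \<times> (UNIV :: 'b set))" using W' by (simp add: open_Times)
  let ?h = "\<lambda>z. (g (fst z), (\<lambda>(x, v). frechet_derivative g (at x) v) z)"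
  have C: "Cinf_on (W \<times> UNIV) ?h"
    by (intro Cinf_on_Pair[OF o] Cinf_on_total_derivative[OF W'(1,3)]
        Cinf_on_compose[OF o W'(1) Cinf_on_fst[OF o] W'(3)]) auto
  have *: "tmap M N f (q, w) \<in> cdom (TM N) (tmap M N f z) \<and>
      ?h (chart (TM M) z (q, w)) = chart (TM N) (tmap M N f z) (tmap M N f (q, w))"
    if q: "(q, w) \<in> cdom (TM M) z" "chart (TM M) z (q, w) \<in> W \<times> UNIV" for q w
  proof
    have qM: "q \<in> cdom M p" "w \<in> tspace M q" "chart M p q \<in> W" "q \<in> pts M"
      using q pv chartedD(2)[OF M p] by auto
    have fq: "f q \<in> cdom N (f p)" using W(2) qM by blast
    show "tmap M N f (q, w) \<in> cdom (TM N) (tmap M N f z)"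
      using fq mderiv_tspace[OF M N qM(4) f qM(2)] pv by (simp add: tmap_def)
    obtain c where c: "curve_at M q w c" using tspace_curveE[OF M qM(4,2)] .
    have r: "local_rep M p q (\<lambda>x. chart N (f p) (f x)) W g" using W(1) qM unfolding local_rep_def by blast
    have 1: "((\<lambda>t. chart N (f p) (f (c t))) has_vector_derivative
        frechet_derivative g (at (chart M p q)) (snd (chart (TM M) z (q, w)))) (at 0)"
      using curve_in_local_rep(1)[OF TM_chart_curve[OF M p qM(1) c] r] unfolding pv .
    have "curve_in N (f p) (f q) (snd (chart (TM N) (f p, mderiv M N f p v) (f q, mderiv M N f q w))) (\<lambda>t. f (c t))"
      by (rule TM_chart_curve[OF N fp fq curve_push[OF M qM(4) f c]])
    then have 2: "((\<lambda>t. chart N (f p) (f (c t))) has_vector_derivative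
        snd (chart (TM N) (f p, mderiv M N f p v) (f q, mderiv M N f q w))) (at 0)"
      unfolding curve_in_def by blast
    have 3: "g (chart M p q) = chart N (f p) (f q)" using W(1) qM unfolding local_rep_def by blast
    show "?h (chart (TM M) z (q, w)) = chart (TM N) (tmap M N f z) (tmap M N f (q, w))"
      using vector_derivative_unique_at[OF 1 2] 3 pv by (simp add: tmap_def)
  qed
  show "\<exists>W h. open W \<and> chart (TM M) z z \<in> W \<and> Cinf_on W h \<and>
        (\<forall>x\<in>cdom (TM M) z. chart (TM M) z x \<in> W \<longrightarrow> tmap M N f x \<in> cdom (TM N) (tmap M N f z) \<and>
          h (chart (TM M) z x) = chart (TM N) (tmap M N f z) (tmap M N f x))"
  proof (rule exI[of _ "W \<times> UNIV"], rule exI[of _ ?h], intro conjI ballI)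
    show "chart (TM M) z z \<in> W \<times> UNIV" using W'(2) pv by simp
    show "chart (TM M) z x \<in> W \<times> UNIV \<longrightarrow> tmap M N f x \<in> cdom (TM N) (tmap M N f z) \<and>
          ?h (chart (TM M) z x) = chart (TM N) (tmap M N f z) (tmap M N f x)" if "x \<in> cdom (TM M) z" for x
      using *[of "fst x" "snd x"] that by (simp del: chart_TM cdom_TM)
  qed (fact o C)+
qed

lemma smooth_TM_pair:
  assumes M: "charted M" and N: "charted N"
  shows "smooth_map (prod_mfd (TM M) (TM N)) (TM (prod_mfd M N)) (\<lambda>z. ((fst (fst z), fst (snd z)), (snd (fst z), snd (snd z))))"
    (is "smooth_map ?P ?T ?F")
proof (rule smooth_mapI)
  fix z assume "z \<in> pts ?P"
  then obtain p u q v where z: "z = ((p, u), (q, v))" and p: "p \<in> pts M" "u \<in> tspace M p" "q \<in> pts N" "v \<in> tspace N q"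
    by auto
  show "?F z \<in> pts ?T" using p z by (simp add: tspace_prod[OF M N])
  let ?h = "\<lambda>z. ((fst (fst z), fst (snd z)), (snd (fst z), snd (snd z)))"
  have C: "Cinf_on UNIV ?h"
    by (intro Cinf_on_bounded_linear open_UNIV bounded_linear_Pair bounded_linear_fst bounded_linear_snd
        bounded_linear_compose[OF bounded_linear_fst bounded_linear_fst]
        bounded_linear_compose[OF bounded_linear_fst bounded_linear_snd]
        bounded_linear_compose[OF bounded_linear_snd bounded_linear_fst]
        bounded_linear_compose[OF bounded_linear_snd bounded_linear_snd])
  have *: "?F x \<in> cdom ?T (?F z) \<and> ?h (chart ?P z x) = chart ?T (?F z) (?F x)" if x: "x \<in> cdom ?P z" for x
  proof -
    obtain p' u' q' v' where x': "x = ((p', u'), (q', v'))" and p': "p' \<in> cdom M p" "u' \<in> tspace M p'" "q' \<in> cdom N q" "v' \<in> tspace N q'"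
      using x z by auto
    have p'': "p' \<in> pts M" "q' \<in> pts N" using p' p M N chartedD(2) by metis+
    obtain a where a: "curve_at M p' u' a" using tspace_curveE[OF M p''(1) p'(2)] .
    obtain b where b: "curve_at N q' v' b" using tspace_curveE[OF N p''(2) p'(4)] .
    have ab: "curve_at (prod_mfd M N) (p', q') (u', v') (\<lambda>t. (a t, b t))" using a b by (simp add: curve_in_prod)
    have 1: "curve_in (prod_mfd M N) (p, q) (p', q') (snd (chart ?T ((p, q), (u, v)) ((p', q'), (u', v')))) (\<lambda>t. (a t, b t))"
      by (rule TM_chart_curve[OF charted_prod[OF M N] _ _ ab]) (use p p' in auto)
    have 2: "curve_in (prod_mfd M N) (p, q) (p', q')
        (snd (chart (TM M) (p, u) (p', u')), snd (chart (TM N) (q, v) (q', v'))) (\<lambda>t. (a t, b t))"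
      using TM_chart_curve[OF M p(1) p'(1) a] TM_chart_curve[OF N p(3) p'(3) b] by (simp add: curve_in_prod)
    show ?thesis using curve_in_unique[OF 1 2] x' z p' p'' by (simp add: tspace_prod[OF M N])
  qed
  show "\<exists>W h. open W \<and> chart ?P z z \<in> W \<and> Cinf_on W h \<and>
        (\<forall>x\<in>cdom ?P z. chart ?P z x \<in> W \<longrightarrow> ?F x \<in> cdom ?T (?F z) \<and> h (chart ?P z x) = chart ?T (?F z) (?F x))"
    by (rule exI[of _ UNIV], rule exI[of _ ?h], intro conjI ballI impI)
       (use C * in \<open>simp_all del: chart_TM cdom_TM chart_prod cdom_prod\<close>)
qed

lemma smooth_zero_section:
  assumes M: "charted M" shows "smooth_map M (TM M) (\<lambda>p. (p, 0))"
proof (rule smooth_mapI)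
  fix p assume p: "p \<in> pts M"
  show "(p, 0) \<in> pts (TM M)" using zero_in_tspace[OF M p] p by simp
  have *: "(x, 0) \<in> cdom (TM M) (p, 0) \<and> (chart M p x, 0) = chart (TM M) (p, 0) (x, 0)" if x: "x \<in> cdom M p" for x
  proof -
    have xM: "x \<in> pts M" using chartedD(2)[OF M p x] .
    have "curve_in M p x 0 (\<lambda>t. x)"
      unfolding curve_in_def using x by (auto intro!: exI[of _ 1] Cinf_on_const)
    then have "snd (chart (TM M) (p, 0) (x, 0)) = 0"
      using curve_in_unique[OF TM_chart_curve[OF M p x curve_const[OF charted_pointed[OF M] xM]]] by blast
    then show ?thesis using x zero_in_tspace[OF M xM] by simp
  qed
  show "\<exists>W h. open W \<and> chart M p p \<in> W \<and> Cinf_on W h \<and>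
        (\<forall>x\<in>cdom M p. chart M p x \<in> W \<longrightarrow> (x, 0) \<in> cdom (TM M) (p, 0) \<and> h (chart M p x) = chart (TM M) (p, 0) (x, 0))"
    by (rule exI[of _ UNIV], rule exI[of _ "\<lambda>y. (y, 0)"])
       (use * in \<open>auto intro!: Cinf_on_bounded_linear bounded_linear_Pair bounded_linear_ident bounded_linear_zero simp del: chart_TM cdom_TM\<close>)
qed

lemma smooth_fibre_inclusion:
  assumes M: "charted M" and q: "q \<in> pts M"
  shows "smooth_map (vec_mfd (tspace M q)) (TM M) (\<lambda>v. (q, v))"
proof (rule smooth_mapI)
  fix v assume "v \<in> pts (vec_mfd (tspace M q))"
  then show "(q, v) \<in> pts (TM M)" using q by simp
  have *: "w \<in> tspace M q \<Longrightarrow> (chart M q q, w) = chart (TM M) (q, v) (q, w)" for w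
    using TM_chart_self[OF M q, of w v] by simp
  show "\<exists>W h. open W \<and> chart (vec_mfd (tspace M q)) v v \<in> W \<and> Cinf_on W h \<and>
        (\<forall>x\<in>cdom (vec_mfd (tspace M q)) v. chart (vec_mfd (tspace M q)) v x \<in> W \<longrightarrow>
           (q, x) \<in> cdom (TM M) (q, v) \<and> h (chart (vec_mfd (tspace M q)) v x) = chart (TM M) (q, v) (q, x))"
    by (rule exI[of _ UNIV], rule exI[of _ "\<lambda>y. (chart M q q, y)"])
       (use * chartedD(1)[OF M q] in \<open>auto intro!: Cinf_on_Pair Cinf_on_const Cinf_on_ident simp del: chart_TM\<close>)
qed

text \<open>Over the base point \<open>q\<close> the chart attached to \<open>(q, v)\<close> does not change the fibre coordinate, so a map into
  one fibre of the tangent bundle is as smooth as its vector component. This makes the values of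
  differentials at a fixed point, such as adjoint actions, smooth vector-valued functions.\<close>

lemma smooth_into_fibre:
  assumes M: "charted M" and P: "pointed P" and f: "smooth_map P (TM M) f"
    and q: "\<And>x. x \<in> pts P \<Longrightarrow> fst (f x) = q"
  shows "smooth_map P (vec_mfd (tspace M q)) (\<lambda>x. snd (f x))"
proof (rule smooth_mapI)
  fix p assume p: "p \<in> pts P"
  have qM: "q \<in> pts M" using smooth_map_pts[OF f p] q[OF p] by auto
  show "snd (f p) \<in> pts (vec_mfd (tspace M q))" using smooth_map_pts[OF f p] q[OF p] by auto
  obtain W g where W: "local_rep P p p (\<lambda>x. chart (TM M) (f p) (f x)) W g"
    using smooth_map_local_rep[OF f p] by metis
  have *: "snd (chart (TM M) (f p) (f x)) = snd (f x) \<and> snd (f x) \<in> tspace M q" if x: "x \<in> cdom P p" for x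
  proof -
    have xP: "x \<in> pts P" using pointedD(2)[OF P p x] .
    have m: "f p = (q, snd (f p))" "f x = (q, snd (f x))" "snd (f x) \<in> tspace M q"
      using q[OF p] q[OF xP] smooth_map_pts[OF f xP] by (auto simp: prod_eq_iff)
    show ?thesis using TM_chart_self[OF M qM m(3), of "snd (f p)"] m by metis
  qed
  show "\<exists>W h. open W \<and> chart P p p \<in> W \<and> Cinf_on W h \<and>
        (\<forall>x\<in>cdom P p. chart P p x \<in> W \<longrightarrow> snd (f x) \<in> cdom (vec_mfd (tspace M q)) (snd (f p)) \<and>
           h (chart P p x) = chart (vec_mfd (tspace M q)) (snd (f p)) (snd (f x)))"
    by (rule exI[of _ W], rule exI[of _ "\<lambda>z. snd (g z)"])
       (use W * in \<open>auto simp: local_rep_def simp del: chart_TM intro: Cinf_on_linear_comp[OF _ bounded_linear_snd]\<close>)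
qed

text \<open>The partial derivative in the second variable is the tangent map of \<open>f\<close> composed with the zero section
  in the first, both of which are smooth.\<close>

lemma smooth_partial_derivative:
  assumes P: "charted P" and Q: "charted Q" and N: "charted N" and f: "smooth_map (prod_mfd P Q) N f"
  shows "smooth_map (prod_mfd P (TM Q)) (TM N)
    (\<lambda>z. (f (fst z, fst (snd z)), mderiv Q N (\<lambda>y. f (fst z, y)) (fst (snd z)) (snd (snd z))))"
proof (rule smooth_map_cong)
  show pt: "pointed (prod_mfd P (TM Q))" using P Q by (simp add: charted_pointed pointed_prod pointed_TM)
  have 1: "smooth_map (prod_mfd P (TM Q)) (prod_mfd (TM P) (TM Q)) (\<lambda>z. ((fst z, 0), snd z))"
    by (intro smooth_Pair smooth_snd[OF smooth_id] smooth_map_compose[OF pt smooth_fst[OF smooth_id] smooth_zero_section[OF P]])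
  show "smooth_map (prod_mfd P (TM Q)) (TM N)
     (\<lambda>z. tmap (prod_mfd P Q) N f ((fst z, fst (snd z)), (0, snd (snd z))))"
    using smooth_map_compose[OF pt smooth_map_compose[OF pt 1 smooth_TM_pair[OF P Q]] smooth_tmap[OF charted_prod[OF P Q] N f]]
    by simp
  fix z assume "z \<in> pts (prod_mfd P (TM Q))"
  then obtain p q w where z: "z = (p, (q, w))" and p: "p \<in> pts P" "q \<in> pts Q" "w \<in> tspace Q q" by auto
  have "smooth_map P N (\<lambda>x. f (x, q))"
    by (rule smooth_map_compose[OF charted_pointed[OF P] smooth_Pair[OF smooth_id smooth_const[OF charted_pointed[OF Q] p(2)]] f])
  then have "mderiv (prod_mfd P Q) N f (p, q) (0, w) = mderiv Q N (\<lambda>y. f (p, y)) q w"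
    using mderiv_partials[OF P Q p(1,2) f zero_in_tspace[OF P p(1)] p(3)] by (simp add: mderiv_zero[OF P p(1)])
  then show "(f (fst z, fst (snd z)), mderiv Q N (\<lambda>y. f (fst z, y)) (fst (snd z)) (snd (snd z))) =
      tmap (prod_mfd P Q) N f ((fst z, fst (snd z)), (0, snd (snd z)))"
    using z by (simp add: tmap_def)
qed

subsection \<open>Vector-valued smooth maps\<close>

lemma smooth_vec_apply:
  assumes "pointed P" "smooth_map P (vec_mfd V) f" "bounded_linear L" "\<And>v. v \<in> V \<Longrightarrow> L v \<in> V'"
  shows "smooth_map P (vec_mfd V') (\<lambda>x. L (f x))"
proof -
  have "smooth_map (vec_mfd V) (vec_mfd V') L"
    by (rule smooth_mapI)
       (use assms(3,4) in \<open>auto intro!: exI[of _ UNIV] exI[of _ L] Cinf_on_bounded_linear\<close>)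
  then show ?thesis by (rule smooth_map_compose[OF assms(1,2)])
qed

lemma smooth_vec_Pair:
  assumes "pointed P" "smooth_map P (vec_mfd V) f" "smooth_map P (vec_mfd V') g"
  shows "smooth_map P (vec_mfd (V \<times> V')) (\<lambda>x. (f x, g x))"
proof -
  have "smooth_map (prod_mfd (vec_mfd V) (vec_mfd V')) (vec_mfd (V \<times> V')) (\<lambda>x. x)"
    by (rule smooth_mapI) (auto intro!: exI[of _ UNIV] exI[of _ "\<lambda>x. x"] Cinf_on_ident)
  from smooth_map_compose[OF assms(1) smooth_Pair[OF assms(2,3)] this] show ?thesis .
qed

lemma smooth_vec_add:
  assumes P: "pointed P" and f: "smooth_map P (vec_mfd V) f" and g: "smooth_map P (vec_mfd V) g" and V: "subspace (V :: 'b::euclidean_space set)"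
  shows "smooth_map P (vec_mfd V) (\<lambda>x. f x + g x)"
proof -
  have "bounded_linear (\<lambda>z :: 'b \<times> 'b. fst z + snd z)"
    by (intro bounded_linear_add bounded_linear_fst bounded_linear_snd)
  from smooth_vec_apply[OF P smooth_vec_Pair[OF P f g] this, of V] show ?thesis
    by (auto simp: subspace_add[OF V])
qed

lemma smooth_vec_diff:
  assumes P: "pointed P" and f: "smooth_map P (vec_mfd V) f" and g: "smooth_map P (vec_mfd V) g" and V: "subspace (V :: 'b::euclidean_space set)"
  shows "smooth_map P (vec_mfd V) (\<lambda>x. f x - g x)"
proof -
  have "bounded_linear (\<lambda>z :: 'b \<times> 'b. fst z - snd z)"
    by (intro bounded_linear_sub bounded_linear_fst bounded_linear_snd)
  from smooth_vec_apply[OF P smooth_vec_Pair[OF P f g] this, of V] show ?thesis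
    by (auto simp: subspace_diff[OF V])
qed

section \<open>The manifold topology of products and subsets\<close>

lemma openin_mfd_topology_iff:
  assumes "\<forall>p\<in>pts M. inj_on (chart M p) (cdom M p)"
  shows "openin (mfd_topology M) W \<longleftrightarrow> W \<subseteq> pts M \<and>
     (\<forall>p\<in>pts M. openin (top_of_set (cimg M p)) (chart M p ` (W \<inter> cdom M p)))"
proof -
  let ?O = "\<lambda>W. W \<subseteq> pts M \<and> (\<forall>p\<in>pts M. openin (top_of_set (cimg M p)) (chart M p ` (W \<inter> cdom M p)))"
  have "istopology ?O"
    unfolding istopology_def
  proof (intro conjI allI impI)
    fix S T assume S: "?O S" and T: "?O T"
    show "S \<inter> T \<subseteq> pts M" using S by blast
    show "\<forall>p\<in>pts M. openin (top_of_set (cimg M p)) (chart M p ` (S \<inter> T \<inter> cdom M p))"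
    proof
      fix p assume p: "p \<in> pts M"
      have "chart M p ` (S \<inter> T \<inter> cdom M p) = chart M p ` (S \<inter> cdom M p) \<inter> chart M p ` (T \<inter> cdom M p)"
        using assms p by (auto simp: inj_on_def)
      then show "openin (top_of_set (cimg M p)) (chart M p ` (S \<inter> T \<inter> cdom M p))"
        using S T p by (simp add: openin_Int)
    qed
  next
    fix K assume K: "\<forall>S\<in>K. ?O S"
    show "\<Union>K \<subseteq> pts M" using K by blast
    show "\<forall>p\<in>pts M. openin (top_of_set (cimg M p)) (chart M p ` (\<Union>K \<inter> cdom M p))"
    proof
      fix p assume p: "p \<in> pts M"
      have "chart M p ` (\<Union>K \<inter> cdom M p) = \<Union>((\<lambda>S. chart M p ` (S \<inter> cdom M p)) ` K)" by blast
      then show "openin (top_of_set (cimg M p)) (chart M p ` (\<Union>K \<inter> cdom M p))"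
        using K p by (auto intro!: openin_Union)
    qed
  qed
  then show ?thesis unfolding mfd_topology_def by (simp add: topology_inverse')
qed

text \<open>Transition maps are continuous, so it suffices to test openness at each point in the one chart
  attached to it. In this form the topologies of products and subsets can be read off.\<close>

lemma openin_mfd:
  assumes M: "charted M"
  shows "openin (mfd_topology M) W \<longleftrightarrow> W \<subseteq> pts M \<and>
     (\<forall>x\<in>W. \<exists>Q. open Q \<and> chart M x x \<in> Q \<and> (\<forall>y\<in>cdom M x. chart M x y \<in> Q \<longrightarrow> y \<in> W))"
    (is "?L \<longleftrightarrow> ?S \<and> ?R")
proof -
  have *: "?L \<longleftrightarrow> W \<subseteq> pts M \<and> (\<forall>p\<in>pts M. openin (top_of_set (cimg M p)) (chart M p ` (W \<inter> cdom M p)))"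
    by (rule openin_mfd_topology_iff) (intro ballI chartedD(3)[OF M])
  show ?thesis
  proof
    assume L: ?L
    then have S: ?S using * by blast
    have "\<exists>Q. open Q \<and> chart M x x \<in> Q \<and> (\<forall>y\<in>cdom M x. chart M x y \<in> Q \<longrightarrow> y \<in> W)" if x: "x \<in> W" for x
    proof -
      have xM: "x \<in> pts M" using x S by blast
      obtain Q where Q: "open Q" "chart M x ` (W \<inter> cdom M x) = cimg M x \<inter> Q"
        using L * xM openin_open by metis
      have "chart M x x \<in> Q" using Q(2) x chartedD(1)[OF M xM] by blast
      moreover have "y \<in> W" if "y \<in> cdom M x" "chart M x y \<in> Q" for y
      proof -
        have "chart M x y \<in> chart M x ` (W \<inter> cdom M x)" using that Q(2) unfolding cimg_def by blast
        then show ?thesis using chartedD(3)[OF M xM] that(1) by (auto simp: inj_on_def)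
      qed
      ultimately show ?thesis using Q(1) by blast
    qed
    then show "?S \<and> ?R" using S by blast
  next
    assume R: "?S \<and> ?R"
    have "openin (top_of_set (cimg M p)) (chart M p ` (W \<inter> cdom M p))" if p: "p \<in> pts M" for p
    proof (subst openin_subopen, intro ballI)
      fix z assume "z \<in> chart M p ` (W \<inter> cdom M p)"
      then obtain x where x: "x \<in> W" "x \<in> cdom M p" "z = chart M p x" by blast
      have xM: "x \<in> pts M" using x R by blast
      obtain Q where Q: "open Q" "chart M x x \<in> Q" "\<And>y. y \<in> cdom M x \<Longrightarrow> chart M x y \<in> Q \<Longrightarrow> y \<in> W"
        using R x(1) by blast
      obtain V g where V: "local_rep M p x (chart M x) V g" "\<And>y. y \<in> cdom M p \<Longrightarrow> chart M p y \<in> V \<Longrightarrow> y \<in> cdom M x"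
        using charted_transition[OF M p xM x(2) chartedD(1)[OF M xM]] by metis
      have V': "open V" "Cinf_on V g" "chart M p x \<in> V" "\<And>y. y \<in> cdom M p \<Longrightarrow> chart M p y \<in> V \<Longrightarrow> g (chart M p y) = chart M x y"
        using V(1) unfolding local_rep_def by blast+
      let ?T = "cimg M p \<inter> (V \<inter> g -` Q)"
      have "openin (top_of_set (cimg M p)) ?T"
        using open_preimage_Cinf[OF V'(1,2) Q(1)] openin_open by blast
      moreover have "z \<in> ?T" using x V' Q unfolding cimg_def by simp
      moreover have "?T \<subseteq> chart M p ` (W \<inter> cdom M p)" using V V' Q(3) unfolding cimg_def by force
      ultimately show "\<exists>T. openin (top_of_set (cimg M p)) T \<and> z \<in> T \<and> T \<subseteq> chart M p ` (W \<inter> cdom M p)" by blast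
    qed
    then show ?L using * R by blast
  qed
qed

lemma openin_mfdD:
  assumes "charted M" "openin (mfd_topology M) W" "x \<in> W"
  obtains Q where "open Q" "chart M x x \<in> Q" "\<And>y. y \<in> cdom M x \<Longrightarrow> chart M x y \<in> Q \<Longrightarrow> y \<in> W"
  using assms(2,3) unfolding openin_mfd[OF assms(1)] by blast

lemma openin_mfd_subset: "charted M \<Longrightarrow> openin (mfd_topology M) W \<Longrightarrow> W \<subseteq> pts M"
  by (simp add: openin_mfd)

lemma openin_chart_preimage:
  assumes M: "charted M" and p: "p \<in> pts M" and Q: "open Q"
  shows "openin (mfd_topology M) {x \<in> cdom M p. chart M p x \<in> Q}"
  unfolding openin_mfd[OF M]
proof (intro conjI ballI)
  show "{x \<in> cdom M p. chart M p x \<in> Q} \<subseteq> pts M" using chartedD(2)[OF M p] by blast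
  fix x assume x: "x \<in> {x \<in> cdom M p. chart M p x \<in> Q}"
  then have xM: "x \<in> pts M" using chartedD(2)[OF M p] by blast
  obtain V g where V: "local_rep M x x (chart M p) V g" "\<And>y. y \<in> cdom M x \<Longrightarrow> chart M x y \<in> V \<Longrightarrow> y \<in> cdom M p"
    using charted_transition[OF M xM p chartedD(1)[OF M xM]] x by blast
  have V': "open V" "Cinf_on V g" "chart M x x \<in> V" "\<And>y. y \<in> cdom M x \<Longrightarrow> chart M x y \<in> V \<Longrightarrow> g (chart M x y) = chart M p y"
    using V(1) unfolding local_rep_def by blast+
  show "\<exists>R. open R \<and> chart M x x \<in> R \<and> (\<forall>y\<in>cdom M x. chart M x y \<in> R \<longrightarrow> y \<in> {x \<in> cdom M p. chart M p x \<in> Q})"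
    by (rule exI[of _ "V \<inter> g -` Q"])
       (use V V' x open_preimage_Cinf[OF V'(1,2) Q] chartedD(1)[OF M xM] in auto)
qed

lemma mfd_topology_prod:
  assumes M: "charted M" and N: "charted N"
  shows "mfd_topology (prod_mfd M N) = prod_topology (mfd_topology M) (mfd_topology N)"
  unfolding topology_eq
proof (intro allI)
  fix S
  show "openin (mfd_topology (prod_mfd M N)) S \<longleftrightarrow> openin (prod_topology (mfd_topology M) (mfd_topology N)) S"
  proof
    assume S: "openin (mfd_topology (prod_mfd M N)) S"
    show "openin (prod_topology (mfd_topology M) (mfd_topology N)) S"
      unfolding openin_prod_topology_alt
    proof (intro allI impI)
      fix x y assume xy: "(x, y) \<in> S"
      have pts: "x \<in> pts M" "y \<in> pts N" using openin_mfd_subset[OF charted_prod[OF M N] S] xy by auto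
      obtain Q where Q: "open Q" "chart (prod_mfd M N) (x, y) (x, y) \<in> Q"
        "\<And>z. z \<in> cdom (prod_mfd M N) (x, y) \<Longrightarrow> chart (prod_mfd M N) (x, y) z \<in> Q \<Longrightarrow> z \<in> S"
        using openin_mfdD[OF charted_prod[OF M N] S xy] by blast
      obtain A B where AB: "open A" "open B" "(chart M x x, chart N y y) \<in> A \<times> B" "A \<times> B \<subseteq> Q"
        using Q(1,2) open_prod_elim[of Q "(chart M x x, chart N y y)"] by auto
      show "\<exists>U V. openin (mfd_topology M) U \<and> openin (mfd_topology N) V \<and> x \<in> U \<and> y \<in> V \<and> U \<times> V \<subseteq> S"
        by (rule exI[of _ "{x' \<in> cdom M x. chart M x x' \<in> A}"], rule exI[of _ "{y' \<in> cdom N y. chart N y y' \<in> B}"])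
           (use AB Q(3) openin_chart_preimage[OF M pts(1)] openin_chart_preimage[OF N pts(2)]
             chartedD(1)[OF M pts(1)] chartedD(1)[OF N pts(2)] in \<open>auto simp: subset_iff\<close>)
    qed
  next
    assume S: "openin (prod_topology (mfd_topology M) (mfd_topology N)) S"
    show "openin (mfd_topology (prod_mfd M N)) S"
      unfolding openin_mfd[OF charted_prod[OF M N]]
    proof (intro conjI ballI subsetI)
      fix z assume z: "z \<in> S"
      obtain U V where UV: "openin (mfd_topology M) U" "openin (mfd_topology N) V" "fst z \<in> U" "snd z \<in> V" "U \<times> V \<subseteq> S"
        using S z unfolding openin_prod_topology_alt by (metis prod.collapse)
      show "z \<in> pts (prod_mfd M N)"
        using UV openin_mfd_subset[OF M UV(1)] openin_mfd_subset[OF N UV(2)] by (auto simp: mem_Times_iff)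
      obtain A where A: "open A" "chart M (fst z) (fst z) \<in> A" "\<And>y. y \<in> cdom M (fst z) \<Longrightarrow> chart M (fst z) y \<in> A \<Longrightarrow> y \<in> U"
        using openin_mfdD[OF M UV(1,3)] by blast
      obtain B where B: "open B" "chart N (snd z) (snd z) \<in> B" "\<And>y. y \<in> cdom N (snd z) \<Longrightarrow> chart N (snd z) y \<in> B \<Longrightarrow> y \<in> V"
        using openin_mfdD[OF N UV(2,4)] by blast
      show "\<exists>Q. open Q \<and> chart (prod_mfd M N) z z \<in> Q \<and>
          (\<forall>y\<in>cdom (prod_mfd M N) z. chart (prod_mfd M N) z y \<in> Q \<longrightarrow> y \<in> S)"
        by (rule exI[of _ "A \<times> B"]) (use A B UV(5) in \<open>auto simp: open_Times subset_iff\<close>)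
    qed
  qed
qed

lemma mfd_topology_sub:
  assumes M: "charted M"
  shows "mfd_topology (sub_mfd M S) = subtopology (mfd_topology M) S"
  unfolding topology_eq
proof (intro allI)
  fix U
  show "openin (mfd_topology (sub_mfd M S)) U \<longleftrightarrow> openin (subtopology (mfd_topology M) S) U"
  proof
    assume U: "openin (mfd_topology (sub_mfd M S)) U"
    have US: "U \<subseteq> pts M \<inter> S" using openin_mfd_subset[OF charted_sub[OF M] U] by simp
    have "\<forall>x\<in>U. \<exists>Q. open Q \<and> chart M x x \<in> Q \<and> (\<forall>y\<in>cdom M x \<inter> S. chart M x y \<in> Q \<longrightarrow> y \<in> U)"
      using U unfolding openin_mfd[OF charted_sub[OF M]] by simp
    then obtain Q where Q: "\<And>x. x \<in> U \<Longrightarrow> open (Q x) \<and> chart M x x \<in> Q x \<and> (\<forall>y\<in>cdom M x \<inter> S. chart M x y \<in> Q x \<longrightarrow> y \<in> U)"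
      by metis
    let ?T = "\<Union>x\<in>U. {y \<in> cdom M x. chart M x y \<in> Q x}"
    have "openin (mfd_topology M) ?T"
      using Q US openin_chart_preimage[OF M] by (intro openin_Union) auto
    moreover have "U = ?T \<inter> S" using Q US chartedD(1)[OF M] by fastforce
    ultimately show "openin (subtopology (mfd_topology M) S) U" unfolding openin_subtopology by blast
  next
    assume "openin (subtopology (mfd_topology M) S) U"
    then obtain T where T: "openin (mfd_topology M) T" "U = T \<inter> S" unfolding openin_subtopology by blast
    show "openin (mfd_topology (sub_mfd M S)) U"
      unfolding openin_mfd[OF charted_sub[OF M]]
    proof (intro conjI ballI)
      show "U \<subseteq> pts (sub_mfd M S)" using T openin_mfd_subset[OF M T(1)] by auto
      fix x assume "x \<in> U"
      then obtain Q where "open Q" "chart M x x \<in> Q" "\<And>y. y \<in> cdom M x \<Longrightarrow> chart M x y \<in> Q \<Longrightarrow> y \<in> T"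
        using openin_mfdD[OF M T(1)] T(2) by blast
      then show "\<exists>Q. open Q \<and> chart (sub_mfd M S) x x \<in> Q \<and>
          (\<forall>y\<in>cdom (sub_mfd M S) x. chart (sub_mfd M S) x y \<in> Q \<longrightarrow> y \<in> U)"
        using T(2) by (intro exI[of _ Q]) auto
    qed
  qed
qed

lemma second_countable_prod_topology:
  assumes "second_countable X" "second_countable Y"
  shows "second_countable (prod_topology X Y)"
proof -
  from assms(1)[unfolded second_countable_def]
  obtain B where B: "countable B" "\<forall>V\<in>B. openin X V" "\<forall>U x. openin X U \<and> x \<in> U \<longrightarrow> (\<exists>V\<in>B. x \<in> V \<and> V \<subseteq> U)"
    by (elim exE conjE)
  from assms(2)[unfolded second_countable_def]
  obtain C where C: "countable C" "\<forall>V\<in>C. openin Y V" "\<forall>U x. openin Y U \<and> x \<in> U \<longrightarrow> (\<exists>V\<in>C. x \<in> V \<and> V \<subseteq> U)"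
    by (elim exE conjE)
  let ?D = "(\<lambda>(U, V). U \<times> V) ` (B \<times> C)"
  show ?thesis
    unfolding second_countable_def
  proof (intro exI[of _ ?D] conjI allI impI ballI)
    show "countable ?D" by (intro countable_image countable_SIGMA B(1) C(1))
    show "openin (prod_topology X Y) V" if "V \<in> ?D" for V
      using that B(2) C(2) by (auto simp: openin_prod_Times_iff)
    fix U x assume U: "openin (prod_topology X Y) U \<and> x \<in> U"
    then obtain P Q where PQ: "openin X P" "openin Y Q" "fst x \<in> P" "snd x \<in> Q" "P \<times> Q \<subseteq> U"
      unfolding openin_prod_topology_alt by (metis prod.collapse)
    obtain P' where P': "P' \<in> B" "fst x \<in> P'" "P' \<subseteq> P" using B(3) PQ(1,3) by blast
    obtain Q' where Q': "Q' \<in> C" "snd x \<in> Q'" "Q' \<subseteq> Q" using C(3) PQ(2,4) by blast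
    have "P' \<times> Q' \<in> ?D" using P'(1) Q'(1) by blast
    moreover have "x \<in> P' \<times> Q'" "P' \<times> Q' \<subseteq> U" using P' Q' PQ(5) by (auto simp: mem_Times_iff)
    ultimately show "\<exists>V\<in>?D. x \<in> V \<and> V \<subseteq> U" by blast
  qed
qed

lemma manifold_iff:
  "manifold M \<longleftrightarrow> charted M \<and> (\<exists>d. \<forall>p\<in>pts M. embedded_submanifold d (cimg M p)) \<and>
     Hausdorff_space (mfd_topology M) \<and> second_countable (mfd_topology M)"
  unfolding manifold_def charted_def pointed_def by blast

lemma manifold_fib_prodI:
  assumes M: "manifold M" and N: "manifold N"
    and e: "\<And>p. p \<in> pts (fib_prod M N f g) \<Longrightarrow> embedded_submanifold d (cimg (fib_prod M N f g) p)"
  shows "manifold (fib_prod M N f g)"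
proof -
  note C = manifold_charted[OF M] manifold_charted[OF N]
  show ?thesis
    unfolding manifold_iff
  proof (intro conjI)
    show "charted (fib_prod M N f g)" using charted_fib_prod[OF C] .
    show "\<exists>d. \<forall>p\<in>pts (fib_prod M N f g). embedded_submanifold d (cimg (fib_prod M N f g) p)" using e by blast
    show "Hausdorff_space (mfd_topology (fib_prod M N f g))"
      unfolding fib_prod_def mfd_topology_sub[OF charted_prod[OF C]] mfd_topology_prod[OF C]
      using M N by (intro Hausdorff_space_subtopology) (simp add: manifold_iff Hausdorff_space_prod_topology)
    show "second_countable (mfd_topology (fib_prod M N f g))"
      unfolding fib_prod_def mfd_topology_sub[OF charted_prod[OF C]] mfd_topology_prod[OF C]
      using M N by (intro second_countable_subtopology second_countable_prod_topology) (auto simp: manifold_iff)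
  qed
qed


section \<open>Submersions in normal form, and fibre products\<close>

text \<open>The data that \<open>embedded_submanifold\<close> asks for at one point, with the dimension left out.\<close>

definition flattening ::
  "'b::euclidean_space set \<Rightarrow> 'b \<Rightarrow> 'b set \<Rightarrow> ('b \<Rightarrow> 'b) \<Rightarrow> ('b \<Rightarrow> 'b) \<Rightarrow> 'b set \<Rightarrow> bool" where
  "flattening S x W \<phi> \<psi> V \<longleftrightarrow> open W \<and> x \<in> W \<and> Cinf_on W \<phi> \<and> open (\<phi> ` W) \<and> Cinf_on (\<phi> ` W) \<psi> \<and>
     (\<forall>y\<in>W. \<psi> (\<phi> y) = y) \<and> subspace V \<and> \<phi> ` (W \<inter> S) = \<phi> ` W \<inter> V"

lemma embedded_submanifold_iff:
  "embedded_submanifold d S \<longleftrightarrow> (\<forall>x\<in>S. \<exists>W \<phi> \<psi> V. flattening S x W \<phi> \<psi> V \<and> dim V = d)"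
  unfolding embedded_submanifold_def flattening_def by (intro ball_cong refl iff_exI) auto

lemma embedded_flattening:
  assumes "embedded_submanifold d (cimg M p)" "x \<in> cdom M p"
  obtains W \<phi> \<psi> V where "flattening (cimg M p) (chart M p x) W \<phi> \<psi> V" "dim V = d"
proof -
  have "chart M p x \<in> cimg M p" using assms(2) unfolding cimg_def by blast
  then show ?thesis using assms(1) that unfolding embedded_submanifold_iff by blast
qed

lemma flatteningD:
  assumes "flattening S x W \<phi> \<psi> V"
  shows "open W" "x \<in> W" "Cinf_on W \<phi>" "open (\<phi> ` W)" "Cinf_on (\<phi> ` W) \<psi>" "subspace V"
    "\<And>y. y \<in> W \<Longrightarrow> \<psi> (\<phi> y) = y" "\<And>y. y \<in> W \<Longrightarrow> \<phi> y \<in> V \<longleftrightarrow> y \<in> S"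
    "\<And>z. z \<in> \<phi> ` W \<Longrightarrow> \<psi> z \<in> W \<and> \<phi> (\<psi> z) = z"
proof -
  show "open W" "x \<in> W" "Cinf_on W \<phi>" "open (\<phi> ` W)" "Cinf_on (\<phi> ` W) \<psi>" "subspace V"
    "\<And>y. y \<in> W \<Longrightarrow> \<psi> (\<phi> y) = y"
    using assms unfolding flattening_def by blast+
  have *: "\<phi> ` (W \<inter> S) = \<phi> ` W \<inter> V" and inv: "\<And>y. y \<in> W \<Longrightarrow> \<psi> (\<phi> y) = y" using assms unfolding flattening_def by blast+
  show "\<phi> y \<in> V \<longleftrightarrow> y \<in> S" if y: "y \<in> W" for y
  proof
    assume "\<phi> y \<in> V"
    then obtain y' where "y' \<in> W \<inter> S" "\<phi> y = \<phi> y'" using * y by blast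
    then show "y \<in> S" using inv y by (metis IntD1 IntD2)
  qed (use * y in blast)
  show "\<psi> z \<in> W \<and> \<phi> (\<psi> z) = z" if "z \<in> \<phi> ` W" for z using that inv by auto
qed

lemma flattening_restrict:
  assumes f: "flattening S x W \<phi> \<psi> V" and W': "open W'" "x \<in> W'"
  shows "flattening S x (W \<inter> W') \<phi> \<psi> V"
proof -
  note F = flatteningD[OF f]
  have im: "\<phi> ` (W \<inter> W') = \<phi> ` W \<inter> \<psi> -` W'"
    using F(7) by force
  have "open (\<phi> ` W \<inter> \<psi> -` W')" by (rule open_preimage_Cinf[OF F(4,5) W'(1)])
  moreover have "\<phi> ` (W \<inter> W' \<inter> S) = \<phi> ` (W \<inter> W') \<inter> V" using F(8) by auto
  ultimately show ?thesis
    unfolding flattening_def using F W' im Cinf_on_subset[OF F(3)] Cinf_on_subset[OF F(5)] by (auto simp: open_Int)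
qed

lemma has_vector_derivative_Cinf:
  assumes "Cinf_on W g" "\<gamma> t \<in> W" "(\<gamma> has_vector_derivative v) (at t)"
  shows "((\<lambda>s. g (\<gamma> s)) has_vector_derivative frechet_derivative g (at (\<gamma> t)) v) (at t)"
proof -
  note L = bounded_linear.linear[OF bounded_linear_frechet_derivative[OF assms(1,2)]]
  show ?thesis
    using has_derivative_compose[OF assms(3)[unfolded has_vector_derivative_def] Cinf_on_has_derivative[OF assms(1,2)]]
    unfolding has_vector_derivative_def by (simp add: linear_scale[OF L])
qed

lemma subspace_projection:
  fixes V :: "'a::euclidean_space set"
  assumes "subspace V"
  obtains P where "linear P" "\<And>x. P x \<in> V" "\<And>x. x \<in> V \<Longrightarrow> P x = x"
proof -
  obtain P :: "'a \<Rightarrow> 'a" where "P ` UNIV \<subseteq> V" "linear P" "\<forall>v\<in>V. P v = v"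
    using linear_exists_left_inverse_on[OF linear_id assms] by (auto simp: inj_on_def)
  then show ?thesis by (intro that[of P]) auto
qed

text \<open>A curve in a subspace is fixed by a linear projection onto it, hence so is its velocity.\<close>

lemma velocity_in_subspace:
  fixes V :: "'a::euclidean_space set"
  assumes V: "subspace V" and v: "(\<gamma> has_vector_derivative v) (at 0)" and e: "e > 0" "\<And>t. t \<in> {-e<..<e} \<Longrightarrow> \<gamma> t \<in> V"
  shows "v \<in> V"
proof -
  obtain P where P: "linear P" "\<And>x. P x \<in> V" "\<And>x. x \<in> V \<Longrightarrow> P x = x" using subspace_projection[OF V] by blast
  have 1: "((\<lambda>t. P (\<gamma> t)) has_vector_derivative P v) (at 0)"
    using bounded_linear.has_vector_derivative[OF linear_conv_bounded_linear[THEN iffD1, OF P(1)] v] .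
  have "((\<lambda>t. P (\<gamma> t)) has_vector_derivative v) (at 0)"
    by (rule has_vector_derivative_transform_within_open[OF v, of "{-e<..<e}"]) (use e P in auto)
  then show ?thesis using vector_derivative_unique_at[OF 1] P(2) by metis
qed

lemma flattening_derivative_inverse:
  assumes "flattening S x W \<phi> \<psi> V" "y \<in> W"
  shows "frechet_derivative \<psi> (at (\<phi> y)) (frechet_derivative \<phi> (at y) v) = v"
    and "frechet_derivative \<phi> (at y) (frechet_derivative \<psi> (at (\<phi> y)) w) = w"
proof -
  note F = flatteningD[OF assms(1)]
  have py: "\<phi> y \<in> \<phi> ` W" using assms(2) by blast
  note D1 = Cinf_on_has_derivative[OF F(3) assms(2)] and D2 = Cinf_on_has_derivative[OF F(5) py]
  have "((\<lambda>z. \<psi> (\<phi> z)) has_derivative (\<lambda>v. frechet_derivative \<psi> (at (\<phi> y)) (frechet_derivative \<phi> (at y) v))) (at y)"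
    by (rule has_derivative_compose[OF D1 D2])
  moreover have "((\<lambda>z. \<psi> (\<phi> z)) has_derivative (\<lambda>v. v)) (at y)"
    by (rule has_derivative_transform_within_open[OF has_derivative_ident F(1) assms(2)]) (simp add: F(7))
  ultimately show "frechet_derivative \<psi> (at (\<phi> y)) (frechet_derivative \<phi> (at y) v) = v"
    using has_derivative_unique by metis
  have D1': "(\<phi> has_derivative frechet_derivative \<phi> (at y)) (at (\<psi> (\<phi> y)))" using D1 F(7) assms(2) by simp
  have "((\<lambda>z. \<phi> (\<psi> z)) has_derivative (\<lambda>v. frechet_derivative \<phi> (at y) (frechet_derivative \<psi> (at (\<phi> y)) v))) (at (\<phi> y))"
    by (rule has_derivative_compose[OF D2 D1'])
  moreover have "((\<lambda>z. \<phi> (\<psi> z)) has_derivative (\<lambda>v. v)) (at (\<phi> y))"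
    by (rule has_derivative_transform_within_open[OF has_derivative_ident F(4) py]) (simp add: F(9))
  ultimately show "frechet_derivative \<phi> (at y) (frechet_derivative \<psi> (at (\<phi> y)) w) = w"
    using has_derivative_unique by metis
qed

lemma curve_flattening:
  assumes c: "curve_in M p x v c" and F: "flattening (cimg M p) (chart M p x) W \<phi> \<psi> V"
  shows "frechet_derivative \<phi> (at (chart M p x)) v \<in> V"
    and "((\<lambda>t. \<phi> (chart M p (c t))) has_vector_derivative frechet_derivative \<phi> (at (chart M p x)) v) (at 0)"
    and "\<exists>e>0. \<forall>t\<in>{-e<..<e}. c t \<in> cdom M p \<and> chart M p (c t) \<in> W \<and> \<phi> (chart M p (c t)) \<in> V"
proof -
  note f = flatteningD[OF F]
  have r: "local_rep M p x (\<lambda>y. \<phi> (chart M p y)) W \<phi>" using f unfolding local_rep_def by blast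
  show 1: "((\<lambda>t. \<phi> (chart M p (c t))) has_vector_derivative frechet_derivative \<phi> (at (chart M p x)) v) (at 0)"
    by (rule curve_in_local_rep(1)[OF c r])
  obtain e where e: "e > 0" "\<forall>t\<in>{-e<..<e}. c t \<in> cdom M p \<and> chart M p (c t) \<in> W"
    using curve_in_local_rep(2)[OF c r] by blast
  have V: "\<phi> (chart M p (c t)) \<in> V" if "t \<in> {-e<..<e}" for t
    using f(8)[of "chart M p (c t)"] e(2) that unfolding cimg_def by blast
  show "frechet_derivative \<phi> (at (chart M p x)) v \<in> V"
    by (rule velocity_in_subspace[OF f(6) 1 e(1) V])
  show "\<exists>e>0. \<forall>t\<in>{-e<..<e}. c t \<in> cdom M p \<and> chart M p (c t) \<in> W \<and> \<phi> (chart M p (c t)) \<in> V"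
    using e V by blast
qed

text \<open>The source of tangent vectors: it suffices to draw curves in the flat model, where straight lines and
  their linear corrections are at hand.\<close>

lemma curve_from_flattening:
  assumes M: "charted M" "p \<in> pts M" "x \<in> cdom M p" and F: "flattening (cimg M p) (chart M p x) W \<phi> \<psi> V"
    and a: "a 0 = \<phi> (chart M p x)" "e > 0" "Cinf_on {-e<..<e} a" "\<And>t. t \<in> {-e<..<e} \<Longrightarrow> a t \<in> V"
      "(a has_vector_derivative w) (at 0)"
  obtains b d where "curve_in M p x (frechet_derivative \<psi> (at (\<phi> (chart M p x))) w) b" "d > 0" "d \<le> e"
    "\<And>t. t \<in> {-d<..<d} \<Longrightarrow> b t \<in> cdom M p \<and> chart M p (b t) \<in> W \<and> \<phi> (chart M p (b t)) = a t"
proof -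
  note f = flatteningD[OF F]
  have a0: "a 0 \<in> \<phi> ` W" using a(1) f(2) by blast
  let ?O = "{-e<..<e} \<inter> a -` (\<phi> ` W)"
  have O: "open ?O" by (rule open_preimage_Cinf[OF _ a(3) f(4)]) simp
  have O0: "0 \<in> ?O" using a(2) a0 by simp
  obtain d where d: "d > 0" "ball 0 d \<subseteq> ?O" using O O0 open_contains_ball by blast
  have be: "ball (0::real) d = {-d<..<d}" by (auto simp: dist_real_def)
  let ?b = "\<lambda>t. cinv M p (\<psi> (a t))"
  have de: "d \<le> e"
  proof (rule ccontr)
    assume "\<not> d \<le> e"
    then have "e \<in> ball 0 d" using a(2) by (auto simp: be)
    then show False using d(2) by auto
  qed
  have b: "?b t \<in> cdom M p \<and> chart M p (?b t) = \<psi> (a t) \<and> \<psi> (a t) \<in> W \<and> \<phi> (\<psi> (a t)) = a t" if t: "t \<in> {-d<..<d}" for t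
  proof -
    have im: "a t \<in> \<phi> ` W" "a t \<in> V" using d(2) t a(4) de unfolding be by auto
    have "\<psi> (a t) \<in> W" "\<phi> (\<psi> (a t)) = a t" using f(9)[OF im(1)] by auto
    moreover from this have "\<psi> (a t) \<in> cimg M p" using f(8)[of "\<psi> (a t)"] im(2) by simp
    moreover from this have "?b t \<in> cdom M p \<and> chart M p (?b t) = \<psi> (a t)"
      unfolding cimg_def cinv_def by (meson f_inv_into_f inv_into_into)
    ultimately show ?thesis by blast
  qed
  have C: "Cinf_on {-d<..<d} (\<lambda>t. \<psi> (a t))"
    by (rule Cinf_on_compose[OF _ f(4) Cinf_on_subset[OF a(3)] f(5)]) (use d(2) de be in auto)
  have v: "((\<lambda>t. \<psi> (a t)) has_vector_derivative frechet_derivative \<psi> (at (\<phi> (chart M p x))) w) (at 0)"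
    using has_vector_derivative_Cinf[OF f(5) a0 a(5)] a(1) by simp
  have "curve_in M p x (frechet_derivative \<psi> (at (\<phi> (chart M p x))) w) ?b"
    unfolding curve_in_def
  proof (intro conjI exI)
    show "?b 0 = x" using a(1) f(2,7) M by (simp add: cinv_chart)
    show "0 < d" by fact
    show "Cinf_on {-d<..<d} (\<lambda>t. chart M p (?b t))"
      using Cinf_on_cong[of "{-d<..<d}" "\<lambda>t. chart M p (?b t)" "\<lambda>t. \<psi> (a t)"] b C by simp
    show "\<forall>t\<in>{-d<..<d}. ?b t \<in> cdom M p" using b by blast
    show "((\<lambda>t. chart M p (?b t)) has_vector_derivative frechet_derivative \<psi> (at (\<phi> (chart M p x))) w) (at 0)"
      by (rule has_vector_derivative_transform_within_open[OF v, of "{-d<..<d}"]) (use b d in auto)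
  qed
  then show ?thesis using that[of ?b d] d(1) de b by metis
qed

lemma subspace_tspace:
  assumes M: "manifold M" and p: "p \<in> pts M"
  shows "subspace (tspace M p)"
proof -
  note C = manifold_charted[OF M]
  have "chart M p p \<in> cimg M p" using chartedD(1)[OF C p] unfolding cimg_def by blast
  then obtain W \<phi> \<psi> V where F: "flattening (cimg M p) (chart M p p) W \<phi> \<psi> V"
    using M p embedded_flattening[OF _ chartedD(1)[OF C p]] unfolding manifold_iff by metis
  note f = flatteningD[OF F]
  let ?D = "frechet_derivative \<psi> (at (\<phi> (chart M p p)))"
  have "\<phi> (chart M p p) \<in> \<phi> ` W" using f(2) by blast
  then have lin: "linear ?D" using bounded_linear_frechet_derivative[OF f(5)] bounded_linear.linear by blast
  have "tspace M p = ?D ` V"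
  proof (intro equalityI subsetI)
    fix v assume "v \<in> tspace M p"
    then obtain c where c: "curve_at M p v c" using tspace_curveE[OF C p] by blast
    show "v \<in> ?D ` V"
      using flattening_derivative_inverse(1)[OF F f(2), of v] curve_flattening(1)[OF c F] by (metis image_eqI)
  next
    fix v assume "v \<in> ?D ` V"
    then obtain w where w: "w \<in> V" "v = ?D w" by blast
    have p0: "\<phi> (chart M p p) \<in> V" using f(8)[OF f(2)] \<open>chart M p p \<in> cimg M p\<close> by simp
    let ?a = "\<lambda>t::real. \<phi> (chart M p p) + t *\<^sub>R w"
    have vd: "(?a has_vector_derivative w) (at 0)" by (auto intro!: derivative_eq_intros)
    have cinf: "Cinf_on {-1<..<1} ?a"
      by (intro Cinf_on_add Cinf_on_const Cinf_on_bounded_linear bounded_linear_scaleR_left) auto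
    have "?D w \<in> tspace M p"
    proof (rule curve_from_flattening[OF C p chartedD(1)[OF C p] F _ zero_less_one cinf _ vd])
      show "?a 0 = \<phi> (chart M p p)" by simp
      show "?a t \<in> V" for t using subspace_add[OF f(6) p0 subspace_scale[OF f(6) w(1)]] .
      fix b assume "curve_at M p (?D w) b"
      then show "?D w \<in> tspace M p" by (rule curve_at_tspace[OF C p])
    qed
    then show "v \<in> tspace M p" unfolding w(2) .
  qed
  then show ?thesis using linear_subspace_image[OF lin f(6)] by simp
qed

lemma smooth_map_local_rep_at:
  assumes M: "charted M" and f: "smooth_map M N f" and p: "p \<in> pts M" and x: "x \<in> cdom M p"
  obtains W g where "local_rep M p x (\<lambda>y. chart N (f x) (f y)) W g"
    "\<And>y. y \<in> cdom M p \<Longrightarrow> chart M p y \<in> W \<Longrightarrow> f y \<in> cdom N (f x)"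
proof -
  have xM: "x \<in> pts M" using chartedD(2)[OF M p x] .
  obtain W1 g1 where 1: "local_rep M p x (chart M x) W1 g1" "\<And>y. y \<in> cdom M p \<Longrightarrow> chart M p y \<in> W1 \<Longrightarrow> y \<in> cdom M x"
    using charted_transition[OF M p xM x chartedD(1)[OF M xM]] by metis
  obtain W2 g2 where 2: "local_rep M x x (\<lambda>y. chart N (f x) (f y)) W2 g2"
    "\<And>y. y \<in> cdom M x \<Longrightarrow> chart M x y \<in> W2 \<Longrightarrow> f y \<in> cdom N (f x)"
    using smooth_map_local_rep[OF f xM] by metis
  have 11: "open W1" "chart M p x \<in> W1" "Cinf_on W1 g1" "\<And>y. y \<in> cdom M p \<Longrightarrow> chart M p y \<in> W1 \<Longrightarrow> g1 (chart M p y) = chart M x y"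
    using 1(1) unfolding local_rep_def by blast+
  have 22: "open W2" "chart M x x \<in> W2" "Cinf_on W2 g2" "\<And>y. y \<in> cdom M x \<Longrightarrow> chart M x y \<in> W2 \<Longrightarrow> g2 (chart M x y) = chart N (f x) (f y)"
    using 2(1) unfolding local_rep_def by blast+
  let ?W = "W1 \<inter> g1 -` W2"
  have o: "open ?W" by (rule open_preimage_Cinf[OF 11(1,3) 22(1)])
  have C: "Cinf_on ?W (\<lambda>z. g2 (g1 z))"
    by (rule Cinf_on_compose[OF o 22(1) Cinf_on_subset[OF 11(3)] 22(3)]) auto
  show ?thesis
  proof (rule that[of ?W "\<lambda>z. g2 (g1 z)"])
    show "local_rep M p x (\<lambda>y. chart N (f x) (f y)) ?W (\<lambda>z. g2 (g1 z))"
      unfolding local_rep_def using o C 11 22 1(2) x by auto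
    show "f y \<in> cdom N (f x)" if "y \<in> cdom M p" "chart M p y \<in> ?W" for y
      using that 1(2) 2(2) 11(4) by auto
  qed
qed

text \<open>Let \<open>T\<close> be the differential at the given point of the submersion \<open>f\<close>, read in flattenings, and \<open>L\<close> a
  right inverse of \<open>T\<close>. The map \<open>z + L (f z - T z)\<close> has the identity as derivative there, so it is a
  change of coordinates, and applying \<open>T\<close> to it gives \<open>f z\<close>: in the new coordinates the submersion is
  the linear map \<open>T\<close>. As \<open>L\<close> takes values in the flat model of the domain, that model is preserved.\<close>

theorem submersion_normal_form:
  fixes M :: "('a, 'b::euclidean_space) mfd" and N :: "('c, 'd::euclidean_space) mfd"
  assumes M: "charted M" "\<And>p. p \<in> pts M \<Longrightarrow> embedded_submanifold m (cimg M p)"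
    and N: "charted N" "\<And>p. p \<in> pts N \<Longrightarrow> embedded_submanifold n (cimg N p)"
    and f: "submersion M N f" and p: "p \<in> pts M" and x: "x \<in> cdom M p"
  obtains W \<phi> \<psi> V W' \<phi>' \<psi>' V' T L where
    "flattening (cimg M p) (chart M p x) W \<phi> \<psi> V" "dim V = m"
    "flattening (cimg N (f x)) (chart N (f x) (f x)) W' \<phi>' \<psi>' V'" "dim V' = n"
    "linear T" "linear L" "\<forall>w. L w \<in> V" "\<forall>v\<in>V. T v \<in> V'" "\<forall>w\<in>V'. T (L w) = w"
    "\<forall>y\<in>cdom M p. chart M p y \<in> W \<longrightarrow>
       f y \<in> cdom N (f x) \<and> chart N (f x) (f y) \<in> W' \<and> \<phi>' (chart N (f x) (f y)) = T (\<phi> (chart M p y))"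
proof -
  have fs: "smooth_map M N f" and surj: "\<And>q. q \<in> pts M \<Longrightarrow> mderiv M N f q ` tspace M q = tspace N (f q)"
    using f unfolding submersion_def by blast+
  have xM: "x \<in> pts M" using chartedD(2)[OF M(1) p x] .
  have q: "f x \<in> pts N" using smooth_map_pts[OF fs xM] .
  obtain W1 g where W1: "local_rep M p x (\<lambda>y. chart N (f x) (f y)) W1 g"
    and fcdom: "\<And>y. y \<in> cdom M p \<Longrightarrow> chart M p y \<in> W1 \<Longrightarrow> f y \<in> cdom N (f x)"
    using smooth_map_local_rep_at[OF M(1) fs p x] by metis
  have g: "open W1" "chart M p x \<in> W1" "Cinf_on W1 g" "\<And>y. y \<in> cdom M p \<Longrightarrow> chart M p y \<in> W1 \<Longrightarrow> g (chart M p y) = chart N (f x) (f y)"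
    using W1 unfolding local_rep_def by blast+
  obtain W2 \<phi>0 \<psi>0 V where F0: "flattening (cimg M p) (chart M p x) W2 \<phi>0 \<psi>0 V" and dV: "dim V = m"
    using embedded_flattening[OF M(2)[OF p] x] by metis
  obtain W' \<phi>' \<psi>' V' where F': "flattening (cimg N (f x)) (chart N (f x) (f x)) W' \<phi>' \<psi>' V'" and dV': "dim V' = n"
    using embedded_flattening[OF N(2)[OF q] chartedD(1)[OF N(1) q]] by metis
  note F = flatteningD[OF F0] and G = flatteningD[OF F']
  let ?\<chi> = "chart M p x"
  let ?org = "\<phi>0 ?\<chi>"
  have \<chi>: "?\<chi> \<in> cimg M p" using x unfolding cimg_def by blast
  have a0V: "?org \<in> V" using F(8)[OF F(2)] \<chi> by blast
  define \<Omega> where "\<Omega> = \<phi>0 ` W2 \<inter> \<psi>0 -` (W1 \<inter> g -` W')"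
  have o\<Omega>: "open \<Omega>" unfolding \<Omega>_def by (rule open_preimage_Cinf[OF F(4,5) open_preimage_Cinf[OF g(1,3) G(1)]])
  have a0\<Omega>: "?org \<in> \<Omega>" unfolding \<Omega>_def using F(2,7) g(2) g(4)[OF x g(2)] G(2) by auto
  let ?f = "\<lambda>z. \<phi>' (g (\<psi>0 z))"
  have Cf: "Cinf_on \<Omega> ?f"
  proof (rule Cinf_on_compose[OF o\<Omega> G(1) _ G(3)])
    show "Cinf_on \<Omega> (\<lambda>z. g (\<psi>0 z))"
      by (rule Cinf_on_compose[OF o\<Omega> g(1) Cinf_on_subset[OF F(5)] g(3)]) (auto simp: \<Omega>_def)
  qed (auto simp: \<Omega>_def)
  have point: "\<exists>y\<in>cdom M p. \<psi>0 z = chart M p y \<and> \<phi>0 (chart M p y) = z" if z: "z \<in> \<Omega>" "z \<in> V" for z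
  proof -
    have "\<psi>0 z \<in> W2" "\<phi>0 (\<psi>0 z) = z" using F(9)[of z] z(1) unfolding \<Omega>_def by auto
    then have "\<psi>0 z \<in> cimg M p" using F(8) z(2) by metis
    then show ?thesis using \<open>\<phi>0 (\<psi>0 z) = z\<close> unfolding cimg_def by auto
  qed
  have fV: "?f z \<in> V' \<and> (\<forall>y\<in>cdom M p. \<psi>0 z = chart M p y \<longrightarrow> f y \<in> cdom N (f x) \<and> chart N (f x) (f y) \<in> W' \<and> ?f z = \<phi>' (chart N (f x) (f y)))"
    if z: "z \<in> \<Omega>" "z \<in> V" for z
  proof -
    have *: "f y \<in> cdom N (f x) \<and> chart N (f x) (f y) \<in> W' \<and> ?f z = \<phi>' (chart N (f x) (f y))"
      if y: "y \<in> cdom M p" "\<psi>0 z = chart M p y" for y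
      using fcdom[OF y(1)] g(4)[OF y(1)] z(1) y(2) unfolding \<Omega>_def by auto
    obtain y where y: "y \<in> cdom M p" "\<psi>0 z = chart M p y" using point[OF z] by blast
    have "chart N (f x) (f y) \<in> cimg N (f x)" using *[OF y] unfolding cimg_def by blast
    then have "?f z \<in> V'" using *[OF y] G(8) by auto
    then show ?thesis using * by blast
  qed
  let ?T = "frechet_derivative ?f (at ?org)"
  have dT: "(?f has_derivative ?T) (at ?org)" by (rule Cinf_on_has_derivative[OF Cf a0\<Omega>])
  have blT: "bounded_linear ?T" by (rule bounded_linear_frechet_derivative[OF Cf a0\<Omega>])
  then have lT: "linear ?T" by (rule bounded_linear.linear)
  \<comment> \<open>\<open>f\<close> maps lines in the flat model of \<open>M\<close> to curves in the flat model of \<open>N\<close>.\<close>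
  have TV: "?T v \<in> V'" if v: "v \<in> V" for v
  proof -
    let ?\<gamma> = "\<lambda>t::real. ?org + t *\<^sub>R v"
    have "(?\<gamma> has_vector_derivative v) (at 0)" by (auto intro!: derivative_eq_intros)
    then have d: "((\<lambda>t. ?f (?\<gamma> t)) has_vector_derivative ?T v) (at 0)"
      using has_vector_derivative_Cinf[OF Cf, of ?\<gamma> 0 v] a0\<Omega> by simp
    have "open (?\<gamma> -` \<Omega>)" by (rule open_vimage[OF o\<Omega>]) (intro continuous_intros)
    moreover have "0 \<in> ?\<gamma> -` \<Omega>" using a0\<Omega> by simp
    ultimately obtain e where e: "e > 0" "ball 0 e \<subseteq> ?\<gamma> -` \<Omega>" using open_contains_ball by blast
    have be: "ball (0::real) e = {-e<..<e}" by (auto simp: dist_real_def)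
    show ?thesis
    proof (rule velocity_in_subspace[OF G(6) d e(1)])
      fix t assume "t \<in> {-e<..<e}"
      then have "?\<gamma> t \<in> \<Omega>" using e(2) be by blast
      moreover have "?\<gamma> t \<in> V" using subspace_add[OF F(6) a0V subspace_scale[OF F(6) v]] .
      ultimately show "?f (?\<gamma> t) \<in> V'" using fV by blast
    qed
  qed
  \<comment> \<open>Realise \<open>w\<close> by a curve in \<open>N\<close>; its velocity comes from a tangent vector of \<open>M\<close>, hence from a curve in \<open>M\<close>.\<close>
  have Tsurj: "\<exists>v\<in>V. ?T v = w" if w: "w \<in> V'" for w
  proof -
    let ?\<eta> = "chart N (f x) (f x)"
    have \<eta>: "?\<eta> \<in> cimg N (f x)" using chartedD(1)[OF N(1) q] unfolding cimg_def by blast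
    have \<eta>V: "\<phi>' ?\<eta> \<in> V'" using G(8)[OF G(2)] \<eta> by blast
    let ?u = "frechet_derivative \<psi>' (at (\<phi>' ?\<eta>)) w"
    have "?u \<in> tspace N (f x)"
    proof -
      let ?a = "\<lambda>t::real. \<phi>' ?\<eta> + t *\<^sub>R w"
      have vd: "(?a has_vector_derivative w) (at 0)" by (auto intro!: derivative_eq_intros)
      have cinf: "Cinf_on {-1<..<1} ?a"
        by (intro Cinf_on_add Cinf_on_const Cinf_on_bounded_linear bounded_linear_scaleR_left) auto
      show ?thesis
      proof (rule curve_from_flattening[OF N(1) q chartedD(1)[OF N(1) q] F' _ zero_less_one cinf _ vd])
        show "?a 0 = \<phi>' ?\<eta>" by simp
        show "?a t \<in> V'" for t using subspace_add[OF G(6) \<eta>V subspace_scale[OF G(6) w]] .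
        fix b assume "curve_at N (f x) ?u b"
        then show "?u \<in> tspace N (f x)" by (rule curve_at_tspace[OF N(1) q])
      qed
    qed
    then obtain v where v: "v \<in> tspace M x" "mderiv M N f x v = ?u" using surj[OF xM] by (metis imageE)
    obtain c where c: "curve_at M x v c" using tspace_curveE[OF M(1) xM v(1)] .
    define v1 where "v1 = frechet_derivative (chart M p \<circ> cinv M x) (at (chart M x x) within cimg M x) v"
    have c1: "curve_in M p x v1 c" unfolding v1_def by (rule curve_transition[OF M(1) xM p x c])
    let ?v = "frechet_derivative \<phi>0 (at ?\<chi>) v1"
    have vV: "?v \<in> V" by (rule curve_flattening(1)[OF c1 F0])
    have c0: "c 0 = x" using c1 unfolding curve_in_def by blast
    have d1: "((\<lambda>t. ?f (\<phi>0 (chart M p (c t)))) has_vector_derivative ?T ?v) (at 0)"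
      using has_vector_derivative_Cinf[OF Cf _ curve_flattening(2)[OF c1 F0]] c0 a0\<Omega> by simp
    have "curve_at N (f x) ?u (\<lambda>t. f (c t))" using curve_push[OF M(1) xM fs c] v(2) by simp
    from curve_flattening(2)[OF this F']
    have d2: "((\<lambda>t. \<phi>' (chart N (f x) (f (c t)))) has_vector_derivative w) (at 0)"
      using flattening_derivative_inverse(2)[OF F' G(2)] by simp
    obtain e1 where e1: "e1 > 0" "\<forall>t\<in>{-e1<..<e1}. c t \<in> cdom M p \<and> chart M p (c t) \<in> W2 \<and> \<phi>0 (chart M p (c t)) \<in> V"
      using curve_flattening(3)[OF c1 F0] by blast
    obtain e2 where e2: "e2 > 0" "\<forall>t\<in>{-e2<..<e2}. c t \<in> cdom M p \<and> chart M p (c t) \<in> W1"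
      using curve_in_local_rep(2)[OF c1 W1] by blast
    have "((\<lambda>t. \<phi>' (chart N (f x) (f (c t)))) has_vector_derivative ?T ?v) (at 0)"
    proof (rule has_vector_derivative_transform_within_open[OF d1, of "{- min e1 e2<..<min e1 e2}"])
      fix t assume "t \<in> {- min e1 e2<..<min e1 e2}"
      then have t: "t \<in> {-e1<..<e1}" "t \<in> {-e2<..<e2}" by auto
      have m: "c t \<in> cdom M p" "chart M p (c t) \<in> W2" "chart M p (c t) \<in> W1" using e1(2) e2(2) t by blast+
      show "?f (\<phi>0 (chart M p (c t))) = \<phi>' (chart N (f x) (f (c t)))"
        using F(7)[OF m(2)] g(4)[OF m(1,3)] by simp
    qed (use e1 e2 in auto)
    then have "?T ?v = w" using vector_derivative_unique_at d2 by blast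
    then show ?thesis using vV by blast
  qed
  obtain L where L: "L ` UNIV \<subseteq> V" "linear L" "\<forall>v\<in>?T ` V. ?T (L v) = v"
    using linear_exists_right_inverse_on[OF lT F(6)] by blast
  have LV: "L w \<in> V" for w using L(1) by blast
  have TL: "?T (L w) = w" if "w \<in> V'" for w using L(3) Tsurj[OF that] by blast
  have blL: "bounded_linear L" using L(2) linear_conv_bounded_linear by blast
  obtain P where P: "linear P" "\<And>x. P x \<in> V" "\<And>x. x \<in> V \<Longrightarrow> P x = x" using subspace_projection[OF F(6)] by blast
  have blP: "bounded_linear P" using P(1) linear_conv_bounded_linear by blast
  define \<Omega>' where "\<Omega>' = \<phi>0 ` W2 \<inter> P -` \<Omega>"
  have "Cinf_on (\<phi>0 ` W2) P" by (rule Cinf_on_bounded_linear[OF F(4) blP])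
  then have o\<Omega>': "open \<Omega>'" unfolding \<Omega>'_def by (rule open_preimage_Cinf[OF F(4) _ o\<Omega>])
  have Pa0: "P ?org = ?org" using P(3)[OF a0V] .
  have a0\<Omega>': "?org \<in> \<Omega>'" unfolding \<Omega>'_def using F(2) a0\<Omega> Pa0 by auto
  \<comment> \<open>The projection \<open>P\<close> extends the change of coordinates from \<open>V\<close> to the ambient space.\<close>
  let ?F = "\<lambda>z. z + L (?f (P z) - ?T (P z))"
  have CP: "Cinf_on \<Omega>' P" by (rule Cinf_on_bounded_linear[OF o\<Omega>' blP])
  have CF: "Cinf_on \<Omega>' ?F"
  proof (intro Cinf_on_add[OF o\<Omega>'] Cinf_on_ident[OF o\<Omega>'] Cinf_on_linear_comp[OF o\<Omega>' blL] Cinf_on_diff[OF o\<Omega>'])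
    show "Cinf_on \<Omega>' (\<lambda>z. ?f (P z))" by (rule Cinf_on_compose[OF o\<Omega>' o\<Omega> CP Cf]) (auto simp: \<Omega>'_def)
    show "Cinf_on \<Omega>' (\<lambda>z. ?T (P z))" by (rule Cinf_on_linear_comp[OF o\<Omega>' blT CP])
  qed
  have dF: "(?F has_derivative (\<lambda>h. h + L (?T (P h) - ?T (P h)))) (at ?org)"
  proof (intro has_derivative_add has_derivative_ident bounded_linear.has_derivative[OF blL] has_derivative_diff
      bounded_linear.has_derivative[OF blT] bounded_linear_imp_has_derivative[OF blP])
    show "((\<lambda>z. ?f (P z)) has_derivative (\<lambda>h. ?T (P h))) (at ?org)"
      by (rule has_derivative_compose[OF bounded_linear_imp_has_derivative[OF blP]]) (simp add: Pa0 dT)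
  qed
  have idF: "frechet_derivative ?F (at ?org) = (\<lambda>v. v)"
    using frechet_derivative_at[OF dF] linear_0[OF L(2)] by simp
  obtain U' Gi where U': "open U'" "?org \<in> U'" "U' \<subseteq> \<Omega>'" "open (?F ` U')" "Cinf_on (?F ` U') Gi"
    "\<And>z. z \<in> U' \<Longrightarrow> Gi (?F z) = z"
    using Cinf_local_inverse[OF o\<Omega>' CF a0\<Omega>' idF] by blast
  define W where "W = W2 \<inter> \<phi>0 -` U'"
  have oW: "open W" unfolding W_def by (rule open_preimage_Cinf[OF F(1,3) U'(1)])
  have WU: "\<phi>0 ` W = U'" using U'(3) unfolding W_def \<Omega>'_def by auto
  have imW: "(\<lambda>y. ?F (\<phi>0 y)) ` W = ?F ` U'" using WU by auto
  have FV: "?F z \<in> V \<longleftrightarrow> z \<in> V" for z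
    using LV subspace_add[OF F(6), of z "L (?f (P z) - ?T (P z))"]
      subspace_diff[OF F(6), of "?F z" "L (?f (P z) - ?T (P z))"] by auto
  have flat: "flattening (cimg M p) ?\<chi> W (\<lambda>y. ?F (\<phi>0 y)) (\<lambda>z. \<psi>0 (Gi z)) V"
    unfolding flattening_def
  proof (intro conjI ballI)
    show "open W" "?\<chi> \<in> W" using oW F(2) U'(2) unfolding W_def by auto
    show "Cinf_on W (\<lambda>y. ?F (\<phi>0 y))"
      by (rule Cinf_on_compose[OF oW o\<Omega>' Cinf_on_subset[OF F(3)] CF]) (use U'(3) WU in \<open>auto simp: W_def\<close>)
    show "open ((\<lambda>y. ?F (\<phi>0 y)) ` W)" unfolding imW by (rule U'(4))
    show "Cinf_on ((\<lambda>y. ?F (\<phi>0 y)) ` W) (\<lambda>z. \<psi>0 (Gi z))"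
      unfolding imW
      by (rule Cinf_on_compose[OF U'(4) F(4) U'(5) F(5)]) (use U'(3,6) in \<open>auto simp: \<Omega>'_def\<close>)
    show "\<psi>0 (Gi (?F (\<phi>0 y))) = y" if "y \<in> W" for y
      using U'(6)[of "\<phi>0 y"] F(7)[of y] that unfolding W_def by auto
    show "subspace V" by (rule F(6))
    have iff: "y \<in> cimg M p \<longleftrightarrow> ?F (\<phi>0 y) \<in> V" if "y \<in> W" for y
      using F(8)[of y] FV[of "\<phi>0 y"] that unfolding W_def by blast
    show "(\<lambda>y. ?F (\<phi>0 y)) ` (W \<inter> cimg M p) = (\<lambda>y. ?F (\<phi>0 y)) ` W \<inter> V" using iff by blast
  qed
  show ?thesis
  proof (rule that[OF flat dV F' dV' lT L(2)], goal_cases)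
    case 1 show ?case using LV by blast
  next
    case 2 show ?case using TV by blast
  next
    case 3 show ?case using TL by blast
  next
    case 4
    show ?case
    proof (intro ballI impI)
      fix y assume y: "y \<in> cdom M p" "chart M p y \<in> W"
      let ?z = "\<phi>0 (chart M p y)"
      have yW: "chart M p y \<in> W2" "?z \<in> U'" using y(2) unfolding W_def by auto
      have "chart M p y \<in> cimg M p" using y(1) unfolding cimg_def by blast
      then have zV: "?z \<in> V" using F(8)[OF yW(1)] by blast
      have z\<Omega>: "?z \<in> \<Omega>" using U'(3) yW(2) P(3)[OF zV] unfolding \<Omega>'_def by auto
      have psi: "\<psi>0 ?z = chart M p y" using F(7)[OF yW(1)] .
      have *: "?f ?z \<in> V'" "f y \<in> cdom N (f x)" "chart N (f x) (f y) \<in> W'" "?f ?z = \<phi>' (chart N (f x) (f y))"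
        using fV[OF z\<Omega> zV] y(1) psi by blast+
      have "?T (?F ?z) = ?T ?z + ?T (L (?f ?z - ?T ?z))" unfolding P(3)[OF zV] by (simp add: linear_add[OF lT])
      also have "?T (L (?f ?z - ?T ?z)) = ?f ?z - ?T ?z" by (rule TL[OF subspace_diff[OF G(6) *(1) TV[OF zV]]])
      finally show "f y \<in> cdom N (f x) \<and> chart N (f x) (f y) \<in> W' \<and> \<phi>' (chart N (f x) (f y)) = ?T (?F ?z)"
        using * by simp
    qed
  qed
qed

text \<open>In the normal form, lifting a curve through a submersion with prescribed velocity is an
  affine problem, solved by correcting a straight line with the right inverse of \<open>T\<close>.\<close>

lemma submersion_lift_curve:
  assumes M: "manifold M" and N: "manifold N" and f: "submersion M N f" and p: "p \<in> pts M"
    and v: "v \<in> tspace M p" and c: "curve_at N (f p) (mderiv M N f p v) c"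
  obtains b e where "curve_at M p v b" "e > 0" "\<And>t. t \<in> {-e<..<e} \<Longrightarrow> f (b t) = c t"
proof -
  note MC = manifold_charted[OF M] and NC = manifold_charted[OF N]
  have fs: "smooth_map M N f" using f unfolding submersion_def by blast
  have q: "f p \<in> pts N" using smooth_map_pts[OF fs p] .
  obtain m where m: "\<And>p. p \<in> pts M \<Longrightarrow> embedded_submanifold m (cimg M p)" using M unfolding manifold_iff by blast
  obtain n where n: "\<And>p. p \<in> pts N \<Longrightarrow> embedded_submanifold n (cimg N p)" using N unfolding manifold_iff by blast
  obtain W \<phi> \<psi> V W' \<phi>' \<psi>' V' T L where
    F: "flattening (cimg M p) (chart M p p) W \<phi> \<psi> V" and "dim V = m" and
    F': "flattening (cimg N (f p)) (chart N (f p) (f p)) W' \<phi>' \<psi>' V'" and "dim V' = n" and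
    T: "linear T" and L: "linear L" and LV': "\<forall>w. L w \<in> V" and TV': "\<forall>v\<in>V. T v \<in> V'" and TL': "\<forall>w\<in>V'. T (L w) = w"
    and nf': "\<forall>y\<in>cdom M p. chart M p y \<in> W \<longrightarrow>
       f y \<in> cdom N (f p) \<and> chart N (f p) (f y) \<in> W' \<and> \<phi>' (chart N (f p) (f y)) = T (\<phi> (chart M p y))"
    using submersion_normal_form[OF MC m NC n f p chartedD(1)[OF MC p]] .
  have LV: "\<And>w. L w \<in> V" and TV: "\<And>v. v \<in> V \<Longrightarrow> T v \<in> V'" and TL: "\<And>w. w \<in> V' \<Longrightarrow> T (L w) = w"
    and nf: "\<And>y. y \<in> cdom M p \<Longrightarrow> chart M p y \<in> W \<Longrightarrow>
       f y \<in> cdom N (f p) \<and> chart N (f p) (f y) \<in> W' \<and> \<phi>' (chart N (f p) (f y)) = T (\<phi> (chart M p y))"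
    using LV' TV' TL' nf' by blast+
  note f1 = flatteningD[OF F] and f2 = flatteningD[OF F']
  have blT: "bounded_linear T" and blL: "bounded_linear L" using T L linear_conv_bounded_linear by blast+
  let ?org = "\<phi> (chart M p p)"
  let ?w = "frechet_derivative \<phi> (at (chart M p p)) v"
  have a0V: "?org \<in> V" using f1(8)[OF f1(2)] chartedD(1)[OF MC p] unfolding cimg_def by blast
  obtain d where d: "curve_at M p v d" using tspace_curveE[OF MC p v] .
  have wV: "?w \<in> V" by (rule curve_flattening(1)[OF d F])
  let ?k = "\<lambda>t. \<phi>' (chart N (f p) (c t))"
  have c0: "c 0 = f p" using c unfolding curve_in_def by blast
  have k0: "?k 0 = T ?org" using nf[OF chartedD(1)[OF MC p] f1(2)] c0 by simp
  have kd: "(?k has_vector_derivative T ?w) (at 0)"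
  proof -
    have "(?k has_vector_derivative frechet_derivative \<phi>' (at (chart N (f p) (f p))) (mderiv M N f p v)) (at 0)"
      by (rule curve_flattening(2)[OF c F'])
    moreover have "((\<lambda>t. \<phi>' (chart N (f p) (f (d t)))) has_vector_derivative
        frechet_derivative \<phi>' (at (chart N (f p) (f p))) (mderiv M N f p v)) (at 0)"
      by (rule curve_flattening(2)[OF curve_push[OF MC p fs d] F'])
    moreover have "((\<lambda>t. \<phi>' (chart N (f p) (f (d t)))) has_vector_derivative T ?w) (at 0)"
    proof -
      obtain e where e: "e > 0" "\<forall>t\<in>{-e<..<e}. d t \<in> cdom M p \<and> chart M p (d t) \<in> W \<and> \<phi> (chart M p (d t)) \<in> V"
        using curve_flattening(3)[OF d F] by blast
      show ?thesis
        by (rule has_vector_derivative_transform_within_open[of "\<lambda>t. T (\<phi> (chart M p (d t)))" _ _ "{-e<..<e}"])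
           (use e nf bounded_linear.has_vector_derivative[OF blT curve_flattening(2)[OF d F]] in auto)
    qed
    ultimately show ?thesis using vector_derivative_unique_at by metis
  qed
  obtain e where e: "e > 0" "\<forall>t\<in>{-e<..<e}. c t \<in> cdom N (f p) \<and> chart N (f p) (c t) \<in> W' \<and> ?k t \<in> V'"
    using curve_flattening(3)[OF c F'] by blast
  have r: "local_rep N (f p) (f p) (\<lambda>y. \<phi>' (chart N (f p) y)) W' \<phi>'" using f2 unfolding local_rep_def by blast
  obtain e' where e': "e' > 0" "Cinf_on {-e'<..<e'} ?k" using curve_in_local_rep(2)[OF c r] by blast
  let ?m = "min e e'"
  let ?l = "\<lambda>t::real. ?org + t *\<^sub>R ?w"
  let ?a = "\<lambda>t. ?l t + L (?k t - T (?l t))"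
  have lV: "?l t \<in> V" for t using subspace_add[OF f1(6) a0V subspace_scale[OF f1(6) wV]] .
  have Ta: "T (?a t) = ?k t" if "t \<in> {- ?m<..<?m}" for t
  proof -
    have "?k t \<in> V'" using e(2) that by auto
    from TL[OF subspace_diff[OF f2(6) this TV[OF lV]]] have "T (L (?k t - T (?l t))) = ?k t - T (?l t)" .
    moreover have "T (?a t) = T (?l t) + T (L (?k t - T (?l t)))" by (rule linear_add[OF T])
    ultimately show ?thesis by simp
  qed
  have lvd: "(?l has_vector_derivative ?w) (at 0)" by (auto intro!: derivative_eq_intros)
  have "(?a has_vector_derivative ?w + L (T ?w - T ?w)) (at 0)"
    by (intro has_vector_derivative_add lvd bounded_linear.has_vector_derivative[OF blL] has_vector_derivative_diff kd
        bounded_linear.has_vector_derivative[OF blT lvd])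
  then have avd: "(?a has_vector_derivative ?w) (at 0)" by (simp add: linear_0[OF L])
  have lC: "Cinf_on {- ?m<..<?m} ?l"
    by (intro Cinf_on_add Cinf_on_const Cinf_on_bounded_linear bounded_linear_scaleR_left) auto
  have aC: "Cinf_on {- ?m<..<?m} ?a"
  proof (rule Cinf_on_add[OF _ lC Cinf_on_linear_comp[OF _ blL Cinf_on_diff]])
    show "Cinf_on {- ?m<..<?m} ?k" by (rule Cinf_on_subset[OF e'(2)]) auto
    show "Cinf_on {- ?m<..<?m} (\<lambda>t. T (?l t))" by (rule Cinf_on_linear_comp[OF _ blT lC]) simp
  qed auto
  have m0: "?m > 0" using e e' by simp
  have a0: "?a 0 = ?org" using k0 by (simp add: linear_0[OF L])
  have aV: "?a t \<in> V" for t using subspace_add[OF f1(6) lV LV] .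
  show thesis
  proof (rule curve_from_flattening[OF MC p chartedD(1)[OF MC p] F a0 m0 aC aV avd])
    fix b and d :: real
    assume b: "curve_at M p (frechet_derivative \<psi> (at ?org) ?w) b" and d: "0 < d" "d \<le> ?m"
      and bt: "\<And>t. t \<in> {-d<..<d} \<Longrightarrow> b t \<in> cdom M p \<and> chart M p (b t) \<in> W \<and> \<phi> (chart M p (b t)) = ?a t"
    have "frechet_derivative \<psi> (at ?org) ?w = v" by (rule flattening_derivative_inverse(1)[OF F f1(2)])
    then have b': "curve_at M p v b" using b by simp
    have "f (b t) = c t" if t: "t \<in> {-d<..<d}" for t
    proof -
      have tm: "t \<in> {- ?m<..<?m}" "t \<in> {-e<..<e}" using t d by auto
      have 1: "f (b t) \<in> cdom N (f p)" "chart N (f p) (f (b t)) \<in> W'" "\<phi>' (chart N (f p) (f (b t))) = ?k t"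
        using nf[of "b t"] bt[OF t] Ta[OF tm(1)] by auto
      have 2: "c t \<in> cdom N (f p)" "chart N (f p) (c t) \<in> W'" using e(2) tm(2) by blast+
      have "chart N (f p) (f (b t)) = chart N (f p) (c t)" 
        by (rule trans[OF sym[OF f2(7)[OF 1(2), unfolded 1(3)]] f2(7)[OF 2(2)]])
      then show ?thesis using chartedD(3)[OF NC q] 1(1) 2(1) by (simp add: inj_on_eq_iff)
    qed
    then show thesis using that[OF b' d(1)] by blast
  qed
qed

text \<open>That the two differentials match on tangent vectors is the chain rule. Conversely, for a matching pair
  take a curve in the second factor and lift its image through the submersion; the two curves form a
  curve in the fibre product.\<close>

theorem tspace_fib_prod:
  assumes M: "manifold M" and P: "charted P" and N: "manifold N" and f: "submersion M N f" and k: "smooth_map P N k"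
    and p: "p \<in> pts M" "q \<in> pts P" "f p = k q"
  shows "tspace (fib_prod M P f k) (p, q) =
    {(u, v). u \<in> tspace M p \<and> v \<in> tspace P q \<and> mderiv M N f p u = mderiv P N k q v}"
proof -
  note MC = manifold_charted[OF M] and NC = manifold_charted[OF N]
  have fs: "smooth_map M N f" using f unfolding submersion_def by blast
  have pq: "(p, q) \<in> pts (fib_prod M P f k)" using p by (simp add: fib_prod_def)
  show ?thesis
  proof (intro equalityI subsetI)
    fix z assume z: "z \<in> tspace (fib_prod M P f k) (p, q)"
    obtain c where "curve_at (fib_prod M P f k) (p, q) z c"
      using tspace_curveE[OF charted_fib_prod[OF MC P] pq z] by blast
    then obtain e where c1: "curve_at M p (fst z) (\<lambda>t. fst (c t))" and c2: "curve_at P q (snd z) (\<lambda>t. snd (c t))"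
      and e: "e > 0" "\<forall>t\<in>{-e<..<e}. c t \<in> {(x, y). f x = k y}"
      unfolding fib_prod_def curve_in_sub curve_in_prod by auto
    have "curve_at N (f p) (mderiv M N f p (fst z)) (\<lambda>t. k (snd (c t)))"
      by (rule curve_in_cong[OF curve_push[OF MC p(1) fs c1] e(1)]) (use e(2) in \<open>auto simp: case_prod_beta\<close>)
    then have "mderiv P N k q (snd z) = mderiv M N f p (fst z)"
      using mderiv_eqI[OF P p(2) k c2] p(3) by simp
    then show "z \<in> {(u, v). u \<in> tspace M p \<and> v \<in> tspace P q \<and> mderiv M N f p u = mderiv P N k q v}"
      using curve_at_tspace[OF MC p(1) c1] curve_at_tspace[OF P p(2) c2] by auto
  next
    fix z assume "z \<in> {(u, v). u \<in> tspace M p \<and> v \<in> tspace P q \<and> mderiv M N f p u = mderiv P N k q v}"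
    then obtain u v where z: "z = (u, v)" and uv: "u \<in> tspace M p" "v \<in> tspace P q" "mderiv M N f p u = mderiv P N k q v" by auto
    obtain c where c: "curve_at P q v c" using tspace_curveE[OF P p(2) uv(2)] .
    have kc: "curve_at N (f p) (mderiv M N f p u) (\<lambda>t. k (c t))" using curve_push[OF P p(2) k c] uv(3) p(3) by simp
    obtain b e where b: "curve_at M p u b" "e > 0" "\<And>t. t \<in> {-e<..<e} \<Longrightarrow> f (b t) = k (c t)"
      using submersion_lift_curve[OF M N f p(1) uv(1) kc] by metis
    have "curve_at (fib_prod M P f k) (p, q) z (\<lambda>t. (b t, c t))"
      unfolding fib_prod_def curve_in_sub curve_in_prod z using b c by auto
    then show "z \<in> tspace (fib_prod M P f k) (p, q)" by (rule curve_at_tspace[OF charted_fib_prod[OF MC P] pq])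
  qed
qed

text \<open>\<open>v \<mapsto> (v - L (T v), T v)\<close> is an isomorphism onto the product of the kernel and the image.\<close>

lemma dim_kernel_complement:
  fixes V :: "'a::euclidean_space set" and T :: "'a \<Rightarrow> 'b::euclidean_space"
  assumes V: "subspace V" and V': "subspace V'" and T: "linear T" and L: "linear L"
    and LV: "\<And>w. L w \<in> V" and TV: "\<And>v. v \<in> V \<Longrightarrow> T v \<in> V'" and TL: "\<And>w. w \<in> V' \<Longrightarrow> T (L w) = w"
  shows "subspace {v \<in> V. T v = 0}" and "dim V = dim {v \<in> V. T v = 0} + dim V'"
proof -
  show sub: "subspace {v \<in> V. T v = 0}"
    using V unfolding subspace_def by (auto simp: linear_0[OF T] linear_add[OF T] linear_scale[OF T])
  let ?h = "\<lambda>v. (v - L (T v), T v)"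
  have lin: "linear ?h"
    by (rule linearI) (simp_all add: linear_add[OF T] linear_add[OF L] linear_scale[OF T] linear_scale[OF L] algebra_simps)
  have im: "?h ` V = {v \<in> V. T v = 0} \<times> V'"
  proof (intro equalityI subsetI)
    fix z assume "z \<in> ?h ` V"
    then show "z \<in> {v \<in> V. T v = 0} \<times> V'"
      using TL TV subspace_diff[OF V _ LV] by (auto simp: linear_diff[OF T])
  next
    fix z assume z: "z \<in> {v \<in> V. T v = 0} \<times> V'"
    have 1: "fst z + L (snd z) \<in> V" using z subspace_add[OF V _ LV] by auto
    have 2: "z = ?h (fst z + L (snd z))" using z TL by (auto simp: linear_add[OF T])
    show "z \<in> ?h ` V" by (rule rev_image_eqI[OF 1]) (rule 2)
  qed
  have inj: "inj_on ?h (span V)" by (auto simp: inj_on_def)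
  have "dim V = dim (?h ` V)" by (rule dim_image_eq[OF lin inj, symmetric])
  also have "\<dots> = dim {v \<in> V. T v = 0} + dim V'" unfolding im by (rule dim_Times[OF sub V'])
  finally show "dim V = dim {v \<in> V. T v = 0} + dim V'" .
qed

text \<open>In coordinates where \<open>f\<close> is the linear map \<open>T\<close>, the equation \<open>f x = k y\<close> reads \<open>T a = k b\<close>. The shear
  \<open>(a, b) \<mapsto> (a - L (k b), b)\<close> turns it into \<open>T a = 0\<close>, a linear equation, and its inverse
  \<open>(a, b) \<mapsto> (a + L (k b), b)\<close> is explicit. The dimension of the solution space is the same in all charts.\<close>

theorem manifold_fib_prod:
  assumes M: "manifold M" and P: "manifold P" and N: "manifold N" and f: "submersion M N f" and k: "smooth_map P N k"
  shows "manifold (fib_prod M P f k)"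
proof -
  note MC = manifold_charted[OF M] and NC = manifold_charted[OF N] and PC = manifold_charted[OF P]
  obtain m where m: "\<And>p. p \<in> pts M \<Longrightarrow> embedded_submanifold m (cimg M p)" using M unfolding manifold_iff by blast
  obtain n where n: "\<And>p. p \<in> pts N \<Longrightarrow> embedded_submanifold n (cimg N p)" using N unfolding manifold_iff by blast
  obtain d where d: "\<And>p. p \<in> pts P \<Longrightarrow> embedded_submanifold d (cimg P p)" using P unfolding manifold_iff by blast
  show ?thesis
  proof (rule manifold_fib_prodI[OF M P, of _ _ "m - n + d"])
    fix pq assume pq: "pq \<in> pts (fib_prod M P f k)"
    obtain p q where pq': "pq = (p, q)" and p: "p \<in> pts M" and q: "q \<in> pts P" using pq by (auto simp: fib_prod_def)
    let ?S = "cimg (fib_prod M P f k) pq"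
    have S: "?S = {(chart M p x, chart P q y) | x y. x \<in> cdom M p \<and> y \<in> cdom P q \<and> f x = k y}"
      unfolding cimg_def fib_prod_def pq' by (force simp: image_iff)
    show "embedded_submanifold (m - n + d) ?S"
      unfolding embedded_submanifold_iff
    proof
      fix z assume "z \<in> ?S"
      then obtain x y where z: "z = (chart M p x, chart P q y)" and x: "x \<in> cdom M p" and y: "y \<in> cdom P q" and xy: "f x = k y"
        unfolding S by auto
      obtain W \<phi> \<psi> V W' \<phi>' \<psi>' V' T L where
        F: "flattening (cimg M p) (chart M p x) W \<phi> \<psi> V" and dV: "dim V = m" and
        F': "flattening (cimg N (f x)) (chart N (f x) (f x)) W' \<phi>' \<psi>' V'" and dV': "dim V' = n" and
        T: "linear T" and L: "linear L" and LV': "\<forall>w. L w \<in> V" and TV': "\<forall>v\<in>V. T v \<in> V'" and TL': "\<forall>w\<in>V'. T (L w) = w"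
        and nf': "\<forall>y\<in>cdom M p. chart M p y \<in> W \<longrightarrow>
           f y \<in> cdom N (f x) \<and> chart N (f x) (f y) \<in> W' \<and> \<phi>' (chart N (f x) (f y)) = T (\<phi> (chart M p y))"
        using submersion_normal_form[OF MC m NC n f p x] .
      have LV: "\<And>w. L w \<in> V" and TV: "\<And>v. v \<in> V \<Longrightarrow> T v \<in> V'" and TL: "\<And>w. w \<in> V' \<Longrightarrow> T (L w) = w"
        and nf: "\<And>y. y \<in> cdom M p \<Longrightarrow> chart M p y \<in> W \<Longrightarrow>
           f y \<in> cdom N (f x) \<and> chart N (f x) (f y) \<in> W' \<and> \<phi>' (chart N (f x) (f y)) = T (\<phi> (chart M p y))"
        using LV' TV' TL' nf' by blast+
      note f1 = flatteningD[OF F] and f2 = flatteningD[OF F']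
      have blL: "bounded_linear L" using L linear_conv_bounded_linear by blast
      have fxN: "f x \<in> pts N" using f smooth_map_pts chartedD(2)[OF MC p x] unfolding submersion_def by metis
      obtain W3 h where W3: "local_rep P q y (\<lambda>y'. chart N (k y) (k y')) W3 h"
        and kcdom: "\<And>y'. y' \<in> cdom P q \<Longrightarrow> chart P q y' \<in> W3 \<Longrightarrow> k y' \<in> cdom N (k y)"
        using smooth_map_local_rep_at[OF PC k q y] by metis
      have h: "open W3" "chart P q y \<in> W3" "Cinf_on W3 h" "\<And>y'. y' \<in> cdom P q \<Longrightarrow> chart P q y' \<in> W3 \<Longrightarrow> h (chart P q y') = chart N (k y) (k y')"
        using W3 unfolding local_rep_def by blast+
      obtain W40 \<phi>4 \<psi>4 V4 where F40: "flattening (cimg P q) (chart P q y) W40 \<phi>4 \<psi>4 V4" and dV4: "dim V4 = d"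
        using embedded_flattening[OF d[OF q] y] by metis
      have oh: "open (W3 \<inter> h -` W')" by (rule open_preimage_Cinf[OF h(1,3) f2(1)])
      define W4 where "W4 = W40 \<inter> (W3 \<inter> h -` W')"
      have F4: "flattening (cimg P q) (chart P q y) W4 \<phi>4 \<psi>4 V4"
        unfolding W4_def by (rule flattening_restrict[OF F40 oh]) (use h(2) h(4)[OF y h(2)] f2(2) xy in auto)
      note f4 = flatteningD[OF F4]
      let ?k = "\<lambda>b. \<phi>' (h b)"
      have Ck: "Cinf_on W4 ?k"
        by (rule Cinf_on_compose[OF f4(1) f2(1) Cinf_on_subset[OF h(3)] f2(3)]) (auto simp: W4_def)
      have kk: "?k (chart P q y') \<in> V' \<and> k y' \<in> cdom N (f x) \<and> chart N (f x) (k y') \<in> W' \<and> ?k (chart P q y') = \<phi>' (chart N (f x) (k y'))"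
        if y': "y' \<in> cdom P q" "chart P q y' \<in> W4" for y'
      proof -
        have m3: "chart P q y' \<in> W3" "h (chart P q y') \<in> W'" using y'(2) unfolding W4_def by auto
        have *: "k y' \<in> cdom N (f x)" "h (chart P q y') = chart N (f x) (k y')" using kcdom[OF y'(1) m3(1)] h(4)[OF y'(1) m3(1)] xy by simp_all
        then have "chart N (f x) (k y') \<in> cimg N (f x)" unfolding cimg_def by blast
        then show ?thesis using * f2(8) m3(2) by metis
      qed
      let ?W = "W \<times> W4"
      \<comment> \<open>The local expression \<open>?k\<close> lives on the open set \<open>W4\<close>, so the shear is defined off the flat models too, as a flattening demands.\<close>
      let ?\<Phi> = "\<lambda>z. (\<phi> (fst z) - L (?k (snd z)), \<phi>4 (snd z))"
      let ?\<Psi> = "\<lambda>z. (\<psi> (fst z + L (?k (\<psi>4 (snd z)))), \<psi>4 (snd z))"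
      let ?K = "{v \<in> V. T v = 0}"
      have oW: "open ?W" by (intro open_Times f1(1) f4(1))
      have C\<Phi>: "Cinf_on ?W ?\<Phi>"
        by (intro Cinf_on_Pair[OF oW] Cinf_on_diff[OF oW] Cinf_on_linear_comp[OF oW blL]
            Cinf_on_compose[OF oW f1(1) Cinf_on_fst[OF oW] f1(3)]
            Cinf_on_compose[OF oW f4(1) Cinf_on_snd[OF oW] f4(3)]
            Cinf_on_compose[OF oW f4(1) Cinf_on_snd[OF oW] Ck]) auto
      have oB: "open ((UNIV :: 'b set) \<times> \<phi>4 ` W4)" by (intro open_Times f4(4)) simp
      have C4: "Cinf_on ((UNIV :: 'b set) \<times> \<phi>4 ` W4) (\<lambda>z. \<psi>4 (snd z))"
        by (rule Cinf_on_compose[OF oB f4(4) Cinf_on_snd[OF oB] f4(5)]) auto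
      have Csum: "Cinf_on ((UNIV :: 'b set) \<times> \<phi>4 ` W4) (\<lambda>z. fst z + L (?k (\<psi>4 (snd z))))"
        by (intro Cinf_on_add[OF oB] Cinf_on_fst[OF oB] Cinf_on_linear_comp[OF oB blL] Cinf_on_compose[OF oB f4(1) C4 Ck])
           (use f4(9) in auto)
      have im: "?\<Phi> ` ?W = ((UNIV :: 'b set) \<times> \<phi>4 ` W4) \<inter> (\<lambda>z. fst z + L (?k (\<psi>4 (snd z)))) -` (\<phi> ` W)"
      proof (intro equalityI subsetI)
        fix z assume "z \<in> ?\<Phi> ` ?W"
        then show "z \<in> ((UNIV :: 'b set) \<times> \<phi>4 ` W4) \<inter> (\<lambda>z. fst z + L (?k (\<psi>4 (snd z)))) -` (\<phi> ` W)"
          using f4(7) by auto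
      next
        fix z assume z: "z \<in> ((UNIV :: 'b set) \<times> \<phi>4 ` W4) \<inter> (\<lambda>z. fst z + L (?k (\<psi>4 (snd z)))) -` (\<phi> ` W)"
        then have z4: "snd z \<in> \<phi>4 ` W4" and z1: "fst z + L (?k (\<psi>4 (snd z))) \<in> \<phi> ` W" by auto
        have 1: "?\<Psi> z \<in> ?W" using f4(9)[OF z4] f1(9)[OF z1] by auto
        have 2: "z = ?\<Phi> (?\<Psi> z)" using f4(9)[OF z4] f1(9)[OF z1] by (simp add: prod_eq_iff)
        show "z \<in> ?\<Phi> ` ?W" by (rule rev_image_eqI[OF 1]) (rule 2)
      qed
      have o\<Phi>: "open (?\<Phi> ` ?W)" unfolding im by (rule open_preimage_Cinf[OF oB Csum f1(4)])
      have C\<Psi>: "Cinf_on (?\<Phi> ` ?W) ?\<Psi>"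
      proof (rule Cinf_on_Pair[OF o\<Phi>])
        show "Cinf_on (?\<Phi> ` ?W) (\<lambda>z. \<psi> (fst z + L (?k (\<psi>4 (snd z)))))"
          by (rule Cinf_on_compose[OF o\<Phi> f1(4) Cinf_on_subset[OF Csum] f1(5)]) (use im in blast)+
        show "Cinf_on (?\<Phi> ` ?W) (\<lambda>z. \<psi>4 (snd z))" by (rule Cinf_on_subset[OF C4]) (use im in blast)
      qed
      have iff: "?\<Phi> w \<in> ?K \<times> V4 \<longleftrightarrow> w \<in> ?S" if w: "w \<in> ?W" for w
      proof
        assume R: "?\<Phi> w \<in> ?K \<times> V4"
        have w1: "fst w \<in> W" and w4: "snd w \<in> W4" using w by auto
        have "snd w \<in> cimg P q" using R f4(8)[OF w4] by auto
        then obtain y' where y': "y' \<in> cdom P q" "snd w = chart P q y'" unfolding cimg_def by blast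
        note k' = kk[OF y'(1)]
        have "\<phi> (fst w) = (\<phi> (fst w) - L (?k (snd w))) + L (?k (snd w))" by simp
        also have "\<dots> \<in> V" using R by (intro subspace_add[OF f1(6) _ LV]) auto
        finally have "fst w \<in> cimg M p" using f1(8)[OF w1] by blast
        then obtain x' where x': "x' \<in> cdom M p" "fst w = chart M p x'" unfolding cimg_def by blast
        have kV: "?k (snd w) \<in> V'" using k' w4 unfolding y'(2) by blast
        have "T (\<phi> (fst w)) - T (L (?k (snd w))) = 0" using R by (simp add: linear_diff[OF T])
        then have "T (\<phi> (fst w)) = ?k (snd w)" using TL[OF kV] by simp
        then have "\<phi>' (chart N (f x) (f x')) = \<phi>' (chart N (f x) (k y'))"
          using nf[OF x'(1)] w1 x'(2) k' w4 y'(2) by simp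
        then have "chart N (f x) (f x') = chart N (f x) (k y')"
          using f2(7) nf[OF x'(1)] w1 x'(2) k' w4 y'(2) by metis
        then have "f x' = k y'"
          using chartedD(3)[OF NC fxN] nf[OF x'(1)] w1 x'(2) k' w4 y'(2) by (auto simp: inj_on_def)
        then show "w \<in> ?S" unfolding S using x' y' by (auto simp: prod_eq_iff)
      next
        assume "w \<in> ?S"
        then obtain x' y' where w': "w = (chart M p x', chart P q y')" and x': "x' \<in> cdom M p" and y': "y' \<in> cdom P q" and e: "f x' = k y'"
          unfolding S by auto
        have w1: "chart M p x' \<in> W" and w4: "chart P q y' \<in> W4" using w w' by auto
        have "chart M p x' \<in> cimg M p" "chart P q y' \<in> cimg P q" using x' y' unfolding cimg_def by blast+
        then have V1: "\<phi> (chart M p x') \<in> V" "\<phi>4 (chart P q y') \<in> V4" using f1(8)[OF w1] f4(8)[OF w4] by blast+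
        have "T (\<phi> (chart M p x')) = ?k (chart P q y')" using nf[OF x' w1] kk[OF y' w4] e by simp
        moreover have "T (L (?k (chart P q y'))) = ?k (chart P q y')" using TL kk[OF y' w4] by blast
        ultimately show "?\<Phi> w \<in> ?K \<times> V4"
          using V1 subspace_diff[OF f1(6) V1(1) LV] unfolding w' by (simp add: linear_diff[OF T])
      qed
      have K: "subspace ?K" "dim V = dim ?K + dim V'" 
        by (rule dim_kernel_complement[OF f1(6) f2(6) T L]; (rule LV TV TL; assumption)?)+
      have "flattening ?S z ?W ?\<Phi> ?\<Psi> (?K \<times> V4)"
        unfolding flattening_def
      proof (intro conjI ballI)
        show "z \<in> ?W" using f1(2) f4(2) z by auto
        show "?\<Psi> (?\<Phi> w) = w" if "w \<in> ?W" for w using that f1(7) f4(7) by auto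
        show "subspace (?K \<times> V4)" by (rule subspace_Times[OF K(1) f4(6)])
        show "?\<Phi> ` (?W \<inter> ?S) = ?\<Phi> ` ?W \<inter> (?K \<times> V4)" using iff by blast
      qed (fact oW C\<Phi> o\<Phi> C\<Psi>)+
      moreover have "dim (?K \<times> V4) = m - n + d" using dim_Times[OF K(1) f4(6)] K(2) dV dV' dV4 by simp
      ultimately show "\<exists>W \<phi> \<psi> V. flattening ?S z W \<phi> \<psi> V \<and> dim V = m - n + d" by blast
    qed
  qed
qed

text \<open>A product is the fibre product over a point.\<close>

lemma manifold_point: "manifold (vec_mfd {0 :: real})"
proof -
  let ?M = "vec_mfd {0 :: real}"
  have "embedded_submanifold 0 (cimg ?M p)" if "p \<in> pts ?M" for p
    unfolding embedded_submanifold_iff flattening_def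
    by (intro ballI exI[of _ UNIV] exI[of _ "\<lambda>x. x"] exI[of _ "{0}"])
       (auto simp: cimg_def subspace_def intro!: Cinf_on_ident)
  moreover have top: "topspace (mfd_topology ?M) \<subseteq> {0}"
    using openin_mfd_subset[OF charted_vec openin_topspace] by fastforce
  have "Hausdorff_space (mfd_topology ?M)"
    unfolding Hausdorff_space_def
  proof (intro allI impI)
    fix x y assume "x \<in> topspace (mfd_topology ?M) \<and> y \<in> topspace (mfd_topology ?M) \<and> x \<noteq> y"
    then show "\<exists>U V. openin (mfd_topology ?M) U \<and> openin (mfd_topology ?M) V \<and> x \<in> U \<and> y \<in> V \<and> disjnt U V"
      using top by blast
  qed
  moreover have "second_countable (mfd_topology ?M)"
    unfolding second_countable_def
  proof (intro exI conjI allI impI ballI)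
    show "countable {U. openin (mfd_topology ?M) U}"
    proof (rule countable_subset)
      show "{U. openin (mfd_topology ?M) U} \<subseteq> Pow {0}" using top openin_subset by fastforce
    qed (simp add: countable_finite)
  qed auto
  ultimately show ?thesis unfolding manifold_iff using charted_vec by blast
qed

lemma prod_as_fib_prod: "prod_mfd M N = fib_prod M N (\<lambda>_. 0 :: real) (\<lambda>_. 0)"
  by (simp add: fib_prod_def sub_mfd_def prod_mfd_def fun_eq_iff)

lemma manifold_prod:
  assumes M: "manifold M" and N: "manifold N"
  shows "manifold (prod_mfd M N)"
proof -
  let ?O = "vec_mfd {0 :: real}"
  have s: "smooth_map K ?O (\<lambda>_. 0)" for K by (rule smooth_const[OF pointed_vec]) simp
  have "mderiv M ?O (\<lambda>_. 0) p ` tspace M p = tspace ?O 0" if p: "p \<in> pts M" for p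
  proof -
    note C = manifold_charted[OF M]
    have "mderiv M ?O (\<lambda>_. 0) p ` tspace M p \<subseteq> {0}"
      using mderiv_const[OF C p pointed_vec, of 0] by auto
    moreover have "0 \<in> mderiv M ?O (\<lambda>_. 0) p ` tspace M p"
      using zero_in_tspace[OF C p] mderiv_zero[OF C p s] by (metis image_eqI)
    moreover have "tspace ?O 0 \<subseteq> {0}"
    proof
      fix v assume "v \<in> tspace ?O 0"
      then obtain c where c: "curve_at ?O 0 v c" using tspace_curveE[OF charted_vec, of 0] by auto
      then have "curve_at ?O 0 0 c" 
      proof -
        obtain e where e: "e > 0" "\<forall>t\<in>{-e<..<e}. c t \<in> {0}" using c unfolding curve_in_def by auto
        show ?thesis
          by (rule curve_in_cong[OF curve_const[OF pointed_vec], of 0 _ e]) (use e in auto)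
      qed
      then show "v \<in> {0}" using curve_in_unique[OF c] by blast
    qed
    ultimately show ?thesis using zero_in_tspace[OF charted_vec, of 0 "{0::real}"] by auto
  qed
  then have "submersion M ?O (\<lambda>_. 0)" unfolding submersion_def using s by blast
  then show ?thesis unfolding prod_as_fib_prod by (rule manifold_fib_prod[OF M N manifold_point _ s])
qed

section \<open>Lie groups\<close>

text \<open>A smooth section through \<open>p\<close> provides a right inverse of the differential at \<open>p\<close>.\<close>

lemma submersion_by_sections:
  assumes M: "charted M" and N: "charted N" and f: "smooth_map M N f"
    and s: "\<And>p. p \<in> pts M \<Longrightarrow> \<exists>s. smooth_map N M s \<and> s (f p) = p \<and> (\<forall>y\<in>pts N. f (s y) = y)"
  shows "submersion M N f"
  unfolding submersion_def
proof (intro conjI ballI f equalityI subsetI)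
  fix p w assume p: "p \<in> pts M"
  show "w \<in> tspace N (f p)" if "w \<in> mderiv M N f p ` tspace M p" using that mderiv_tspace[OF M N p f] by blast
  assume w: "w \<in> tspace N (f p)"
  obtain s where s: "smooth_map N M s" "s (f p) = p" "\<forall>y\<in>pts N. f (s y) = y" using s[OF p] by blast
  have fp: "f p \<in> pts N" by (rule smooth_map_pts[OF f p])
  have sf: "smooth_map N N (\<lambda>y. f (s y))" by (rule smooth_map_compose[OF charted_pointed[OF N] s(1) f])
  have "mderiv N N (\<lambda>y. f (s y)) (f p) w = w"
    using mderiv_cong[OF N fp sf _ smooth_id w] s(3) mderiv_id[OF N fp w] by simp
  then have "mderiv M N f p (mderiv N M s (f p) w) = w"
    using mderiv_compose[OF N M fp s(1) f w] s(2) by simp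
  moreover have "mderiv N M s (f p) w \<in> tspace M p" using mderiv_tspace[OF N M fp s(1) w] s(2) by simp
  ultimately show "w \<in> mderiv M N f p ` tspace M p" by (metis image_eqI)
qed

lemma lie_groupD:
  assumes "lie_group M G"
  shows "manifold M" "charted M" "pointed M" "group G" "carrier G = pts M"
    "smooth_map (prod_mfd M M) M (\<lambda>(x, y). x \<otimes>\<^bsub>G\<^esub> y)" "smooth_map M M (\<lambda>x. inv\<^bsub>G\<^esub> x)"
  using assms manifold_charted charted_pointed unfolding lie_group_def by blast+

lemma (in group) inv_cancel_left:
  "x \<in> carrier G \<Longrightarrow> y \<in> carrier G \<Longrightarrow> inv x \<otimes> (x \<otimes> y) = y"
  "x \<in> carrier G \<Longrightarrow> y \<in> carrier G \<Longrightarrow> x \<otimes> (inv x \<otimes> y) = y"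
  by (simp_all add: m_assoc[symmetric])

locale lie_grp = fixes M :: "('g, 'k::euclidean_space) mfd" and G :: "'g monoid" (structure)
  assumes lie: "lie_group M G"
begin

sublocale group G using lie_groupD(4)[OF lie] .

lemmas mfd = lie_groupD(1)[OF lie] and charted = lie_groupD(2)[OF lie] and pointed = lie_groupD(3)[OF lie]
  and carrier_pts = lie_groupD(5)[OF lie]

lemma pts_carrier [simp]: "pts M = carrier G" by (rule carrier_pts[symmetric])

lemma one_pts: "\<one> \<in> pts M" by simp

lemma smooth_mult: "pointed P \<Longrightarrow> smooth_map P M a \<Longrightarrow> smooth_map P M b \<Longrightarrow> smooth_map P M (\<lambda>x. a x \<otimes> b x)"
  using smooth_map_compose[OF _ smooth_Pair lie_groupD(6)[OF lie], of P a b] by simp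

lemma smooth_inv: "pointed P \<Longrightarrow> smooth_map P M a \<Longrightarrow> smooth_map P M (\<lambda>x. inv (a x))"
  using smooth_map_compose[OF _ _ lie_groupD(7)[OF lie]] .

lemma smooth_constant: "g \<in> carrier G \<Longrightarrow> smooth_map P M (\<lambda>x. g)"
  using smooth_const[OF pointed] by simp

lemma smooth_conj: "g \<in> carrier G \<Longrightarrow> smooth_map M M (\<lambda>x. g \<otimes> x \<otimes> inv g)"
  by (intro smooth_mult pointed smooth_constant smooth_id inv_closed)

lemma subspace_lie_alg: "subspace (lie_alg M G)"
  unfolding lie_alg_def by (rule subspace_tspace[OF mfd one_pts])

lemma mderiv_in_lie_alg:
  assumes "charted P" "p \<in> pts P" "smooth_map P M a" "a p = \<one>" "v \<in> tspace P p"
  shows "mderiv P M a p v \<in> lie_alg M G"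
  using mderiv_tspace[OF assms(1) charted assms(2,3,5)] assms(4) unfolding lie_alg_def by simp

text \<open>The partial differentials of multiplication at the identity are identities, since the identity is a
  unit. Formulated for two maps into the group that take the value \<open>\<one>\<close> at the given point, this turns
  every algebraic identity between such maps into a linear identity between their differentials. All
  computations with Lie algebras below are done in this way.\<close>

lemma mderiv_mult:
  assumes P: "charted P" "p \<in> pts P" and a: "smooth_map P M a" "a p = \<one>" and b: "smooth_map P M b" "b p = \<one>"
    and v: "v \<in> tspace P p"
  shows "mderiv P M (\<lambda>x. a x \<otimes> b x) p v = mderiv P M a p v + mderiv P M b p v"
proof -
  let ?m = "\<lambda>z. fst z \<otimes> snd z"
  have m: "smooth_map (prod_mfd M M) M ?m" using lie_groupD(6)[OF lie] by (simp add: case_prod_beta')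
  have ab: "mderiv P M a p v \<in> tspace M \<one>" "mderiv P M b p v \<in> tspace M \<one>"
    using mderiv_tspace[OF P(1) charted P(2) a(1) v] mderiv_tspace[OF P(1) charted P(2) b(1) v] a(2) b(2) by auto
  have "mderiv P M (\<lambda>x. a x \<otimes> b x) p v = mderiv (prod_mfd M M) M ?m (\<one>, \<one>) (mderiv P M a p v, mderiv P M b p v)"
    using mderiv_compose[OF P(1) charted_prod[OF charted charted] P(2) smooth_Pair[OF a(1) b(1)] m v]
    by (simp add: mderiv_Pair[OF P a(1) b(1) v] a(2) b(2))
  also have "\<dots> = mderiv M M (\<lambda>x. x \<otimes> \<one>) \<one> (mderiv P M a p v) + mderiv M M (\<lambda>x. \<one> \<otimes> x) \<one> (mderiv P M b p v)"
    using mderiv_partials[OF charted charted one_pts one_pts m ab] by simp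
  also have "mderiv M M (\<lambda>x. x \<otimes> \<one>) \<one> (mderiv P M a p v) = mderiv P M a p v"
    using mderiv_cong[OF charted one_pts smooth_mult[OF pointed smooth_id smooth_constant[OF one_closed]] _ smooth_id ab(1)]
      mderiv_id[OF charted one_pts ab(1)] by simp
  also have "mderiv M M (\<lambda>x. \<one> \<otimes> x) \<one> (mderiv P M b p v) = mderiv P M b p v"
    using mderiv_cong[OF charted one_pts smooth_mult[OF pointed smooth_constant[OF one_closed] smooth_id] _ smooth_id ab(2)]
      mderiv_id[OF charted one_pts ab(2)] by simp
  finally show ?thesis .
qed

lemma mderiv_inv:
  assumes P: "charted P" "p \<in> pts P" and a: "smooth_map P M a" "a p = \<one>" and v: "v \<in> tspace P p"
  shows "mderiv P M (\<lambda>x. inv (a x)) p v = - mderiv P M a p v"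
proof -
  have i: "smooth_map P M (\<lambda>x. inv (a x))" by (rule smooth_inv[OF charted_pointed[OF P(1)] a(1)])
  have "mderiv P M (\<lambda>x. a x \<otimes> inv (a x)) p v = mderiv P M (\<lambda>x. \<one>) p v"
  proof (rule mderiv_cong[OF P smooth_mult[OF charted_pointed[OF P(1)] a(1) i] _ smooth_constant[OF one_closed] v])
    show "a x \<otimes> inv (a x) = \<one>" if "x \<in> pts P" for x using smooth_map_pts[OF a(1) that] by simp
  qed
  also have "\<dots> = 0" by (rule mderiv_const[OF P pointed one_pts v])
  finally show ?thesis using mderiv_mult[OF P a i _ v] a(2) by (simp add: eq_neg_iff_add_eq_0 add.commute)
qed

lemma mderiv_conj:
  assumes P: "charted P" "p \<in> pts P" and a: "smooth_map P M a" "a p = \<one>" and v: "v \<in> tspace P p" and g: "g \<in> carrier G"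
  shows "mderiv P M (\<lambda>x. g \<otimes> a x \<otimes> inv g) p v = Ad M G g (mderiv P M a p v)"
  unfolding Ad_def using mderiv_compose[OF P(1) charted P(2) a(1) smooth_conj[OF g] v] a(2) by simp

lemma Ad_linear: "g \<in> carrier G \<Longrightarrow> linear (Ad M G g)"
  unfolding Ad_def by (rule mderiv_linear[OF charted one_pts smooth_conj])

lemma Ad_closed: "g \<in> carrier G \<Longrightarrow> v \<in> lie_alg M G \<Longrightarrow> Ad M G g v \<in> lie_alg M G"
  unfolding Ad_def using mderiv_in_lie_alg[OF charted one_pts smooth_conj] by (simp add: lie_alg_def)

lemma Ad_mult:
  assumes g: "g \<in> carrier G" "h \<in> carrier G" and v: "v \<in> lie_alg M G"
  shows "Ad M G (g \<otimes> h) v = Ad M G g (Ad M G h v)"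
proof -
  have v': "v \<in> tspace M \<one>" using v unfolding lie_alg_def .
  have "Ad M G g (Ad M G h v) = mderiv M M (\<lambda>x. g \<otimes> (h \<otimes> x \<otimes> inv h) \<otimes> inv g) \<one> v"
    using mderiv_conj[OF charted one_pts smooth_conj[OF g(2)] _ v' g(1)] g unfolding Ad_def by simp
  also have "\<dots> = mderiv M M (\<lambda>x. (g \<otimes> h) \<otimes> x \<otimes> inv (g \<otimes> h)) \<one> v"
    by (rule mderiv_cong[OF charted one_pts _ _ _ v'])
       (use g in \<open>auto intro!: smooth_mult pointed smooth_constant smooth_id simp: m_assoc inv_mult_group\<close>)
  finally show ?thesis unfolding Ad_def by simp
qed

end

section \<open>Crossed modules and their 2-groups\<close>

lemma prod_gpd_simps:
  "arr (prod_gpd X Y) = prod_mfd (arr X) (arr Y)" "obj (prod_gpd X Y) = prod_mfd (obj X) (obj Y)"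
  "src (prod_gpd X Y) z = (src X (fst z), src Y (snd z))" "tgt (prod_gpd X Y) z = (tgt X (fst z), tgt Y (snd z))"
  "gcomp (prod_gpd X Y) w = (gcomp X (fst (fst w), fst (snd w)), gcomp Y (snd (fst w), snd (snd w)))"
  "gunit (prod_gpd X Y) u = (gunit X (fst u), gunit Y (snd u))"
  by (simp_all add: prod_gpd_def case_prod_beta)

locale lie_crossed_module =
  fixes MG :: "('g, 'k::euclidean_space) mfd" and G :: "'g monoid"
    and MH :: "('h, 'l::euclidean_space) mfd" and H :: "'h monoid"
    and \<tau> :: "'h \<Rightarrow> 'g" and \<alpha> :: "'g \<times> 'h \<Rightarrow> 'h"
  assumes cm: "crossed_module MG G MH H \<tau> \<alpha>"
begin

sublocale G: lie_grp MG G using cm unfolding crossed_module_def by unfold_locales blast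
sublocale H: lie_grp MH H using cm unfolding crossed_module_def by unfold_locales blast

abbreviation MS where "MS \<equiv> prod_mfd MH MG"
abbreviation S where "S \<equiv> semidirect G H \<alpha>"

lemma tau_smooth: "smooth_map MH MG \<tau>" and alpha_smooth: "smooth_map (prod_mfd MG MH) MH \<alpha>"
  using cm unfolding crossed_module_def by blast+

lemma tau_closed [simp]: "h \<in> carrier H \<Longrightarrow> \<tau> h \<in> carrier G"
  and tau_mult [simp]: "h \<in> carrier H \<Longrightarrow> h' \<in> carrier H \<Longrightarrow> \<tau> (h \<otimes>\<^bsub>H\<^esub> h') = \<tau> h \<otimes>\<^bsub>G\<^esub> \<tau> h'"
  using cm unfolding crossed_module_def hom_def by auto

lemma tau_group_hom: "group_hom H G \<tau>"
  using cm unfolding crossed_module_def by unfold_locales blast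

lemma tau_one [simp]: "\<tau> \<one>\<^bsub>H\<^esub> = \<one>\<^bsub>G\<^esub>" by (rule group_hom.hom_one[OF tau_group_hom])

lemma tau_inv [simp]: "h \<in> carrier H \<Longrightarrow> \<tau> (inv\<^bsub>H\<^esub> h) = inv\<^bsub>G\<^esub> (\<tau> h)"
  by (rule group_hom.hom_inv[OF tau_group_hom])

lemma alpha_group_hom: "g \<in> carrier G \<Longrightarrow> group_hom H H (\<lambda>h. \<alpha> (g, h))"
  using cm unfolding crossed_module_def iso_def by unfold_locales blast

lemma alpha_closed [simp]: "g \<in> carrier G \<Longrightarrow> h \<in> carrier H \<Longrightarrow> \<alpha> (g, h) \<in> carrier H"
  using group_hom.hom_closed[OF alpha_group_hom] .

lemma alpha_mult [simp]: "g \<in> carrier G \<Longrightarrow> h \<in> carrier H \<Longrightarrow> h' \<in> carrier H \<Longrightarrow>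
    \<alpha> (g, h \<otimes>\<^bsub>H\<^esub> h') = \<alpha> (g, h) \<otimes>\<^bsub>H\<^esub> \<alpha> (g, h')"
  using group_hom.hom_mult[OF alpha_group_hom] .

lemma alpha_one [simp]: "g \<in> carrier G \<Longrightarrow> \<alpha> (g, \<one>\<^bsub>H\<^esub>) = \<one>\<^bsub>H\<^esub>"
  using group_hom.hom_one[OF alpha_group_hom] .

lemma alpha_inv: "g \<in> carrier G \<Longrightarrow> h \<in> carrier H \<Longrightarrow> \<alpha> (g, inv\<^bsub>H\<^esub> h) = inv\<^bsub>H\<^esub> (\<alpha> (g, h))"
  using group_hom.hom_inv[OF alpha_group_hom] .

lemma alpha_unit [simp]: "h \<in> carrier H \<Longrightarrow> \<alpha> (\<one>\<^bsub>G\<^esub>, h) = h"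
  and alpha_comp: "g \<in> carrier G \<Longrightarrow> g' \<in> carrier G \<Longrightarrow> h \<in> carrier H \<Longrightarrow> \<alpha> (g \<otimes>\<^bsub>G\<^esub> g', h) = \<alpha> (g, \<alpha> (g', h))"
  and tau_alpha: "g \<in> carrier G \<Longrightarrow> h \<in> carrier H \<Longrightarrow> \<tau> (\<alpha> (g, h)) = g \<otimes>\<^bsub>G\<^esub> \<tau> h \<otimes>\<^bsub>G\<^esub> inv\<^bsub>G\<^esub> g"
  and alpha_tau: "h \<in> carrier H \<Longrightarrow> h' \<in> carrier H \<Longrightarrow> \<alpha> (\<tau> h, h') = h \<otimes>\<^bsub>H\<^esub> h' \<otimes>\<^bsub>H\<^esub> inv\<^bsub>H\<^esub> h"
  using cm unfolding crossed_module_def by blast+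

lemma alpha_cancel [simp]:
  assumes "g \<in> carrier G" "h \<in> carrier H"
  shows "\<alpha> (inv\<^bsub>G\<^esub> g, \<alpha> (g, h)) = h" "\<alpha> (g, \<alpha> (inv\<^bsub>G\<^esub> g, h)) = h"
  using alpha_comp[of "inv\<^bsub>G\<^esub> g" g h] alpha_comp[of g "inv\<^bsub>G\<^esub> g" h] assms by simp_all

lemma smooth_tau: "pointed P \<Longrightarrow> smooth_map P MH a \<Longrightarrow> smooth_map P MG (\<lambda>x. \<tau> (a x))"
  using smooth_map_compose[OF _ _ tau_smooth] .

lemma smooth_alpha: "pointed P \<Longrightarrow> smooth_map P MG a \<Longrightarrow> smooth_map P MH b \<Longrightarrow> smooth_map P MH (\<lambda>x. \<alpha> (a x, b x))"
  using smooth_map_compose[OF _ smooth_Pair alpha_smooth] .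

lemma charted_MS: "charted MS" by (rule charted_prod[OF H.charted G.charted])
lemma pointed_MS: "pointed MS" by (rule charted_pointed[OF charted_MS])
lemma manifold_MS: "manifold MS" by (rule manifold_prod[OF H.mfd G.mfd])

lemma semidirect_simps [simp]:
  "carrier S = carrier H \<times> carrier G" "\<one>\<^bsub>S\<^esub> = (\<one>\<^bsub>H\<^esub>, \<one>\<^bsub>G\<^esub>)"
  "x \<otimes>\<^bsub>S\<^esub> y = (fst x \<otimes>\<^bsub>H\<^esub> \<alpha> (snd x, fst y), snd x \<otimes>\<^bsub>G\<^esub> snd y)"
  by (simp_all add: semidirect_def case_prod_beta)

lemma group_semidirect: "group S"
proof (rule groupI)
  show "x \<otimes>\<^bsub>S\<^esub> y \<otimes>\<^bsub>S\<^esub> z = x \<otimes>\<^bsub>S\<^esub> (y \<otimes>\<^bsub>S\<^esub> z)" if "x \<in> carrier S" "y \<in> carrier S" "z \<in> carrier S" for x y z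
    using that by (auto simp: alpha_comp G.m_assoc H.m_assoc)
  show "\<exists>y\<in>carrier S. y \<otimes>\<^bsub>S\<^esub> x = \<one>\<^bsub>S\<^esub>" if "x \<in> carrier S" for x
    by (rule bexI[of _ "(\<alpha> (inv\<^bsub>G\<^esub> (snd x), inv\<^bsub>H\<^esub> (fst x)), inv\<^bsub>G\<^esub> (snd x))"])
       (use that in \<open>auto simp: alpha_inv\<close>)
qed auto

lemma inv_semidirect:
  "h \<in> carrier H \<Longrightarrow> g \<in> carrier G \<Longrightarrow> inv\<^bsub>S\<^esub> (h, g) = (\<alpha> (inv\<^bsub>G\<^esub> g, inv\<^bsub>H\<^esub> h), inv\<^bsub>G\<^esub> g)"
  by (rule group.inv_equality[OF group_semidirect]) (auto simp: alpha_inv)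

lemma lie_group_semidirect: "lie_group MS S"
  unfolding lie_group_def
proof (intro conjI group_semidirect manifold_MS)
  show "carrier S = pts MS" by simp
  have P: "pointed (prod_mfd MS MS)" by (intro pointed_prod pointed_MS)
  show "smooth_map (prod_mfd MS MS) MS (\<lambda>(x, y). x \<otimes>\<^bsub>S\<^esub> y)"
    unfolding case_prod_beta' semidirect_simps
    by (intro smooth_Pair H.smooth_mult G.smooth_mult smooth_alpha P)
       (rule smooth_fst smooth_snd smooth_id)+
  show "smooth_map MS MS (\<lambda>x. inv\<^bsub>S\<^esub> x)"
  proof (rule smooth_map_cong[OF pointed_MS])
    show "smooth_map MS MS (\<lambda>x. (\<alpha> (inv\<^bsub>G\<^esub> (snd x), inv\<^bsub>H\<^esub> (fst x)), inv\<^bsub>G\<^esub> (snd x)))"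
      by (intro smooth_Pair H.smooth_inv G.smooth_inv smooth_alpha pointed_MS)
         (rule smooth_fst smooth_snd smooth_id)+
  qed (auto simp: inv_semidirect)
qed

sublocale S: lie_grp MS S by unfold_locales (rule lie_group_semidirect)

lemma lie_alg_semidirect: "lie_alg MS S = lie_alg MH H \<times> lie_alg MG G"
  unfolding lie_alg_def by (simp add: tspace_prod[OF H.charted G.charted])

abbreviation LG where "LG \<equiv> lie_alg MG G"
abbreviation LH where "LH \<equiv> lie_alg MH H"

definition dtau :: "'l \<Rightarrow> 'k" where "dtau = mderiv MH MG \<tau> \<one>\<^bsub>H\<^esub>"
definition dalpha :: "'g \<Rightarrow> 'l \<Rightarrow> 'l" where "dalpha g = mderiv MH MH (\<lambda>h. \<alpha> (g, h)) \<one>\<^bsub>H\<^esub>"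

text \<open>The \<open>H\<close>-component of the adjoint action of \<open>h\<close> on the Lie algebra of \<open>G\<close> inside the
  semidirect product.\<close>

definition dcross :: "'h \<Rightarrow> 'k \<Rightarrow> 'l" where
  "dcross h = mderiv MG MH (\<lambda>g. h \<otimes>\<^bsub>H\<^esub> \<alpha> (g, inv\<^bsub>H\<^esub> h)) \<one>\<^bsub>G\<^esub>"

lemma smooth_alpha_fixed: "g \<in> carrier G \<Longrightarrow> smooth_map MH MH (\<lambda>h. \<alpha> (g, h))"
  by (intro smooth_alpha H.pointed G.smooth_constant smooth_id)

lemma smooth_cross: "h \<in> carrier H \<Longrightarrow> smooth_map MG MH (\<lambda>g. h \<otimes>\<^bsub>H\<^esub> \<alpha> (g, inv\<^bsub>H\<^esub> h))"
  by (intro H.smooth_mult smooth_alpha G.pointed H.smooth_constant smooth_id H.inv_closed)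

lemma dtau_linear: "linear dtau"
  unfolding dtau_def by (rule mderiv_linear[OF H.charted H.one_pts tau_smooth])

lemma dalpha_linear: "g \<in> carrier G \<Longrightarrow> linear (dalpha g)"
  unfolding dalpha_def by (rule mderiv_linear[OF H.charted H.one_pts smooth_alpha_fixed])

lemma dcross_linear: "h \<in> carrier H \<Longrightarrow> linear (dcross h)"
  unfolding dcross_def by (rule mderiv_linear[OF G.charted G.one_pts smooth_cross])

lemma dtau_closed: "B \<in> LH \<Longrightarrow> dtau B \<in> LG"
  unfolding dtau_def using G.mderiv_in_lie_alg[OF H.charted H.one_pts tau_smooth] by (simp add: lie_alg_def)

lemma dcross_closed: "h \<in> carrier H \<Longrightarrow> A \<in> LG \<Longrightarrow> dcross h A \<in> LH"
  unfolding dcross_def using H.mderiv_in_lie_alg[OF G.charted G.one_pts smooth_cross] by (simp add: lie_alg_def)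

lemma LH_D: "B \<in> LH \<Longrightarrow> B \<in> tspace MH \<one>\<^bsub>H\<^esub>" and LG_D: "A \<in> LG \<Longrightarrow> A \<in> tspace MG \<one>\<^bsub>G\<^esub>"
  unfolding lie_alg_def by simp_all

lemma Ad_semidirect_G:
  assumes k: "k \<in> carrier G" and B: "B \<in> LH" and A: "A \<in> LG"
  shows "Ad MS S (\<one>\<^bsub>H\<^esub>, k) (B, A) = (dalpha k B, Ad MG G k A)"
proof -
  have BA: "(B, A) \<in> tspace MS (\<one>\<^bsub>H\<^esub>, \<one>\<^bsub>G\<^esub>)" using A B by (simp add: lie_alg_def tspace_prod[OF H.charted G.charted])
  have o: "(\<one>\<^bsub>H\<^esub>, \<one>\<^bsub>G\<^esub>) \<in> pts MS" by simp
  have s1: "smooth_map MS MH (\<lambda>x. \<alpha> (k, fst x))"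
    by (intro smooth_alpha pointed_MS G.smooth_constant[OF k] smooth_fst[OF smooth_id])
  have s2: "smooth_map MS MG (\<lambda>x. k \<otimes>\<^bsub>G\<^esub> snd x \<otimes>\<^bsub>G\<^esub> inv\<^bsub>G\<^esub> k)"
    by (intro G.smooth_mult pointed_MS G.smooth_constant k G.inv_closed smooth_snd[OF smooth_id])
  have "Ad MS S (\<one>\<^bsub>H\<^esub>, k) (B, A) = mderiv MS MS (\<lambda>x. (\<alpha> (k, fst x), k \<otimes>\<^bsub>G\<^esub> snd x \<otimes>\<^bsub>G\<^esub> inv\<^bsub>G\<^esub> k)) (\<one>\<^bsub>H\<^esub>, \<one>\<^bsub>G\<^esub>) (B, A)"
    unfolding Ad_def semidirect_simps(2)
  proof (rule mderiv_cong[OF charted_MS o _ _ smooth_Pair[OF s1 s2] BA])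
    show "smooth_map MS MS (\<lambda>x. (\<one>\<^bsub>H\<^esub>, k) \<otimes>\<^bsub>S\<^esub> x \<otimes>\<^bsub>S\<^esub> inv\<^bsub>S\<^esub> (\<one>\<^bsub>H\<^esub>, k))" by (rule S.smooth_conj) (simp add: k)
  qed (use k in \<open>auto simp: inv_semidirect alpha_comp\<close>)
  also have "\<dots> = (mderiv MS MH (\<lambda>x. \<alpha> (k, fst x)) (\<one>\<^bsub>H\<^esub>, \<one>\<^bsub>G\<^esub>) (B, A), mderiv MS MG (\<lambda>x. k \<otimes>\<^bsub>G\<^esub> snd x \<otimes>\<^bsub>G\<^esub> inv\<^bsub>G\<^esub> k) (\<one>\<^bsub>H\<^esub>, \<one>\<^bsub>G\<^esub>) (B, A))"
    by (rule mderiv_Pair[OF charted_MS o s1 s2 BA])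
  also have "mderiv MS MH (\<lambda>x. \<alpha> (k, fst x)) (\<one>\<^bsub>H\<^esub>, \<one>\<^bsub>G\<^esub>) (B, A) = dalpha k B"
    using mderiv_compose[OF charted_MS H.charted o smooth_fst[OF smooth_id] smooth_alpha_fixed[OF k] BA]
      mderiv_fst[OF H.charted G.charted o BA] unfolding dalpha_def by simp
  also have "mderiv MS MG (\<lambda>x. k \<otimes>\<^bsub>G\<^esub> snd x \<otimes>\<^bsub>G\<^esub> inv\<^bsub>G\<^esub> k) (\<one>\<^bsub>H\<^esub>, \<one>\<^bsub>G\<^esub>) (B, A) = Ad MG G k A"
    using mderiv_compose[OF charted_MS G.charted o smooth_snd[OF smooth_id] G.smooth_conj[OF k] BA]
      mderiv_snd[OF H.charted G.charted o BA] unfolding Ad_def by simp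
  finally show ?thesis .
qed

text \<open>Conjugation by \<open>(h, \<one>)\<close> sends \<open>(x, g)\<close> to \<open>((h x h\<inverse>) (h \<alpha>\<^sub>g(h\<inverse>)), g)\<close>, a product of a function of \<open>x\<close> and a
  function of \<open>g\<close>.\<close>

lemma Ad_semidirect_H:
  assumes h: "h \<in> carrier H" and B: "B \<in> LH" and A: "A \<in> LG"
  shows "Ad MS S (h, \<one>\<^bsub>G\<^esub>) (B, A) = (Ad MH H h B + dcross h A, A)"
proof -
  have BA: "(B, A) \<in> tspace MS (\<one>\<^bsub>H\<^esub>, \<one>\<^bsub>G\<^esub>)" using A B by (simp add: lie_alg_def tspace_prod[OF H.charted G.charted])
  have o: "(\<one>\<^bsub>H\<^esub>, \<one>\<^bsub>G\<^esub>) \<in> pts MS" by simp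
  let ?a = "\<lambda>x. h \<otimes>\<^bsub>H\<^esub> fst x \<otimes>\<^bsub>H\<^esub> inv\<^bsub>H\<^esub> h" and ?b = "\<lambda>x. h \<otimes>\<^bsub>H\<^esub> \<alpha> (snd x, inv\<^bsub>H\<^esub> h)"
  have s1: "smooth_map MS MH ?a"
    by (intro H.smooth_mult pointed_MS H.smooth_constant h H.inv_closed smooth_fst[OF smooth_id])
  have s2: "smooth_map MS MH ?b"
    by (intro H.smooth_mult pointed_MS H.smooth_constant h H.inv_closed smooth_alpha smooth_snd[OF smooth_id])
  have s12: "smooth_map MS MH (\<lambda>x. ?a x \<otimes>\<^bsub>H\<^esub> ?b x)" by (rule H.smooth_mult[OF pointed_MS s1 s2])
  have "Ad MS S (h, \<one>\<^bsub>G\<^esub>) (B, A) = mderiv MS MS (\<lambda>x. (?a x \<otimes>\<^bsub>H\<^esub> ?b x, snd x)) (\<one>\<^bsub>H\<^esub>, \<one>\<^bsub>G\<^esub>) (B, A)"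
    unfolding Ad_def semidirect_simps(2)
  proof (rule mderiv_cong[OF charted_MS o _ _ smooth_Pair[OF s12 smooth_snd[OF smooth_id]] BA])
    show "smooth_map MS MS (\<lambda>x. (h, \<one>\<^bsub>G\<^esub>) \<otimes>\<^bsub>S\<^esub> x \<otimes>\<^bsub>S\<^esub> inv\<^bsub>S\<^esub> (h, \<one>\<^bsub>G\<^esub>))" by (rule S.smooth_conj) (simp add: h)
  qed (use h in \<open>auto simp: inv_semidirect H.m_assoc H.inv_cancel_left\<close>)
  also have "\<dots> = (mderiv MS MH (\<lambda>x. ?a x \<otimes>\<^bsub>H\<^esub> ?b x) (\<one>\<^bsub>H\<^esub>, \<one>\<^bsub>G\<^esub>) (B, A), A)"
    using mderiv_Pair[OF charted_MS o s12 smooth_snd[OF smooth_id] BA] mderiv_snd[OF H.charted G.charted o BA] by simp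
  also have "mderiv MS MH (\<lambda>x. ?a x \<otimes>\<^bsub>H\<^esub> ?b x) (\<one>\<^bsub>H\<^esub>, \<one>\<^bsub>G\<^esub>) (B, A) =
      mderiv MS MH ?a (\<one>\<^bsub>H\<^esub>, \<one>\<^bsub>G\<^esub>) (B, A) + mderiv MS MH ?b (\<one>\<^bsub>H\<^esub>, \<one>\<^bsub>G\<^esub>) (B, A)"
    by (rule H.mderiv_mult[OF charted_MS o s1 _ s2 _ BA]) (use h in auto)
  also have "mderiv MS MH ?a (\<one>\<^bsub>H\<^esub>, \<one>\<^bsub>G\<^esub>) (B, A) = Ad MH H h B"
    using mderiv_compose[OF charted_MS H.charted o smooth_fst[OF smooth_id] H.smooth_conj[OF h] BA]
      mderiv_fst[OF H.charted G.charted o BA] unfolding Ad_def by simp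
  also have "mderiv MS MH ?b (\<one>\<^bsub>H\<^esub>, \<one>\<^bsub>G\<^esub>) (B, A) = dcross h A"
    using mderiv_compose[OF charted_MS G.charted o smooth_snd[OF smooth_id] smooth_cross[OF h] BA]
      mderiv_snd[OF H.charted G.charted o BA] unfolding dcross_def by simp
  finally show ?thesis .
qed

lemma LH_subspace: "subspace LH" and LG_subspace: "subspace LG"
  by (rule H.subspace_lie_alg G.subspace_lie_alg)+

text \<open>Compare the \<open>H\<close>-components in the multiplicativity of the adjoint action of \<open>(h, \<one>)\<close>.\<close>

lemma dcross_mult:
  assumes h: "h \<in> carrier H" "h' \<in> carrier H" and A: "A \<in> LG"
  shows "dcross (h \<otimes>\<^bsub>H\<^esub> h') A = Ad MH H h (dcross h' A) + dcross h A"
proof -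
  have 0: "0 \<in> LH" using subspace_0[OF LH_subspace] .
  have "Ad MS S ((h, \<one>\<^bsub>G\<^esub>) \<otimes>\<^bsub>S\<^esub> (h', \<one>\<^bsub>G\<^esub>)) (0, A) = Ad MS S (h, \<one>\<^bsub>G\<^esub>) (Ad MS S (h', \<one>\<^bsub>G\<^esub>) (0, A))"
    by (rule S.Ad_mult) (use h A 0 in \<open>auto simp: lie_alg_semidirect\<close>)
  then show ?thesis
    using h A 0 dcross_closed[OF h(2) A] by (simp add: Ad_semidirect_H linear_0[OF H.Ad_linear])
qed

text \<open>Differentiate \<open>\<tau> (h \<alpha>\<^sub>g(h\<inverse>)) = (\<tau>(h) g \<tau>(h)\<inverse>) g\<inverse>\<close>, which is equivariance of \<open>\<tau>\<close>.\<close>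

lemma dtau_dcross:
  assumes h: "h \<in> carrier H" and A: "A \<in> LG"
  shows "dtau (dcross h A) = Ad MG G (\<tau> h) A - A"
proof -
  note A' = LG_D[OF A]
  have "dtau (dcross h A) = mderiv MG MG (\<lambda>g. \<tau> (h \<otimes>\<^bsub>H\<^esub> \<alpha> (g, inv\<^bsub>H\<^esub> h))) \<one>\<^bsub>G\<^esub> A"
    using mderiv_compose[OF G.charted H.charted G.one_pts smooth_cross[OF h] tau_smooth A'] h
    unfolding dtau_def dcross_def by simp
  also have "\<dots> = mderiv MG MG (\<lambda>g. (\<tau> h \<otimes>\<^bsub>G\<^esub> g \<otimes>\<^bsub>G\<^esub> inv\<^bsub>G\<^esub> (\<tau> h)) \<otimes>\<^bsub>G\<^esub> inv\<^bsub>G\<^esub> g) \<one>\<^bsub>G\<^esub> A"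
    by (rule mderiv_cong[OF G.charted G.one_pts smooth_tau[OF G.pointed smooth_cross[OF h]] _
          G.smooth_mult[OF G.pointed G.smooth_conj[OF tau_closed[OF h]] G.smooth_inv[OF G.pointed smooth_id]] A'])
       (use h in \<open>auto simp: tau_alpha G.m_assoc\<close>)
  also have "\<dots> = mderiv MG MG (\<lambda>g. \<tau> h \<otimes>\<^bsub>G\<^esub> g \<otimes>\<^bsub>G\<^esub> inv\<^bsub>G\<^esub> (\<tau> h)) \<one>\<^bsub>G\<^esub> A + mderiv MG MG (\<lambda>g. inv\<^bsub>G\<^esub> g) \<one>\<^bsub>G\<^esub> A"
    by (rule G.mderiv_mult[OF G.charted G.one_pts G.smooth_conj[OF tau_closed[OF h]] _ G.smooth_inv[OF G.pointed smooth_id] _ A'])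
       (use h in auto)
  also have "mderiv MG MG (\<lambda>g. inv\<^bsub>G\<^esub> g) \<one>\<^bsub>G\<^esub> A = - A"
    using G.mderiv_inv[OF G.charted G.one_pts smooth_id _ A'] mderiv_id[OF G.charted G.one_pts A'] by simp
  finally show ?thesis unfolding Ad_def by simp
qed

text \<open>Differentiate \<open>h \<alpha>\<^sub>\<tau>\<^sub>(\<^sub>b\<^sub>)(h\<inverse>) = (h b h\<inverse>) b\<inverse>\<close>, which is the Peiffer identity.\<close>

lemma dcross_dtau:
  assumes h: "h \<in> carrier H" and B: "B \<in> LH"
  shows "dcross h (dtau B) = Ad MH H h B - B"
proof -
  note B' = LH_D[OF B]
  have "dcross h (dtau B) = mderiv MH MH (\<lambda>b. h \<otimes>\<^bsub>H\<^esub> \<alpha> (\<tau> b, inv\<^bsub>H\<^esub> h)) \<one>\<^bsub>H\<^esub> B"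
    using mderiv_compose[OF H.charted G.charted H.one_pts tau_smooth smooth_cross[OF h] B']
    unfolding dtau_def dcross_def by simp
  also have "\<dots> = mderiv MH MH (\<lambda>b. (h \<otimes>\<^bsub>H\<^esub> b \<otimes>\<^bsub>H\<^esub> inv\<^bsub>H\<^esub> h) \<otimes>\<^bsub>H\<^esub> inv\<^bsub>H\<^esub> b) \<one>\<^bsub>H\<^esub> B"
    by (rule mderiv_cong[OF H.charted H.one_pts smooth_map_compose[OF H.pointed tau_smooth smooth_cross[OF h]] _
          H.smooth_mult[OF H.pointed H.smooth_conj[OF h] H.smooth_inv[OF H.pointed smooth_id]] B'])
       (use h in \<open>auto simp: alpha_tau H.m_assoc\<close>)
  also have "\<dots> = mderiv MH MH (\<lambda>b. h \<otimes>\<^bsub>H\<^esub> b \<otimes>\<^bsub>H\<^esub> inv\<^bsub>H\<^esub> h) \<one>\<^bsub>H\<^esub> B + mderiv MH MH (\<lambda>b. inv\<^bsub>H\<^esub> b) \<one>\<^bsub>H\<^esub> B"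
    by (rule H.mderiv_mult[OF H.charted H.one_pts H.smooth_conj[OF h] _ H.smooth_inv[OF H.pointed smooth_id] _ B'])
       (use h in auto)
  also have "mderiv MH MH (\<lambda>b. inv\<^bsub>H\<^esub> b) \<one>\<^bsub>H\<^esub> B = - B"
    using H.mderiv_inv[OF H.charted H.one_pts smooth_id _ B'] mderiv_id[OF H.charted H.one_pts B'] by simp
  finally show ?thesis unfolding Ad_def by simp
qed

text \<open>The same differential arises from the inverse action, since applying \<open>\<alpha>\<^sub>g\<close> to
  \<open>\<alpha>\<^sub>g\<inverse>(h) h\<inverse>\<close> gives \<open>h \<alpha>\<^sub>g(h\<inverse>)\<close> and \<open>\<alpha>\<^sub>g\<close> fixes the identity.\<close>

lemma dcross_inverse_action:
  assumes h: "h \<in> carrier H" and A: "A \<in> LG"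
  shows "mderiv MG MH (\<lambda>g. \<alpha> (inv\<^bsub>G\<^esub> g, h) \<otimes>\<^bsub>H\<^esub> inv\<^bsub>H\<^esub> h) \<one>\<^bsub>G\<^esub> A = dcross h A"
proof -
  note A' = LG_D[OF A]
  let ?c = "\<lambda>g. \<alpha> (inv\<^bsub>G\<^esub> g, h) \<otimes>\<^bsub>H\<^esub> inv\<^bsub>H\<^esub> h"
  have c: "smooth_map MG MH ?c"
    by (intro H.smooth_mult smooth_alpha G.smooth_inv G.pointed H.smooth_constant smooth_id H.inv_closed h)
  have c1: "?c \<one>\<^bsub>G\<^esub> = \<one>\<^bsub>H\<^esub>" using h by simp
  have cA: "mderiv MG MH ?c \<one>\<^bsub>G\<^esub> A \<in> tspace MH \<one>\<^bsub>H\<^esub>" using mderiv_tspace[OF G.charted H.charted G.one_pts c A'] unfolding c1 .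
  have "dcross h A = mderiv MG MH (\<lambda>g. \<alpha> (g, ?c g)) \<one>\<^bsub>G\<^esub> A"
    unfolding dcross_def
    by (rule mderiv_cong[OF G.charted G.one_pts smooth_cross[OF h] _ smooth_alpha[OF G.pointed smooth_id c] A'])
       (use h in auto)
  also have "\<dots> = mderiv (prod_mfd MG MH) MH \<alpha> (\<one>\<^bsub>G\<^esub>, ?c \<one>\<^bsub>G\<^esub>) (A, mderiv MG MH ?c \<one>\<^bsub>G\<^esub> A)"
    using mderiv_compose[OF G.charted charted_prod[OF G.charted H.charted] G.one_pts smooth_Pair[OF smooth_id c] alpha_smooth A']
    by (simp add: mderiv_Pair[OF G.charted G.one_pts smooth_id c A'] mderiv_id[OF G.charted G.one_pts A'])
  also have "\<dots> = mderiv MG MH (\<lambda>g. \<alpha> (g, \<one>\<^bsub>H\<^esub>)) \<one>\<^bsub>G\<^esub> A + mderiv MH MH (\<lambda>x. \<alpha> (\<one>\<^bsub>G\<^esub>, x)) \<one>\<^bsub>H\<^esub> (mderiv MG MH ?c \<one>\<^bsub>G\<^esub> A)"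
    unfolding c1 by (rule mderiv_partials[OF G.charted H.charted G.one_pts H.one_pts alpha_smooth A' cA])
  also have "mderiv MG MH (\<lambda>g. \<alpha> (g, \<one>\<^bsub>H\<^esub>)) \<one>\<^bsub>G\<^esub> A = mderiv MG MH (\<lambda>g. \<one>\<^bsub>H\<^esub>) \<one>\<^bsub>G\<^esub> A"
    by (rule mderiv_cong[OF G.charted G.one_pts smooth_alpha[OF G.pointed smooth_id H.smooth_constant] _ H.smooth_constant A'])
       auto
  also have "\<dots> = 0" by (rule mderiv_const[OF G.charted G.one_pts H.pointed H.one_pts A'])
  also have "mderiv MH MH (\<lambda>x. \<alpha> (\<one>\<^bsub>G\<^esub>, x)) \<one>\<^bsub>H\<^esub> (mderiv MG MH ?c \<one>\<^bsub>G\<^esub> A) = mderiv MG MH ?c \<one>\<^bsub>G\<^esub> A"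
    using mderiv_cong[OF H.charted H.one_pts smooth_alpha_fixed[OF G.one_closed] _ smooth_id cA]
      mderiv_id[OF H.charted H.one_pts cA] by simp
  finally show ?thesis by simp
qed

subsection \<open>The 2-group of a crossed module\<close>

abbreviation TG where "TG \<equiv> cm_two_group MG G MH H \<tau> \<alpha>"

lemma TG_simps [simp]:
  "arr (tg_gpd TG) = MS" "obj (tg_gpd TG) = MG" "src (tg_gpd TG) = snd"
  "tgt (tg_gpd TG) = (\<lambda>x. \<tau> (fst x) \<otimes>\<^bsub>G\<^esub> snd x)"
  "gcomp (tg_gpd TG) = (\<lambda>z. (fst (fst z) \<otimes>\<^bsub>H\<^esub> fst (snd z), snd (snd z)))"
  "gunit (tg_gpd TG) = (\<lambda>g. (\<one>\<^bsub>H\<^esub>, g))"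
  "ginv (tg_gpd TG) = (\<lambda>x. (inv\<^bsub>H\<^esub> (fst x), \<tau> (fst x) \<otimes>\<^bsub>G\<^esub> snd x))"
  "grp1 TG = S" "grp0 TG = G"
  by (simp_all add: cm_two_group_def case_prod_beta' fun_eq_iff)

lemma smooth_TG_tgt: "smooth_map MS MG (\<lambda>x. \<tau> (fst x) \<otimes>\<^bsub>G\<^esub> snd x)"
  by (intro G.smooth_mult pointed_MS smooth_tau smooth_fst[OF smooth_id] smooth_snd[OF smooth_id])

lemma submersion_TG_src: "submersion MS MG snd"
proof (rule submersion_by_sections[OF charted_MS G.charted smooth_snd[OF smooth_id]])
  fix p assume p: "p \<in> pts MS"
  have "smooth_map MG MS (\<lambda>y. (fst p, y))"
    by (intro smooth_Pair smooth_id H.smooth_constant) (use p in auto)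
  then show "\<exists>s. smooth_map MG MS s \<and> s (snd p) = p \<and> (\<forall>y\<in>pts MG. snd (s y) = y)"
    by (intro exI[of _ "\<lambda>y. (fst p, y)"]) simp
qed

lemma submersion_TG_tgt: "submersion MS MG (\<lambda>x. \<tau> (fst x) \<otimes>\<^bsub>G\<^esub> snd x)"
proof (rule submersion_by_sections[OF charted_MS G.charted smooth_TG_tgt])
  fix p assume p: "p \<in> pts MS"
  then have p': "fst p \<in> carrier H" "snd p \<in> carrier G" by auto
  have "smooth_map MG MS (\<lambda>y. (fst p, inv\<^bsub>G\<^esub> (\<tau> (fst p)) \<otimes>\<^bsub>G\<^esub> y))"
    by (intro smooth_Pair smooth_id H.smooth_constant G.smooth_mult G.smooth_constant G.pointed) (use p' in auto)
  then show "\<exists>s. smooth_map MG MS s \<and> s (\<tau> (fst p) \<otimes>\<^bsub>G\<^esub> snd p) = p \<and> (\<forall>y\<in>pts MG. \<tau> (fst (s y)) \<otimes>\<^bsub>G\<^esub> snd (s y) = y)"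
    by (intro exI[of _ "\<lambda>y. (fst p, inv\<^bsub>G\<^esub> (\<tau> (fst p)) \<otimes>\<^bsub>G\<^esub> y)"])
       (use p' in \<open>auto simp: G.inv_cancel_left\<close>)
qed

lemma lie_groupoid_TG: "lie_groupoid (tg_gpd TG)"
proof -
  have C: "pointed (composable (tg_gpd TG))" "pointed MS"
    unfolding composable_def fib_prod_def TG_simps by (intro pointed_sub pointed_prod pointed_MS)+
  have c1: "smooth_map (composable (tg_gpd TG)) MS fst" "smooth_map (composable (tg_gpd TG)) MS snd"
    unfolding composable_def TG_simps by (rule smooth_fib_prod_fst[OF smooth_id] smooth_fib_prod_snd[OF smooth_id])+
  have "smooth_map (composable (tg_gpd TG)) MS (\<lambda>z. (fst (fst z) \<otimes>\<^bsub>H\<^esub> fst (snd z), snd (snd z)))"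
    by (intro smooth_Pair H.smooth_mult C smooth_fst[OF c1(1)] smooth_fst[OF c1(2)] smooth_snd[OF c1(2)])
  moreover have "smooth_map MG MS (\<lambda>g. (\<one>\<^bsub>H\<^esub>, g))" by (intro smooth_Pair smooth_id H.smooth_constant) simp
  moreover have "smooth_map MS MS (\<lambda>x. (inv\<^bsub>H\<^esub> (fst x), \<tau> (fst x) \<otimes>\<^bsub>G\<^esub> snd x))"
    by (intro smooth_Pair H.smooth_inv smooth_TG_tgt C smooth_fst[OF smooth_id])
  ultimately show ?thesis
    unfolding lie_groupoid_def TG_simps
    using manifold_MS G.mfd submersion_TG_src submersion_TG_tgt
    by (auto simp: H.m_assoc G.m_assoc G.inv_cancel_left)
qed

theorem lie_two_group_TG: "lie_two_group TG"
  unfolding lie_two_group_def TG_simps(1,2,8,9)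
proof (intro conjI lie_groupoid_TG lie_group_semidirect G.lie)
  show "smooth_functor (prod_gpd (tg_gpd TG) (tg_gpd TG)) (tg_gpd TG) (\<lambda>(x, y). x \<otimes>\<^bsub>S\<^esub> y) (\<lambda>(x, y). x \<otimes>\<^bsub>G\<^esub> y)"
    unfolding smooth_functor_def
  proof (intro conjI ballI impI, unfold prod_gpd_simps TG_simps)
    show "smooth_map (prod_mfd MS MS) MS (\<lambda>(x, y). x \<otimes>\<^bsub>S\<^esub> y)" using lie_group_semidirect unfolding lie_group_def by blast
    show "smooth_map (prod_mfd MG MG) MG (\<lambda>(x, y). x \<otimes>\<^bsub>G\<^esub> y)" using lie_groupD(6)[OF G.lie] .
  qed (auto simp: tau_alpha alpha_comp alpha_tau G.m_assoc H.m_assoc G.inv_cancel_left H.inv_cancel_left)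
qed

end

section \<open>Submersions under composition and base change\<close>

lemma pointed_fib_prod: "pointed M \<Longrightarrow> pointed N \<Longrightarrow> pointed (fib_prod M N f g)"
  unfolding fib_prod_def by (intro pointed_sub pointed_prod)

lemma submersion_compose:
  assumes M: "charted M" and N: "charted N" and f: "submersion M N f" and g: "submersion N P g"
  shows "submersion M P (\<lambda>x. g (f x))"
  unfolding submersion_def
proof (intro conjI ballI)
  have fs: "smooth_map M N f" and gs: "smooth_map N P g" using f g unfolding submersion_def by blast+
  show "smooth_map M P (\<lambda>x. g (f x))" by (rule smooth_map_compose[OF charted_pointed[OF M] fs gs])
  fix p assume p: "p \<in> pts M"
  have "mderiv M P (\<lambda>x. g (f x)) p ` tspace M p = mderiv N P g (f p) ` (mderiv M N f p ` tspace M p)"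
    unfolding image_image by (rule image_cong[OF refl]) (rule mderiv_compose[OF M N p fs gs])
  also have "\<dots> = tspace P (g (f p))"
    using f g p smooth_map_pts[OF fs p] unfolding submersion_def by simp
  finally show "mderiv M P (\<lambda>x. g (f x)) p ` tspace M p = tspace P (g (f p))" .
qed

lemma submersion_fst:
  assumes M: "charted M" and N: "charted N"
  shows "submersion (prod_mfd M N) M fst"
proof (rule submersion_by_sections[OF charted_prod[OF M N] M smooth_fst[OF smooth_id]])
  fix p assume "p \<in> pts (prod_mfd M N)"
  then have p: "snd p \<in> pts N" by auto
  have "smooth_map M (prod_mfd M N) (\<lambda>y. (y, snd p))"
    by (rule smooth_Pair[OF smooth_id smooth_const[OF charted_pointed[OF N] p]])
  then show "\<exists>s. smooth_map M (prod_mfd M N) s \<and> s (fst p) = p \<and> (\<forall>y\<in>pts M. fst (s y) = y)"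
    by (intro exI[of _ "\<lambda>y. (y, snd p)"]) simp
qed

lemma submersion_involution:
  assumes M: "charted M" and f: "smooth_map M M f" and i: "\<And>x. x \<in> pts M \<Longrightarrow> f (f x) = x"
  shows "submersion M M f"
proof (rule submersion_by_sections[OF M M f])
  fix p assume "p \<in> pts M"
  then show "\<exists>s. smooth_map M M s \<and> s (f p) = p \<and> (\<forall>y\<in>pts M. f (s y) = y)"
    using f i by (intro exI[of _ f]) simp
qed

text \<open>A tangent vector \<open>v\<close> of \<open>P\<close> extends to a tangent vector of the fibre product because its image under
  the differential of \<open>k\<close> is hit by the differential of the submersion.\<close>

lemma submersion_fib_prod_snd:
  assumes M: "manifold M" and P: "charted P" and N: "manifold N" and f: "submersion M N f" and k: "smooth_map P N k"
  shows "submersion (fib_prod M P f k) P snd"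
  unfolding submersion_def
proof (intro conjI ballI)
  note MC = manifold_charted[OF M] and NC = manifold_charted[OF N]
  let ?F = "fib_prod M P f k"
  show s: "smooth_map ?F P snd" by (rule smooth_fib_prod_snd[OF smooth_id])
  fix pq assume pq: "pq \<in> pts ?F"
  then obtain p q where pq': "pq = (p, q)" and p: "p \<in> pts M" "q \<in> pts P" "f p = k q" by (auto simp: fib_prod_def)
  note T = tspace_fib_prod[OF M P N f k p]
  have d: "mderiv ?F P snd pq z = snd z" if z: "z \<in> tspace ?F pq" for z
  proof -
    have pq2: "pq \<in> pts (prod_mfd M P) \<inter> {(x, y). f x = k y}" using p pq' by auto
    have "z \<in> tspace (prod_mfd M P) pq" using z T p unfolding pq' by (auto simp: tspace_prod[OF MC P])
    then show ?thesis
      using mderiv_restrict[OF charted_prod[OF MC P] pq2 smooth_snd[OF smooth_id]] z pq2 mderiv_snd[OF MC P]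
      unfolding fib_prod_def by simp
  qed
  show "mderiv ?F P snd pq ` tspace ?F pq = tspace P (snd pq)"
  proof (intro equalityI subsetI)
    fix v assume "v \<in> mderiv ?F P snd pq ` tspace ?F pq"
    then show "v \<in> tspace P (snd pq)" using d T unfolding pq' by auto
  next
    fix v assume v: "v \<in> tspace P (snd pq)"
    then have v': "v \<in> tspace P q" using pq' by simp
    have "mderiv P N k q v \<in> tspace N (f p)" using mderiv_tspace[OF P NC p(2) k v'] p(3) by simp
    then obtain u where u: "u \<in> tspace M p" "mderiv M N f p u = mderiv P N k q v"
      using f p(1) unfolding submersion_def by (metis imageE)
    then have uv: "(u, v) \<in> tspace ?F pq" using T v' unfolding pq' by simp
    show "v \<in> mderiv ?F P snd pq ` tspace ?F pq"
      by (rule rev_image_eqI[OF uv]) (simp add: d[OF uv])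
  qed
qed

lemma smooth_openin_preimage:
  assumes M: "charted M" and N: "charted N" and f: "smooth_map M N f" and U: "openin (mfd_topology N) U"
  shows "openin (mfd_topology M) {x \<in> pts M. f x \<in> U}"
  unfolding openin_mfd[OF M]
proof (intro conjI ballI)
  fix x assume x: "x \<in> {x \<in> pts M. f x \<in> U}"
  then have xM: "x \<in> pts M" and fx: "f x \<in> U" by auto
  obtain Q where Q: "open Q" "chart N (f x) (f x) \<in> Q" "\<And>y. y \<in> cdom N (f x) \<Longrightarrow> chart N (f x) y \<in> Q \<Longrightarrow> y \<in> U"
    using openin_mfdD[OF N U fx] by blast
  obtain W g where W: "local_rep M x x (\<lambda>y. chart N (f x) (f y)) W g"
    "\<And>y. y \<in> cdom M x \<Longrightarrow> chart M x y \<in> W \<Longrightarrow> f y \<in> cdom N (f x)"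
    using smooth_map_local_rep[OF f xM] by metis
  have g: "open W" "chart M x x \<in> W" "Cinf_on W g" "\<And>y. y \<in> cdom M x \<Longrightarrow> chart M x y \<in> W \<Longrightarrow> g (chart M x y) = chart N (f x) (f y)"
    using W(1) unfolding local_rep_def by blast+
  show "\<exists>R. open R \<and> chart M x x \<in> R \<and> (\<forall>y\<in>cdom M x. chart M x y \<in> R \<longrightarrow> y \<in> {x \<in> pts M. f x \<in> U})"
    by (rule exI[of _ "W \<inter> g -` Q"])
       (use W g Q open_preimage_Cinf[OF g(1,3) Q(1)] chartedD(1,2)[OF M xM] in auto)
qed auto

lemma diffeoI:
  assumes N: "pointed N" and f: "smooth_map M N f" and g: "smooth_map N M g"
    and gf: "\<And>x. x \<in> pts M \<Longrightarrow> g (f x) = x" and fg: "\<And>y. y \<in> pts N \<Longrightarrow> f (g y) = y"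
  shows "diffeo M N f"
  unfolding diffeo_def
proof (intro conjI f)
  show b: "bij_betw f (pts M) (pts N)"
    by (rule bij_betw_byWitness[where f' = g]) (use gf fg smooth_map_pts[OF f] smooth_map_pts[OF g] in auto)
  show "smooth_map N M (inv_into (pts M) f)"
  proof (rule smooth_map_cong[OF N _ g])
    fix y assume y: "y \<in> pts N"
    show "inv_into (pts M) f y = g y"
      by (rule inv_into_f_eq[OF bij_betw_imp_inj_on[OF b] smooth_map_pts[OF g y] fg[OF y]])
  qed
qed

section \<open>The decorated bundle\<close>

locale decorated_bundle = lie_crossed_module MG G MH H \<tau> \<alpha>
  for MG :: "('g, 'k::euclidean_space) mfd" and G :: "'g monoid"
    and MH :: "('h, 'l::euclidean_space) mfd" and H :: "'h monoid"
    and \<tau> :: "'h \<Rightarrow> 'g" and \<alpha> :: "'g \<times> 'h \<Rightarrow> 'h" +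
  fixes X :: "('x1, 'm1::euclidean_space, 'x0, 'm0::euclidean_space) gpd"
    and E :: "('e, 'f::euclidean_space) mfd" and \<pi> :: "'e \<Rightarrow> 'x0"
    and R :: "'e \<times> 'g \<Rightarrow> 'e" and \<mu> :: "'x1 \<times> 'e \<Rightarrow> 'e"
  assumes gb: "groupoid_bundle X MG G E \<pi> R \<mu>"
begin

abbreviation sE where "sE \<equiv> fib_prod (arr X) E (src X) \<pi>"
abbreviation DA where "DA \<equiv> prod_mfd sE MH"
abbreviation D where "D \<equiv> dec_gpd X G MH H \<tau> E \<pi> R \<mu>"
abbreviation R1 :: "(('x1 \<times> 'e) \<times> 'h) \<times> ('h \<times> 'g) \<Rightarrow> ('x1 \<times> 'e) \<times> 'h" where "R1 \<equiv> dec_action G H \<alpha> R"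

lemma X_groupoid: "lie_groupoid X" and E_principal: "principal_bundle (obj X) MG G E \<pi> R"
  and mu_smooth: "smooth_map sE E \<mu>"
  using gb unfolding groupoid_bundle_def by blast+

lemma X1_mfd: "manifold (arr X)" and X0_mfd: "manifold (obj X)"
  and src_submersion: "submersion (arr X) (obj X) (src X)"
  and X_comp_smooth: "smooth_map (composable X) (arr X) (gcomp X)"
  and X_unit_smooth: "smooth_map (obj X) (arr X) (gunit X)" and X_inv_smooth: "smooth_map (arr X) (arr X) (ginv X)"
  and src_smooth: "smooth_map (arr X) (obj X) (src X)"
  using X_groupoid unfolding lie_groupoid_def submersion_def by blast+

lemma E_mfd: "manifold E" and pi_smooth: "smooth_map E (obj X) \<pi>" and R_smooth: "smooth_map (prod_mfd E MG) E R"
  using E_principal unfolding principal_bundle_def right_action_def by blast+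

lemma E_charted: "charted E" and X1_charted: "charted (arr X)" and X0_charted: "charted (obj X)"
  using manifold_charted E_mfd X1_mfd X0_mfd by blast+

lemma sE_mfd: "manifold sE" by (rule manifold_fib_prod[OF X1_mfd E_mfd X0_mfd src_submersion pi_smooth])
lemma sE_charted: "charted sE" by (rule manifold_charted[OF sE_mfd])
lemma DA_mfd: "manifold DA" by (rule manifold_prod[OF sE_mfd H.mfd])
lemma DA_charted: "charted DA" by (rule manifold_charted[OF DA_mfd])

lemmas pointed_E = charted_pointed[OF E_charted] and pointed_DA = charted_pointed[OF DA_charted]

lemma pts_sE: "pts sE = {(\<gamma>, p). \<gamma> \<in> pts (arr X) \<and> p \<in> pts E \<and> src X \<gamma> = \<pi> p}"
  by (auto simp: fib_prod_def)

lemma pts_DA: "pts DA = {((\<gamma>, p), h) | \<gamma> p h. \<gamma> \<in> pts (arr X) \<and> p \<in> pts E \<and> src X \<gamma> = \<pi> p \<and> h \<in> carrier H}"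
  by (auto simp: pts_sE)

lemma D_simps [simp]:
  "arr D = DA" "obj D = E" "src D = (\<lambda>z. snd (fst z))"
  "tgt D = (\<lambda>z. R (\<mu> (fst z), \<tau> (inv\<^bsub>H\<^esub> (snd z))))"
  "gcomp D = (\<lambda>w. ((gcomp X (fst (fst (fst w)), fst (fst (snd w))), snd (fst (snd w))), snd (fst w) \<otimes>\<^bsub>H\<^esub> snd (snd w)))"
  "gunit D = (\<lambda>p. ((gunit X (\<pi> p), p), \<one>\<^bsub>H\<^esub>))"
  "ginv D = (\<lambda>z. ((ginv X (fst (fst z)), R (\<mu> (fst z), \<tau> (inv\<^bsub>H\<^esub> (snd z)))), inv\<^bsub>H\<^esub> (snd z)))"
  by (simp_all add: dec_gpd_def case_prod_beta' fun_eq_iff)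

lemma R1_def: "R1 w = ((fst (fst (fst w)), R (snd (fst (fst w)), snd (snd w))),
    \<alpha> (inv\<^bsub>G\<^esub> (snd (snd w)), inv\<^bsub>H\<^esub> (fst (snd w)) \<otimes>\<^bsub>H\<^esub> snd (fst w)))"
  by (simp add: dec_action_def case_prod_beta)

lemma dec_proj_eq: "dec_proj = (\<lambda>z. fst (fst z))"
  by (simp add: dec_proj_def case_prod_beta')

lemma alpha_inv_tau:
  "h \<in> carrier H \<Longrightarrow> h' \<in> carrier H \<Longrightarrow> \<alpha> (inv\<^bsub>G\<^esub> (\<tau> h), h') = inv\<^bsub>H\<^esub> h \<otimes>\<^bsub>H\<^esub> h' \<otimes>\<^bsub>H\<^esub> h"
  using alpha_tau[of "inv\<^bsub>H\<^esub> h" h'] by simp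

subsection \<open>Algebra of the groupoid and its action\<close>

lemma X_src_tgt_pts [simp]: "\<gamma> \<in> pts (arr X) \<Longrightarrow> src X \<gamma> \<in> pts (obj X)" "\<gamma> \<in> pts (arr X) \<Longrightarrow> tgt X \<gamma> \<in> pts (obj X)"
  "x \<in> pts (obj X) \<Longrightarrow> gunit X x \<in> pts (arr X)" "\<gamma> \<in> pts (arr X) \<Longrightarrow> ginv X \<gamma> \<in> pts (arr X)"
  using X_groupoid smooth_map_pts unfolding lie_groupoid_def submersion_def by metis+

lemma X_comp_pts [simp]:
  "b \<in> pts (arr X) \<Longrightarrow> a \<in> pts (arr X) \<Longrightarrow> src X b = tgt X a \<Longrightarrow> gcomp X (b, a) \<in> pts (arr X)"
  using smooth_map_pts[OF X_comp_smooth, of "(b, a)"] by (simp add: composable_def fib_prod_def)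

lemma X_laws [simp]:
  "x \<in> pts (obj X) \<Longrightarrow> src X (gunit X x) = x" "x \<in> pts (obj X) \<Longrightarrow> tgt X (gunit X x) = x"
  "b \<in> pts (arr X) \<Longrightarrow> a \<in> pts (arr X) \<Longrightarrow> src X b = tgt X a \<Longrightarrow> src X (gcomp X (b, a)) = src X a"
  "b \<in> pts (arr X) \<Longrightarrow> a \<in> pts (arr X) \<Longrightarrow> src X b = tgt X a \<Longrightarrow> tgt X (gcomp X (b, a)) = tgt X b"
  "a \<in> pts (arr X) \<Longrightarrow> src X a = x \<Longrightarrow> gcomp X (a, gunit X x) = a"
  "a \<in> pts (arr X) \<Longrightarrow> gcomp X (gunit X (tgt X a), a) = a"
  "a \<in> pts (arr X) \<Longrightarrow> src X (ginv X a) = tgt X a" "a \<in> pts (arr X) \<Longrightarrow> tgt X (ginv X a) = src X a"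
  "a \<in> pts (arr X) \<Longrightarrow> gcomp X (ginv X a, a) = gunit X (src X a)"
  "a \<in> pts (arr X) \<Longrightarrow> gcomp X (a, ginv X a) = gunit X (tgt X a)"
  using X_groupoid unfolding lie_groupoid_def by blast+

lemma X_assoc:
  "c \<in> pts (arr X) \<Longrightarrow> b \<in> pts (arr X) \<Longrightarrow> a \<in> pts (arr X) \<Longrightarrow> src X c = tgt X b \<Longrightarrow> src X b = tgt X a \<Longrightarrow>
   gcomp X (gcomp X (c, b), a) = gcomp X (c, gcomp X (b, a))"
  using X_groupoid unfolding lie_groupoid_def by blast

lemma pi_pts [simp]: "p \<in> pts E \<Longrightarrow> \<pi> p \<in> pts (obj X)"
  by (rule smooth_map_pts[OF pi_smooth])

lemma R_pts [simp]: "p \<in> pts E \<Longrightarrow> g \<in> carrier G \<Longrightarrow> R (p, g) \<in> pts E"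
  using smooth_map_pts[OF R_smooth, of "(p, g)"] by simp

lemma mu_pts [simp]: "\<gamma> \<in> pts (arr X) \<Longrightarrow> p \<in> pts E \<Longrightarrow> src X \<gamma> = \<pi> p \<Longrightarrow> \<mu> (\<gamma>, p) \<in> pts E"
  using smooth_map_pts[OF mu_smooth, of "(\<gamma>, p)"] by (simp add: pts_sE)

lemma action_laws [simp]:
  "p \<in> pts E \<Longrightarrow> R (p, \<one>\<^bsub>G\<^esub>) = p"
  "p \<in> pts E \<Longrightarrow> g \<in> carrier G \<Longrightarrow> g' \<in> carrier G \<Longrightarrow> R (R (p, g), g') = R (p, g \<otimes>\<^bsub>G\<^esub> g')"
  "p \<in> pts E \<Longrightarrow> g \<in> carrier G \<Longrightarrow> \<pi> (R (p, g)) = \<pi> p"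
  using E_principal unfolding principal_bundle_def right_action_def by blast+

lemma mu_laws [simp]:
  "\<gamma> \<in> pts (arr X) \<Longrightarrow> p \<in> pts E \<Longrightarrow> src X \<gamma> = \<pi> p \<Longrightarrow> \<pi> (\<mu> (\<gamma>, p)) = tgt X \<gamma>"
  "p \<in> pts E \<Longrightarrow> \<mu> (gunit X (\<pi> p), p) = p"
  "\<gamma>2 \<in> pts (arr X) \<Longrightarrow> \<gamma>1 \<in> pts (arr X) \<Longrightarrow> p \<in> pts E \<Longrightarrow> src X \<gamma>2 = tgt X \<gamma>1 \<Longrightarrow> src X \<gamma>1 = \<pi> p \<Longrightarrow>
     \<mu> (\<gamma>2, \<mu> (\<gamma>1, p)) = \<mu> (gcomp X (\<gamma>2, \<gamma>1), p)"
  "\<gamma> \<in> pts (arr X) \<Longrightarrow> p \<in> pts E \<Longrightarrow> g \<in> carrier G \<Longrightarrow> src X \<gamma> = \<pi> p \<Longrightarrow> \<mu> (\<gamma>, R (p, g)) = R (\<mu> (\<gamma>, p), g)"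
  using gb unfolding groupoid_bundle_def by simp_all

subsection \<open>Smoothness of the structure maps\<close>

lemma smooth_R: "pointed P \<Longrightarrow> smooth_map P E a \<Longrightarrow> smooth_map P MG b \<Longrightarrow> smooth_map P E (\<lambda>x. R (a x, b x))"
  using smooth_map_compose[OF _ smooth_Pair R_smooth] .

lemma smooth_mu: "pointed P \<Longrightarrow> smooth_map P sE a \<Longrightarrow> smooth_map P E (\<lambda>x. \<mu> (a x))"
  using smooth_map_compose[OF _ _ mu_smooth] .

lemma DA_projections:
  assumes "smooth_map P DA f"
  shows "smooth_map P sE (\<lambda>x. fst (f x))" "smooth_map P (arr X) (\<lambda>x. fst (fst (f x)))"
    "smooth_map P E (\<lambda>x. snd (fst (f x)))" "smooth_map P MH (\<lambda>x. snd (f x))"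
proof -
  show s: "smooth_map P sE (\<lambda>x. fst (f x))" by (rule smooth_fst[OF assms])
  show "smooth_map P (arr X) (\<lambda>x. fst (fst (f x)))" by (rule smooth_fib_prod_fst[OF s])
  show "smooth_map P E (\<lambda>x. snd (fst (f x)))" by (rule smooth_fib_prod_snd[OF s])
  show "smooth_map P MH (\<lambda>x. snd (f x))" by (rule smooth_snd[OF assms])
qed

lemma smooth_into_DA:
  assumes "pointed P" "smooth_map P (arr X) a" "smooth_map P E b" "smooth_map P MH c"
    "\<And>x. x \<in> pts P \<Longrightarrow> src X (a x) = \<pi> (b x)"
  shows "smooth_map P DA (\<lambda>x. ((a x, b x), c x))"
  by (intro smooth_Pair smooth_into_fib_prod assms)

lemma smooth_tgt_D: "smooth_map DA E (tgt D)"
  unfolding D_simps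
  by (intro smooth_R pointed_DA smooth_mu smooth_tau H.smooth_inv DA_projections[OF smooth_id])

lemma submersion_src_D: "submersion DA E (src D)"
  unfolding D_simps
  by (rule submersion_compose[OF DA_charted sE_charted submersion_fst[OF sE_charted H.charted]
        submersion_fib_prod_snd[OF X1_mfd E_charted X0_mfd src_submersion pi_smooth]])

lemma smooth_inv_D: "smooth_map DA DA (ginv D)"
  unfolding D_simps
proof (rule smooth_into_DA[OF pointed_DA])
  show "smooth_map DA (arr X) (\<lambda>z. ginv X (fst (fst z)))"
    by (rule smooth_map_compose[OF pointed_DA DA_projections(2)[OF smooth_id] X_inv_smooth])
  show "smooth_map DA E (\<lambda>z. R (\<mu> (fst z), \<tau> (inv\<^bsub>H\<^esub> (snd z))))" using smooth_tgt_D unfolding D_simps .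
  show "smooth_map DA MH (\<lambda>z. inv\<^bsub>H\<^esub> (snd z))" by (intro H.smooth_inv pointed_DA DA_projections(4)[OF smooth_id])
qed (auto simp: pts_DA simp del: pts_prod)

text \<open>Inversion is a diffeomorphism that exchanges source and target.\<close>

lemma submersion_tgt_D: "submersion DA E (tgt D)"
proof -
  have "submersion DA DA (ginv D)"
  proof (rule submersion_involution[OF DA_charted smooth_inv_D])
    fix z assume z: "z \<in> pts DA"
    have "ginv X (ginv X a) = a" if a: "a \<in> pts (arr X)" for a
    proof -
      have "gcomp X (ginv X (ginv X a), gcomp X (ginv X a, a)) = gcomp X (gcomp X (ginv X (ginv X a), ginv X a), a)"
        using a by (intro X_assoc[symmetric]) auto
      then show ?thesis using a X_laws(5)[of "ginv X (ginv X a)"] by simp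
    qed
    then show "ginv D (ginv D z) = z" using z unfolding pts_DA by (auto simp del: pts_prod)
  qed
  from submersion_compose[OF DA_charted DA_charted this submersion_src_D] show ?thesis by simp
qed

lemma lie_groupoid_D: "lie_groupoid D"
proof -
  let ?C = "composable D"
  have C: "pointed ?C" 
    unfolding composable_def D_simps by (rule pointed_fib_prod[OF pointed_DA pointed_DA])
  have c1: "smooth_map ?C DA fst" "smooth_map ?C DA snd"
    unfolding composable_def D_simps by (rule smooth_fib_prod_fst[OF smooth_id] smooth_fib_prod_snd[OF smooth_id])+
  have pC: "fst w \<in> pts DA \<and> snd w \<in> pts DA \<and> snd (fst (fst w)) = R (\<mu> (fst (snd w)), \<tau> (inv\<^bsub>H\<^esub> (snd (snd w))))" if "w \<in> pts ?C" for w
    using that unfolding composable_def fib_prod_def D_simps by auto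
  have xC: "src X (fst (fst (fst w))) = tgt X (fst (fst (snd w)))" if w: "w \<in> pts ?C" for w
  proof -
    obtain \<gamma>2 p2 h2 \<gamma>1 p1 h1 where "w = (((\<gamma>2, p2), h2), ((\<gamma>1, p1), h1))" by (metis surj_pair)
    then show ?thesis using pC[OF w] unfolding pts_DA by auto
  qed
  have comp: "smooth_map ?C DA (gcomp D)"
    unfolding D_simps
  proof (rule smooth_into_DA[OF C])
    have "smooth_map ?C (composable X) (\<lambda>w. (fst (fst (fst w)), fst (fst (snd w))))"
      unfolding composable_def[of X]
      by (rule smooth_into_fib_prod[OF C DA_projections(2)[OF c1(1)] DA_projections(2)[OF c1(2)]]) (rule xC)
    from smooth_map_compose[OF C this X_comp_smooth]
    show "smooth_map ?C (arr X) (\<lambda>w. gcomp X (fst (fst (fst w)), fst (fst (snd w))))" .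
    show "smooth_map ?C E (\<lambda>w. snd (fst (snd w)))" by (rule DA_projections(3)[OF c1(2)])
    show "smooth_map ?C MH (\<lambda>w. snd (fst w) \<otimes>\<^bsub>H\<^esub> snd (snd w))"
      by (rule H.smooth_mult[OF C DA_projections(4)[OF c1(1)] DA_projections(4)[OF c1(2)]])
    fix w assume w: "w \<in> pts ?C"
    then show "src X (gcomp X (fst (fst (fst w)), fst (fst (snd w)))) = \<pi> (snd (fst (snd w)))"
      using pC[OF w] xC[OF w] unfolding pts_DA by auto
  qed
  have unit: "smooth_map E DA (gunit D)"
    unfolding D_simps
    by (rule smooth_into_DA[OF pointed_E smooth_map_compose[OF pointed_E pi_smooth X_unit_smooth] smooth_id H.smooth_constant]) auto
  show ?thesis
    unfolding lie_groupoid_def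
  proof (intro conjI ballI impI; (unfold D_simps(1,2))?)
    show "manifold DA" "manifold E" by (rule DA_mfd E_mfd)+
    show "submersion DA E (src D)" "submersion DA E (tgt D)" by (rule submersion_src_D submersion_tgt_D)+
    show "smooth_map ?C DA (gcomp D)" "smooth_map E DA (gunit D)" "smooth_map DA DA (ginv D)"
      by (rule comp unit smooth_inv_D)+
    show "src D (gunit D p) = p" "tgt D (gunit D p) = p" if "p \<in> pts E" for p using that by simp_all
    fix a assume a: "a \<in> pts DA"
    show "gcomp D (a, gunit D (src D a)) = a" "gcomp D (gunit D (tgt D a), a) = a"
      "src D (ginv D a) = tgt D a" "tgt D (ginv D a) = src D a"
      "gcomp D (ginv D a, a) = gunit D (src D a)" "gcomp D (a, ginv D a) = gunit D (tgt D a)"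
      using a unfolding pts_DA by auto
    fix b assume b: "b \<in> pts DA"
    show "src D (gcomp D (b, a)) = src D a" by simp
    show "tgt D (gcomp D (b, a)) = tgt D b" if "src D b = tgt D a"
      using that a b unfolding pts_DA by (auto simp: H.inv_mult_group)
    fix c assume c: "c \<in> pts DA"
    show "gcomp D (gcomp D (c, b), a) = gcomp D (c, gcomp D (b, a))" if "src D c = tgt D b \<and> src D b = tgt D a"
      using that a b c unfolding pts_DA by (auto simp: H.m_assoc X_assoc)
  qed
qed

subsection \<open>The principal action\<close>

lemma smooth_R1: "smooth_map (prod_mfd DA MS) DA R1"
proof -
  have P: "pointed (prod_mfd DA MS)" by (intro pointed_prod pointed_DA pointed_MS)
  note f = smooth_fst[OF smooth_id, of DA MS] and s = smooth_snd[OF smooth_id, of DA MS]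
  have "smooth_map (prod_mfd DA MS) DA (\<lambda>w. ((fst (fst (fst w)), R (snd (fst (fst w)), snd (snd w))),
    \<alpha> (inv\<^bsub>G\<^esub> (snd (snd w)), inv\<^bsub>H\<^esub> (fst (snd w)) \<otimes>\<^bsub>H\<^esub> snd (fst w))))"
    by (rule smooth_into_DA[OF P DA_projections(2)[OF f] smooth_R[OF P DA_projections(3)[OF f] smooth_snd[OF s]]
          smooth_alpha[OF P G.smooth_inv[OF P smooth_snd[OF s]]
            H.smooth_mult[OF P H.smooth_inv[OF P smooth_fst[OF s]] DA_projections(4)[OF f]]]])
       (auto simp: pts_sE)
  then show ?thesis unfolding R1_def[abs_def] .
qed

lemma R1_mult:
  assumes "z \<in> pts DA" "a \<in> carrier S" "b \<in> carrier S"
  shows "R1 (R1 (z, a), b) = R1 (z, a \<otimes>\<^bsub>S\<^esub> b)"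
  using assms unfolding pts_DA
  by (auto simp: R1_def alpha_comp alpha_inv G.inv_mult_group H.inv_mult_group H.m_assoc)

lemma R1_one: "z \<in> pts DA \<Longrightarrow> R1 (z, \<one>\<^bsub>S\<^esub>) = z"
  unfolding pts_DA by (auto simp: R1_def)

text \<open>Over the arrows with source in \<open>U\<close>, a local trivialisation \<open>\<Phi>\<close> of \<open>E\<close> over \<open>U\<close> gives the
  trivialisation that sends \<open>(\<gamma>, (h, g))\<close> to the translate of \<open>(\<gamma>, \<Phi>(s(\<gamma>), e), e)\<close> by \<open>(h, g)\<close>.\<close>

lemma dec_local_trivialisation:
  assumes x: "x \<in> pts (arr X)"
  shows "\<exists>U \<Phi>. openin (mfd_topology (arr X)) U \<and> x \<in> U \<and>
        diffeo (prod_mfd (sub_mfd (arr X) U) MS) (sub_mfd DA (dec_proj -` U)) \<Phi> \<and>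
        (\<forall>y\<in>U. \<forall>g\<in>carrier S. dec_proj (\<Phi> (y, g)) = y \<and>
           (\<forall>h\<in>carrier S. R1 (\<Phi> (y, g), h) = \<Phi> (y, g \<otimes>\<^bsub>S\<^esub> h)))"
proof -
  have "src X x \<in> pts (obj X)" using x by simp
  then obtain U \<Phi> where U: "openin (mfd_topology (obj X)) U" "src X x \<in> U"
    and d: "diffeo (prod_mfd (sub_mfd (obj X) U) MG) (sub_mfd E (\<pi> -` U)) \<Phi>"
    and triv: "\<And>y g. y \<in> U \<Longrightarrow> g \<in> carrier G \<Longrightarrow> \<pi> (\<Phi> (y, g)) = y"
      "\<And>y g h. y \<in> U \<Longrightarrow> g \<in> carrier G \<Longrightarrow> h \<in> carrier G \<Longrightarrow> R (\<Phi> (y, g), h) = \<Phi> (y, g \<otimes>\<^bsub>G\<^esub> h)"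
    using E_principal unfolding principal_bundle_def by metis
  let ?PU = "prod_mfd (sub_mfd (obj X) U) MG" and ?EU = "sub_mfd E (\<pi> -` U)"
  define V where "V = {\<gamma> \<in> pts (arr X). src X \<gamma> \<in> U}"
  have V: "openin (mfd_topology (arr X)) V" unfolding V_def by (rule smooth_openin_preimage[OF X1_charted X0_charted src_smooth U(1)])
  have sm: "smooth_map ?PU ?EU \<Phi>" and bij: "bij_betw \<Phi> (pts ?PU) (pts ?EU)"
    and smi': "smooth_map ?EU ?PU (inv_into (pts ?PU) \<Phi>)" using d unfolding diffeo_def by blast+
  define i where "i = inv_into (pts ?PU) \<Phi>"
  have smi: "smooth_map ?EU ?PU i" using smi' unfolding i_def .
  have Upts: "U \<subseteq> pts (obj X)" by (rule openin_mfd_subset[OF X0_charted U(1)])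
  have Phi_pts: "\<Phi> (y, g) \<in> pts E" if "y \<in> U" "g \<in> carrier G" for y g
    using smooth_map_pts[OF sm, of "(y, g)"] that Upts by auto
  have iPhi: "i (\<Phi> (y, g)) = (y, g)" if "y \<in> U" "g \<in> carrier G" for y g
    using bij_betw_inv_into_left[OF bij, of "(y, g)"] that Upts unfolding i_def by auto
  have Phii: "\<Phi> (i q) = q \<and> fst (i q) = \<pi> q \<and> snd (i q) \<in> carrier G" if q: "q \<in> pts E" "\<pi> q \<in> U" for q
  proof -
    have q': "q \<in> pts ?EU" using q by simp
    have 1: "\<Phi> (i q) = q" unfolding i_def by (rule bij_betw_inv_into_right[OF bij q'])
    have 2: "i q \<in> pts ?PU" by (rule smooth_map_pts[OF smi q'])
    then have "\<pi> (\<Phi> (fst (i q), snd (i q))) = fst (i q)" by (intro triv(1)) auto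
    then show ?thesis using 1 2 by auto
  qed
  let ?P = "prod_mfd (sub_mfd (arr X) V) MS" and ?Q = "sub_mfd DA (dec_proj -` V)"
  have P: "pointed ?P" by (intro pointed_prod pointed_sub charted_pointed[OF X1_charted] pointed_MS)
  have Q: "pointed ?Q" by (intro pointed_sub pointed_DA)
  let ?F = "\<lambda>w. ((fst w, \<Phi> (src X (fst w), snd (snd w))), \<alpha> (inv\<^bsub>G\<^esub> (snd (snd w)), inv\<^bsub>H\<^esub> (fst (snd w))))"
  \<comment> \<open>The given trivialisation recovers \<open>g\<close> from the point of \<open>E\<close>; then \<open>h\<close> is recovered from the decoration \<open>\<alpha>\<^sub>g\<inverse>(h\<inverse>)\<close>.\<close>
  let ?Fi = "\<lambda>z. (fst (fst z), (\<alpha> (snd (i (snd (fst z))), inv\<^bsub>H\<^esub> (snd z)), snd (i (snd (fst z)))))"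
  have w1: "smooth_map ?P (arr X) fst" by (rule smooth_out_of_sub[OF smooth_fst[OF smooth_id]])
  note w2 = smooth_snd[OF smooth_id, of "sub_mfd (arr X) V" MS]
  have pP: "fst w \<in> pts (arr X)" "src X (fst w) \<in> U" "fst (snd w) \<in> carrier H" "snd (snd w) \<in> carrier G" if "w \<in> pts ?P" for w
    using that unfolding V_def by auto
  have F: "smooth_map ?P ?Q ?F"
  proof (rule smooth_into_sub[OF P smooth_into_DA[OF P w1]])
    have "smooth_map ?P (sub_mfd (obj X) U) (\<lambda>w. src X (fst w))"
      by (rule smooth_into_sub[OF P smooth_map_compose[OF P w1 src_smooth] pP(2)])
    from smooth_out_of_sub[OF smooth_map_compose[OF P smooth_Pair[OF this smooth_snd[OF w2]] sm]]
    show "smooth_map ?P E (\<lambda>w. \<Phi> (src X (fst w), snd (snd w)))" .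
    show "smooth_map ?P MH (\<lambda>w. \<alpha> (inv\<^bsub>G\<^esub> (snd (snd w)), inv\<^bsub>H\<^esub> (fst (snd w))))"
      by (rule smooth_alpha[OF P G.smooth_inv[OF P smooth_snd[OF w2]] H.smooth_inv[OF P smooth_fst[OF w2]]])
    show "src X (fst w) = \<pi> (\<Phi> (src X (fst w), snd (snd w)))" if "w \<in> pts ?P" for w
      using triv(1) pP[OF that] by simp
    show "?F w \<in> dec_proj -` V" if "w \<in> pts ?P" for w using that by (auto simp: dec_proj_eq)
  qed
  have pQ: "fst (fst z) \<in> pts (arr X)" "snd (fst z) \<in> pts E" "src X (fst (fst z)) = \<pi> (snd (fst z))"
    "\<pi> (snd (fst z)) \<in> U" "snd z \<in> carrier H" "fst (fst z) \<in> V" if "z \<in> pts ?Q" for z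
    using that by (auto simp: dec_proj_eq pts_sE V_def)
  have z: "smooth_map ?Q DA (\<lambda>z. z)" by (rule smooth_restrict[OF smooth_id])
  have Fi: "smooth_map ?Q ?P ?Fi"
  proof (rule smooth_Pair)
    show "smooth_map ?Q (sub_mfd (arr X) V) (\<lambda>z. fst (fst z))"
      by (rule smooth_into_sub[OF Q DA_projections(2)[OF z] pQ(6)])
    have "smooth_map ?Q ?EU (\<lambda>z. snd (fst z))"
      by (rule smooth_into_sub[OF Q DA_projections(3)[OF z]]) (use pQ(4) in auto)
    from smooth_snd[OF smooth_map_compose[OF Q this smi]]
    have g: "smooth_map ?Q MG (\<lambda>z. snd (i (snd (fst z))))" .
    show "smooth_map ?Q MS (\<lambda>z. (\<alpha> (snd (i (snd (fst z))), inv\<^bsub>H\<^esub> (snd z)), snd (i (snd (fst z)))))"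
      by (rule smooth_Pair[OF smooth_alpha[OF Q g H.smooth_inv[OF Q DA_projections(4)[OF z]]] g])
  qed
  have diff: "diffeo ?P ?Q ?F"
  proof (rule diffeoI[OF Q F Fi])
    fix w assume "w \<in> pts ?P"
    then show "?Fi (?F w) = w" using pP[of w] by (simp add: iPhi alpha_inv prod_eq_iff)
  next
    fix z assume zQ: "z \<in> pts ?Q"
    note q = pQ[OF zQ]
    have iq: "\<Phi> (i (snd (fst z))) = snd (fst z)" "fst (i (snd (fst z))) = \<pi> (snd (fst z))" "snd (i (snd (fst z))) \<in> carrier G"
      using Phii[OF q(2,4)] by blast+
    have "\<Phi> (src X (fst (fst z)), snd (i (snd (fst z)))) = snd (fst z)"
      using iq(1) unfolding q(3) iq(2)[symmetric] by simp
    then show "?F (?Fi z) = z" using q iq by (simp add: alpha_inv prod_eq_iff)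
  qed
  show ?thesis
  proof (rule exI[of _ V], rule exI[of _ ?F], intro conjI ballI)
    show "openin (mfd_topology (arr X)) V" by (rule V)
    show "x \<in> V" using x U(2) by (simp add: V_def)
    show "diffeo ?P ?Q ?F" by (rule diff)
    fix y g assume y: "y \<in> V" and g: "g \<in> carrier S"
    show "dec_proj (?F (y, g)) = y" by (simp add: dec_proj_eq)
    fix h assume "h \<in> carrier S"
    then show "R1 (?F (y, g), h) = ?F (y, g \<otimes>\<^bsub>S\<^esub> h)"
      using y g by (auto simp: V_def R1_def triv(2) alpha_comp alpha_inv G.inv_mult_group H.inv_mult_group)
  qed
qed

theorem principal_two_bundle_D: "principal_two_bundle X TG D dec_proj \<pi> R1 R"
  unfolding principal_two_bundle_def
proof (intro conjI X_groupoid lie_two_group_TG lie_groupoid_D)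
  show "smooth_functor D X dec_proj \<pi>"
    unfolding smooth_functor_def
  proof (intro conjI ballI impI; (unfold D_simps(1,2))?)
    show "smooth_map DA (arr X) dec_proj" unfolding dec_proj_eq by (rule DA_projections(2)[OF smooth_id])
    show "smooth_map E (obj X) \<pi>" by (rule pi_smooth)
  qed (auto simp: dec_proj_eq pts_sE)
  show "smooth_functor (prod_gpd D (tg_gpd TG)) D R1 R"
    unfolding smooth_functor_def
  proof (intro conjI ballI impI; (unfold prod_gpd_simps D_simps(1,2) TG_simps(1,2))?)
    show "smooth_map (prod_mfd DA MS) DA R1" by (rule smooth_R1)
    show "smooth_map (prod_mfd E MG) E R" by (rule R_smooth)
  qed (auto simp: R1_def pts_sE alpha_inv tau_alpha alpha_comp alpha_inv_tau G.inv_mult_group H.inv_mult_group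
      G.m_assoc H.m_assoc G.inv_cancel_left H.inv_cancel_left)
  show "principal_bundle (arr X) (arr (tg_gpd TG)) (grp1 TG) (arr D) dec_proj R1"
    unfolding principal_bundle_def TG_simps D_simps
  proof (intro conjI X1_mfd lie_group_semidirect DA_mfd ballI)
    show "smooth_map DA (arr X) dec_proj" unfolding dec_proj_eq by (rule DA_projections(2)[OF smooth_id])
    show "right_action DA MS S R1"
      unfolding right_action_def using smooth_R1 R1_one R1_mult by blast
    show "dec_proj (R1 (p, g)) = dec_proj p" for p g by (simp add: dec_proj_eq R1_def)
  qed (rule dec_local_trivialisation)
  show "principal_bundle (obj X) (obj (tg_gpd TG)) (grp0 TG) (obj D) \<pi> R"
    using E_principal by simp
qed

end

section \<open>Logarithmic derivatives\<close>

context lie_grp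
begin

text \<open>The vector \<open>v h\<inverse>\<close> of the Lie algebra, for \<open>v\<close> tangent to the group at \<open>h\<close>.\<close>

definition rlog :: "'g \<Rightarrow> 'k \<Rightarrow> 'k" where
  "rlog h = mderiv M M (\<lambda>x. x \<otimes> inv h) h"

lemma smooth_right_mult: "h \<in> carrier G \<Longrightarrow> smooth_map M M (\<lambda>x. x \<otimes> h)"
  by (intro smooth_mult pointed smooth_id smooth_constant)

lemma rlog_linear: "h \<in> carrier G \<Longrightarrow> linear (rlog h)"
  unfolding rlog_def by (rule mderiv_linear[OF charted _ smooth_right_mult]) auto

lemma rlog_closed: "h \<in> carrier G \<Longrightarrow> v \<in> tspace M h \<Longrightarrow> rlog h v \<in> lie_alg M G"
  unfolding rlog_def by (rule mderiv_in_lie_alg[OF charted _ smooth_right_mult]) auto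

lemma rlog_mderiv:
  assumes P: "charted P" "p \<in> pts P" and a: "smooth_map P M a" and v: "v \<in> tspace P p"
  shows "rlog (a p) (mderiv P M a p v) = mderiv P M (\<lambda>x. a x \<otimes> inv (a p)) p v"
proof -
  have "a p \<in> carrier G" using smooth_map_pts[OF a P(2)] by simp
  then show ?thesis
    unfolding rlog_def using mderiv_compose[OF P(1) charted P(2) a smooth_right_mult[OF inv_closed] v] by simp
qed

text \<open>\<open>a b (a\<^sub>0 b\<^sub>0)\<inverse> = (a a\<^sub>0\<inverse>) (a\<^sub>0 (b b\<^sub>0\<inverse>) a\<^sub>0\<inverse>)\<close>, where \<open>a\<^sub>0\<close> and \<open>b\<^sub>0\<close> are the values at the given point.\<close>

lemma rlog_mult:
  assumes P: "charted P" "p \<in> pts P" and a: "smooth_map P M a" and b: "smooth_map P M b" and v: "v \<in> tspace P p"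
  shows "rlog (a p \<otimes> b p) (mderiv P M (\<lambda>x. a x \<otimes> b x) p v)
    = rlog (a p) (mderiv P M a p v) + Ad M G (a p) (rlog (b p) (mderiv P M b p v))"
proof -
  note PP = charted_pointed[OF P(1)]
  have ab: "a p \<in> carrier G" "b p \<in> carrier G" using smooth_map_pts[OF a P(2)] smooth_map_pts[OF b P(2)] by auto
  have s1: "smooth_map P M (\<lambda>x. a x \<otimes> inv (a p))" and s2: "smooth_map P M (\<lambda>x. b x \<otimes> inv (b p))"
    and s3: "smooth_map P M (\<lambda>x. a p \<otimes> (b x \<otimes> inv (b p)) \<otimes> inv (a p))"
    using ab by (intro smooth_mult PP a b smooth_constant inv_closed; simp)+
  have "rlog (a p \<otimes> b p) (mderiv P M (\<lambda>x. a x \<otimes> b x) p v) = mderiv P M (\<lambda>x. a x \<otimes> b x \<otimes> inv (a p \<otimes> b p)) p v"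
    by (rule rlog_mderiv[OF P smooth_mult[OF PP a b] v])
  also have "\<dots> = mderiv P M (\<lambda>x. (a x \<otimes> inv (a p)) \<otimes> (a p \<otimes> (b x \<otimes> inv (b p)) \<otimes> inv (a p))) p v"
  proof (rule mderiv_cong[OF P _ _ smooth_mult[OF PP s1 s3] v])
    show "smooth_map P M (\<lambda>x. a x \<otimes> b x \<otimes> inv (a p \<otimes> b p))"
      using ab by (intro smooth_mult PP a b smooth_constant) simp
    fix x assume "x \<in> pts P"
    then have "a x \<in> carrier G" "b x \<in> carrier G" using smooth_map_pts[OF a] smooth_map_pts[OF b] by auto
    then show "a x \<otimes> b x \<otimes> inv (a p \<otimes> b p) = (a x \<otimes> inv (a p)) \<otimes> (a p \<otimes> (b x \<otimes> inv (b p)) \<otimes> inv (a p))"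
      using ab by (simp add: m_assoc inv_mult_group inv_cancel_left)
  qed
  also have "\<dots> = mderiv P M (\<lambda>x. a x \<otimes> inv (a p)) p v + mderiv P M (\<lambda>x. a p \<otimes> (b x \<otimes> inv (b p)) \<otimes> inv (a p)) p v"
    using ab by (intro mderiv_mult[OF P s1 _ s3 _ v]) auto
  also have "mderiv P M (\<lambda>x. a p \<otimes> (b x \<otimes> inv (b p)) \<otimes> inv (a p)) p v = Ad M G (a p) (mderiv P M (\<lambda>x. b x \<otimes> inv (b p)) p v)"
    using ab by (intro mderiv_conj[OF P s2 _ v]) auto
  finally show ?thesis unfolding rlog_mderiv[OF P a v] rlog_mderiv[OF P b v] .
qed

lemma rlog_const: "p \<in> pts P \<Longrightarrow> charted P \<Longrightarrow> v \<in> tspace P p \<Longrightarrow> g \<in> carrier G \<Longrightarrow> rlog g (mderiv P M (\<lambda>x. g) p v) = 0"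
  using mderiv_const[of P p M g v] pointed linear_0[OF rlog_linear] by simp

lemma Ad_inv_cancel:
  "g \<in> carrier G \<Longrightarrow> v \<in> lie_alg M G \<Longrightarrow> Ad M G (inv g) (Ad M G g v) = v"
  "g \<in> carrier G \<Longrightarrow> v \<in> lie_alg M G \<Longrightarrow> Ad M G g (Ad M G (inv g) v) = v"
proof -
  have 1: "Ad M G \<one> v = v" if v: "v \<in> lie_alg M G" for v
    using mderiv_cong[OF charted one_pts smooth_conj[OF one_closed] _ smooth_id] mderiv_id[OF charted one_pts] v
    unfolding Ad_def lie_alg_def by simp
  show "g \<in> carrier G \<Longrightarrow> v \<in> lie_alg M G \<Longrightarrow> Ad M G (inv g) (Ad M G g v) = v"
    "g \<in> carrier G \<Longrightarrow> v \<in> lie_alg M G \<Longrightarrow> Ad M G g (Ad M G (inv g) v) = v"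
    using Ad_mult[of "inv g" g v] Ad_mult[of g "inv g" v] 1 by simp_all
qed

lemma rlog_inv:
  assumes P: "charted P" "p \<in> pts P" and a: "smooth_map P M a" and v: "v \<in> tspace P p"
  shows "rlog (inv (a p)) (mderiv P M (\<lambda>x. inv (a x)) p v) = - Ad M G (inv (a p)) (rlog (a p) (mderiv P M a p v))"
proof -
  note PP = charted_pointed[OF P(1)]
  have ap: "a p \<in> carrier G" using smooth_map_pts[OF a P(2)] by simp
  have s: "smooth_map P M (\<lambda>x. inv (a x))" by (rule smooth_inv[OF PP a])
  have "rlog (inv (a p) \<otimes> a p) (mderiv P M (\<lambda>x. inv (a x) \<otimes> a x) p v) = rlog \<one> (mderiv P M (\<lambda>x. \<one>) p v)"
  proof -
    have "mderiv P M (\<lambda>x. inv (a x) \<otimes> a x) p v = mderiv P M (\<lambda>x. \<one>) p v"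
      by (rule mderiv_cong[OF P smooth_mult[OF PP s a] _ smooth_constant v]) (use smooth_map_pts[OF a] in auto)
    then show ?thesis using ap by simp
  qed
  also have "\<dots> = 0" by (rule rlog_const[OF P(2,1) v one_closed])
  finally show ?thesis using rlog_mult[OF P s a v] by (simp add: eq_neg_iff_add_eq_0)
qed

lemma smooth_rlog:
  assumes P: "pointed P" and f: "smooth_map P (TM M) f"
  shows "smooth_map P (vec_mfd (lie_alg M G)) (\<lambda>x. rlog (fst (f x)) (snd (f x)))"
proof -
  let ?m = "\<lambda>z. snd z \<otimes> inv (fst z)"
  have MM: "pointed (prod_mfd M M)" by (intro pointed_prod pointed)
  have m: "smooth_map (prod_mfd M M) M ?m"
    by (intro smooth_mult smooth_inv MM smooth_fst[OF smooth_id] smooth_snd[OF smooth_id])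
  have "smooth_map P (prod_mfd M (TM M)) (\<lambda>x. (fst (f x), f x))"
    by (rule smooth_Pair[OF smooth_map_compose[OF P f smooth_TM_base] f])
  from smooth_map_compose[OF P this smooth_partial_derivative[OF charted charted charted m]]
  have "smooth_map P (TM M) (\<lambda>x. (fst (f x) \<otimes> inv (fst (f x)), rlog (fst (f x)) (snd (f x))))"
    by (simp add: rlog_def)
  moreover have "fst (f x) \<otimes> inv (fst (f x)) = \<one>" if "x \<in> pts P" for x
    using smooth_map_pts[OF smooth_map_compose[OF P f smooth_TM_base] that] by simp
  ultimately show ?thesis
    unfolding lie_alg_def using smooth_into_fibre[OF charted P, of _ "\<one>"] by fastforce
qed

end

context lie_crossed_module
begin

lemma rlog_alpha:
  assumes P: "charted P" "p \<in> pts P" and a: "smooth_map P MH a" and v: "v \<in> tspace P p" and g: "g \<in> carrier G"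
  shows "H.rlog (\<alpha> (g, a p)) (mderiv P MH (\<lambda>x. \<alpha> (g, a x)) p v) = dalpha g (H.rlog (a p) (mderiv P MH a p v))"
proof -
  note PP = charted_pointed[OF P(1)]
  have ap: "a p \<in> carrier H" using smooth_map_pts[OF a P(2)] by simp
  have s1: "smooth_map P MH (\<lambda>x. \<alpha> (g, a x))" by (rule smooth_alpha[OF PP G.smooth_constant[OF g] a])
  have s2: "smooth_map P MH (\<lambda>x. a x \<otimes>\<^bsub>H\<^esub> inv\<^bsub>H\<^esub> (a p))"
    using ap by (intro H.smooth_mult PP a H.smooth_constant) simp
  have "H.rlog (\<alpha> (g, a p)) (mderiv P MH (\<lambda>x. \<alpha> (g, a x)) p v) = mderiv P MH (\<lambda>x. \<alpha> (g, a x) \<otimes>\<^bsub>H\<^esub> inv\<^bsub>H\<^esub> (\<alpha> (g, a p))) p v"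
    by (rule H.rlog_mderiv[OF P s1 v])
  also have "\<dots> = mderiv P MH (\<lambda>x. \<alpha> (g, a x \<otimes>\<^bsub>H\<^esub> inv\<^bsub>H\<^esub> (a p))) p v"
  proof (rule mderiv_cong[OF P _ _ smooth_alpha[OF PP G.smooth_constant[OF g] s2] v])
    show "smooth_map P MH (\<lambda>x. \<alpha> (g, a x) \<otimes>\<^bsub>H\<^esub> inv\<^bsub>H\<^esub> (\<alpha> (g, a p)))"
      using ap g by (intro H.smooth_mult PP s1 H.smooth_constant) simp
    fix x assume "x \<in> pts P"
    then have "a x \<in> carrier H" using smooth_map_pts[OF a] by simp
    then show "\<alpha> (g, a x) \<otimes>\<^bsub>H\<^esub> inv\<^bsub>H\<^esub> (\<alpha> (g, a p)) = \<alpha> (g, a x \<otimes>\<^bsub>H\<^esub> inv\<^bsub>H\<^esub> (a p))"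
      using ap g by (simp add: alpha_inv)
  qed
  also have "\<dots> = dalpha g (mderiv P MH (\<lambda>x. a x \<otimes>\<^bsub>H\<^esub> inv\<^bsub>H\<^esub> (a p)) p v)"
    unfolding dalpha_def using mderiv_compose[OF P(1) H.charted P(2) s2 smooth_alpha_fixed[OF g] v] ap by simp
  finally show ?thesis unfolding H.rlog_mderiv[OF P a v] .
qed

lemma rlog_tau:
  assumes P: "charted P" "p \<in> pts P" and a: "smooth_map P MH a" and v: "v \<in> tspace P p"
  shows "G.rlog (\<tau> (a p)) (mderiv P MG (\<lambda>x. \<tau> (a x)) p v) = dtau (H.rlog (a p) (mderiv P MH a p v))"
proof -
  note PP = charted_pointed[OF P(1)]
  have ap: "a p \<in> carrier H" using smooth_map_pts[OF a P(2)] by simp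
  have s1: "smooth_map P MG (\<lambda>x. \<tau> (a x))" by (rule smooth_tau[OF PP a])
  have s2: "smooth_map P MH (\<lambda>x. a x \<otimes>\<^bsub>H\<^esub> inv\<^bsub>H\<^esub> (a p))"
    using ap by (intro H.smooth_mult PP a H.smooth_constant) simp
  have "G.rlog (\<tau> (a p)) (mderiv P MG (\<lambda>x. \<tau> (a x)) p v) = mderiv P MG (\<lambda>x. \<tau> (a x) \<otimes>\<^bsub>G\<^esub> inv\<^bsub>G\<^esub> (\<tau> (a p))) p v"
    by (rule G.rlog_mderiv[OF P s1 v])
  also have "\<dots> = mderiv P MG (\<lambda>x. \<tau> (a x \<otimes>\<^bsub>H\<^esub> inv\<^bsub>H\<^esub> (a p))) p v"
  proof (rule mderiv_cong[OF P _ _ smooth_tau[OF PP s2] v])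
    show "smooth_map P MG (\<lambda>x. \<tau> (a x) \<otimes>\<^bsub>G\<^esub> inv\<^bsub>G\<^esub> (\<tau> (a p)))"
      using ap by (intro G.smooth_mult PP s1 G.smooth_constant) simp
    fix x assume "x \<in> pts P"
    then have "a x \<in> carrier H" using smooth_map_pts[OF a] by simp
    then show "\<tau> (a x) \<otimes>\<^bsub>G\<^esub> inv\<^bsub>G\<^esub> (\<tau> (a p)) = \<tau> (a x \<otimes>\<^bsub>H\<^esub> inv\<^bsub>H\<^esub> (a p))"
      using ap by simp
  qed
  also have "\<dots> = dtau (mderiv P MH (\<lambda>x. a x \<otimes>\<^bsub>H\<^esub> inv\<^bsub>H\<^esub> (a p)) p v)"
    unfolding dtau_def using mderiv_compose[OF P(1) H.charted P(2) s2 tau_smooth v] ap by simp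
  finally show ?thesis unfolding H.rlog_mderiv[OF P a v] .
qed

lemma dalpha_mult:
  assumes g: "g \<in> carrier G" "g' \<in> carrier G" and B: "B \<in> LH"
  shows "dalpha (g \<otimes>\<^bsub>G\<^esub> g') B = dalpha g (dalpha g' B)"
proof -
  note B' = LH_D[OF B]
  have gg: "g \<otimes>\<^bsub>G\<^esub> g' \<in> carrier G" using g by simp
  have "dalpha g (dalpha g' B) = mderiv MH MH (\<lambda>h. \<alpha> (g, \<alpha> (g', h))) \<one>\<^bsub>H\<^esub> B"
    unfolding dalpha_def
    using mderiv_compose[OF H.charted H.charted H.one_pts smooth_alpha_fixed[OF g(2)] smooth_alpha_fixed[OF g(1)] B'] g by simp
  also have "\<dots> = dalpha (g \<otimes>\<^bsub>G\<^esub> g') B"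
    unfolding dalpha_def
    by (rule mderiv_cong[OF H.charted H.one_pts smooth_map_compose[OF H.pointed smooth_alpha_fixed[OF g(2)] smooth_alpha_fixed[OF g(1)]] _ smooth_alpha_fixed[OF gg] B'])
       (use g in \<open>simp add: alpha_comp\<close>)
  finally show ?thesis by simp
qed

lemma dalpha_tau:
  assumes h: "h \<in> carrier H" and B: "B \<in> LH"
  shows "dalpha (\<tau> h) B = Ad MH H h B"
  unfolding dalpha_def Ad_def
  by (rule mderiv_cong[OF H.charted H.one_pts smooth_alpha_fixed[OF tau_closed[OF h]] _ H.smooth_conj[OF h] LH_D[OF B]])
     (use h in \<open>simp add: alpha_tau\<close>)

lemma dtau_dalpha:
  assumes g: "g \<in> carrier G" and B: "B \<in> LH"
  shows "dtau (dalpha g B) = Ad MG G g (dtau B)"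
proof -
  note B' = LH_D[OF B]
  have "dtau (dalpha g B) = mderiv MH MG (\<lambda>h. \<tau> (\<alpha> (g, h))) \<one>\<^bsub>H\<^esub> B"
    unfolding dtau_def dalpha_def
    using mderiv_compose[OF H.charted H.charted H.one_pts smooth_alpha_fixed[OF g] tau_smooth B'] g by simp
  also have "\<dots> = mderiv MH MG (\<lambda>h. g \<otimes>\<^bsub>G\<^esub> \<tau> h \<otimes>\<^bsub>G\<^esub> inv\<^bsub>G\<^esub> g) \<one>\<^bsub>H\<^esub> B"
    by (rule mderiv_cong[OF H.charted H.one_pts smooth_tau[OF H.pointed smooth_alpha_fixed[OF g]] _
          smooth_map_compose[OF H.pointed tau_smooth G.smooth_conj[OF g]] B']) (use g in \<open>simp add: tau_alpha\<close>)
  also have "\<dots> = Ad MG G g (dtau B)"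
    unfolding dtau_def by (rule G.mderiv_conj[OF H.charted H.one_pts tau_smooth tau_one B' g])
  finally show ?thesis .
qed

lemma dcross_alpha:
  assumes k: "k \<in> carrier G" and h: "h \<in> carrier H" and A: "A \<in> LG"
  shows "dcross (\<alpha> (k, h)) (Ad MG G k A) = dalpha k (dcross h A)"
proof -
  note A' = LG_D[OF A]
  have kh: "\<alpha> (k, h) \<in> carrier H" using k h by simp
  have "dcross (\<alpha> (k, h)) (Ad MG G k A) = mderiv MG MH (\<lambda>y. \<alpha> (k, h) \<otimes>\<^bsub>H\<^esub> \<alpha> (k \<otimes>\<^bsub>G\<^esub> y \<otimes>\<^bsub>G\<^esub> inv\<^bsub>G\<^esub> k, inv\<^bsub>H\<^esub> (\<alpha> (k, h)))) \<one>\<^bsub>G\<^esub> A"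
    unfolding dcross_def Ad_def
    using mderiv_compose[OF G.charted G.charted G.one_pts G.smooth_conj[OF k] smooth_cross[OF kh] A'] k by simp
  also have "\<dots> = mderiv MG MH (\<lambda>y. \<alpha> (k, h \<otimes>\<^bsub>H\<^esub> \<alpha> (y, inv\<^bsub>H\<^esub> h))) \<one>\<^bsub>G\<^esub> A"
    by (rule mderiv_cong[OF G.charted G.one_pts smooth_map_compose[OF G.pointed G.smooth_conj[OF k] smooth_cross[OF kh]] _
          smooth_map_compose[OF G.pointed smooth_cross[OF h] smooth_alpha_fixed[OF k]] A'])
       (use k h in \<open>auto simp: alpha_comp alpha_inv\<close>)
  also have "\<dots> = dalpha k (dcross h A)"
    unfolding dcross_def dalpha_def
    using mderiv_compose[OF G.charted H.charted G.one_pts smooth_cross[OF h] smooth_alpha_fixed[OF k] A'] h by simp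
  finally show ?thesis .
qed

text \<open>Factor \<open>(h, g)\<inverse> = (\<one>, g\<inverse>) (h\<inverse>, \<one>)\<close>.\<close>

lemma Ad_semidirect_inv:
  assumes h: "h \<in> carrier H" and g: "g \<in> carrier G" and B: "B \<in> LH" and A: "A \<in> LG"
  shows "Ad MS S (inv\<^bsub>S\<^esub> (h, g)) (B, A) =
    (dalpha (inv\<^bsub>G\<^esub> g) (Ad MH H (inv\<^bsub>H\<^esub> h) B + dcross (inv\<^bsub>H\<^esub> h) A), Ad MG G (inv\<^bsub>G\<^esub> g) A)"
proof -
  have hi: "inv\<^bsub>H\<^esub> h \<in> carrier H" and gi: "inv\<^bsub>G\<^esub> g \<in> carrier G" using h g by auto
  have e: "inv\<^bsub>S\<^esub> (h, g) = (\<one>\<^bsub>H\<^esub>, inv\<^bsub>G\<^esub> g) \<otimes>\<^bsub>S\<^esub> (inv\<^bsub>H\<^esub> h, \<one>\<^bsub>G\<^esub>)" using h g by (simp add: inv_semidirect)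
  have "Ad MS S (inv\<^bsub>S\<^esub> (h, g)) (B, A) = Ad MS S (\<one>\<^bsub>H\<^esub>, inv\<^bsub>G\<^esub> g) (Ad MS S (inv\<^bsub>H\<^esub> h, \<one>\<^bsub>G\<^esub>) (B, A))"
    unfolding e by (rule S.Ad_mult) (use h g B A in \<open>auto simp: lie_alg_semidirect\<close>)
  also have "\<dots> = Ad MS S (\<one>\<^bsub>H\<^esub>, inv\<^bsub>G\<^esub> g) (Ad MH H (inv\<^bsub>H\<^esub> h) B + dcross (inv\<^bsub>H\<^esub> h) A, A)"
    by (simp add: Ad_semidirect_H[OF hi B A])
  also have "\<dots> = (dalpha (inv\<^bsub>G\<^esub> g) (Ad MH H (inv\<^bsub>H\<^esub> h) B + dcross (inv\<^bsub>H\<^esub> h) A), Ad MG G (inv\<^bsub>G\<^esub> g) A)"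
    by (rule Ad_semidirect_G[OF gi subspace_add[OF LH_subspace H.Ad_closed[OF hi B] dcross_closed[OF hi A]] A])
  finally show ?thesis .
qed

lemma smooth_dcross:
  assumes P: "pointed P" and a: "smooth_map P MH a" and A: "smooth_map P (vec_mfd LG) A"
  shows "smooth_map P (vec_mfd LH) (\<lambda>x. dcross (a x) (A x))"
proof -
  let ?m = "\<lambda>z. fst z \<otimes>\<^bsub>H\<^esub> \<alpha> (snd z, inv\<^bsub>H\<^esub> (fst z))"
  have MM: "pointed (prod_mfd MH MG)" by (rule pointed_MS)
  have m: "smooth_map (prod_mfd MH MG) MH ?m"
    by (intro H.smooth_mult H.smooth_inv smooth_alpha MM smooth_fst[OF smooth_id] smooth_snd[OF smooth_id])
  have "smooth_map P (TM MG) (\<lambda>x. (\<one>\<^bsub>G\<^esub>, A x))"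
    using smooth_map_compose[OF P A[unfolded lie_alg_def] smooth_fibre_inclusion[OF G.charted G.one_pts]] .
  from smooth_map_compose[OF P smooth_Pair[OF a this] smooth_partial_derivative[OF H.charted G.charted H.charted m]]
  have "smooth_map P (TM MH) (\<lambda>x. (a x \<otimes>\<^bsub>H\<^esub> \<alpha> (\<one>\<^bsub>G\<^esub>, inv\<^bsub>H\<^esub> (a x)), dcross (a x) (A x)))"
    by (simp add: dcross_def)
  from smooth_into_fibre[OF H.charted P this, of "\<one>\<^bsub>H\<^esub>"] show ?thesis
    using smooth_map_pts[OF a] by (auto simp: lie_alg_def)
qed

section \<open>The Lie 2-algebra\<close>

abbreviation LTG where "LTG \<equiv> lie_alg_gpd TG"

lemma LTG_objects [simp]: "arr LTG = vec_mfd (lie_alg MS S)" "obj LTG = vec_mfd LG"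
  by (simp_all add: lie_alg_gpd_def Let_def)

lemma LTG_src: 
  assumes "B \<in> LH" "A \<in> LG" shows "src LTG (B, A) = A"
  using assms mderiv_snd[OF H.charted G.charted, of "(\<one>\<^bsub>H\<^esub>, \<one>\<^bsub>G\<^esub>)" "(B, A)"]
  by (simp add: lie_alg_gpd_def Let_def lie_alg_def tspace_prod[OF H.charted G.charted])

lemma mderiv_TG_tgt:
  assumes "B \<in> LH" "A \<in> LG" shows "mderiv MS MG (\<lambda>x. \<tau> (fst x) \<otimes>\<^bsub>G\<^esub> snd x) (\<one>\<^bsub>H\<^esub>, \<one>\<^bsub>G\<^esub>) (B, A) = dtau B + A"
proof -
  have BA: "(B, A) \<in> tspace MS (\<one>\<^bsub>H\<^esub>, \<one>\<^bsub>G\<^esub>)" using assms by (simp add: lie_alg_def tspace_prod[OF H.charted G.charted])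
  have o: "(\<one>\<^bsub>H\<^esub>, \<one>\<^bsub>G\<^esub>) \<in> pts MS" by simp
  have "mderiv MS MG (\<lambda>x. \<tau> (fst x) \<otimes>\<^bsub>G\<^esub> snd x) (\<one>\<^bsub>H\<^esub>, \<one>\<^bsub>G\<^esub>) (B, A) =
      mderiv MS MG (\<lambda>x. \<tau> (fst x)) (\<one>\<^bsub>H\<^esub>, \<one>\<^bsub>G\<^esub>) (B, A) + mderiv MS MG snd (\<one>\<^bsub>H\<^esub>, \<one>\<^bsub>G\<^esub>) (B, A)"
    by (rule G.mderiv_mult[OF charted_MS o smooth_tau[OF pointed_MS smooth_fst[OF smooth_id]] _ smooth_snd[OF smooth_id] _ BA]) auto
  also have "mderiv MS MG (\<lambda>x. \<tau> (fst x)) (\<one>\<^bsub>H\<^esub>, \<one>\<^bsub>G\<^esub>) (B, A) = dtau B"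
    using mderiv_compose[OF charted_MS H.charted o smooth_fst[OF smooth_id] tau_smooth BA]
      mderiv_fst[OF H.charted G.charted o BA] unfolding dtau_def by simp
  also have "mderiv MS MG snd (\<one>\<^bsub>H\<^esub>, \<one>\<^bsub>G\<^esub>) (B, A) = A" using mderiv_snd[OF H.charted G.charted o BA] by simp
  finally show ?thesis .
qed

lemma LTG_tgt: 
  assumes "B \<in> LH" "A \<in> LG" shows "tgt LTG (B, A) = dtau B + A"
  using mderiv_TG_tgt[OF assms] by (simp add: lie_alg_gpd_def Let_def)

lemma LTG_unit:
  assumes "A \<in> LG" shows "gunit LTG A = (0, A)"
  using mderiv_Pair[OF G.charted G.one_pts H.smooth_constant smooth_id LG_D[OF assms], of "\<one>\<^bsub>H\<^esub>"]
    mderiv_id[OF G.charted G.one_pts LG_D[OF assms]] mderiv_const[OF G.charted G.one_pts H.pointed H.one_pts LG_D[OF assms]]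
  by (simp add: lie_alg_gpd_def Let_def)

lemma LTG_inv:
  assumes "B \<in> LH" "A \<in> LG" shows "ginv LTG (B, A) = (- B, dtau B + A)"
proof -
  have BA: "(B, A) \<in> tspace MS (\<one>\<^bsub>H\<^esub>, \<one>\<^bsub>G\<^esub>)" using assms by (simp add: lie_alg_def tspace_prod[OF H.charted G.charted])
  have o: "(\<one>\<^bsub>H\<^esub>, \<one>\<^bsub>G\<^esub>) \<in> pts MS" by simp
  have "mderiv MS MH (\<lambda>x. inv\<^bsub>H\<^esub> (fst x)) (\<one>\<^bsub>H\<^esub>, \<one>\<^bsub>G\<^esub>) (B, A) = - B"
    using H.mderiv_inv[OF charted_MS o smooth_fst[OF smooth_id] _ BA] mderiv_fst[OF H.charted G.charted o BA] by simp
  then show ?thesis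
    using mderiv_Pair[OF charted_MS o H.smooth_inv[OF pointed_MS smooth_fst[OF smooth_id]] smooth_TG_tgt BA] mderiv_TG_tgt[OF assms]
    by (simp add: lie_alg_gpd_def Let_def)
qed

text \<open>The differential of \<open>((h\<^sub>2, g\<^sub>2), (h\<^sub>1, g\<^sub>1)) \<mapsto> (h\<^sub>2 h\<^sub>1, g\<^sub>1)\<close> is determined only on vectors tangent to the
  manifold of composable pairs. The matching hypothesis says that the given pair is one of these.\<close>

lemma LTG_comp:
  assumes B: "B2 \<in> LH" "B1 \<in> LH" and A: "A2 \<in> LG" "A1 \<in> LG" and m: "A2 = dtau B1 + A1"
  shows "gcomp LTG ((B2, A2), (B1, A1)) = (B2 + B1, A1)"
proof -
  let ?C = "composable (tg_gpd TG)" and ?e = "(\<one>\<^bsub>H\<^esub>, \<one>\<^bsub>G\<^esub>)" and ?v = "((B2, A2), (B1, A1))"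
  have C: "?C = fib_prod MS MS snd (\<lambda>x. \<tau> (fst x) \<otimes>\<^bsub>G\<^esub> snd x)" by (simp add: composable_def)
  have CC: "charted ?C" unfolding C by (rule charted_fib_prod[OF charted_MS charted_MS])
  have t: "(B2, A2) \<in> tspace MS ?e" "(B1, A1) \<in> tspace MS ?e"
    using A B by (simp_all add: lie_alg_def tspace_prod[OF H.charted G.charted])
  have o: "?e \<in> pts MS" by simp
  have e: "(?e, ?e) \<in> pts ?C" unfolding C by (simp add: fib_prod_def)
  have v: "?v \<in> tspace ?C (?e, ?e)"
    unfolding C
    by (subst tspace_fib_prod[OF manifold_MS charted_MS G.mfd submersion_TG_src smooth_TG_tgt o o])
       (use t m mderiv_snd[OF H.charted G.charted o t(1)] mderiv_TG_tgt[OF B(2) A(2)] in simp_all)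
  have v': "?v \<in> tspace (prod_mfd MS MS) (?e, ?e)" using t by (simp add: tspace_prod[OF charted_MS charted_MS])
  have ee: "(?e, ?e) \<in> pts (prod_mfd MS MS) \<inter> {(x, y). snd x = \<tau> (fst y) \<otimes>\<^bsub>G\<^esub> snd y}" by simp
  have oo: "(?e, ?e) \<in> pts (prod_mfd MS MS)" by simp
  note CM = charted_prod[OF charted_MS charted_MS]
  let ?P = "prod_mfd MS MS"
  note f = smooth_fst[OF smooth_id, of MS MS] and s = smooth_snd[OF smooth_id, of MS MS]
  have g: "smooth_map ?P MS (\<lambda>z. (fst (fst z) \<otimes>\<^bsub>H\<^esub> fst (snd z), snd (snd z)))"
    by (intro smooth_Pair H.smooth_mult charted_pointed[OF CM] smooth_fst[OF f] smooth_fst[OF s] smooth_snd[OF s])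
  have 1: "mderiv ?P MH (\<lambda>z. fst (fst z)) (?e, ?e) ?v = B2"
    using mderiv_fst_comp[OF CM oo f v'] mderiv_fst[OF charted_MS charted_MS oo v'] by simp
  have 2: "mderiv ?P MH (\<lambda>z. fst (snd z)) (?e, ?e) ?v = B1"
    using mderiv_fst_comp[OF CM oo s v'] mderiv_snd[OF charted_MS charted_MS oo v'] by simp
  have 3: "mderiv ?P MG (\<lambda>z. snd (snd z)) (?e, ?e) ?v = A1"
    using mderiv_snd_comp[OF CM oo s v'] mderiv_snd[OF charted_MS charted_MS oo v'] by simp
  have "mderiv ?P MH (\<lambda>z. fst (fst z) \<otimes>\<^bsub>H\<^esub> fst (snd z)) (?e, ?e) ?v = B2 + B1"
    using H.mderiv_mult[OF CM oo smooth_fst[OF f] _ smooth_fst[OF s] _ v'] 1 2 by simp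
  then have "mderiv ?P MS (\<lambda>z. (fst (fst z) \<otimes>\<^bsub>H\<^esub> fst (snd z), snd (snd z))) (?e, ?e) ?v = (B2 + B1, A1)"
    using mderiv_Pair[OF CM oo H.smooth_mult[OF charted_pointed[OF CM] smooth_fst[OF f] smooth_fst[OF s]] smooth_snd[OF s] v'] 3 by simp
  then have "mderiv ?C MS (\<lambda>z. (fst (fst z) \<otimes>\<^bsub>H\<^esub> fst (snd z), snd (snd z))) (?e, ?e) ?v = (B2 + B1, A1)"
    using mderiv_restrict[OF CM ee g v[unfolded C fib_prod_def]] unfolding C fib_prod_def by simp
  then show ?thesis by (simp add: lie_alg_gpd_def Let_def)
qed

end

section \<open>Tangent maps and one-forms\<close>

lemma tmap_apply: "tmap M N f z = (f (fst z), mderiv M N f (fst z) (snd z))"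
  by (simp add: tmap_def case_prod_beta)

lemma tmap_compose:
  assumes "charted M" "charted N" "smooth_map M N f" "smooth_map N P g" "z \<in> pts (TM M)"
  shows "tmap N P g (tmap M N f z) = tmap M P (\<lambda>x. g (f x)) z"
proof -
  have z: "fst z \<in> pts M" "snd z \<in> tspace M (fst z)" using assms(5) by auto
  show ?thesis using mderiv_compose[OF assms(1,2) z(1) assms(3,4) z(2)] by (simp add: tmap_apply)
qed

lemma tmap_cong:
  assumes "charted M" "smooth_map M N f" "smooth_map M N g" "z \<in> pts (TM M)" "\<And>x. x \<in> pts M \<Longrightarrow> f x = g x"
  shows "tmap M N f z = tmap M N g z"
proof -
  have z: "fst z \<in> pts M" "snd z \<in> tspace M (fst z)" using assms(4) by auto
  show ?thesis
    unfolding tmap_apply prod.inject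
    by (intro conjI assms(5)[OF z(1)]) (rule mderiv_cong[OF assms(1) z(1) assms(2) assms(5) assms(3) z(2)])
qed

lemma tspace_fib_prod_subset:
  assumes M: "charted M" and P: "charted P" and pq: "pq \<in> pts (fib_prod M P f k)" and z: "z \<in> tspace (fib_prod M P f k) pq"
  shows "z \<in> tspace (prod_mfd M P) pq"
proof -
  have "pq \<in> pts (prod_mfd M P) \<inter> {(x, y). f x = k y}" using pq by (simp add: fib_prod_def)
  from tspace_sub_subset[OF charted_prod[OF M P] this] show ?thesis using z unfolding fib_prod_def by (rule subsetD)
qed

lemma mderiv_fib_prod_projections:
  assumes M: "charted M" and P: "charted P" and pq: "pq \<in> pts (fib_prod M P f k)" and z: "z \<in> tspace (fib_prod M P f k) pq"
  shows "mderiv (fib_prod M P f k) M fst pq z = fst z" "mderiv (fib_prod M P f k) P snd pq z = snd z"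
proof -
  have pq1: "pq \<in> pts (prod_mfd M P)" and pq2: "pq \<in> pts (prod_mfd M P) \<inter> {(x, y). f x = k y}"
    using pq by (auto simp: fib_prod_def)
  note z' = tspace_fib_prod_subset[OF assms]
  show "mderiv (fib_prod M P f k) M fst pq z = fst z"
    using mderiv_restrict[OF charted_prod[OF M P] pq2 smooth_fst[OF smooth_id]] z mderiv_fst[OF M P pq1 z']
    unfolding fib_prod_def by simp
  show "mderiv (fib_prod M P f k) P snd pq z = snd z"
    using mderiv_restrict[OF charted_prod[OF M P] pq2 smooth_snd[OF smooth_id]] z mderiv_snd[OF M P pq1 z']
    unfolding fib_prod_def by simp
qed

lemma one_form_value: "one_form M V a \<Longrightarrow> z \<in> pts (TM M) \<Longrightarrow> a z \<in> V"
  unfolding one_form_def using smooth_map_pts by fastforce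

lemma one_form_smooth: "one_form M V a \<Longrightarrow> smooth_map (TM M) (vec_mfd V) a"
  unfolding one_form_def by blast

lemma one_form_add_vectors:
  "one_form M V a \<Longrightarrow> p \<in> pts M \<Longrightarrow> u \<in> tspace M p \<Longrightarrow> v \<in> tspace M p \<Longrightarrow> a (p, u + v) = a (p, u) + a (p, v)"
  unfolding one_form_def linear_on_subspace_def by blast

lemma one_form_scaleR_vector:
  "one_form M V a \<Longrightarrow> p \<in> pts M \<Longrightarrow> u \<in> tspace M p \<Longrightarrow> a (p, c *\<^sub>R u) = c *\<^sub>R a (p, u)"
  unfolding one_form_def linear_on_subspace_def by blast

lemma one_formI:
  assumes "smooth_map (TM M) (vec_mfd V) a"
    "\<And>p u v. p \<in> pts M \<Longrightarrow> u \<in> tspace M p \<Longrightarrow> v \<in> tspace M p \<Longrightarrow> a (p, u + v) = a (p, u) + a (p, v)"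
    "\<And>p u c. p \<in> pts M \<Longrightarrow> u \<in> tspace M p \<Longrightarrow> a (p, c *\<^sub>R u) = c *\<^sub>R a (p, u)"
  shows "one_form M V a"
  using assms unfolding one_form_def linear_on_subspace_def by blast

text \<open>The sum of two tangent vectors is a tangent vector, so linearity can be checked on either expression.\<close>

lemma one_form_cong:
  assumes M: "manifold M" and b: "one_form M V b" and eq: "\<And>z. z \<in> pts (TM M) \<Longrightarrow> a z = b z"
  shows "one_form M V a"
proof (rule one_formI)
  note P = charted_pointed[OF manifold_charted[OF M]]
  show "smooth_map (TM M) (vec_mfd V) a"
    by (rule smooth_map_cong[OF pointed_TM[OF P] eq one_form_smooth[OF b]])
  fix p u assume p: "p \<in> pts M" and u: "u \<in> tspace M p"
  note S = subspace_tspace[OF M p]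
  show "a (p, u + v) = a (p, u) + a (p, v)" if v: "v \<in> tspace M p" for v
    using one_form_add_vectors[OF b p u v] eq p u v subspace_add[OF S u v] by simp
  show "a (p, c *\<^sub>R u) = c *\<^sub>R a (p, u)" for c
    using one_form_scaleR_vector[OF b p u] eq p u subspace_scale[OF S u] by simp
qed

lemma one_form_add:
  assumes M: "pointed M" and V: "subspace V" and a: "one_form M V a" and b: "one_form M V b"
  shows "one_form M V (\<lambda>z. a z + b z)"
proof (rule one_formI)
  show "smooth_map (TM M) (vec_mfd V) (\<lambda>z. a z + b z)"
    by (rule smooth_vec_add[OF pointed_TM[OF M] one_form_smooth[OF a] one_form_smooth[OF b] V])
qed (simp_all add: one_form_add_vectors[OF a] one_form_add_vectors[OF b] one_form_scaleR_vector[OF a] one_form_scaleR_vector[OF b] algebra_simps)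

lemma one_form_diff:
  assumes M: "pointed M" and V: "subspace V" and a: "one_form M V a" and b: "one_form M V b"
  shows "one_form M V (\<lambda>z. a z - b z)"
proof (rule one_formI)
  show "smooth_map (TM M) (vec_mfd V) (\<lambda>z. a z - b z)"
    by (rule smooth_vec_diff[OF pointed_TM[OF M] one_form_smooth[OF a] one_form_smooth[OF b] V])
qed (simp_all add: one_form_add_vectors[OF a] one_form_add_vectors[OF b] one_form_scaleR_vector[OF a] one_form_scaleR_vector[OF b] algebra_simps)

lemma one_form_Pair:
  assumes M: "pointed M" and a: "one_form M V a" and b: "one_form M V' b"
  shows "one_form M (V \<times> V') (\<lambda>z. (a z, b z))"
proof (rule one_formI)
  show "smooth_map (TM M) (vec_mfd (V \<times> V')) (\<lambda>z. (a z, b z))"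
    by (rule smooth_vec_Pair[OF pointed_TM[OF M] one_form_smooth[OF a] one_form_smooth[OF b]])
qed (simp_all add: one_form_add_vectors[OF a] one_form_add_vectors[OF b] one_form_scaleR_vector[OF a] one_form_scaleR_vector[OF b])

lemma one_form_linear:
  assumes M: "pointed M" and a: "one_form M V a" and L: "linear L" and LV: "\<And>v. v \<in> V \<Longrightarrow> L v \<in> V'"
  shows "one_form M V' (\<lambda>z. L (a z))"
proof (rule one_formI)
  have "bounded_linear L" using L linear_conv_bounded_linear by blast
  then show "smooth_map (TM M) (vec_mfd V') (\<lambda>z. L (a z))"
    using LV by (intro smooth_vec_apply[OF pointed_TM[OF M] one_form_smooth[OF a]])
qed (simp_all add: one_form_add_vectors[OF a] one_form_scaleR_vector[OF a] linear_add[OF L] linear_scale[OF L])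

lemma one_form_pullback:
  assumes M: "charted M" and N: "charted N" and f: "smooth_map M N f" and a: "one_form N V a"
  shows "one_form M V (\<lambda>z. a (tmap M N f z))"
proof (rule one_formI)
  show "smooth_map (TM M) (vec_mfd V) (\<lambda>z. a (tmap M N f z))"
    by (rule smooth_map_compose[OF pointed_TM[OF charted_pointed[OF M]] smooth_tmap[OF M N f] one_form_smooth[OF a]])
  fix p u assume p: "p \<in> pts M" and u: "u \<in> tspace M p"
  note fp = smooth_map_pts[OF f p] and fu = mderiv_tspace[OF M N p f u]
  show "a (tmap M N f (p, u + v)) = a (tmap M N f (p, u)) + a (tmap M N f (p, v))" if v: "v \<in> tspace M p" for v
    using one_form_add_vectors[OF a fp fu mderiv_tspace[OF M N p f v]] by (simp add: tmap_apply mderiv_add[OF M p f])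
  show "a (tmap M N f (p, c *\<^sub>R u)) = c *\<^sub>R a (tmap M N f (p, u))" for c
    using one_form_scaleR_vector[OF a fp fu] by (simp add: tmap_apply mderiv_scaleR[OF M p f])
qed

section \<open>The tangent groupoid of the decorated bundle\<close>

context decorated_bundle
begin

lemma src_D_smooth: "smooth_map DA E (src D)" using submersion_src_D unfolding submersion_def by blast

lemma comp_D_smooth: "smooth_map (composable D) DA (gcomp D)" and unit_D_smooth: "smooth_map E DA (gunit D)"
  using lie_groupoid_D unfolding lie_groupoid_def D_simps(1,2) by blast+

lemma tspace_DA:
  assumes "x \<in> pts DA" "V \<in> tspace DA x"
  shows "fst x \<in> pts sE" "snd x \<in> carrier H" "snd (fst x) \<in> pts E"
    "fst V \<in> tspace sE (fst x)" "snd V \<in> tspace MH (snd x)" "snd (fst V) \<in> tspace E (snd (fst x))"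
proof -
  show x: "fst x \<in> pts sE" "snd x \<in> carrier H" using assms(1) by auto
  show "snd (fst x) \<in> pts E" using x(1) by (auto simp: pts_sE)
  have "V \<in> tspace sE (fst x) \<times> tspace MH (snd x)"
    using assms tspace_prod[OF sE_charted H.charted, of "fst x" "snd x"] x by simp
  then show V: "fst V \<in> tspace sE (fst x)" "snd V \<in> tspace MH (snd x)" by auto
  have "fst V \<in> tspace (prod_mfd (arr X) E) (fst x)" by (rule tspace_fib_prod_subset[OF X1_charted E_charted x(1) V(1)])
  then show "snd (fst V) \<in> tspace E (snd (fst x))"
    using tspace_prod[OF X1_charted E_charted, of "fst (fst x)" "snd (fst x)"] x(1) by (auto simp: pts_sE)
qed

lemma tmap_src_D:
  assumes "x \<in> pts DA" "V \<in> tspace DA x"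
  shows "tmap DA E (src D) (x, V) = (snd (fst x), snd (fst V))"
proof -
  have "mderiv DA E (\<lambda>z. snd (fst z)) x V = mderiv sE E snd (fst x) (mderiv DA sE fst x V)"
    by (rule mderiv_compose[OF DA_charted sE_charted assms(1) smooth_fst[OF smooth_id] smooth_fib_prod_snd[OF smooth_id] assms(2)])
  also have "mderiv DA sE fst x V = fst V" by (rule mderiv_fst[OF sE_charted H.charted assms])
  also have "mderiv sE E snd (fst x) (fst V) = snd (fst V)"
    by (rule mderiv_fib_prod_projections(2)[OF X1_charted E_charted tspace_DA(1,4)[OF assms]])
  finally show ?thesis by (simp add: tmap_apply)
qed

abbreviation dsrc where "dsrc \<equiv> tmap DA E (src D)"
abbreviation dtgt where "dtgt \<equiv> tmap DA E (tgt D)"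
abbreviation dcomp where
  "dcomp z2 z1 \<equiv> tmap (composable D) DA (gcomp D) ((fst z2, fst z1), (snd z2, snd z1))"

lemma dsrc_pts: "z \<in> pts (TM DA) \<Longrightarrow> dsrc z \<in> pts (TM E)" and dtgt_pts: "z \<in> pts (TM DA) \<Longrightarrow> dtgt z \<in> pts (TM E)"
  by (rule tmap_pts[OF DA_charted E_charted src_D_smooth] tmap_pts[OF DA_charted E_charted smooth_tgt_D]; assumption)+

lemma composable_D_charted: "charted (composable D)"
  unfolding composable_def D_simps(1) by (rule charted_fib_prod[OF DA_charted DA_charted])

text \<open>A pair of tangent vectors that is composable in the tangent groupoid is tangent to the manifold of
  composable pairs, because the source map is a submersion.\<close>

lemma composable_tangent:
  assumes z: "z2 \<in> pts (TM DA)" "z1 \<in> pts (TM DA)" and m: "dsrc z2 = dtgt z1"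
  shows "((fst z2, fst z1), (snd z2, snd z1)) \<in> pts (TM (composable D))"
proof -
  have x: "fst z2 \<in> pts DA" "fst z1 \<in> pts DA" "snd z2 \<in> tspace DA (fst z2)" "snd z1 \<in> tspace DA (fst z1)"
    using z by auto
  have m': "src D (fst z2) = tgt D (fst z1)" "mderiv DA E (src D) (fst z2) (snd z2) = mderiv DA E (tgt D) (fst z1) (snd z1)"
    using m by (simp_all only: tmap_apply prod.inject)
  have "(fst z2, fst z1) \<in> pts (composable D)"
    using x(1,2) m'(1) unfolding composable_def fib_prod_def D_simps(1) by simp
  moreover have "(snd z2, snd z1) \<in> tspace (composable D) (fst z2, fst z1)"
    using x m' tspace_fib_prod[OF DA_mfd DA_charted E_mfd submersion_src_D smooth_tgt_D x(1,2) m'(1)]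
    unfolding composable_def D_simps(1) by simp
  ultimately show ?thesis by simp
qed

lemma composable_projections:
  "smooth_map (composable D) DA fst" "smooth_map (composable D) DA snd"
  unfolding composable_def D_simps(1) by (rule smooth_fib_prod_fst[OF smooth_id] smooth_fib_prod_snd[OF smooth_id])+

lemma tmap_composable_projections:
  assumes "((x2, x1), (V2, V1)) \<in> pts (TM (composable D))"
  shows "tmap (composable D) DA fst ((x2, x1), (V2, V1)) = (x2, V2)" "tmap (composable D) DA snd ((x2, x1), (V2, V1)) = (x1, V1)"
  using assms mderiv_fib_prod_projections[OF DA_charted DA_charted, of "(x2, x1)" "src D" "tgt D" "(V2, V1)"]
  by (simp_all add: tmap_apply composable_def del: D_simps(3,4))

lemma pts_composable: "w \<in> pts (composable D) \<Longrightarrow> fst w \<in> pts DA \<and> snd w \<in> pts DA \<and> src D (fst w) = tgt D (snd w)"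
  unfolding composable_def fib_prod_def D_simps(1) by auto

lemma dsrc_dcomp:
  assumes z: "z2 \<in> pts (TM DA)" "z1 \<in> pts (TM DA)" and m: "dsrc z2 = dtgt z1"
  shows "dsrc (dcomp z2 z1) = dsrc z1" "dtgt (dcomp z2 z1) = dtgt z2" "dcomp z2 z1 \<in> pts (TM DA)"
proof -
  let ?w = "((fst z2, fst z1), (snd z2, snd z1))"
  note w = composable_tangent[OF assms] and CD = composable_D_charted
  note CP = charted_pointed[OF CD]
  show "dcomp z2 z1 \<in> pts (TM DA)" by (rule tmap_pts[OF CD DA_charted comp_D_smooth w])
  have laws: "\<And>w. w \<in> pts (composable D) \<Longrightarrow> src D (gcomp D w) = src D (snd w) \<and> tgt D (gcomp D w) = tgt D (fst w)"
    using lie_groupoid_D pts_composable unfolding lie_groupoid_def D_simps(1) by (metis prod.collapse)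
  have "dsrc (dcomp z2 z1) = tmap (composable D) E (\<lambda>w. src D (gcomp D w)) ?w"
    by (rule tmap_compose[OF CD DA_charted comp_D_smooth src_D_smooth w])
  also have "\<dots> = tmap (composable D) E (\<lambda>w. src D (snd w)) ?w"
    by (rule tmap_cong[OF CD smooth_map_compose[OF CP comp_D_smooth src_D_smooth]
          smooth_map_compose[OF CP composable_projections(2) src_D_smooth] w]) (use laws in blast)
  also have "\<dots> = dsrc (tmap (composable D) DA snd ?w)"
    by (rule tmap_compose[OF CD DA_charted composable_projections(2) src_D_smooth w, symmetric])
  finally show "dsrc (dcomp z2 z1) = dsrc z1" using tmap_composable_projections[OF w] by simp
  have "dtgt (dcomp z2 z1) = tmap (composable D) E (\<lambda>w. tgt D (gcomp D w)) ?w"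
    by (rule tmap_compose[OF CD DA_charted comp_D_smooth smooth_tgt_D w])
  also have "\<dots> = tmap (composable D) E (\<lambda>w. tgt D (fst w)) ?w"
    by (rule tmap_cong[OF CD smooth_map_compose[OF CP comp_D_smooth smooth_tgt_D]
          smooth_map_compose[OF CP composable_projections(1) smooth_tgt_D] w]) (use laws in blast)
  also have "\<dots> = dtgt (tmap (composable D) DA fst ?w)"
    by (rule tmap_compose[OF CD DA_charted composable_projections(1) smooth_tgt_D w, symmetric])
  finally show "dtgt (dcomp z2 z1) = dtgt z2" using tmap_composable_projections[OF w] by simp
qed

lemma dsrc_dunit:
  assumes z: "z \<in> pts (TM E)"
  shows "dsrc (tmap E DA (gunit D) z) = z" "dtgt (tmap E DA (gunit D) z) = z" "tmap E DA (gunit D) z \<in> pts (TM DA)"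
proof -
  have id: "tmap E E (\<lambda>p. p) z = z" using z mderiv_id[OF E_charted] by (auto simp: tmap_apply)
  show "tmap E DA (gunit D) z \<in> pts (TM DA)" by (rule tmap_pts[OF E_charted DA_charted unit_D_smooth z])
  have "dsrc (tmap E DA (gunit D) z) = tmap E E (\<lambda>p. src D (gunit D p)) z"
    by (rule tmap_compose[OF E_charted DA_charted unit_D_smooth src_D_smooth z])
  also have "\<dots> = tmap E E (\<lambda>p. p) z"
    by (rule tmap_cong[OF E_charted smooth_map_compose[OF pointed_E unit_D_smooth src_D_smooth] smooth_id z]) simp
  finally show "dsrc (tmap E DA (gunit D) z) = z" using id by simp
  have "dtgt (tmap E DA (gunit D) z) = tmap E E (\<lambda>p. tgt D (gunit D p)) z"
    by (rule tmap_compose[OF E_charted DA_charted unit_D_smooth smooth_tgt_D z])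
  also have "\<dots> = tmap E E (\<lambda>p. p) z"
    by (rule tmap_cong[OF E_charted smooth_map_compose[OF pointed_E unit_D_smooth smooth_tgt_D] smooth_id z]) simp
  finally show "dtgt (tmap E DA (gunit D) z) = z" using id by simp
qed

text \<open>In the Lie 2-algebra of the crossed module the source is the projection to \<open>L(G)\<close>, the target is
  \<open>(B, A) \<mapsto> \<tau>(B) + A\<close> and composition adds the \<open>L(H)\<close>-components. Functoriality thus amounts to these linear
  conditions; compatibility of the \<open>L(G)\<close>-components with units and composition follows from the one
  on sources.\<close>

lemma form_functorI:
  assumes W1: "one_form DA (lie_alg MS S) W1" and W0: "one_form E LG W0"
    and s: "\<And>z. z \<in> pts (TM DA) \<Longrightarrow> snd (W1 z) = W0 (dsrc z)"
    and t: "\<And>z. z \<in> pts (TM DA) \<Longrightarrow> dtau (fst (W1 z)) + snd (W1 z) = W0 (dtgt z)"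
    and u: "\<And>z. z \<in> pts (TM E) \<Longrightarrow> fst (W1 (tmap E DA (gunit D) z)) = 0"
    and c: "\<And>z2 z1. z2 \<in> pts (TM DA) \<Longrightarrow> z1 \<in> pts (TM DA) \<Longrightarrow> dsrc z2 = dtgt z1 \<Longrightarrow>
      fst (W1 (dcomp z2 z1)) = fst (W1 z2) + fst (W1 z1)"
  shows "smooth_functor (tangent_gpd D) LTG W1 W0"
proof -
  have val: "fst (W1 z) \<in> LH" "snd (W1 z) \<in> LG" if "z \<in> pts (TM DA)" for z
    using one_form_value[OF W1 that] by (auto simp: lie_alg_semidirect)
  have T: "arr (tangent_gpd D) = TM DA" "obj (tangent_gpd D) = TM E" "src (tangent_gpd D) = dsrc" "tgt (tangent_gpd D) = dtgt"
    "gunit (tangent_gpd D) = tmap E DA (gunit D)" "\<And>z2 z1. gcomp (tangent_gpd D) (z2, z1) = dcomp z2 z1"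
    by (simp_all add: tangent_gpd_def case_prod_beta del: D_simps(3-7))
  show ?thesis
    unfolding smooth_functor_def T LTG_objects
  proof (intro conjI ballI impI)
    show "smooth_map (TM DA) (vec_mfd (lie_alg MS S)) W1" "smooth_map (TM E) (vec_mfd LG) W0"
      by (rule one_form_smooth[OF W1] one_form_smooth[OF W0])+
    fix z assume z: "z \<in> pts (TM DA)"
    show "src LTG (W1 z) = W0 (dsrc z)" using LTG_src[OF val[OF z]] unfolding s[OF z, symmetric] prod.collapse .
    show "tgt LTG (W1 z) = W0 (dtgt z)" using LTG_tgt[OF val[OF z]] unfolding t[OF z, symmetric] prod.collapse .
  next
    fix z assume z: "z \<in> pts (TM E)"
    have "snd (W1 (tmap E DA (gunit D) z)) = W0 z" using s[OF dsrc_dunit(3)[OF z]] dsrc_dunit(1)[OF z] by simp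
    then show "W1 (tmap E DA (gunit D) z) = gunit LTG (W0 z)"
      using u[OF z] LTG_unit[OF one_form_value[OF W0 z]] by (simp add: prod_eq_iff)
  next
    fix b a assume b: "b \<in> pts (TM DA)" and a: "a \<in> pts (TM DA)" and m: "dsrc b = dtgt a"
    have "snd (W1 b) = dtau (fst (W1 a)) + snd (W1 a)" using s[OF b] t[OF a] m by simp
    from LTG_comp[OF val(1)[OF b] val(1)[OF a] val(2)[OF b] val(2)[OF a] this]
    have "gcomp LTG (W1 b, W1 a) = (fst (W1 b) + fst (W1 a), snd (W1 a))" unfolding prod.collapse .
    moreover have "snd (W1 (dcomp b a)) = snd (W1 a)"
      using s[OF dsrc_dcomp(3)[OF b a m]] dsrc_dcomp(1)[OF b a m] s[OF a] by simp
    ultimately show "W1 (dcomp b a) = gcomp LTG (W1 b, W1 a)" using c[OF b a m] by (simp add: prod_eq_iff)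
  qed
qed

lemma smooth_R_fixed: "g \<in> carrier G \<Longrightarrow> smooth_map E E (\<lambda>p. R (p, g))"
  by (intro smooth_R pointed_E smooth_id G.smooth_constant)

lemma smooth_R1_fixed: "a \<in> carrier S \<Longrightarrow> smooth_map DA DA (\<lambda>x. R1 (x, a))"
  using smooth_map_compose[OF pointed_DA smooth_Pair[OF smooth_id S.smooth_constant] smooth_R1] by simp

text \<open>The action covers right translations of \<open>E\<close>, by the source of the acting element on sources and by
  its target on targets.\<close>

lemma R1_base: "src D (R1 (x, a)) = R (src D x, snd a)"
  "x \<in> pts DA \<Longrightarrow> a \<in> carrier S \<Longrightarrow> tgt D (R1 (x, a)) = R (tgt D x, \<tau> (fst a) \<otimes>\<^bsub>G\<^esub> snd a)"
  by (auto simp: R1_def pts_sE alpha_inv tau_alpha G.m_assoc H.inv_mult_group G.inv_mult_group G.inv_cancel_left)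

lemma dsrc_action:
  assumes a: "a \<in> carrier S" and z: "z \<in> pts (TM DA)"
  shows "dsrc (tangent_action DA R1 a z) = tangent_action E R (snd a) (dsrc z)"
    "dtgt (tangent_action DA R1 a z) = tangent_action E R (\<tau> (fst a) \<otimes>\<^bsub>G\<^esub> snd a) (dtgt z)"
    "tangent_action DA R1 a z \<in> pts (TM DA)"
proof -
  have g: "snd a \<in> carrier G" "\<tau> (fst a) \<otimes>\<^bsub>G\<^esub> snd a \<in> carrier G" using a by auto
  show "tangent_action DA R1 a z \<in> pts (TM DA)"
    unfolding tangent_action_def by (rule tmap_pts[OF DA_charted DA_charted smooth_R1_fixed[OF a] z])
  show "dsrc (tangent_action DA R1 a z) = tangent_action E R (snd a) (dsrc z)"
    unfolding tangent_action_def tmap_compose[OF DA_charted DA_charted smooth_R1_fixed[OF a] src_D_smooth z]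
      tmap_compose[OF DA_charted E_charted src_D_smooth smooth_R_fixed[OF g(1)] z] R1_base(1) ..
  show "dtgt (tangent_action DA R1 a z) = tangent_action E R (\<tau> (fst a) \<otimes>\<^bsub>G\<^esub> snd a) (dtgt z)"
    unfolding tangent_action_def tmap_compose[OF DA_charted DA_charted smooth_R1_fixed[OF a] smooth_tgt_D z]
      tmap_compose[OF DA_charted E_charted smooth_tgt_D smooth_R_fixed[OF g(2)] z]
    by (rule tmap_cong[OF DA_charted smooth_map_compose[OF pointed_DA smooth_R1_fixed[OF a] smooth_tgt_D]
          smooth_map_compose[OF pointed_DA smooth_tgt_D smooth_R_fixed[OF g(2)]] z R1_base(2)[OF _ a]])
qed

abbreviation fund1 where "fund1 \<equiv> fundamental DA MS S R1"
abbreviation fund0 where "fund0 \<equiv> fundamental E MG G R"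

lemma fund_eq: "fund1 (x, A) = (x, mderiv MS DA (\<lambda>a. R1 (x, a)) (\<one>\<^bsub>H\<^esub>, \<one>\<^bsub>G\<^esub>) A)"
  "fund0 (p, B) = (p, mderiv MG E (\<lambda>g. R (p, g)) \<one>\<^bsub>G\<^esub> B)"
  by (simp_all add: fundamental_def)

lemma smooth_orbit: "p \<in> pts E \<Longrightarrow> smooth_map MG E (\<lambda>g. R (p, g))"
  by (intro smooth_R G.pointed smooth_id smooth_const[OF pointed_E])

lemma smooth_orbit1: "x \<in> pts DA \<Longrightarrow> smooth_map MS DA (\<lambda>a. R1 (x, a))"
  using smooth_map_compose[OF pointed_MS smooth_Pair[OF smooth_const[OF pointed_DA] smooth_id] smooth_R1] by simp

lemma LS_D: "A \<in> lie_alg MS S \<Longrightarrow> A \<in> tspace MS (\<one>\<^bsub>H\<^esub>, \<one>\<^bsub>G\<^esub>)"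
  by (simp add: lie_alg_def)

lemma one_MS: "(\<one>\<^bsub>H\<^esub>, \<one>\<^bsub>G\<^esub>) \<in> pts MS" by simp

lemma R1_at_one: "x \<in> pts DA \<Longrightarrow> R1 (x, (\<one>\<^bsub>H\<^esub>, \<one>\<^bsub>G\<^esub>)) = x"
  using R1_one by simp

lemma fund_pts:
  "x \<in> pts DA \<Longrightarrow> A \<in> lie_alg MS S \<Longrightarrow> fund1 (x, A) \<in> pts (TM DA)"
  "p \<in> pts E \<Longrightarrow> B \<in> LG \<Longrightarrow> fund0 (p, B) \<in> pts (TM E)"
  using mderiv_tspace[OF charted_MS DA_charted one_MS smooth_orbit1 LS_D, of x A] R1_at_one[of x]
    mderiv_tspace[OF G.charted E_charted G.one_pts smooth_orbit LG_D, of p B]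
  by (simp_all add: fund_eq)

text \<open>The fundamental vector fields form a functor, because the action is one.\<close>

lemma dsrc_fund:
  assumes x: "x \<in> pts DA" and A: "A \<in> lie_alg MS S"
  shows "dsrc (fund1 (x, A)) = fund0 (src D x, snd A)"
    "dtgt (fund1 (x, A)) = fund0 (tgt D x, dtau (fst A) + snd A)"
proof -
  have sp: "src D x \<in> pts E" "tgt D x \<in> pts E" by (rule smooth_map_pts[OF src_D_smooth x] smooth_map_pts[OF smooth_tgt_D x])+
  note A' = LS_D[OF A] and s1 = smooth_orbit1[OF x]
  have AA: "fst A \<in> LH" "snd A \<in> LG" using A by (auto simp: lie_alg_semidirect)
  have "mderiv DA E (src D) x (mderiv MS DA (\<lambda>a. R1 (x, a)) (\<one>\<^bsub>H\<^esub>, \<one>\<^bsub>G\<^esub>) A) = mderiv MS E (\<lambda>a. src D (R1 (x, a))) (\<one>\<^bsub>H\<^esub>, \<one>\<^bsub>G\<^esub>) A"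
    using mderiv_compose[OF charted_MS DA_charted one_MS s1 src_D_smooth A'] R1_at_one[OF x] by (simp del: D_simps)
  also have "\<dots> = mderiv MS E (\<lambda>a. R (src D x, snd a)) (\<one>\<^bsub>H\<^esub>, \<one>\<^bsub>G\<^esub>) A" unfolding R1_base(1) ..
  also have "\<dots> = mderiv MG E (\<lambda>g. R (src D x, g)) \<one>\<^bsub>G\<^esub> (snd A)"
    using mderiv_compose[OF charted_MS G.charted one_MS smooth_snd[OF smooth_id] smooth_orbit[OF sp(1)] A']
      mderiv_snd[OF H.charted G.charted one_MS A'] by simp
  finally show "dsrc (fund1 (x, A)) = fund0 (src D x, snd A)" by (simp add: fund_eq tmap_apply del: D_simps)
  have "mderiv DA E (tgt D) x (mderiv MS DA (\<lambda>a. R1 (x, a)) (\<one>\<^bsub>H\<^esub>, \<one>\<^bsub>G\<^esub>) A) = mderiv MS E (\<lambda>a. tgt D (R1 (x, a))) (\<one>\<^bsub>H\<^esub>, \<one>\<^bsub>G\<^esub>) A"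
    using mderiv_compose[OF charted_MS DA_charted one_MS s1 smooth_tgt_D A'] R1_at_one[OF x] by (simp del: D_simps)
  also have "\<dots> = mderiv MS E (\<lambda>a. R (tgt D x, \<tau> (fst a) \<otimes>\<^bsub>G\<^esub> snd a)) (\<one>\<^bsub>H\<^esub>, \<one>\<^bsub>G\<^esub>) A"
    by (rule mderiv_cong[OF charted_MS one_MS smooth_map_compose[OF pointed_MS s1 smooth_tgt_D] R1_base(2)[OF x]
          smooth_map_compose[OF pointed_MS smooth_TG_tgt smooth_orbit[OF sp(2)]] A']) simp
  also have "\<dots> = mderiv MG E (\<lambda>g. R (tgt D x, g)) \<one>\<^bsub>G\<^esub> (dtau (fst A) + snd A)"
    using mderiv_compose[OF charted_MS G.charted one_MS smooth_TG_tgt smooth_orbit[OF sp(2)] A']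
      mderiv_TG_tgt[OF AA] by simp
  finally show "dtgt (fund1 (x, A)) = fund0 (tgt D x, dtau (fst A) + snd A)" by (simp add: fund_eq tmap_apply del: D_simps)
qed

lemma smooth_fund0: "smooth_map (prod_mfd E (vec_mfd LG)) (TM E) fund0"
proof (rule smooth_map_cong)
  let ?P = "prod_mfd E (vec_mfd LG)"
  show P: "pointed ?P" by (intro pointed_prod pointed_E pointed_vec)
  have "smooth_map ?P (TM MG) (\<lambda>z. (\<one>\<^bsub>G\<^esub>, snd z))"
    using smooth_map_compose[OF P smooth_snd[OF smooth_id, of E "vec_mfd LG"] smooth_fibre_inclusion[OF G.charted G.one_pts, folded lie_alg_def]] .
  from smooth_map_compose[OF P smooth_Pair[OF smooth_fst[OF smooth_id] this] smooth_partial_derivative[OF E_charted G.charted E_charted R_smooth]]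
  show "smooth_map ?P (TM E) (\<lambda>z. (R (fst z, \<one>\<^bsub>G\<^esub>), mderiv MG E (\<lambda>g. R (fst z, g)) \<one>\<^bsub>G\<^esub> (snd z)))" by simp
  show "fund0 z = (R (fst z, \<one>\<^bsub>G\<^esub>), mderiv MG E (\<lambda>g. R (fst z, g)) \<one>\<^bsub>G\<^esub> (snd z))" if "z \<in> pts ?P" for z
    using that by (auto simp: fund_eq)
qed

end

section \<open>The decorated connection\<close>

locale decorated_connection = decorated_bundle MG G MH H \<tau> \<alpha> X E \<pi> R \<mu>
  for MG :: "('g, 'k::euclidean_space) mfd" and G :: "'g monoid"
    and MH :: "('h, 'l::euclidean_space) mfd" and H :: "'h monoid"
    and \<tau> :: "'h \<Rightarrow> 'g" and \<alpha> :: "'g \<times> 'h \<Rightarrow> 'h"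
    and X :: "('x1, 'm1::euclidean_space, 'x0, 'm0::euclidean_space) gpd"
    and E :: "('e, 'f::euclidean_space) mfd" and \<pi> :: "'e \<Rightarrow> 'x0"
    and R :: "'e \<times> 'g \<Rightarrow> 'e" and \<mu> :: "'x1 \<times> 'e \<Rightarrow> 'e" +
  fixes \<omega> :: "'e \<times> 'f \<Rightarrow> 'k"
  assumes conn: "groupoid_bundle_connection X MG G E \<pi> R \<mu> \<omega>"
begin

lemma omega_form: "one_form E LG \<omega>"
  and omega_equivariant: "z \<in> pts (TM E) \<Longrightarrow> g \<in> carrier G \<Longrightarrow> \<omega> (tangent_action E R g z) = Ad MG G (inv\<^bsub>G\<^esub> g) (\<omega> z)"
  and omega_fund: "p \<in> pts E \<Longrightarrow> A \<in> LG \<Longrightarrow> \<omega> (fund0 (p, A)) = A"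
  and omega_invariant: "y \<in> pts (TM sE) \<Longrightarrow> \<omega> (tmap sE E snd y) = \<omega> (tmap sE E \<mu> y)"
  using conn unfolding groupoid_bundle_connection_def connection_form_def equivariant_form_def Let_def by blast+

lemma omega_value: "z \<in> pts (TM E) \<Longrightarrow> \<omega> z \<in> LG"
  by (rule one_form_value[OF omega_form])

text \<open>Differentiating \<open>a(x) b(x)\<close> gives the translate of the velocity of \<open>a\<close> plus a vertical
  vector, so a connection form sees the logarithmic derivative of \<open>b\<close>.\<close>

lemma omega_moving_frame:
  assumes P: "charted P" "x \<in> pts P" and a: "smooth_map P E a" and b: "smooth_map P MG b" and v: "v \<in> tspace P x"
  shows "\<omega> (R (a x, b x), mderiv P E (\<lambda>y. R (a y, b y)) x v) =
    Ad MG G (inv\<^bsub>G\<^esub> (b x)) (\<omega> (a x, mderiv P E a x v) + G.rlog (b x) (mderiv P MG b x v))"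
proof -
  note PP = charted_pointed[OF P(1)]
  let ?q = "a x" and ?k = "b x" and ?u = "mderiv P E a x v" and ?w = "mderiv P MG b x v"
  have q: "?q \<in> pts E" and k: "?k \<in> carrier G" using smooth_map_pts[OF a P(2)] smooth_map_pts[OF b P(2)] by simp_all
  have ki: "inv\<^bsub>G\<^esub> ?k \<in> carrier G" and kM: "?k \<in> pts MG" using k by simp_all
  have qk: "R (?q, ?k) \<in> pts E" using q k by simp
  have u: "?u \<in> tspace E ?q" and w: "?w \<in> tspace MG ?k"
    by (rule mderiv_tspace[OF P(1) E_charted P(2) a v] mderiv_tspace[OF P(1) G.charted P(2) b v])+
  have lm: "smooth_map MG MG (\<lambda>y. inv\<^bsub>G\<^esub> ?k \<otimes>\<^bsub>G\<^esub> y)" by (intro G.smooth_mult G.pointed smooth_id G.smooth_constant ki)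
  let ?W = "mderiv MG MG (\<lambda>y. inv\<^bsub>G\<^esub> ?k \<otimes>\<^bsub>G\<^esub> y) ?k ?w"
  have W: "?W = Ad MG G (inv\<^bsub>G\<^esub> ?k) (G.rlog ?k ?w)"
  proof -
    have "Ad MG G (inv\<^bsub>G\<^esub> ?k) (G.rlog ?k ?w) =
        mderiv MG MG (\<lambda>y. inv\<^bsub>G\<^esub> ?k \<otimes>\<^bsub>G\<^esub> (y \<otimes>\<^bsub>G\<^esub> inv\<^bsub>G\<^esub> ?k) \<otimes>\<^bsub>G\<^esub> inv\<^bsub>G\<^esub> (inv\<^bsub>G\<^esub> ?k)) ?k ?w"
      unfolding G.rlog_def using k by (intro G.mderiv_conj[OF G.charted kM G.smooth_right_mult[OF ki] _ w ki, symmetric]) simp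
    also have "\<dots> = ?W"
      by (rule mderiv_cong[OF G.charted kM smooth_map_compose[OF G.pointed G.smooth_right_mult[OF ki] G.smooth_conj[OF ki]] _ lm w])
         (use k in \<open>simp add: G.m_assoc\<close>)
    finally show ?thesis by simp
  qed
  have Wc: "?W \<in> LG" unfolding W by (rule G.Ad_closed[OF ki G.rlog_closed[OF k w]])
  have "mderiv P E (\<lambda>y. R (a y, b y)) x v = mderiv (prod_mfd E MG) E R (?q, ?k) (?u, ?w)"
    using mderiv_compose[OF P(1) charted_prod[OF E_charted G.charted] P(2) smooth_Pair[OF a b] R_smooth v]
      mderiv_Pair[OF P a b v] by simp
  also have "\<dots> = mderiv E E (\<lambda>y. R (y, ?k)) ?q ?u + mderiv MG E (\<lambda>y. R (?q, y)) ?k ?w"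
    by (rule mderiv_partials[OF E_charted G.charted q kM R_smooth u w])
  also have "mderiv MG E (\<lambda>y. R (?q, y)) ?k ?w = mderiv MG E (\<lambda>y. R (R (?q, ?k), inv\<^bsub>G\<^esub> ?k \<otimes>\<^bsub>G\<^esub> y)) ?k ?w"
    by (rule mderiv_cong[OF G.charted kM smooth_orbit[OF q] _ smooth_map_compose[OF G.pointed lm smooth_orbit[OF qk]] w])
       (use q k in \<open>simp add: G.inv_cancel_left\<close>)
  also have "\<dots> = mderiv MG E (\<lambda>y. R (R (?q, ?k), y)) \<one>\<^bsub>G\<^esub> ?W"
    using mderiv_compose[OF G.charted G.charted kM lm smooth_orbit[OF qk] w] k by simp
  finally have e: "mderiv P E (\<lambda>y. R (a y, b y)) x v =
    mderiv E E (\<lambda>y. R (y, ?k)) ?q ?u + mderiv MG E (\<lambda>y. R (R (?q, ?k), y)) \<one>\<^bsub>G\<^esub> ?W" .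
  have t1: "mderiv E E (\<lambda>y. R (y, ?k)) ?q ?u \<in> tspace E (R (?q, ?k))"
    by (rule mderiv_tspace[OF E_charted E_charted q smooth_R_fixed[OF k] u])
  have t2: "mderiv MG E (\<lambda>y. R (R (?q, ?k), y)) \<one>\<^bsub>G\<^esub> ?W \<in> tspace E (R (?q, ?k))"
    using fund_pts(2)[OF qk Wc] by (simp add: fund_eq)
  have "\<omega> (R (?q, ?k), mderiv E E (\<lambda>y. R (y, ?k)) ?q ?u) = Ad MG G (inv\<^bsub>G\<^esub> ?k) (\<omega> (?q, ?u))"
    using omega_equivariant[of "(?q, ?u)" ?k] q u k by (simp add: tangent_action_def tmap_apply)
  moreover have "\<omega> (R (?q, ?k), mderiv MG E (\<lambda>y. R (R (?q, ?k), y)) \<one>\<^bsub>G\<^esub> ?W) = ?W"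
    using omega_fund[OF qk Wc] by (simp add: fund_eq)
  ultimately show ?thesis
    using one_form_add_vectors[OF omega_form qk t1 t2]
    unfolding e linear_add[OF G.Ad_linear[OF ki]] W by simp
qed

abbreviation W1 where "W1 \<equiv> dec_form MG G MH H \<alpha> \<omega> :: (('x1 \<times> 'e) \<times> 'h) \<times> (('m1 \<times> 'f) \<times> 'l) \<Rightarrow> 'l \<times> 'k"

text \<open>The adjoint action contributes \<open>dcross\<close> in the \<open>H\<close>-direction and fixes the \<open>G\<close>-component.\<close>

lemma W1_eq:
  assumes z: "z \<in> pts (TM DA)"
  shows "W1 z = (dcross (snd (fst z)) (\<omega> (dsrc z)) - H.rlog (snd (fst z)) (snd (snd z)), \<omega> (dsrc z))"
proof -
  obtain x V where zxV: "z = (x, V)" by (cases z)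
  have x: "x \<in> pts DA" and V: "V \<in> tspace DA x" using z zxV by auto
  note t = tspace_DA[OF x V]
  have s: "dsrc z = (snd (fst x), snd (fst V))" unfolding zxV by (rule tmap_src_D[OF x V])
  have w: "\<omega> (snd (fst x), snd (fst V)) \<in> LG" using omega_value t(3,6) by simp
  show ?thesis
    unfolding s unfolding zxV dec_form_def
    using Ad_semidirect_H[OF t(2) subspace_0[OF LH_subspace] w] linear_0[OF H.Ad_linear[OF t(2)]]
    by (simp add: case_prod_beta H.rlog_def)
qed

lemma W1_form: "one_form DA (lie_alg MS S) W1"
proof -
  note sr = one_form_pullback[OF DA_charted E_charted src_D_smooth omega_form]
  note PT = pointed_TM[OF pointed_DA]
  have base: "smooth_map (TM DA) MH (\<lambda>z. snd (fst z))"
    by (rule smooth_map_compose[OF PT smooth_TM_base smooth_snd[OF smooth_id]])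
  have a: "one_form DA LH (\<lambda>z. dcross (snd (fst z)) (\<omega> (dsrc z)))"
  proof (rule one_formI)
    show "smooth_map (TM DA) (vec_mfd LH) (\<lambda>z. dcross (snd (fst z)) (\<omega> (dsrc z)))"
      by (rule smooth_dcross[OF PT base one_form_smooth[OF sr]])
    fix x u assume x: "x \<in> pts DA" and u: "u \<in> tspace DA x"
    have h: "snd x \<in> carrier H" using x by auto
    show "dcross (snd (fst (x, u + v))) (\<omega> (dsrc (x, u + v))) = dcross (snd (fst (x, u))) (\<omega> (dsrc (x, u))) + dcross (snd (fst (x, v))) (\<omega> (dsrc (x, v)))"
      if v: "v \<in> tspace DA x" for v
      using one_form_add_vectors[OF sr x u v] linear_add[OF dcross_linear[OF h]] by simp
    show "dcross (snd (fst (x, c *\<^sub>R u))) (\<omega> (dsrc (x, c *\<^sub>R u))) = c *\<^sub>R dcross (snd (fst (x, u))) (\<omega> (dsrc (x, u)))" for c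
      using one_form_scaleR_vector[OF sr x u] linear_scale[OF dcross_linear[OF h]] by simp
  qed
  have b: "one_form DA LH (\<lambda>z. H.rlog (snd (fst z)) (snd (snd z)))"
  proof (rule one_formI)
    have "smooth_map (TM DA) (vec_mfd LH) (\<lambda>z. H.rlog (fst (tmap DA MH snd z)) (snd (tmap DA MH snd z)))"
      by (rule H.smooth_rlog[OF PT smooth_tmap[OF DA_charted H.charted smooth_snd[OF smooth_id]]])
    then show "smooth_map (TM DA) (vec_mfd LH) (\<lambda>z. H.rlog (snd (fst z)) (snd (snd z)))"
    proof (rule smooth_map_cong[OF PT, rotated])
      fix z assume z: "z \<in> pts (TM DA)"
      have x: "fst z \<in> pts DA" "snd z \<in> tspace DA (fst z)" using z by auto
      show "H.rlog (snd (fst z)) (snd (snd z)) = H.rlog (fst (tmap DA MH snd z)) (snd (tmap DA MH snd z))"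
        by (simp add: tmap_apply mderiv_snd[OF sE_charted H.charted x])
    qed
    fix x and u v :: "('m1 \<times> 'f) \<times> 'l" and c :: real
    assume "x \<in> pts DA"
    then have h: "snd x \<in> carrier H" by auto
    show "H.rlog (snd (fst (x, u + v))) (snd (snd (x, u + v))) = H.rlog (snd (fst (x, u))) (snd (snd (x, u))) + H.rlog (snd (fst (x, v))) (snd (snd (x, v)))"
      by (simp add: linear_add[OF H.rlog_linear[OF h]])
    show "H.rlog (snd (fst (x, c *\<^sub>R u))) (snd (snd (x, c *\<^sub>R u))) = c *\<^sub>R H.rlog (snd (fst (x, u))) (snd (snd (x, u)))"
      by (simp add: linear_scale[OF H.rlog_linear[OF h]])
  qed
  show ?thesis
    unfolding lie_alg_semidirect
    by (rule one_form_cong[OF DA_mfd one_form_Pair[OF pointed_DA one_form_diff[OF pointed_DA LH_subspace a b] sr] W1_eq])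
qed

text \<open>The target of \<open>(\<gamma>, p, h)\<close> is \<open>\<mu>(\<gamma>, p) \<tau>(h\<inverse>)\<close>. By invariance of \<open>\<omega>\<close> under \<open>\<mu>\<close> and the moving-frame formula, \<open>\<omega>\<close> of
  its velocity is \<open>Ad\<^sub>\<tau>\<^sub>h (\<omega>(v)) - \<tau>(K h\<inverse>)\<close>; the first term is \<open>\<omega>(v) + \<tau>(dcross h (\<omega>(v)))\<close>.\<close>

lemma W1_tgt:
  assumes z: "z \<in> pts (TM DA)"
  shows "dtau (fst (W1 z)) + snd (W1 z) = \<omega> (dtgt z)"
proof -
  obtain x V where zxV: "z = (x, V)" by (cases z)
  have x: "x \<in> pts DA" and V: "V \<in> tspace DA x" using z zxV by auto
  note t = tspace_DA[OF x V]
  let ?h = "snd x" and ?K = "snd V"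
  have hi: "inv\<^bsub>H\<^esub> ?h \<in> carrier H" using t by simp
  have mu: "smooth_map DA E (\<lambda>z. \<mu> (fst z))" by (rule smooth_mu[OF pointed_DA DA_projections(1)[OF smooth_id]])
  have sinv: "smooth_map DA MH (\<lambda>z. inv\<^bsub>H\<^esub> (snd z))" by (rule H.smooth_inv[OF pointed_DA smooth_snd[OF smooth_id]])
  have ti: "smooth_map DA MG (\<lambda>z. \<tau> (inv\<^bsub>H\<^esub> (snd z)))" by (rule smooth_tau[OF pointed_DA sinv])
  have dK: "mderiv DA MH snd x V = ?K" by (rule mderiv_snd[OF sE_charted H.charted x V])
  have r: "H.rlog ?h ?K \<in> LH" using H.rlog_closed[OF t(2,5)] .
  have w: "\<omega> (dsrc z) \<in> LG" by (rule omega_value[OF dsrc_pts[OF z]])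
  have 1: "\<omega> (\<mu> (fst x), mderiv DA E (\<lambda>z. \<mu> (fst z)) x V) = \<omega> (dsrc z)"
  proof -
    have "mderiv DA E (\<lambda>z. \<mu> (fst z)) x V = mderiv sE E \<mu> (fst x) (fst V)"
      using mderiv_compose[OF DA_charted sE_charted x smooth_fst[OF smooth_id] mu_smooth V] mderiv_fst[OF sE_charted H.charted x V] by simp
    moreover have "\<omega> (tmap sE E snd (fst x, fst V)) = \<omega> (tmap sE E \<mu> (fst x, fst V))"
      by (rule omega_invariant) (use t in simp)
    moreover have "mderiv sE E snd (fst x) (fst V) = snd (fst V)"
      by (rule mderiv_fib_prod_projections(2)[OF X1_charted E_charted t(1,4)])
    ultimately show ?thesis unfolding zxV tmap_src_D[OF x V] by (simp add: tmap_apply)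
  qed
  have 2: "G.rlog (\<tau> (inv\<^bsub>H\<^esub> ?h)) (mderiv DA MG (\<lambda>z. \<tau> (inv\<^bsub>H\<^esub> (snd z))) x V) = - dtau (Ad MH H (inv\<^bsub>H\<^esub> ?h) (H.rlog ?h ?K))"
    using rlog_tau[OF DA_charted x sinv V] H.rlog_inv[OF DA_charted x smooth_snd[OF smooth_id] V] dK
    by (simp add: linear_neg[OF dtau_linear])
  have 3: "Ad MG G (\<tau> ?h) (dtau (Ad MH H (inv\<^bsub>H\<^esub> ?h) (H.rlog ?h ?K))) = dtau (H.rlog ?h ?K)"
    using dtau_dalpha[OF tau_closed[OF t(2)] H.Ad_closed[OF hi r]] dalpha_tau[OF t(2) H.Ad_closed[OF hi r]]
      H.Ad_inv_cancel(2)[OF t(2) r] by simp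
  have "\<omega> (dtgt z) = Ad MG G (inv\<^bsub>G\<^esub> (\<tau> (inv\<^bsub>H\<^esub> ?h))) (\<omega> (dsrc z) - dtau (Ad MH H (inv\<^bsub>H\<^esub> ?h) (H.rlog ?h ?K)))"
    using omega_moving_frame[OF DA_charted x mu ti V] unfolding 1 2 unfolding zxV by (simp add: tmap_apply)
  also have "\<dots> = Ad MG G (\<tau> ?h) (\<omega> (dsrc z)) - dtau (H.rlog ?h ?K)"
    using t(2) 3 by (simp add: linear_diff[OF G.Ad_linear])
  finally have tz: "\<omega> (dtgt z) = Ad MG G (\<tau> ?h) (\<omega> (dsrc z)) - dtau (H.rlog ?h ?K)" .
  have e: "W1 z = (dcross ?h (\<omega> (dsrc z)) - H.rlog ?h ?K, \<omega> (dsrc z))"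
    unfolding W1_eq[OF z] unfolding zxV fst_conv snd_conv ..
  show ?thesis
    unfolding tz e fst_conv snd_conv linear_diff[OF dtau_linear] dtau_dcross[OF t(2) w] by simp
qed

lemma W1_unit:
  assumes z: "z \<in> pts (TM E)"
  shows "fst (W1 (tmap E DA (gunit D) z)) = 0"
proof -
  have p: "fst z \<in> pts E" "snd z \<in> tspace E (fst z)" using z by auto
  have A: "\<omega> z \<in> LG" by (rule omega_value[OF z])
  have s: "snd (gunit D q) = \<one>\<^bsub>H\<^esub>" for q by simp
  have "snd (mderiv E DA (gunit D) (fst z) (snd z)) = mderiv E MH (\<lambda>q. \<one>\<^bsub>H\<^esub>) (fst z) (snd z)"
    using mderiv_snd_comp[OF E_charted p(1) unit_D_smooth p(2)] unfolding s by simp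
  also have "\<dots> = 0" by (rule mderiv_const[OF E_charted p(1) H.pointed H.one_pts p(2)])
  finally have "snd (snd (tmap E DA (gunit D) z)) = 0" by (simp only: tmap_apply snd_conv)
  moreover have "snd (fst (tmap E DA (gunit D) z)) = \<one>\<^bsub>H\<^esub>" by (simp add: tmap_apply)
  moreover have "dcross \<one>\<^bsub>H\<^esub> (\<omega> z) = 0"
  proof -
    have 0: "Ad MH H \<one>\<^bsub>H\<^esub> (dcross \<one>\<^bsub>H\<^esub> (\<omega> z)) = 0"
      using dcross_mult[OF H.one_closed H.one_closed A] by simp
    have "dcross \<one>\<^bsub>H\<^esub> (\<omega> z) = Ad MH H (inv\<^bsub>H\<^esub> \<one>\<^bsub>H\<^esub>) (Ad MH H \<one>\<^bsub>H\<^esub> (dcross \<one>\<^bsub>H\<^esub> (\<omega> z)))"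
      by (rule H.Ad_inv_cancel(1)[OF H.one_closed dcross_closed[OF H.one_closed A], symmetric])
    also have "\<dots> = 0" unfolding 0 by (rule linear_0[OF H.Ad_linear]) simp
    finally show ?thesis .
  qed
  ultimately show ?thesis
    using W1_eq[OF dsrc_dunit(3)[OF z]] dsrc_dunit(1)[OF z] linear_0[OF H.rlog_linear[OF H.one_closed]] by simp
qed

text \<open>Composability says \<open>\<omega>(v\<^sub>2) = \<tau>(b\<^sub>1) + \<omega>(v\<^sub>1)\<close>, where \<open>b\<^sub>1\<close> is the \<open>L(H)\<close>-component at the first arrow. In
  \<open>dcross h\<^sub>2 (\<omega>(v\<^sub>2))\<close> the term \<open>\<tau>(b\<^sub>1)\<close> becomes \<open>Ad b\<^sub>1 - b\<^sub>1\<close> for the adjoint action of \<open>h\<^sub>2\<close>. Here \<open>- b\<^sub>1\<close> cancels the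
  summand \<open>b\<^sub>1\<close>, and \<open>Ad b\<^sub>1\<close> supplies exactly the terms of the cocycle rule for \<open>dcross\<close> and of the product
  rule for \<open>K h\<inverse>\<close>.\<close>

lemma W1_comp:
  assumes z: "z2 \<in> pts (TM DA)" "z1 \<in> pts (TM DA)" and m: "dsrc z2 = dtgt z1"
  shows "fst (W1 (dcomp z2 z1)) = fst (W1 z2) + fst (W1 z1)"
proof -
  obtain x2 V2 where 2: "z2 = (x2, V2)" by (cases z2)
  obtain x1 V1 where 1: "z1 = (x1, V1)" by (cases z1)
  have x: "x2 \<in> pts DA" "V2 \<in> tspace DA x2" "x1 \<in> pts DA" "V1 \<in> tspace DA x1" using z 1 2 by auto
  note t2 = tspace_DA[OF x(1,2)] and t1 = tspace_DA[OF x(3,4)]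
  let ?w = "(x2, x1)" and ?V = "(V2, V1)" and ?C = "composable D"
  have w: "(?w, ?V) \<in> pts (TM ?C)" using composable_tangent[OF assms] 1 2 by simp
  then have w': "?w \<in> pts ?C" "?V \<in> tspace ?C ?w" by auto
  note CC = composable_D_charted
  have p: "smooth_map ?C MH (\<lambda>w. snd (fst w))" "smooth_map ?C MH (\<lambda>w. snd (snd w))"
    by (rule smooth_snd[OF composable_projections(1)] smooth_snd[OF composable_projections(2)])+
  have d: "mderiv ?C MH (\<lambda>w. snd (fst w)) ?w ?V = snd V2" "mderiv ?C MH (\<lambda>w. snd (snd w)) ?w ?V = snd V1"
    using mderiv_snd_comp[OF CC w'(1) composable_projections(1) w'(2)] mderiv_snd_comp[OF CC w'(1) composable_projections(2) w'(2)]
      tmap_composable_projections[OF w] by (simp_all add: tmap_apply)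
  let ?h2 = "snd x2" and ?h1 = "snd x1" and ?B2 = "H.rlog (snd x2) (snd V2)" and ?B1 = "H.rlog (snd x1) (snd V1)"
  have s: "snd (gcomp D w) = snd (fst w) \<otimes>\<^bsub>H\<^esub> snd (snd w)" for w by simp
  have K: "snd (snd (dcomp z2 z1)) = mderiv ?C MH (\<lambda>w. snd (fst w) \<otimes>\<^bsub>H\<^esub> snd (snd w)) ?w ?V"
    using mderiv_snd_comp[OF CC w'(1) comp_D_smooth w'(2)] unfolding s 1 2 by (simp add: tmap_apply)
  have r: "H.rlog (?h2 \<otimes>\<^bsub>H\<^esub> ?h1) (snd (snd (dcomp z2 z1))) = ?B2 + Ad MH H ?h2 ?B1"
    using H.rlog_mult[OF CC w'(1) p w'(2)] unfolding K d by simp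
  have B1: "?B1 \<in> LH" by (rule H.rlog_closed[OF t1(2,5)])
  have A1: "\<omega> (dsrc z1) \<in> LG" by (rule omega_value[OF dsrc_pts[OF z(2)]])
  have f1: "fst (W1 z1) = dcross ?h1 (\<omega> (dsrc z1)) - ?B1" using W1_eq[OF z(2)] 1 by simp
  have s1: "snd (W1 z1) = \<omega> (dsrc z1)" using W1_eq[OF z(2)] by simp
  have f1c: "fst (W1 z1) \<in> LH" unfolding f1 by (rule subspace_diff[OF LH_subspace dcross_closed[OF t1(2) A1] B1])
  have A2: "\<omega> (dsrc z2) = dtau (fst (W1 z1)) + \<omega> (dsrc z1)" using W1_tgt[OF z(2)] m s1 by simp
  have "dcross ?h2 (\<omega> (dsrc z2)) = Ad MH H ?h2 (fst (W1 z1)) - fst (W1 z1) + dcross ?h2 (\<omega> (dsrc z1))"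
    unfolding A2 by (simp add: linear_add[OF dcross_linear[OF t2(2)]] dcross_dtau[OF t2(2) f1c])
  moreover have "Ad MH H ?h2 (fst (W1 z1)) = Ad MH H ?h2 (dcross ?h1 (\<omega> (dsrc z1))) - Ad MH H ?h2 ?B1"
    unfolding f1 by (rule linear_diff[OF H.Ad_linear[OF t2(2)]])
  ultimately have "fst (W1 z2) + fst (W1 z1) = dcross (?h2 \<otimes>\<^bsub>H\<^esub> ?h1) (\<omega> (dsrc z1)) - (?B2 + Ad MH H ?h2 ?B1)"
    using W1_eq[OF z(1)] 2 dcross_mult[OF t2(2) t1(2) A1] by simp
  moreover have "fst (W1 (dcomp z2 z1)) = dcross (?h2 \<otimes>\<^bsub>H\<^esub> ?h1) (\<omega> (dsrc z1)) - (?B2 + Ad MH H ?h2 ?B1)"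
  proof -
    have "snd (fst (dcomp z2 z1)) = ?h2 \<otimes>\<^bsub>H\<^esub> ?h1" using 1 2 by (simp add: tmap_apply)
    then show ?thesis using W1_eq[OF dsrc_dcomp(3)[OF assms]] dsrc_dcomp(1)[OF assms] r by simp
  qed
  ultimately show ?thesis by simp
qed

lemma W1_functor: "smooth_functor (tangent_gpd D) LTG W1 \<omega>"
  by (rule form_functorI[OF W1_form omega_form]) (use W1_eq W1_tgt W1_unit W1_comp in auto)

text \<open>After factoring the adjoint action of \<open>(h, g)\<inverse>\<close>, the logarithmic derivative transforms by the product
  rule and \<open>dcross\<close> by its cocycle rule together with equivariance under \<open>\<alpha>\<close>.\<close>

lemma W1_equivariant:
  assumes z: "z \<in> pts (TM DA)" and a: "a \<in> carrier S"
  shows "W1 (tangent_action DA R1 a z) = Ad MS S (inv\<^bsub>S\<^esub> a) (W1 z)"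
proof -
  obtain x V where zxV: "z = (x, V)" by (cases z)
  have x: "x \<in> pts DA" and V: "V \<in> tspace DA x" using z zxV by auto
  note t = tspace_DA[OF x V]
  let ?h = "snd x" and ?B = "H.rlog (snd x) (snd V)" and ?A = "\<omega> (dsrc z)"
  obtain h g where hg: "a = (h, g)" by (cases a)
  have h: "h \<in> carrier H" and g: "g \<in> carrier G" using a hg by auto
  have hi: "inv\<^bsub>H\<^esub> h \<in> carrier H" and gi: "inv\<^bsub>G\<^esub> g \<in> carrier G" using h g by auto
  have B: "?B \<in> LH" by (rule H.rlog_closed[OF t(2,5)])
  have A: "?A \<in> LG" by (rule omega_value[OF dsrc_pts[OF z]])
  let ?z' = "tangent_action DA R1 a z"
  have A': "\<omega> (dsrc ?z') = Ad MG G (inv\<^bsub>G\<^esub> g) ?A"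
    unfolding dsrc_action(1)[OF a z] using omega_equivariant[OF dsrc_pts[OF z]] g hg by simp
  have h': "snd (fst ?z') = \<alpha> (inv\<^bsub>G\<^esub> g, inv\<^bsub>H\<^esub> h \<otimes>\<^bsub>H\<^esub> ?h)"
    unfolding tangent_action_def tmap_apply zxV hg by (simp add: R1_def)
  have sn: "snd (R1 (y, a)) = \<alpha> (inv\<^bsub>G\<^esub> g, inv\<^bsub>H\<^esub> h \<otimes>\<^bsub>H\<^esub> snd y)" for y by (simp add: R1_def hg)
  have sm: "smooth_map DA MH (\<lambda>y. inv\<^bsub>H\<^esub> h \<otimes>\<^bsub>H\<^esub> snd y)"
    by (intro H.smooth_mult pointed_DA H.smooth_constant hi smooth_snd[OF smooth_id])
  have "snd (snd ?z') = mderiv DA MH (\<lambda>y. \<alpha> (inv\<^bsub>G\<^esub> g, inv\<^bsub>H\<^esub> h \<otimes>\<^bsub>H\<^esub> snd y)) x V"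
    using mderiv_snd_comp[OF DA_charted x smooth_R1_fixed[OF a] V] unfolding sn tangent_action_def tmap_apply zxV by simp
  then have "H.rlog (snd (fst ?z')) (snd (snd ?z')) = dalpha (inv\<^bsub>G\<^esub> g) (H.rlog (inv\<^bsub>H\<^esub> h \<otimes>\<^bsub>H\<^esub> ?h) (mderiv DA MH (\<lambda>y. inv\<^bsub>H\<^esub> h \<otimes>\<^bsub>H\<^esub> snd y) x V))"
    unfolding h' using rlog_alpha[OF DA_charted x sm V gi] by simp
  also have "H.rlog (inv\<^bsub>H\<^esub> h \<otimes>\<^bsub>H\<^esub> ?h) (mderiv DA MH (\<lambda>y. inv\<^bsub>H\<^esub> h \<otimes>\<^bsub>H\<^esub> snd y) x V) = Ad MH H (inv\<^bsub>H\<^esub> h) ?B"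
    using H.rlog_mult[OF DA_charted x H.smooth_constant[OF hi] smooth_snd[OF smooth_id] V] H.rlog_const[OF x DA_charted V hi]
      mderiv_snd[OF sE_charted H.charted x V] by simp
  finally have r: "H.rlog (snd (fst ?z')) (snd (snd ?z')) = dalpha (inv\<^bsub>G\<^esub> g) (Ad MH H (inv\<^bsub>H\<^esub> h) ?B)" .
  have c: "dcross (\<alpha> (inv\<^bsub>G\<^esub> g, inv\<^bsub>H\<^esub> h \<otimes>\<^bsub>H\<^esub> ?h)) (Ad MG G (inv\<^bsub>G\<^esub> g) ?A)
      = dalpha (inv\<^bsub>G\<^esub> g) (Ad MH H (inv\<^bsub>H\<^esub> h) (dcross ?h ?A) + dcross (inv\<^bsub>H\<^esub> h) ?A)"
    using dcross_alpha[OF gi _ A, of "inv\<^bsub>H\<^esub> h \<otimes>\<^bsub>H\<^esub> ?h"] dcross_mult[OF hi t(2) A] hi t(2) by simp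
  have Wz: "W1 z = (dcross ?h ?A - ?B, ?A)" using W1_eq[OF z] zxV by simp
  have cB: "dcross ?h ?A - ?B \<in> LH" by (rule subspace_diff[OF LH_subspace dcross_closed[OF t(2) A] B])
  have "Ad MS S (inv\<^bsub>S\<^esub> a) (W1 z) = (dalpha (inv\<^bsub>G\<^esub> g) (Ad MH H (inv\<^bsub>H\<^esub> h) (dcross ?h ?A - ?B) + dcross (inv\<^bsub>H\<^esub> h) ?A), Ad MG G (inv\<^bsub>G\<^esub> g) ?A)"
    unfolding Wz hg by (rule Ad_semidirect_inv[OF h g cB A])
  also have "\<dots> = W1 ?z'"
    unfolding W1_eq[OF dsrc_action(3)[OF a z]] A' r unfolding h' c
    by (simp add: linear_diff[OF H.Ad_linear[OF hi]] linear_add[OF dalpha_linear[OF gi]] linear_diff[OF dalpha_linear[OF gi]])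
  finally show ?thesis by simp
qed

text \<open>The orbit map has \<open>H\<close>-component \<open>(h', g) \<mapsto> \<alpha>\<^sub>g\<inverse>(h'\<inverse> h)\<close>; translated back by \<open>h\<inverse>\<close> it is the product of
  \<open>\<alpha>\<^sub>g\<inverse>(h'\<inverse>)\<close> and \<open>\<alpha>\<^sub>g\<inverse>(h) h\<inverse>\<close>. The first factor contributes \<open>- B\<close>, and the second \<open>dcross\<close>, which cancels the
  contribution of the adjoint action in the form.\<close>

lemma W1_fund:
  assumes x: "x \<in> pts DA" and A: "A \<in> lie_alg MS S"
  shows "W1 (fund1 (x, A)) = A"
proof -
  note A' = LS_D[OF A]
  have AA: "fst A \<in> LH" "snd A \<in> LG" using A by (auto simp: lie_alg_semidirect)
  have h: "snd x \<in> carrier H" and p: "src D x \<in> pts E" using x smooth_map_pts[OF src_D_smooth x] by auto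
  let ?h = "snd x" and ?e = "(\<one>\<^bsub>H\<^esub>, \<one>\<^bsub>G\<^esub>)"
  have "dsrc (fund1 (x, A)) = fund0 (src D x, snd A)" by (rule dsrc_fund(1)[OF x A])
  then have w: "\<omega> (dsrc (fund1 (x, A))) = snd A" using omega_fund[OF p AA(2)] by simp
  let ?i = "\<lambda>a. inv\<^bsub>H\<^esub> (fst a)" and ?j = "\<lambda>a. inv\<^bsub>G\<^esub> (snd a)"
  let ?f = "\<lambda>a. \<alpha> (?j a, ?i a)" and ?c = "\<lambda>g. \<alpha> (inv\<^bsub>G\<^esub> g, ?h) \<otimes>\<^bsub>H\<^esub> inv\<^bsub>H\<^esub> ?h"
  have si: "smooth_map MS MH ?i" and sj: "smooth_map MS MG ?j"
    by (intro H.smooth_inv G.smooth_inv pointed_MS smooth_fst[OF smooth_id] smooth_snd[OF smooth_id])+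
  have sf: "smooth_map MS MH ?f" by (rule smooth_alpha[OF pointed_MS sj si])
  have sc: "smooth_map MG MH ?c"
    by (intro H.smooth_mult smooth_alpha G.smooth_inv G.pointed H.smooth_constant smooth_id H.inv_closed h)
  have sc': "smooth_map MS MH (\<lambda>a. ?c (snd a))" by (rule smooth_map_compose[OF pointed_MS smooth_snd[OF smooth_id] sc])
  have sn: "snd (R1 (x, a)) = \<alpha> (?j a, ?i a \<otimes>\<^bsub>H\<^esub> ?h)" for a by (simp add: R1_def)
  have ss: "smooth_map MS MH (\<lambda>a. \<alpha> (?j a, ?i a \<otimes>\<^bsub>H\<^esub> ?h))"
    by (rule smooth_alpha[OF pointed_MS sj H.smooth_mult[OF pointed_MS si H.smooth_constant[OF h]]])
  have "snd (snd (fund1 (x, A))) = mderiv MS MH (\<lambda>a. \<alpha> (?j a, ?i a \<otimes>\<^bsub>H\<^esub> ?h)) ?e A"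
    using mderiv_snd_comp[OF charted_MS one_MS smooth_orbit1[OF x] A'] unfolding sn fund_eq by simp
  then have "H.rlog ?h (snd (snd (fund1 (x, A)))) = mderiv MS MH (\<lambda>a. \<alpha> (?j a, ?i a \<otimes>\<^bsub>H\<^esub> ?h) \<otimes>\<^bsub>H\<^esub> inv\<^bsub>H\<^esub> ?h) ?e A"
    using H.rlog_mderiv[OF charted_MS one_MS ss A'] h by simp
  also have "\<dots> = mderiv MS MH (\<lambda>a. ?f a \<otimes>\<^bsub>H\<^esub> ?c (snd a)) ?e A"
    by (rule mderiv_cong[OF charted_MS one_MS _ _ H.smooth_mult[OF pointed_MS sf sc'] A'])
       (use h in \<open>auto intro!: H.smooth_mult[OF pointed_MS ss] H.smooth_constant simp: H.m_assoc\<close>)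
  also have "\<dots> = mderiv MS MH ?f ?e A + mderiv MS MH (\<lambda>a. ?c (snd a)) ?e A"
    by (rule H.mderiv_mult[OF charted_MS one_MS sf _ sc' _ A']) (use h in auto)
  also have "mderiv MS MH (\<lambda>a. ?c (snd a)) ?e A = dcross ?h (snd A)"
    using mderiv_compose[OF charted_MS G.charted one_MS smooth_snd[OF smooth_id] sc A'] mderiv_snd[OF H.charted G.charted one_MS A']
      dcross_inverse_action[OF h AA(2)] by simp
  also have "mderiv MS MH ?f ?e A = - fst A"
  proof -
    have "mderiv MS MH ?f ?e (fst A, snd A) = mderiv MH MH (\<lambda>y. ?f (y, \<one>\<^bsub>G\<^esub>)) \<one>\<^bsub>H\<^esub> (fst A) + mderiv MG MH (\<lambda>y. ?f (\<one>\<^bsub>H\<^esub>, y)) \<one>\<^bsub>G\<^esub> (snd A)"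
      by (rule mderiv_partials[OF H.charted G.charted H.one_pts G.one_pts sf LH_D[OF AA(1)] LG_D[OF AA(2)]])
    also have "mderiv MH MH (\<lambda>y. ?f (y, \<one>\<^bsub>G\<^esub>)) \<one>\<^bsub>H\<^esub> (fst A) = mderiv MH MH (\<lambda>y. inv\<^bsub>H\<^esub> y) \<one>\<^bsub>H\<^esub> (fst A)"
      by (rule mderiv_cong[OF H.charted H.one_pts _ _ H.smooth_inv[OF H.pointed smooth_id] LH_D[OF AA(1)]])
         (auto intro!: smooth_alpha H.smooth_inv H.pointed smooth_id G.smooth_constant)
    also have "\<dots> = - fst A"
      using H.mderiv_inv[OF H.charted H.one_pts smooth_id _ LH_D[OF AA(1)]] mderiv_id[OF H.charted H.one_pts LH_D[OF AA(1)]] by simp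
    also have "mderiv MG MH (\<lambda>y. ?f (\<one>\<^bsub>H\<^esub>, y)) \<one>\<^bsub>G\<^esub> (snd A) = mderiv MG MH (\<lambda>y. \<one>\<^bsub>H\<^esub>) \<one>\<^bsub>G\<^esub> (snd A)"
      by (rule mderiv_cong[OF G.charted G.one_pts _ _ H.smooth_constant LG_D[OF AA(2)]])
         (auto intro!: smooth_alpha G.smooth_inv G.pointed smooth_id H.smooth_constant)
    also have "\<dots> = 0" by (rule mderiv_const[OF G.charted G.one_pts H.pointed H.one_pts LG_D[OF AA(2)]])
    finally show ?thesis by simp
  qed
  finally show ?thesis
    using W1_eq[OF fund_pts(1)[OF x A]] w by (simp add: fund_eq prod_eq_iff)
qed

theorem dec_form_strict: "strict_connection X TG D dec_proj \<pi> R1 R W1 \<omega>"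
  unfolding strict_connection_def equivariant_two_form_def equivariant_form_def TG_simps(1,2,8,9) D_simps(1,2)
  using principal_two_bundle_D W1_functor W1_form W1_equivariant W1_fund omega_form omega_equivariant omega_fund by blast

subsection \<open>The modified pair\<close>

context
  fixes lam :: "'e \<times> 'f \<Rightarrow> 'l"
  assumes lam: "one_form E LH lam"
    and lam_equivariant: "\<And>z g. z \<in> pts (TM E) \<Longrightarrow> g \<in> carrier G \<Longrightarrow> lam (tangent_action E R g z) = dalpha (inv\<^bsub>G\<^esub> g) (lam z)"
begin

abbreviation V1 where "V1 \<equiv> modified_form1 X MG G MH H \<tau> \<alpha> E \<pi> R \<mu> \<omega> lam"
abbreviation V0 where "V0 \<equiv> modified_form0 MG MH H \<tau> \<omega> lam"

lemma V1_eq: "V1 z = W1 z + (lam (dtgt z) - lam (dsrc z), dtau (lam (dsrc z)))"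
  unfolding modified_form1_def Let_def dtau_def D_simps(1,2) by (simp add: prod_eq_iff del: D_simps)

lemma V0_eq: "V0 z = \<omega> z + dtau (lam z)"
  unfolding modified_form0_def dtau_def ..

lemma lam_value: "z \<in> pts (TM E) \<Longrightarrow> lam z \<in> LH"
  by (rule one_form_value[OF lam])

lemma V1_form: "one_form DA (lie_alg MS S) V1"
proof -
  note s = one_form_pullback[OF DA_charted E_charted src_D_smooth lam]
  note t = one_form_pullback[OF DA_charted E_charted smooth_tgt_D lam]
  have "one_form DA (lie_alg MS S) (\<lambda>z. (lam (dtgt z) - lam (dsrc z), dtau (lam (dsrc z))))"
    unfolding lie_alg_semidirect
    by (rule one_form_Pair[OF pointed_DA one_form_diff[OF pointed_DA LH_subspace t s] one_form_linear[OF pointed_DA s dtau_linear dtau_closed]])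
  from one_form_add[OF pointed_DA S.subspace_lie_alg W1_form this] show ?thesis unfolding V1_eq[abs_def] .
qed

lemma V0_form: "one_form E LG V0"
  unfolding V0_eq[abs_def]
  by (rule one_form_add[OF pointed_E LG_subspace omega_form one_form_linear[OF pointed_E lam dtau_linear dtau_closed]])

text \<open>Sources and targets of the correction telescope: along a composition the target value at the first
  arrow is the source value at the second.\<close>

lemma V1_functor: "smooth_functor (tangent_gpd D) LTG V1 V0"
proof (rule form_functorI[OF V1_form V0_form])
  fix z assume z: "z \<in> pts (TM DA)"
  show "snd (V1 z) = V0 (dsrc z)" using W1_eq[OF z] by (simp add: V1_eq V0_eq)
  show "dtau (fst (V1 z)) + snd (V1 z) = V0 (dtgt z)"
    using W1_tgt[OF z] by (simp add: V1_eq V0_eq linear_add[OF dtau_linear] linear_diff[OF dtau_linear])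
next
  fix z assume z: "z \<in> pts (TM E)"
  show "fst (V1 (tmap E DA (gunit D) z)) = 0"
    using W1_unit[OF z] unfolding V1_eq dsrc_dunit(1,2)[OF z] by simp
next
  fix z2 z1 assume z: "z2 \<in> pts (TM DA)" "z1 \<in> pts (TM DA)" and m: "dsrc z2 = dtgt z1"
  show "fst (V1 (dcomp z2 z1)) = fst (V1 z2) + fst (V1 z1)"
    using W1_comp[OF z m] unfolding V1_eq dsrc_dcomp(1,2)[OF z m] m by simp
qed

text \<open>For the correction the Peiffer identity is decisive: the term \<open>\<tau>(\<lambda>)\<close> at the source enters through \<open>dcross\<close> as
  \<open>Ad \<lambda> - \<lambda>\<close>, which replaces the adjoint transform of the source value by the value itself.\<close>

lemma V1_equivariant:
  assumes z: "z \<in> pts (TM DA)" and a: "a \<in> carrier S"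
  shows "V1 (tangent_action DA R1 a z) = Ad MS S (inv\<^bsub>S\<^esub> a) (V1 z)"
proof -
  obtain h g where hg: "a = (h, g)" by (cases a)
  have h: "h \<in> carrier H" and g: "g \<in> carrier G" using a hg by auto
  have hi: "inv\<^bsub>H\<^esub> h \<in> carrier H" and gi: "inv\<^bsub>G\<^esub> g \<in> carrier G" and hgG: "\<tau> h \<otimes>\<^bsub>G\<^esub> g \<in> carrier G" using h g by auto
  let ?s = "lam (dsrc z)" and ?t = "lam (dtgt z)"
  have s: "?s \<in> LH" and t: "?t \<in> LH" using lam_value dsrc_pts[OF z] dtgt_pts[OF z] by blast+
  have ts: "?t - ?s \<in> LH" by (rule subspace_diff[OF LH_subspace t s])
  have ai: "inv\<^bsub>S\<^esub> a \<in> carrier S" by (rule S.inv_closed[OF a])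
  have 1: "lam (dsrc (tangent_action DA R1 a z)) = dalpha (inv\<^bsub>G\<^esub> g) ?s"
    unfolding dsrc_action(1)[OF a z] using lam_equivariant[OF dsrc_pts[OF z] g] hg by simp
  have 2: "lam (dtgt (tangent_action DA R1 a z)) = dalpha (inv\<^bsub>G\<^esub> g) (Ad MH H (inv\<^bsub>H\<^esub> h) ?t)"
  proof -
    have "lam (dtgt (tangent_action DA R1 a z)) = dalpha (inv\<^bsub>G\<^esub> (\<tau> h \<otimes>\<^bsub>G\<^esub> g)) ?t"
      unfolding dsrc_action(2)[OF a z] using lam_equivariant[OF dtgt_pts[OF z] hgG] hg by simp
    also have "inv\<^bsub>G\<^esub> (\<tau> h \<otimes>\<^bsub>G\<^esub> g) = inv\<^bsub>G\<^esub> g \<otimes>\<^bsub>G\<^esub> \<tau> (inv\<^bsub>H\<^esub> h)" using h g by (simp add: G.inv_mult_group)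
    also have "dalpha (inv\<^bsub>G\<^esub> g \<otimes>\<^bsub>G\<^esub> \<tau> (inv\<^bsub>H\<^esub> h)) ?t = dalpha (inv\<^bsub>G\<^esub> g) (dalpha (\<tau> (inv\<^bsub>H\<^esub> h)) ?t)"
      by (rule dalpha_mult[OF gi tau_closed[OF hi] t])
    also have "dalpha (\<tau> (inv\<^bsub>H\<^esub> h)) ?t = Ad MH H (inv\<^bsub>H\<^esub> h) ?t" by (rule dalpha_tau[OF hi t])
    finally show ?thesis .
  qed
  have "Ad MS S (inv\<^bsub>S\<^esub> a) (?t - ?s, dtau ?s) =
      (dalpha (inv\<^bsub>G\<^esub> g) (Ad MH H (inv\<^bsub>H\<^esub> h) (?t - ?s) + dcross (inv\<^bsub>H\<^esub> h) (dtau ?s)), Ad MG G (inv\<^bsub>G\<^esub> g) (dtau ?s))"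
    unfolding hg by (rule Ad_semidirect_inv[OF h g ts dtau_closed[OF s]])
  also have "\<dots> = (dalpha (inv\<^bsub>G\<^esub> g) (Ad MH H (inv\<^bsub>H\<^esub> h) ?t) - dalpha (inv\<^bsub>G\<^esub> g) ?s, dtau (dalpha (inv\<^bsub>G\<^esub> g) ?s))"
    unfolding dcross_dtau[OF hi s] dtau_dalpha[OF gi s] linear_diff[OF H.Ad_linear[OF hi]]
    by (simp add: linear_diff[OF dalpha_linear[OF gi]])
  finally have c: "Ad MS S (inv\<^bsub>S\<^esub> a) (?t - ?s, dtau ?s) =
    (dalpha (inv\<^bsub>G\<^esub> g) (Ad MH H (inv\<^bsub>H\<^esub> h) ?t) - dalpha (inv\<^bsub>G\<^esub> g) ?s, dtau (dalpha (inv\<^bsub>G\<^esub> g) ?s))" .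
  show ?thesis
    unfolding V1_eq linear_add[OF S.Ad_linear[OF ai]] W1_equivariant[OF z a] c 1 2 ..
qed

lemma V0_equivariant:
  assumes z: "z \<in> pts (TM E)" and g: "g \<in> carrier G"
  shows "V0 (tangent_action E R g z) = Ad MG G (inv\<^bsub>G\<^esub> g) (V0 z)"
proof -
  have gi: "inv\<^bsub>G\<^esub> g \<in> carrier G" using g by simp
  show ?thesis
    unfolding V0_eq omega_equivariant[OF z g] lam_equivariant[OF z g] dtau_dalpha[OF gi lam_value[OF z]]
    by (rule linear_add[OF G.Ad_linear[OF gi], symmetric])
qed

text \<open>An arrow of the Lie 2-algebra from \<open>B + \<tau>(\<lambda>(\<delta>\<^sub>p B))\<close>, the value of the modified form on \<open>\<delta>\<^sub>p B\<close>, to \<open>B\<close>: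
  the two occurrences of \<open>\<tau>(\<lambda>(\<delta>\<^sub>p B))\<close> cancel in its target.\<close>

definition \<kappa> :: "'e \<times> 'k \<Rightarrow> 'l \<times> 'k" where
  "\<kappa> z = (- lam (fund0 z), snd z + dtau (lam (fund0 z)))"

lemma kappa_closed:
  assumes "p \<in> pts E" "B \<in> LG"
  shows "- lam (fund0 (p, B)) \<in> LH" "B + dtau (lam (fund0 (p, B))) \<in> LG" "lam (fund0 (p, B)) \<in> LH"
proof -
  show l: "lam (fund0 (p, B)) \<in> LH" by (rule lam_value[OF fund_pts(2)[OF assms]])
  show "- lam (fund0 (p, B)) \<in> LH" by (rule subspace_neg[OF LH_subspace l])
  show "B + dtau (lam (fund0 (p, B))) \<in> LG" by (rule subspace_add[OF LG_subspace assms(2) dtau_closed[OF l]])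
qed

lemma kappa_smooth: "smooth_map (prod_mfd E (vec_mfd LG)) (vec_mfd (lie_alg MS S)) \<kappa>"
proof -
  let ?P = "prod_mfd E (vec_mfd LG)"
  have P: "pointed ?P" by (intro pointed_prod pointed_E pointed_vec)
  have l: "smooth_map ?P (vec_mfd LH) (\<lambda>z. lam (fund0 z))" by (rule smooth_map_compose[OF P smooth_fund0 one_form_smooth[OF lam]])
  have bl: "bounded_linear dtau" using dtau_linear linear_conv_bounded_linear by blast
  have n: "smooth_map ?P (vec_mfd LH) (\<lambda>z. - lam (fund0 z))"
    by (rule smooth_vec_apply[OF P l bounded_linear_minus[OF bounded_linear_ident] subspace_neg[OF LH_subspace]])
  have d: "smooth_map ?P (vec_mfd LG) (\<lambda>z. dtau (lam (fund0 z)))"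
    by (rule smooth_vec_apply[OF P l bl dtau_closed])
  show ?thesis
    unfolding lie_alg_semidirect \<kappa>_def[abs_def]
    by (rule smooth_vec_Pair[OF P n smooth_vec_add[OF P smooth_snd[OF smooth_id] d LG_subspace]])
qed

text \<open>On the fundamental vector of \<open>A\<close> the modified form takes the value \<open>A + (t - s, \<tau>(s))\<close>, where \<open>s\<close> and \<open>t\<close> are the
  values of \<open>\<lambda>\<close> on the fundamental vectors at source and target. Composing with \<open>(- t, \<dots>)\<close> at the target or with
  \<open>(- s, \<dots>)\<close> at the source leaves the same element.\<close>

lemma kappa_nat_iso:
  "smooth_nat_iso (prod_gpd D LTG) LTG (\<lambda>z. V1 (fund1 z)) (\<lambda>z. V0 (fund0 z)) snd snd \<kappa>"
  unfolding smooth_nat_iso_def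
proof (intro conjI ballI; (unfold prod_gpd_simps D_simps(1,2) LTG_objects)?)
  show "smooth_map (prod_mfd E (vec_mfd LG)) (vec_mfd (lie_alg MS S)) \<kappa>" by (rule kappa_smooth)
next
  fix z assume "z \<in> pts (prod_mfd E (vec_mfd LG))"
  then obtain p B where z: "z = (p, B)" and p: "p \<in> pts E" and B: "B \<in> LG" by auto
  note c = kappa_closed[OF p B]
  let ?l = "lam (fund0 (p, B))"
  have k: "\<kappa> z = (- ?l, B + dtau ?l)" by (simp add: \<kappa>_def z)
  have F0: "V0 (fund0 z) = B + dtau ?l" using omega_fund[OF p B] by (simp add: V0_eq z)
  have d0: "dtau (- ?l) + (B + dtau ?l) = B" by (simp add: linear_neg[OF dtau_linear])
  have i: "ginv LTG (\<kappa> z) = (?l, B)" unfolding k LTG_inv[OF c(1,2)] d0 by simp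
  show "src LTG (\<kappa> z) = V0 (fund0 z)" unfolding k F0 by (rule LTG_src[OF c(1,2)])
  show "tgt LTG (\<kappa> z) = snd z" unfolding k LTG_tgt[OF c(1,2)] d0 by (simp add: z)
  show "gcomp LTG (ginv LTG (\<kappa> z), \<kappa> z) = gunit LTG (V0 (fund0 z))"
    unfolding i unfolding k F0 LTG_unit[OF c(2)] using LTG_comp[OF c(3,1) B c(2)] d0 by simp
  show "gcomp LTG (\<kappa> z, ginv LTG (\<kappa> z)) = gunit LTG (snd z)"
    unfolding i unfolding k using LTG_comp[OF c(1,3) c(2) B] LTG_unit[OF B] by (simp add: z add.commute)
next
  fix w assume "w \<in> pts (prod_mfd DA (vec_mfd (lie_alg MS S)))"
  then obtain x A where w: "w = (x, A)" and x: "x \<in> pts DA" and A: "A \<in> lie_alg MS S" by auto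
  obtain A1 A0 where A10: "A = (A1, A0)" by (cases A)
  have AA: "A1 \<in> LH" "A0 \<in> LG" using A by (auto simp: lie_alg_semidirect A10)
  have tA: "dtau A1 + A0 \<in> LG" by (rule subspace_add[OF LG_subspace dtau_closed[OF AA(1)] AA(2)])
  have p: "src D x \<in> pts E" and q: "tgt D x \<in> pts E" by (rule smooth_map_pts[OF src_D_smooth x] smooth_map_pts[OF smooth_tgt_D x])+
  let ?s = "lam (fund0 (src D x, A0))" and ?t = "lam (fund0 (tgt D x, dtau A1 + A0))"
  note cs = kappa_closed[OF p AA(2)] and ct = kappa_closed[OF q tA]
  have sA: "src LTG A = A0" and tA': "tgt LTG A = dtau A1 + A0"
    unfolding A10 by (rule LTG_src[OF AA] LTG_tgt[OF AA])+
  have ks: "\<kappa> (src D (fst w), src LTG (snd w)) = (- ?s, A0 + dtau ?s)"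
    unfolding w fst_conv snd_conv sA \<kappa>_def by simp
  have kt: "\<kappa> (tgt D (fst w), tgt LTG (snd w)) = (- ?t, (dtau A1 + A0) + dtau ?t)"
    unfolding w fst_conv snd_conv tA' \<kappa>_def by simp
  have V: "V1 (fund1 w) = (A1 + (?t - ?s), A0 + dtau ?s)"
    unfolding V1_eq w W1_fund[OF x A] dsrc_fund[OF x A] unfolding A10 by simp
  have vc: "A1 + (?t - ?s) \<in> LH"
    by (rule subspace_add[OF LH_subspace AA(1) subspace_diff[OF LH_subspace ct(3) cs(3)]])
  have "gcomp LTG (A, (- ?s, A0 + dtau ?s)) = (A1 + - ?s, A0 + dtau ?s)"
    unfolding A10 by (rule LTG_comp[OF AA(1) cs(1) AA(2) cs(2)]) (simp add: linear_neg[OF dtau_linear])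
  moreover have "gcomp LTG ((- ?t, (dtau A1 + A0) + dtau ?t), (A1 + (?t - ?s), A0 + dtau ?s)) = (- ?t + (A1 + (?t - ?s)), A0 + dtau ?s)"
    by (rule LTG_comp[OF ct(1) vc ct(2) cs(2)]) (simp add: linear_add[OF dtau_linear] linear_diff[OF dtau_linear])
  ultimately show "gcomp LTG (snd w, \<kappa> (src D (fst w), src LTG (snd w))) = gcomp LTG (\<kappa> (tgt D (fst w), tgt LTG (snd w)), V1 (fund1 w))"
    unfolding ks kt V by (simp add: w)
qed

lemma fund0_equivariant:
  assumes p: "p \<in> pts E" and B: "B \<in> LG" and g: "g \<in> carrier G"
  shows "fund0 (R (p, g), Ad MG G (inv\<^bsub>G\<^esub> g) B) = tangent_action E R g (fund0 (p, B))"
proof -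
  have gi: "inv\<^bsub>G\<^esub> g \<in> carrier G" and pg: "R (p, g) \<in> pts E" using p g by simp_all
  note B' = LG_D[OF B]
  have "mderiv MG E (\<lambda>y. R (R (p, g), y)) \<one>\<^bsub>G\<^esub> (Ad MG G (inv\<^bsub>G\<^esub> g) B) =
      mderiv MG E (\<lambda>y. R (R (p, g), inv\<^bsub>G\<^esub> g \<otimes>\<^bsub>G\<^esub> y \<otimes>\<^bsub>G\<^esub> inv\<^bsub>G\<^esub> (inv\<^bsub>G\<^esub> g))) \<one>\<^bsub>G\<^esub> B"
    unfolding Ad_def using mderiv_compose[OF G.charted G.charted G.one_pts G.smooth_conj[OF gi] smooth_orbit[OF pg] B'] g by simp
  also have "\<dots> = mderiv MG E (\<lambda>y. R (R (p, y), g)) \<one>\<^bsub>G\<^esub> B"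
    by (rule mderiv_cong[OF G.charted G.one_pts smooth_map_compose[OF G.pointed G.smooth_conj[OF gi] smooth_orbit[OF pg]] _
          smooth_map_compose[OF G.pointed smooth_orbit[OF p] smooth_R_fixed[OF g]] B'])
       (use p g in \<open>simp add: G.m_assoc G.inv_cancel_left\<close>)
  also have "\<dots> = mderiv E E (\<lambda>q. R (q, g)) p (mderiv MG E (\<lambda>y. R (p, y)) \<one>\<^bsub>G\<^esub> B)"
    using mderiv_compose[OF G.charted E_charted G.one_pts smooth_orbit[OF p] smooth_R_fixed[OF g] B'] p by simp
  finally show ?thesis by (simp add: fund_eq tangent_action_def tmap_apply)
qed

lemma kappa_equivariant:
  assumes p: "p \<in> pts E" and B: "B \<in> LG" and g: "g \<in> carrier G"
  shows "\<kappa> (R (p, g), Ad MG G (inv\<^bsub>G\<^esub> g) B) = Ad MS S (inv\<^bsub>S\<^esub> (\<one>\<^bsub>H\<^esub>, g)) (\<kappa> (p, B))"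
proof -
  have gi: "inv\<^bsub>G\<^esub> g \<in> carrier G" using g by simp
  note c = kappa_closed[OF p B]
  let ?l = "lam (fund0 (p, B))"
  have e: "inv\<^bsub>S\<^esub> (\<one>\<^bsub>H\<^esub>, g) = (\<one>\<^bsub>H\<^esub>, inv\<^bsub>G\<^esub> g)" using g by (simp add: inv_semidirect)
  have "lam (fund0 (R (p, g), Ad MG G (inv\<^bsub>G\<^esub> g) B)) = dalpha (inv\<^bsub>G\<^esub> g) ?l"
    unfolding fund0_equivariant[OF assms] by (rule lam_equivariant[OF fund_pts(2)[OF p B] g])
  then show ?thesis
    using Ad_semidirect_G[OF gi c(1,2)]
    by (simp add: \<kappa>_def e dtau_dalpha[OF gi c(3)] linear_neg[OF dalpha_linear[OF gi]] linear_add[OF G.Ad_linear[OF gi]])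
qed

lemma kappa_linear:
  assumes p: "p \<in> pts E" shows "linear_on_subspace LG (\<lambda>B. \<kappa> (p, B))"
proof -
  note lin = mderiv_linear[OF G.charted G.one_pts smooth_orbit[OF p]]
  have t: "B \<in> LG \<Longrightarrow> mderiv MG E (\<lambda>g. R (p, g)) \<one>\<^bsub>G\<^esub> B \<in> tspace E p" for B
    using fund_pts(2)[OF p] by (simp add: fund_eq)
  show ?thesis
    unfolding linear_on_subspace_def \<kappa>_def fund_eq
    by (auto simp: linear_add[OF lin] linear_scale[OF lin] one_form_add_vectors[OF lam p t t] one_form_scaleR_vector[OF lam p t]
        linear_add[OF dtau_linear] linear_scale[OF dtau_linear] algebra_simps)
qed

theorem modified_form_semistrict: "semistrict_connection X TG D dec_proj \<pi> R1 R V1 V0"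
  unfolding semistrict_connection_def equivariant_two_form_def equivariant_form_def TG_simps(1,2,6,8,9) D_simps(1,2)
proof (intro conjI exI[of _ \<kappa>] ballI)
  show "principal_two_bundle X TG D dec_proj \<pi> R1 R" by (rule principal_two_bundle_D)
  show "smooth_functor (tangent_gpd D) LTG V1 V0" by (rule V1_functor)
  show "one_form DA (lie_alg MS S) V1" "one_form E LG V0" by (rule V1_form V0_form)+
qed (rule V1_equivariant V0_equivariant kappa_nat_iso kappa_linear kappa_equivariant; assumption?)+

end

end

theorem proposition5p35:
  fixes X :: "('x1, 'm1::euclidean_space, 'x0, 'm0::euclidean_space) gpd"
    and MG :: "('g, 'k::euclidean_space) mfd" and G :: "'g monoid"
    and MH :: "('h, 'l::euclidean_space) mfd" and H :: "'h monoid"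
    and \<tau> :: "'h \<Rightarrow> 'g" and \<alpha> :: "'g \<times> 'h \<Rightarrow> 'h"
    and E :: "('e, 'f::euclidean_space) mfd" and \<pi> :: "'e \<Rightarrow> 'x0"
    and R :: "'e \<times> 'g \<Rightarrow> 'e" and \<mu> :: "'x1 \<times> 'e \<Rightarrow> 'e"
    and \<omega> :: "'e \<times> 'f \<Rightarrow> 'k"
  assumes "groupoid_bundle X MG G E \<pi> R \<mu>"
    and "groupoid_bundle_connection X MG G E \<pi> R \<mu> \<omega>"
    and "crossed_module MG G MH H \<tau> \<alpha>"
  shows "strict_connection X (cm_two_group MG G MH H \<tau> \<alpha>) (dec_gpd X G MH H \<tau> E \<pi> R \<mu>)
           dec_proj \<pi> (dec_action G H \<alpha> R) R (dec_form MG G MH H \<alpha> \<omega>) \<omega> \<and>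
         (\<forall>lam :: 'e \<times> 'f \<Rightarrow> 'l.
            one_form E (lie_alg MH H) lam \<and>
            (\<forall>z\<in>pts (TM E). \<forall>g\<in>carrier G. lam (tangent_action E R g z) =
                mderiv MH MH (\<lambda>h. \<alpha> (inv\<^bsub>G\<^esub> g, h)) \<one>\<^bsub>H\<^esub> (lam z)) \<longrightarrow>
            semistrict_connection X (cm_two_group MG G MH H \<tau> \<alpha>) (dec_gpd X G MH H \<tau> E \<pi> R \<mu>)
              dec_proj \<pi> (dec_action G H \<alpha> R) R
              (modified_form1 X MG G MH H \<tau> \<alpha> E \<pi> R \<mu> \<omega> lam) (modified_form0 MG MH H \<tau> \<omega> lam))"
proof -
  interpret decorated_connection MG G MH H \<tau> \<alpha> X E \<pi> R \<mu> \<omega>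
    by unfold_locales (fact assms)+
  show ?thesis
    using dec_form_strict modified_form_semistrict unfolding dalpha_def by blast
qed

end
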